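(* Let $G$ be a group such that every amenable subgroup of $G$ is virtually solvable. If $G$ is residually-$\mathcal{F}$, then $G$ is in $\mathcal{F}$.
   Context: All groups are discrete, compact spaces are Hausdorff, and $G$-spaces are non-empty spaces with a $G$-action by homeomorphisms. $\mathrm{Sub}(G)$ is the set of subgroups of $G$ with the topology induced from the product topology on $\{0,1\}^G$, with the conjugation action of $G$. A URS of $G$ is a non-empty closed $G$-invariant minimal subset of $\mathrm{Sub}(G)$. If $X$ is a minimal compact $G$-space (all orbits are dense), the closure in $\mathrm{Sub}(G)$ of the set of point stabilizers $\{G_x:x\in X\}$ contains a unique URS, denoted $S_G(X)$. A compact $G$-space $X$ is strongly proximal if the orbit closure of every probability measure on $X$ in the space $\mathrm{Prob}(X)$ (with the weak-$*$ topology) contains a Dirac measure. The Furstenberg boundary $\partial_F G$ is the universal minimal and strongly proximal compact $G$-space (every minimal strongly proximal compact $G$-space is a continuous $G$-equivariant image of it). The Furstenberg URS of $G$ is $\mathcal{A}_G:=S_G(\partial_F G)$. $\mathcal{F}$ denotes the class of groups $G$ such that $\mathcal{A}_G$ is a singleton (equivalently, $\mathcal{A}_G=\{\mathrm{Rad}(G)\}$ where $\mathrm{Rad}(G)$ is the amenable radical; equivalently, $H\leq \mathrm{Rad}(G)$ for every URS $\mathcal{H}$ of $G$ consisting of amenable subgroups and every $H\in\mathcal{H}$). For a class of groups $\mathcal{C}$, a group $G$ is residually-$\mathcal{C}$ if the intersection of all normal subgroups $N$ of $G$ such that $G/N\in\mathcal{C}$ is trivial. *)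

theory Defs
  imports "HOL-Algebra.Group_Action" "HOL-Algebra.Solvable_Groups" "HOL-Probability.Probability"
begin

text \<open>Amenability of a discrete group: existence of a left-invariant, finitely additive
  probability measure defined on all subsets.\<close>

definition amenable_group :: "('a, 'b) monoid_scheme \<Rightarrow> bool" where
  "amenable_group G \<longleftrightarrow> group G \<and>
     (\<exists>m :: 'a set \<Rightarrow> real.
        (\<forall>A. A \<subseteq> carrier G \<longrightarrow> 0 \<le> m A) \<and>
        m (carrier G) = 1 \<and>
        (\<forall>A B. A \<subseteq> carrier G \<longrightarrow> B \<subseteq> carrier G \<longrightarrow> A \<inter> B = {} \<longrightarrow> m (A \<union> B) = m A + m B) \<and>
        (\<forall>g \<in> carrier G. \<forall>A. A \<subseteq> carrier G \<longrightarrow> m (g <#\<^bsub>G\<^esub> A) = m A))"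

definition virtually_solvable :: "('a, 'b) monoid_scheme \<Rightarrow> bool" where
  "virtually_solvable G \<longleftrightarrow> group G \<and>
     (\<exists>H. subgroup H G \<and> finite (rcosets\<^bsub>G\<^esub> H) \<and> solvable (G\<lparr>carrier := H\<rparr>))"

definition Sub_topology :: "('a, 'b) monoid_scheme \<Rightarrow> 'a set topology" where
  "Sub_topology G = pullback_topology {H. subgroup H G} (\<lambda>H. \<lambda>g\<in>carrier G. g \<in> H)
     (product_topology (\<lambda>_. discrete_topology (UNIV :: bool set)) (carrier G))"

definition conj_invariant :: "('a, 'b) monoid_scheme \<Rightarrow> 'a set set \<Rightarrow> bool" where
  "conj_invariant G S \<longleftrightarrow>
     (\<forall>g \<in> carrier G. \<forall>H \<in> S. g <#\<^bsub>G\<^esub> H #>\<^bsub>G\<^esub> (inv\<^bsub>G\<^esub> g) \<in> S)"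

definition is_URS :: "('a, 'b) monoid_scheme \<Rightarrow> 'a set set \<Rightarrow> bool" where
  "is_URS G S \<longleftrightarrow>
     S \<noteq> {} \<and> closedin (Sub_topology G) S \<and> conj_invariant G S \<and>
     (\<forall>T. T \<noteq> {} \<and> T \<subseteq> S \<and> closedin (Sub_topology G) T \<and> conj_invariant G T \<longrightarrow> T = S)"

text \<open>The predicate \<open>group_action\<close> only additionally requires each \<open>\<phi> g\<close> to be \<open>undefined\<close> outside the
  space, which is a normalisation without mathematical content.\<close>

definition compact_G_space ::
    "('a, 'b) monoid_scheme \<Rightarrow> 'x topology \<Rightarrow> ('a \<Rightarrow> 'x \<Rightarrow> 'x) \<Rightarrow> bool" where
  "compact_G_space G X \<phi> \<longleftrightarrow>
     compact_space X \<and> Hausdorff_space X \<and> topspace X \<noteq> {} \<and>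
     group_action G (topspace X) \<phi> \<and> (\<forall>g \<in> carrier G. homeomorphic_map X X (\<phi> g))"

definition minimal_G_space ::
    "('a, 'b) monoid_scheme \<Rightarrow> 'x topology \<Rightarrow> ('a \<Rightarrow> 'x \<Rightarrow> 'x) \<Rightarrow> bool" where
  "minimal_G_space G X \<phi> \<longleftrightarrow>
     (\<forall>x \<in> topspace X. X closure_of (orbit G \<phi> x) = topspace X)"

definition stabilizer_URS ::
    "('a, 'b) monoid_scheme \<Rightarrow> 'x topology \<Rightarrow> ('a \<Rightarrow> 'x \<Rightarrow> 'x) \<Rightarrow> 'a set set" where
  "stabilizer_URS G X \<phi> =
     (THE S. is_URS G S \<and> S \<subseteq> Sub_topology G closure_of (stabilizer G \<phi> ` topspace X))"

definition borel_of :: "'x topology \<Rightarrow> 'x measure" where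
  "borel_of X = sigma (topspace X) {U. openin X U}"

text \<open>Probability measures on a compact Hausdorff space are, as usual, regular Borel measures.
  For a finite measure, inner regularity by compact sets implies outer regularity.\<close>

definition Prob :: "'x topology \<Rightarrow> 'x measure set" where
  "Prob X = {\<mu>. prob_space \<mu> \<and> sets \<mu> = sets (borel_of X) \<and>
     (\<forall>A \<in> sets \<mu>. emeasure \<mu> A = (SUP K \<in> {K. compactin X K \<and> K \<subseteq> A}. emeasure \<mu> K))}"

text \<open>The weak-* topology: the coarsest topology on \<open>Prob X\<close> making \<open>\<mu> \<mapsto> \<integral> f d\<mu>\<close> continuous for
  every continuous real-valued \<open>f\<close>.\<close>

definition Prob_topology :: "'x topology \<Rightarrow> 'x measure topology" where
  "Prob_topology X = topology_generated_by
     {{\<mu> \<in> Prob X. (\<integral>x. f x \<partial>\<mu>) \<in> U} | f (U :: real set). continuous_map X euclideanreal f \<and> open U}"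

definition strongly_proximal ::
    "('a, 'b) monoid_scheme \<Rightarrow> 'x topology \<Rightarrow> ('a \<Rightarrow> 'x \<Rightarrow> 'x) \<Rightarrow> bool" where
  "strongly_proximal G X \<phi> \<longleftrightarrow>
     (\<forall>\<mu> \<in> Prob X. \<exists>x \<in> topspace X.
        return (borel_of X) x \<in>
          Prob_topology X closure_of {distr \<mu> (borel_of X) (\<phi> g) | g. g \<in> carrier G})"

definition G_boundary ::
    "('a, 'b) monoid_scheme \<Rightarrow> 'x topology \<Rightarrow> ('a \<Rightarrow> 'x \<Rightarrow> 'x) \<Rightarrow> bool" where
  "G_boundary G X \<phi> \<longleftrightarrow>
     compact_G_space G X \<phi> \<and> minimal_G_space G X \<phi> \<and> strongly_proximal G X \<phi>"

definition G_factor_map ::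
    "('a, 'b) monoid_scheme \<Rightarrow> 'x topology \<Rightarrow> ('a \<Rightarrow> 'x \<Rightarrow> 'x) \<Rightarrow>
     'y topology \<Rightarrow> ('a \<Rightarrow> 'y \<Rightarrow> 'y) \<Rightarrow> ('x \<Rightarrow> 'y) \<Rightarrow> bool" where
  "G_factor_map G X \<phi> Y \<psi> f \<longleftrightarrow>
     continuous_map X Y f \<and> f ` topspace X = topspace Y \<and>
     (\<forall>g \<in> carrier G. \<forall>x \<in> topspace X. f (\<phi> g x) = \<psi> g (f x))"

text \<open>A Hausdorff space with a dense subset \<open>D\<close> has at most \<open>2 ^ 2 ^ card D\<close> points, and in a
  minimal \<open>G\<close>-space every orbit is dense. Hence every minimal compact \<open>G\<close>-space
  is isomorphic to one whose points have type \<open>'a set set\<close>, where \<open>'a\<close> is the type of the elements of \<open>G\<close>, so quantifying over such spaces loses no generality.\<close>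

definition is_Furstenberg_boundary ::
    "('a, 'b) monoid_scheme \<Rightarrow> 'a set set topology \<Rightarrow> ('a \<Rightarrow> 'a set set \<Rightarrow> 'a set set) \<Rightarrow> bool" where
  "is_Furstenberg_boundary G X \<phi> \<longleftrightarrow>
     G_boundary G X \<phi> \<and>
     (\<forall>(Y :: 'a set set topology) \<psi>. G_boundary G Y \<psi> \<longrightarrow> (\<exists>f. G_factor_map G X \<phi> Y \<psi> f))"

text \<open>The Furstenberg boundary is unique up to isomorphism, and the subset \<open>stabilizer_URS\<close> of
  \<open>Sub(G)\<close> is invariant under isomorphism, so the choice of a representative is immaterial.\<close>

definition Furstenberg_boundary ::
    "('a, 'b) monoid_scheme \<Rightarrow> 'a set set topology \<times> ('a \<Rightarrow> 'a set set \<Rightarrow> 'a set set)" where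
  "Furstenberg_boundary G = (SOME (X, \<phi>). is_Furstenberg_boundary G X \<phi>)"

definition Furstenberg_URS :: "('a, 'b) monoid_scheme \<Rightarrow> 'a set set" where
  "Furstenberg_URS G = (case Furstenberg_boundary G of (X, \<phi>) \<Rightarrow> stabilizer_URS G X \<phi>)"

definition class_F :: "('a, 'b) monoid_scheme \<Rightarrow> bool" where
  "class_F G \<longleftrightarrow> group G \<and> (\<exists>H. Furstenberg_URS G = {H})"

text \<open>The intersection is taken inside \<open>G\<close>, so that it is \<open>G\<close> for an empty family.\<close>

definition residually :: "('a set monoid \<Rightarrow> bool) \<Rightarrow> ('a, 'b) monoid_scheme \<Rightarrow> bool" where
  "residually C G \<longleftrightarrow>
     carrier G \<inter> \<Inter> {N. N \<lhd> G \<and> C (G Mod N)} = {\<one>\<^bsub>G\<^esub>}"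

end

theory Submission
  imports Defs
begin

text \<open>The proof works with charges, that is, finitely additive probabilities. Charges on the Borel
  sets of a compact \<open>G\<close>-space form a compact \<open>G\<close>-space under pointwise convergence, and averaging
  over an amenable group naturally produces a charge. Strong proximality means that every
  non-empty closed invariant set of charges contains a Dirac charge (\<open>strongly_proximal_iff\<close>).

  Let \<open>B\<close> be the Furstenberg boundary of \<open>G\<close> and \<open>\<A>\<close> the Furstenberg URS. Two facts link \<open>\<A>\<close> with
  charges. If a closed conjugation invariant set of subgroups has a member that fixes a charge on
  \<open>B\<close>, then contracting this charge shows that some member fixes a point of \<open>B\<close>
  (\<open>fixing_subgroup_in_stabilizer\<close>), and then every member of \<open>\<A>\<close> contains a member of the set
  (\<open>dominated_by_fixing\<close>). In particular a normal subgroup that fixes a charge lies below every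
  member of \<open>\<A>\<close> (\<open>normal_fixing_below\<close>). On the other hand the stabilizers of points of \<open>B\<close>, and
  so the members of \<open>\<A>\<close>, are amenable (\<open>amenable_stabilizer\<close>), because some boundary of \<open>G\<close>
  consists of means on \<open>G\<close> (\<open>boundary_of_charges\<close>). It therefore suffices to find a normal
  subgroup \<open>E\<close> that contains every member of \<open>\<A>\<close> and fixes a charge on \<open>B\<close>: then \<open>\<A> = {E}\<close>.

  Let \<open>N\<close> be normal with \<open>G/N\<close> in \<open>\<F>\<close>. Then there is a normal subgroup \<open>R\<close>, amenable modulo \<open>N\<close>,
  that contains every member of \<open>\<A>\<close> (\<open>co_fixing_if_quotient_in_class_F\<close>). The key step is that \<open>N\<close>
  acts minimally on \<open>\<A>\<close> (\<open>URS_minimal_under_co_fixing\<close>). The Furstenberg boundary \<open>Y\<close> of \<open>N\<close>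
  carries an action of the whole group (\<open>boundary_of_normal_subgroup\<close>), since equivariant maps
  into boundaries are unique (\<open>equivariant_maps_into_boundary_agree\<close>). The stabilizers in \<open>R\<close> of
  points of \<open>Y\<close> intersect \<open>N\<close> in amenable subgroups and are amenable modulo \<open>N\<close>, so they fix
  charges on \<open>B\<close>, and the limits of these stabilizers contain exactly one \<open>N\<close>-minimal closed set.
  It and \<open>\<A>\<close> dominate each other: each member of one contains a member of the other. For closed
  sets of subgroups this forces a common member (\<open>mutually_dominating_meet\<close>), and minimality then
  gives equality.

  Minimality under \<open>N\<close> makes the product \<open>KN\<close> the same for all \<open>K \<in> \<A>\<close>
  (\<open>minimal_closed_translates_agree\<close>), hence normal. The argument applies to all co-fixing
  subgroups \<open>M\<close>, a class that contains the subgroups \<open>N\<close> as above and is closed under finite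
  intersections (\<open>co_fixing_Int\<close>). Fix \<open>K \<in> \<A>\<close> and let \<open>E\<close> be the intersection of the products
  \<open>KM\<close>; it is normal and contains every member of \<open>\<A>\<close>. Being amenable, \<open>K\<close> has a solvable subgroup
  \<open>K0\<close> of finite index. As the subgroups \<open>M\<close> form a directed family, the intersection of the
  products \<open>K0 M\<close> has finite index in \<open>E\<close> (\<open>co_fixing_closure_finite_index\<close>). It is solvable,
  because a term of its derived series lies in every \<open>N\<close> (\<open>derived_series_co_fixing_closure\<close>) and
  the intersection of these is trivial. So \<open>E\<close> is virtually solvable and fixes a charge on \<open>B\<close>.\<close>

section \<open>Compact spaces with a group action\<close>

lemma compact_space_INT_nonempty:
  assumes "compact_space X" "\<And>i. i \<in> I \<Longrightarrow> closedin X (C i)"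
    and "\<And>F. finite F \<Longrightarrow> F \<subseteq> I \<Longrightarrow> topspace X \<inter> (\<Inter>i\<in>F. C i) \<noteq> {}"
  shows "topspace X \<inter> (\<Inter>i\<in>I. C i) \<noteq> {}"
proof -
  have "\<Inter>(insert (topspace X) (C ` I)) \<noteq> {}"
  proof (rule assms(1)[unfolded compact_space_fip, rule_format], intro conjI ballI allI impI notI)
    fix c assume "c \<in> insert (topspace X) (C ` I)" then show "closedin X c" using assms by auto
  next
    fix F assume "finite F \<and> F \<subseteq> insert (topspace X) (C ` I)" and F0: "\<Inter>F = {}"
    then have F: "finite F" "F \<subseteq> insert (topspace X) (C ` I)" by auto
    have "finite (F - {topspace X})" "F - {topspace X} \<subseteq> C ` I" using F by auto
    from finite_subset_image[OF this]
    obtain J where J: "finite J" "J \<subseteq> I" "F - {topspace X} = C ` J" by blast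
    have "topspace X \<inter> (\<Inter>i\<in>J. C i) \<subseteq> \<Inter>F"
    proof
      fix x assume x: "x \<in> topspace X \<inter> (\<Inter>i\<in>J. C i)"
      show "x \<in> \<Inter>F"
      proof
        fix S assume "S \<in> F"
        then have "S = topspace X \<or> S \<in> C ` J" using J(3) by auto
        then show "x \<in> S" using x by auto
      qed
    qed
    then show False using assms(3)[OF J(1,2)] F0 by auto
  qed
  then show ?thesis by auto
qed

text \<open>Zorn's lemma for closed sets, with a side condition \<open>P\<close> that survives intersections. It is used
  for invariant sets, for convex invariant sets, for faces of a convex set and for sets of
  subgroups that are closed under passing to smaller members of a given set.\<close>

lemma minimal_closed_subset:
  assumes comp: "compact_space X" and T: "closedin X T" "T \<noteq> {}" "P T"
    and chain: "\<And>\<C>. \<C> \<noteq> {} \<Longrightarrow> (\<forall>C\<in>\<C>. closedin X C \<and> P C) \<Longrightarrow> P (\<Inter>\<C>)"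
  obtains M where "M \<subseteq> T" "closedin X M" "M \<noteq> {}" "P M"
    "\<And>M'. M' \<subseteq> M \<Longrightarrow> closedin X M' \<Longrightarrow> M' \<noteq> {} \<Longrightarrow> P M' \<Longrightarrow> M' = M"
proof -
  define \<A> where "\<A> = {C. closedin X C \<and> C \<noteq> {} \<and> C \<subseteq> T \<and> P C}"
  have "\<exists>M\<in>uminus ` \<A>. \<forall>Z\<in>uminus ` \<A>. M \<subseteq> Z \<longrightarrow> Z = M"
  proof (rule subset_Zorn_nonempty)
    show "uminus ` \<A> \<noteq> {}" using T by (auto simp: \<A>_def)
    fix \<D> assume ne: "\<D> \<noteq> {}" and D: "subset.chain (uminus ` \<A>) \<D>"
    define \<C> where "\<C> = uminus ` \<D>"
    have CA: "\<C> \<subseteq> \<A>" using D by (auto simp: \<C>_def subset_chain_def)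
    have lin: "C \<subseteq> C' \<or> C' \<subseteq> C" if "C \<in> \<C>" "C' \<in> \<C>" for C C'
    proof -
      have "- C \<in> \<D>" "- C' \<in> \<D>" using that by (auto simp: \<C>_def)
      then have "- C \<subseteq> - C' \<or> - C' \<subseteq> - C" using D unfolding subset_chain_def by blast
      then show ?thesis by auto
    qed
    have fin: "\<exists>C\<in>\<C>. C \<subseteq> \<Inter>F" if "finite F" "F \<noteq> {}" "F \<subseteq> \<C>" for F
      using that
    proof (induction F rule: finite_ne_induct)
      case (insert C F)
      then obtain C' where C': "C' \<in> \<C>" "C' \<subseteq> \<Inter>F" by auto
      then show ?case using lin[of C C'] insert.prems by auto
    qed auto
    have ne': "\<C> \<noteq> {}" using ne by (auto simp: \<C>_def)
    have "\<Inter>\<C> \<noteq> {}"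
    proof (rule comp[unfolded compact_space_fip, rule_format], intro conjI ballI allI impI notI)
      fix F assume F: "finite F \<and> F \<subseteq> \<C>" "\<Inter>F = {}"
      have "F \<noteq> {}" using F(2) by (metis Inter_empty UNIV_not_empty)
      from fin[OF conjunct1[OF F(1)] this conjunct2[OF F(1)]]
      obtain C where C: "C \<in> \<C>" "C \<subseteq> \<Inter>F" by metis
      have "C = {}" using C(2) unfolding F(2) by simp
      moreover have "C \<in> \<A>" using C(1) CA by (rule subsetD[rotated])
      ultimately show False by (simp add: \<A>_def)
    next
      fix C assume "C \<in> \<C>" then show "closedin X C" using CA by (auto simp: \<A>_def)
    qed
    moreover have "closedin X (\<Inter>\<C>)"
    proof (rule closedin_Inter[OF ne'])
      fix S assume "S \<in> \<C>"
      then show "closedin X S" using CA unfolding \<A>_def by blast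
    qed
    moreover have "P (\<Inter>\<C>)"
      by (rule chain[OF ne']) (use CA \<A>_def in blast)
    moreover have "\<Inter>\<C> \<subseteq> T"
    proof -
      obtain C where "C \<in> \<C>" using ne' by blast
      moreover have "C \<subseteq> T" using CA calculation unfolding \<A>_def by blast
      ultimately show ?thesis by (rule order_trans[OF Inter_lower])
    qed
    ultimately have "\<Inter>\<C> \<in> \<A>" unfolding \<A>_def by simp
    moreover have "\<Union>\<D> = - \<Inter>\<C>" unfolding \<C>_def by (simp add: uminus_Inf)
    ultimately show "\<Union>\<D> \<in> uminus ` \<A>" by (metis imageI)
  qed
  then obtain M where M: "M \<in> \<A>" and M': "\<forall>Z\<in>uminus ` \<A>. - M \<subseteq> Z \<longrightarrow> Z = - M" by (metis imageE)
  show thesis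
  proof (rule that[of M])
    show "M \<subseteq> T" "closedin X M" "M \<noteq> {}" "P M" using M unfolding \<A>_def by simp_all
    fix N assume *: "N \<subseteq> M" "closedin X N" "N \<noteq> {}" "P N"
    then have "N \<in> \<A>" using M order_trans[of N M T] unfolding \<A>_def by simp
    then have "- N = - M" using M' * by simp
    then show "N = M" by simp
  qed
qed

text \<open>Projections along compact factors are closed. This is how conditions of the form ``there is a
  point \<open>x\<close> such that'' are shown to be closed in the remaining variable.\<close>

lemma closed_map_projections:
  assumes "compact_space X" "compact_space Y" "closedin (prod_topology X Y) S"
  shows "closedin X (fst ` S)" "closedin Y (snd ` S)"
  using closed_map_fst[of Y X] closed_map_snd[of X Y] assms
  by (auto simp: closed_map_def)

text \<open>The acting set \<open>S\<close> need not be the whole group: the same notion is applied to normal subgroups.\<close>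

definition invariant_under :: "'a set \<Rightarrow> ('a \<Rightarrow> 'x \<Rightarrow> 'x) \<Rightarrow> 'x set \<Rightarrow> bool" where
  "invariant_under S \<phi> T \<longleftrightarrow> (\<forall>g\<in>S. \<forall>x\<in>T. \<phi> g x \<in> T)"

locale flow =
  fixes G (structure) and X and \<phi>
  assumes cgs: "compact_G_space G X \<phi>"
begin

sublocale group_action G "topspace X" \<phi>
  using cgs by (simp add: compact_G_space_def)

sublocale group G
  using group_hom by (rule group_hom.axioms(1))

lemma is_group: "group G" by unfold_locales

lemma compact: "compact_space X" and Hausdorff: "Hausdorff_space X" and nonempty: "topspace X \<noteq> {}"
  using cgs by (auto simp: compact_G_space_def)

lemma cont: "g \<in> carrier G \<Longrightarrow> continuous_map X X (\<phi> g)"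
  using cgs by (auto simp: compact_G_space_def intro: homeomorphic_imp_continuous_map)

lemma act_closed [intro, simp]: "g \<in> carrier G \<Longrightarrow> x \<in> topspace X \<Longrightarrow> \<phi> g x \<in> topspace X"
  using element_image by blast

lemma act_one [simp]: "x \<in> topspace X \<Longrightarrow> \<phi> \<one> x = x"
  using id_eq_one by (metis restrict_apply')

lemma act_mult: "g \<in> carrier G \<Longrightarrow> h \<in> carrier G \<Longrightarrow> x \<in> topspace X \<Longrightarrow> \<phi> (g \<otimes> h) x = \<phi> g (\<phi> h x)"
  using composition_rule by simp

lemma act_inv [simp]: "g \<in> carrier G \<Longrightarrow> x \<in> topspace X \<Longrightarrow> \<phi> (inv g) (\<phi> g x) = x"
  using act_mult[of "inv g" g x] by simp

lemma act_inv' [simp]: "g \<in> carrier G \<Longrightarrow> x \<in> topspace X \<Longrightarrow> \<phi> g (\<phi> (inv g) x) = x"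
  using act_mult[of g "inv g" x] by simp

lemma act_image: "g \<in> carrier G \<Longrightarrow> A \<subseteq> topspace X \<Longrightarrow> \<phi> g ` A = \<phi> (inv g) -` A \<inter> topspace X"
  by (force simp: image_iff)

lemma openin_preimage: "g \<in> carrier G \<Longrightarrow> openin X U \<Longrightarrow> openin X (\<phi> g -` U \<inter> topspace X)"
  using openin_continuous_map_preimage[OF cont] by (simp add: vimage_def Collect_conj_eq Int_commute)

lemma closedin_preimage: "g \<in> carrier G \<Longrightarrow> closedin X U \<Longrightarrow> closedin X (\<phi> g -` U \<inter> topspace X)"
  using closedin_continuous_map_preimage[OF cont] by (simp add: vimage_def Collect_conj_eq Int_commute)

lemma closedin_act_image:
  assumes "g \<in> carrier G" "closedin X A" shows "closedin X (\<phi> g ` A)"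
  using closedin_preimage[of "inv g" A] act_image[of g A] assms closedin_subset[OF assms(2)] by simp

lemma minimal_invariant_subset:
  assumes "closedin X T" "T \<noteq> {}" "invariant_under S \<phi> T"
  obtains M where "M \<subseteq> T" "closedin X M" "M \<noteq> {}" "invariant_under S \<phi> M"
    "\<And>M'. M' \<subseteq> M \<Longrightarrow> closedin X M' \<Longrightarrow> M' \<noteq> {} \<Longrightarrow> invariant_under S \<phi> M' \<Longrightarrow> M' = M"
  using minimal_closed_subset[OF compact assms(1,2), where P = "invariant_under S \<phi>"] assms(3)
  by (auto simp: invariant_under_def)

lemma orbit_subset: "x \<in> topspace X \<Longrightarrow> orbit G \<phi> x \<subseteq> topspace X"
  by (auto simp: orbit_def)

lemma orbit_closure_subset:
  assumes "invariant_under (carrier G) \<phi> T" "closedin X T" "x \<in> T"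
  shows "X closure_of (orbit G \<phi> x) \<subseteq> T"
  using assms by (intro closure_of_minimal) (auto simp: orbit_def invariant_under_def)

lemma closure_invariant:
  assumes "invariant_under S \<phi> T" "S \<subseteq> carrier G" "T \<subseteq> topspace X"
  shows "invariant_under S \<phi> (X closure_of T)"
proof -
  have "\<phi> g ` (X closure_of T) \<subseteq> X closure_of T" if "g \<in> S" for g
  proof -
    have "\<phi> g ` (X closure_of T) \<subseteq> X closure_of (\<phi> g ` T)"
      using cont[of g] that assms by (auto simp: continuous_map_eq_image_closure_subset)
    also have "\<dots> \<subseteq> X closure_of T"
      using assms that by (intro closure_of_mono) (auto simp: invariant_under_def)
    finally show ?thesis .
  qed
  then show ?thesis by (auto simp: invariant_under_def)
qed

lemma minimal_iff:
  "minimal_G_space G X \<phi> \<longleftrightarrow>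
    (\<forall>T. closedin X T \<longrightarrow> T \<noteq> {} \<longrightarrow> invariant_under (carrier G) \<phi> T \<longrightarrow> T = topspace X)"
proof (intro iffI allI impI)
  fix T assume m: "minimal_G_space G X \<phi>" and T: "closedin X T" "T \<noteq> {}" "invariant_under (carrier G) \<phi> T"
  from T obtain y where y: "y \<in> T" by auto
  then have "X closure_of (orbit G \<phi> y) = topspace X"
    using m closedin_subset[OF T(1)] by (auto simp: minimal_G_space_def)
  then show "T = topspace X" using orbit_closure_subset[OF T(3,1) y] closedin_subset[OF T(1)] by auto
next
  assume *: "\<forall>T. closedin X T \<longrightarrow> T \<noteq> {} \<longrightarrow> invariant_under (carrier G) \<phi> T \<longrightarrow> T = topspace X"
  show "minimal_G_space G X \<phi>" unfolding minimal_G_space_def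
  proof
    fix x assume x: "x \<in> topspace X"
    have inv: "invariant_under (carrier G) \<phi> (orbit G \<phi> x)"
      using x by (auto simp: invariant_under_def orbit_def simp flip: act_mult)
    have "x \<in> orbit G \<phi> x" using x by (force simp: orbit_def intro: exI[of _ \<one>])
    moreover have "orbit G \<phi> x \<subseteq> X closure_of orbit G \<phi> x"
      using closure_of_subset orbit_subset[OF x] by blast
    ultimately have "X closure_of orbit G \<phi> x \<noteq> {}" by auto
    then show "X closure_of (orbit G \<phi> x) = topspace X"
      using * closure_invariant[OF inv _ orbit_subset[OF x]] by auto
  qed
qed

end

lemma group_actionI:
  fixes G (structure)
  assumes "group G" "\<And>g. g \<in> carrier G \<Longrightarrow> \<phi> g \<in> extensional E"
    and cl: "\<And>g x. g \<in> carrier G \<Longrightarrow> x \<in> E \<Longrightarrow> \<phi> g x \<in> E"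
    and one: "\<And>x. x \<in> E \<Longrightarrow> \<phi> \<one>\<^bsub>G\<^esub> x = x"
    and mult: "\<And>g h x. g \<in> carrier G \<Longrightarrow> h \<in> carrier G \<Longrightarrow> x \<in> E \<Longrightarrow> \<phi> (g \<otimes>\<^bsub>G\<^esub> h) x = \<phi> g (\<phi> h x)"
  shows "group_action G E \<phi>"
proof -
  interpret group G by fact
  have bij: "\<phi> g \<in> Bij E" if g: "g \<in> carrier G" for g
  proof -
    have "bij_betw (\<phi> g) E E"
    proof (rule bij_betw_byWitness[where f' = "\<phi> (inv g)"])
      show "\<forall>a\<in>E. \<phi> (inv g) (\<phi> g a) = a" using mult[of "inv g" g] one g by simp
      show "\<forall>a\<in>E. \<phi> g (\<phi> (inv g) a) = a" using mult[of g "inv g"] one g by simp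
    qed (use cl g in auto)
    then show ?thesis using assms(2)[OF g] by (simp add: Bij_def)
  qed
  have "\<phi> \<in> hom G (BijGroup E)"
  proof (rule homI)
    fix g h assume gh: "g \<in> carrier G" "h \<in> carrier G"
    have "\<phi> (g \<otimes> h) x = compose E (\<phi> g) (\<phi> h) x" for x
      using gh mult[of g h x] assms(2)[of "g \<otimes> h"] by (cases "x \<in> E") (auto simp: compose_def extensional_def)
    then show "\<phi> (g \<otimes> h) = \<phi> g \<otimes>\<^bsub>BijGroup E\<^esub> \<phi> h"
      using bij gh by (auto simp: BijGroup_def)
  qed (use bij in \<open>auto simp: BijGroup_def\<close>)
  then show ?thesis
    by (simp add: group_action_def group_hom_def group_hom_axioms_def group_BijGroup assms(1))
qed

lemma compact_G_spaceI:
  fixes G (structure)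
  assumes "group G" "compact_space X" "Hausdorff_space X" "topspace X \<noteq> {}"
    and ext: "\<And>g. g \<in> carrier G \<Longrightarrow> \<phi> g \<in> extensional (topspace X)"
    and cont: "\<And>g. g \<in> carrier G \<Longrightarrow> continuous_map X X (\<phi> g)"
    and one: "\<And>x. x \<in> topspace X \<Longrightarrow> \<phi> \<one>\<^bsub>G\<^esub> x = x"
    and mult: "\<And>g h x. g \<in> carrier G \<Longrightarrow> h \<in> carrier G \<Longrightarrow> x \<in> topspace X \<Longrightarrow>
                 \<phi> (g \<otimes>\<^bsub>G\<^esub> h) x = \<phi> g (\<phi> h x)"
  shows "compact_G_space G X \<phi>"
proof -
  interpret group G by fact
  have cl: "\<phi> g x \<in> topspace X" if "g \<in> carrier G" "x \<in> topspace X" for g x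
    using continuous_map_image_subset_topspace[OF cont] that by blast
  have "group_action G (topspace X) \<phi>"
    using assms cl by (intro group_actionI) auto
  moreover have "homeomorphic_map X X (\<phi> g)" if g: "g \<in> carrier G" for g
    using mult[of "inv g" g] mult[of g "inv g"] one g cont
    by (auto simp: homeomorphic_map_maps homeomorphic_maps_def intro!: exI[of _ "\<phi> (inv g)"])
  ultimately show ?thesis using assms by (auto simp: compact_G_space_def)
qed

lemma (in flow) subflow:
  assumes C: "closedin X C" "C \<noteq> {}" "invariant_under (carrier G) \<phi> C"
  shows "compact_G_space G (subtopology X C) (\<lambda>g. restrict (\<phi> g) C)"
proof (rule compact_G_spaceI)
  have sub: "C \<subseteq> topspace X" using C closedin_subset by auto
  then have top: "topspace (subtopology X C) = C" by (rule topspace_subtopology_subset)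
  show "compact_space (subtopology X C)"
    using closedin_compact_space[OF compact C(1)] compactin_subspace by blast
  show "Hausdorff_space (subtopology X C)" using Hausdorff Hausdorff_space_subtopology by blast
  show "topspace (subtopology X C) \<noteq> {}" using top C by auto
  show "restrict (\<phi> \<one>) C x = x" if "x \<in> topspace (subtopology X C)" for x
  proof -
    have "x \<in> C" "x \<in> topspace X" using that by auto
    then show ?thesis by simp
  qed
  have inv: "\<phi> g x \<in> C" if "g \<in> carrier G" "x \<in> C" for g x
    using C(3) that by (auto simp: invariant_under_def)
  fix g assume g: "g \<in> carrier G"
  show "restrict (\<phi> g) C \<in> extensional (topspace (subtopology X C))" using top by auto
  show "continuous_map (subtopology X C) (subtopology X C) (restrict (\<phi> g) C)"
  proof (rule continuous_map_into_subtopology)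
    show "continuous_map (subtopology X C) X (restrict (\<phi> g) C)"
      by (rule continuous_map_eq[OF continuous_map_from_subtopology[OF cont[OF g]]]) simp
    show "restrict (\<phi> g) C \<in> topspace (subtopology X C) \<rightarrow> C"
      unfolding top using inv[OF g] by simp
  qed
  fix h x assume h: "h \<in> carrier G" and "x \<in> topspace (subtopology X C)"
  then have "x \<in> C" "x \<in> topspace X" by auto
  then show "restrict (\<phi> (g \<otimes> h)) C x = restrict (\<phi> g) C (restrict (\<phi> h) C x)"
    using g h inv[OF h] act_mult[OF g h] by simp
qed (rule is_group)


section \<open>Finitely additive probability measures\<close>

text \<open>A charge is a finitely additive probability on a field \<open>M\<close> of subsets of \<open>\<Omega>\<close>. Two fields occur:
  the Borel sets of a compact space, and all subsets of a group, in which case a charge is what is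
  usually called a mean. Outside \<open>M\<close> the value is fixed to \<open>undefined\<close>, so that charges agreeing
  on \<open>M\<close> are equal.\<close>

definition charges :: "'x set \<Rightarrow> 'x set set \<Rightarrow> ('x set \<Rightarrow> real) set" where
  "charges \<Omega> M = {m \<in> M \<rightarrow>\<^sub>E {0..1}. m \<Omega> = 1 \<and>
     (\<forall>A\<in>M. \<forall>B\<in>M. A \<inter> B = {} \<longrightarrow> m (A \<union> B) = m A + m B)}"

text \<open>The topology of pointwise convergence on \<open>M\<close>. For Borel charges it is finer than weak
  convergence, yet still compact because only finite additivity has to survive limits.\<close>

definition charge_space :: "'x set \<Rightarrow> 'x set set \<Rightarrow> ('x set \<Rightarrow> real) topology" where
  "charge_space \<Omega> M = subtopology (product_topology (\<lambda>_. euclideanreal) M) (charges \<Omega> M)"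

definition push :: "'x set \<Rightarrow> 'y set set \<Rightarrow> ('x \<Rightarrow> 'y) \<Rightarrow> ('x set \<Rightarrow> real) \<Rightarrow> 'y set \<Rightarrow> real" where
  "push \<Omega> N f m = (\<lambda>A\<in>N. m (f -` A \<inter> \<Omega>))"

definition charge_act ::
    "'x set \<Rightarrow> 'x set set \<Rightarrow> ('a \<Rightarrow> 'x \<Rightarrow> 'x) \<Rightarrow> 'a \<Rightarrow> ('x set \<Rightarrow> real) \<Rightarrow> 'x set \<Rightarrow> real" where
  "charge_act \<Omega> M \<phi> g = restrict (push \<Omega> M (\<phi> g)) (charges \<Omega> M)"

definition point_charge :: "'x set set \<Rightarrow> 'x \<Rightarrow> 'x set \<Rightarrow> real" where
  "point_charge M x = (\<lambda>A\<in>M. indicator A x)"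

lemma topspace_charge_space [simp]: "topspace (charge_space \<Omega> M) = charges \<Omega> M"
  by (auto simp: charge_space_def charges_def PiE_def)

lemma charge_range: "m \<in> charges \<Omega> M \<Longrightarrow> A \<in> M \<Longrightarrow> 0 \<le> m A \<and> m A \<le> 1"
  by (auto simp: charges_def)

lemma charge_add:
  "m \<in> charges \<Omega> M \<Longrightarrow> A \<in> M \<Longrightarrow> B \<in> M \<Longrightarrow> A \<inter> B = {} \<Longrightarrow> m (A \<union> B) = m A + m B"
  by (auto simp: charges_def)

lemma charge_total: "m \<in> charges \<Omega> M \<Longrightarrow> m \<Omega> = 1"
  by (auto simp: charges_def)

lemma charges_eqI:
  "m \<in> charges \<Omega> M \<Longrightarrow> m' \<in> charges \<Omega> M \<Longrightarrow> (\<And>A. A \<in> M \<Longrightarrow> m A = m' A) \<Longrightarrow> m = m'"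
  by (rule PiE_ext[of _ M "\<lambda>_. {0..1}"]) (auto simp: charges_def)

lemma chargesI:
  assumes "m \<in> extensional M" "\<And>A. A \<in> M \<Longrightarrow> 0 \<le> m A \<and> m A \<le> 1" "m \<Omega> = 1"
    "\<And>A B. A \<in> M \<Longrightarrow> B \<in> M \<Longrightarrow> A \<inter> B = {} \<Longrightarrow> m (A \<union> B) = m A + m B"
  shows "m \<in> charges \<Omega> M"
  using assms by (auto simp: charges_def PiE_def)

lemma continuous_map_charge_eval:
  assumes "A \<in> M" shows "continuous_map (charge_space \<Omega> M) euclideanreal (\<lambda>m. m A)"
  unfolding charge_space_def
  by (intro continuous_map_from_subtopology continuous_map_product_projection assms)

lemma continuous_map_into_charge_space:
  assumes "\<And>z. z \<in> topspace Z \<Longrightarrow> F z \<in> charges \<Omega> M"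
    "\<And>A. A \<in> M \<Longrightarrow> continuous_map Z euclideanreal (\<lambda>z. F z A)"
  shows "continuous_map Z (charge_space \<Omega> M) F"
  unfolding charge_space_def
proof (rule continuous_map_into_subtopology)
  show "continuous_map Z (product_topology (\<lambda>_. euclideanreal) M) F"
    unfolding continuous_map_componentwise using assms
    by (auto simp: charges_def PiE_def)
qed (use assms in auto)

lemma closedin_eval_le:
  assumes "continuous_map X euclideanreal f" "continuous_map X euclideanreal g"
  shows "closedin X {x \<in> topspace X. f x \<le> g x}"
proof -
  have "closedin X {x \<in> topspace X. g x - f x \<in> {0..}}"
    using assms by (intro closedin_continuous_map_preimage[of X euclideanreal]) (auto intro!: continuous_intros)
  moreover have "{x \<in> topspace X. g x - f x \<in> {0..}} = {x \<in> topspace X. f x \<le> g x}" by auto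
  ultimately show ?thesis by simp
qed

lemma Hausdorff_charge_space: "Hausdorff_space (charge_space \<Omega> M)"
  unfolding charge_space_def by (intro Hausdorff_space_subtopology) (simp add: Hausdorff_space_product_topology)

context
  fixes \<Omega> :: "'x set" and M
  assumes alg: "Sigma_Algebra.algebra \<Omega> M"
begin

interpretation A: Sigma_Algebra.algebra \<Omega> M by (rule alg)

lemma compact_charge_space: "compact_space (charge_space \<Omega> M)"
proof -
  let ?P = "product_topology (\<lambda>_. euclideanreal) M"
  have c: "continuous_map ?P euclideanreal (\<lambda>m. m A)" if "A \<in> M" for A
    using that by (rule continuous_map_product_projection)
  have K: "compactin ?P (M \<rightarrow>\<^sub>E {0..1})"
    by (simp add: compactin_PiE)
  have HP: "Hausdorff_space ?P" by (simp add: Hausdorff_space_product_topology)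
  define E where "E = (\<lambda>(A,B). if A \<inter> B = {} then {m \<in> topspace ?P. m (A \<union> B) = m A + m B} else topspace ?P)"
  have E: "closedin ?P (E p)" if p: "p \<in> M \<times> M" for p
  proof -
    obtain A B where AB: "p = (A, B)" "A \<in> M" "B \<in> M" using p by (rule SigmaE)
    have "closedin ?P {m \<in> topspace ?P. m (A \<union> B) = m A + m B}"
      using AB by (intro closedin_continuous_maps_eq[of euclideanreal] c continuous_map_add) auto
    then show ?thesis
      using AB closedin_topspace[of ?P] by (cases "A \<inter> B = {}") (simp_all add: E_def)
  qed
  have "charges \<Omega> M = (M \<rightarrow>\<^sub>E {0..1}) \<inter> {m \<in> topspace ?P. m \<Omega> = 1} \<inter> (\<Inter>p\<in>M \<times> M. E p)"
    by (auto simp: charges_def E_def PiE_def split: if_splits)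
  moreover have "closedin ?P {m \<in> topspace ?P. m \<Omega> = 1}"
    by (intro closedin_continuous_maps_eq[of euclideanreal] c) auto
  moreover have "closedin ?P (M \<rightarrow>\<^sub>E {0..1})"
    using K HP compactin_imp_closedin by blast
  ultimately have "closedin ?P (charges \<Omega> M)"
    using E A.top by (auto intro!: closedin_Int closedin_INT)
  moreover have "charges \<Omega> M \<subseteq> M \<rightarrow>\<^sub>E {0..1}" by (auto simp: charges_def)
  ultimately have "compactin ?P (charges \<Omega> M)" using closed_compactin K by blast
  then show ?thesis unfolding charge_space_def by (rule compact_space_subtopology)
qed

lemma charge_empty: "m \<in> charges \<Omega> M \<Longrightarrow> m {} = 0"
  using charge_add[of m \<Omega> M "{}" "{}"] by simp

lemma charge_Diff:
  assumes "m \<in> charges \<Omega> M" "A \<in> M" "B \<in> M" "A \<subseteq> B" shows "m (B - A) = m B - m A"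
  using charge_add[of m \<Omega> M A "B - A"] assms A.Diff[of B A] by (auto simp: Un_absorb1)

lemma charge_mono:
  assumes "m \<in> charges \<Omega> M" "A \<in> M" "B \<in> M" "A \<subseteq> B" shows "m A \<le> m B"
  using charge_Diff[OF assms] charge_range[OF assms(1), of "B - A"] assms A.Diff[of B A] by auto

lemma charge_Un_le:
  assumes "m \<in> charges \<Omega> M" "A \<in> M" "B \<in> M" shows "m (A \<union> B) \<le> m A + m B"
proof -
  have "m (A \<union> B) = m A + m (B - A)"
    using charge_add[of m \<Omega> M A "B - A"] assms A.Diff[of B A] by auto
  also have "m (B - A) \<le> m B" using assms by (intro charge_mono) auto
  finally show ?thesis by simp
qed

lemma charge_UN_le:
  assumes "m \<in> charges \<Omega> M" "finite I" "\<And>i. i \<in> I \<Longrightarrow> A i \<in> M"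
  shows "m (\<Union>i\<in>I. A i) \<le> (\<Sum>i\<in>I. m (A i))"
  using assms(2,3)
proof (induction I rule: finite_induct)
  case empty then show ?case using charge_empty[OF assms(1)] by simp
next
  case (insert i I)
  have "m (\<Union>j\<in>insert i I. A j) \<le> m (A i) + m (\<Union>j\<in>I. A j)"
    using charge_Un_le[OF assms(1), of "A i" "\<Union>j\<in>I. A j"] insert by (auto intro: A.finite_UN)
  then show ?case using insert by auto
qed

lemma charge_Int_ge:
  assumes "m \<in> charges \<Omega> M" "A \<in> M" "B \<in> M" shows "m (A \<inter> B) \<ge> m A + m B - 1"
proof -
  have "B - A \<inter> B = B - A" by auto
  then have "m (A \<union> B) + m (A \<inter> B) = m A + m B"
    using charge_add[OF assms(1), of A "B - A"] charge_Diff[OF assms(1), of "A \<inter> B" B] assms A.Diff[of B A]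
      A.Int[of A B] by auto
  then show ?thesis using charge_range[OF assms(1) A.Un[OF assms(2,3)]] by linarith
qed

lemma push_charge:
  assumes m: "m \<in> charges \<Omega> M" and f: "f \<in> \<Omega> \<rightarrow> \<Omega>'" "\<Omega>' \<in> N" "\<And>A. A \<in> N \<Longrightarrow> f -` A \<inter> \<Omega> \<in> M"
    and N: "\<And>A B. A \<in> N \<Longrightarrow> B \<in> N \<Longrightarrow> A \<union> B \<in> N"
  shows "push \<Omega> N f m \<in> charges \<Omega>' N"
proof (rule chargesI)
  have "f -` \<Omega>' \<inter> \<Omega> = \<Omega>" using f by auto
  then show "push \<Omega> N f m \<Omega>' = 1" using f(2) charge_total[OF m] by (simp add: push_def)
  fix A B assume AB: "A \<in> N" "B \<in> N" "A \<inter> B = {}"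
  have "m ((f -` A \<inter> \<Omega>) \<union> (f -` B \<inter> \<Omega>)) = m (f -` A \<inter> \<Omega>) + m (f -` B \<inter> \<Omega>)"
    using AB by (intro charge_add[OF m] f) auto
  moreover have "f -` (A \<union> B) \<inter> \<Omega> = (f -` A \<inter> \<Omega>) \<union> (f -` B \<inter> \<Omega>)" by auto
  ultimately show "push \<Omega> N f m (A \<union> B) = push \<Omega> N f m A + push \<Omega> N f m B"
    using AB N by (simp add: push_def)
qed (use charge_range[OF m] f in \<open>auto simp: push_def\<close>)

lemma continuous_map_push:
  assumes f: "f \<in> \<Omega> \<rightarrow> \<Omega>'" "\<Omega>' \<in> N" "\<And>A. A \<in> N \<Longrightarrow> f -` A \<inter> \<Omega> \<in> M"
    and N: "\<And>A B. A \<in> N \<Longrightarrow> B \<in> N \<Longrightarrow> A \<union> B \<in> N"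
  shows "continuous_map (charge_space \<Omega> M) (charge_space \<Omega>' N) (push \<Omega> N f)"
proof (rule continuous_map_into_charge_space)
  fix A assume "A \<in> N"
  then show "continuous_map (charge_space \<Omega> M) euclideanreal (\<lambda>z. push \<Omega> N f z A)"
    using continuous_map_charge_eval[OF f(3)] by (simp add: push_def)
qed (use push_charge[OF _ assms] in auto)

lemma point_charge: "x \<in> \<Omega> \<Longrightarrow> point_charge M x \<in> charges \<Omega> M"
  by (rule chargesI) (auto simp: point_charge_def indicator_def)

lemma charge_flow:
  assumes act: "group_action G \<Omega> \<phi>" and ne: "\<Omega> \<noteq> {}"
    and inv: "\<And>g A. g \<in> carrier G \<Longrightarrow> A \<in> M \<Longrightarrow> \<phi> g -` A \<inter> \<Omega> \<in> M"
  shows "compact_G_space G (charge_space \<Omega> M) (charge_act \<Omega> M \<phi>)"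
proof -
  interpret group_action G \<Omega> \<phi> by fact
  interpret G: group G using group_hom by (rule group_hom.axioms(1))
  have cl: "\<phi> g \<in> \<Omega> \<rightarrow> \<Omega>" if "g \<in> carrier G" for g using that element_image by blast
  have pc: "push \<Omega> M (\<phi> g) m \<in> charges \<Omega> M" if "g \<in> carrier G" "m \<in> charges \<Omega> M" for g m
    using that by (intro push_charge cl inv) auto
  show ?thesis
  proof (rule compact_G_spaceI)
    show "topspace (charge_space \<Omega> M) \<noteq> {}" using point_charge ne by auto
    fix g assume g: "g \<in> carrier G"
    show "continuous_map (charge_space \<Omega> M) (charge_space \<Omega> M) (charge_act \<Omega> M \<phi> g)"
      by (rule continuous_map_eq[OF continuous_map_push[where f = "\<phi> g"]])
         (use g cl inv in \<open>auto simp: charge_act_def\<close>)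
    fix h m assume h: "h \<in> carrier G" and m: "m \<in> topspace (charge_space \<Omega> M)"
    have "push \<Omega> M (\<phi> (g \<otimes>\<^bsub>G\<^esub> h)) m = push \<Omega> M (\<phi> g) (push \<Omega> M (\<phi> h) m)"
    proof
      fix A
      have "\<phi> (g \<otimes>\<^bsub>G\<^esub> h) -` A \<inter> \<Omega> = \<phi> h -` (\<phi> g -` A \<inter> \<Omega>) \<inter> \<Omega>"
        using composition_rule g h cl[OF h] by auto
      then show "push \<Omega> M (\<phi> (g \<otimes>\<^bsub>G\<^esub> h)) m A = push \<Omega> M (\<phi> g) (push \<Omega> M (\<phi> h) m) A"
        using inv[OF g, of A] by (simp add: push_def)
    qed
    then show "charge_act \<Omega> M \<phi> (g \<otimes>\<^bsub>G\<^esub> h) m = charge_act \<Omega> M \<phi> g (charge_act \<Omega> M \<phi> h m)"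
      using g h m pc by (simp add: charge_act_def)
  next
    fix m assume m: "m \<in> topspace (charge_space \<Omega> M)"
    have "push \<Omega> M (\<phi> \<one>\<^bsub>G\<^esub>) m A = m A" for A
    proof (cases "A \<in> M")
      case True
      have "\<phi> \<one>\<^bsub>G\<^esub> x = x" if "x \<in> \<Omega>" for x using that id_eq_one by (metis restrict_apply')
      then have "\<phi> \<one>\<^bsub>G\<^esub> -` A \<inter> \<Omega> = A" using A.sets_into_space[OF True] by auto
      then show ?thesis using True by (simp add: push_def)
    next
      case False then show ?thesis using m by (auto simp: push_def charges_def PiE_def extensional_def)
    qed
    then show "charge_act \<Omega> M \<phi> \<one>\<^bsub>G\<^esub> m = m" using m by (auto simp: charge_act_def)
  qed (auto simp: G.is_group compact_charge_space Hausdorff_charge_space charge_act_def)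
qed

end

section \<open>Borel charges\<close>

definition borel_charges :: "'x topology \<Rightarrow> ('x set \<Rightarrow> real) set" where
  "borel_charges X = charges (topspace X) (sets (borel_of X))"

definition borel_charge_space :: "'x topology \<Rightarrow> ('x set \<Rightarrow> real) topology" where
  "borel_charge_space X = charge_space (topspace X) (sets (borel_of X))"

definition borel_charge_act ::
    "'x topology \<Rightarrow> ('a \<Rightarrow> 'x \<Rightarrow> 'x) \<Rightarrow> 'a \<Rightarrow> ('x set \<Rightarrow> real) \<Rightarrow> 'x set \<Rightarrow> real" where
  "borel_charge_act X \<phi> = charge_act (topspace X) (sets (borel_of X)) \<phi>"

text \<open>A limit of point masses in the space of charges need not give mass \<open>1\<close> to any singleton; what
  survives is that all open neighbourhoods of one point have full mass.\<close>

definition dirac_at :: "'x topology \<Rightarrow> ('x set \<Rightarrow> real) \<Rightarrow> 'x \<Rightarrow> bool" where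
  "dirac_at X m x \<longleftrightarrow> x \<in> topspace X \<and> (\<forall>U. openin X U \<longrightarrow> x \<in> U \<longrightarrow> m U = 1)"

lemma space_borel_of [simp]: "space (borel_of X) = topspace X"
  by (auto simp: borel_of_def space_measure_of_conv)

lemma sets_borel_of: "sets (borel_of X) = sigma_sets (topspace X) {U. openin X U}"
  unfolding borel_of_def by (rule sets_measure_of) (auto dest: openin_subset)

lemma borel_open: "openin X U \<Longrightarrow> U \<in> sets (borel_of X)"
  by (auto simp: sets_borel_of)

lemma borel_closed: "closedin X U \<Longrightarrow> U \<in> sets (borel_of X)"
  using sets.Diff[OF sets.top borel_open[of X "topspace X - U"]]
  by (auto simp: closedin_def double_diff)

lemma algebra_borel_of: "Sigma_Algebra.algebra (topspace X) (sets (borel_of X))"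
  using sets.algebra_axioms[of "borel_of X"] by simp

lemma borel_of_measurable:
  assumes "continuous_map X Y f" shows "f \<in> borel_of X \<rightarrow>\<^sub>M borel_of Y"
proof -
  have "f \<in> borel_of X \<rightarrow>\<^sub>M sigma (topspace Y) {U. openin Y U}"
  proof (rule measurable_sigma_sets[of _ _ "{U. openin Y U}"])
    show "sets (sigma (topspace Y) {U. openin Y U}) = sigma_sets (topspace Y) {U. openin Y U}"
      by (rule sets_measure_of) (auto dest: openin_subset)
    show "f \<in> space (borel_of X) \<rightarrow> topspace Y" using continuous_map_image_subset_topspace[OF assms] by auto
    fix U assume "U \<in> {U. openin Y U}"
    then have "openin X (f -` U \<inter> topspace X)"
      using openin_continuous_map_preimage[OF assms] by (simp add: vimage_def Collect_conj_eq Int_commute)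
    then show "f -` U \<inter> space (borel_of X) \<in> sets (borel_of X)" by (simp add: borel_open)
  qed (auto dest: openin_subset)
  then show ?thesis by (simp add: borel_of_def)
qed

lemma borel_preimage:
  assumes "continuous_map X Y f" "A \<in> sets (borel_of Y)" shows "f -` A \<inter> topspace X \<in> sets (borel_of X)"
  using measurable_sets[OF borel_of_measurable[OF assms(1)] assms(2)] by simp

lemma borel_measurable_continuous:
  "continuous_map X euclideanreal f \<Longrightarrow> \<mu> \<in> Prob X \<Longrightarrow> f \<in> borel_measurable \<mu>"
proof -
  assume f: "continuous_map X euclideanreal f" and \<mu>: "\<mu> \<in> Prob X"
  have "borel_of (euclideanreal :: real topology) = borel"
    by (simp add: borel_of_def borel_def)
  then show ?thesis using borel_of_measurable[OF f] \<mu>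
    by (auto simp: Prob_def cong: measurable_cong_sets)
qed

context flow begin

lemma borel_act_preimage: "g \<in> carrier G \<Longrightarrow> A \<in> sets (borel_of X) \<Longrightarrow> \<phi> g -` A \<inter> topspace X \<in> sets (borel_of X)"
  by (rule borel_preimage[OF cont])

lemma borel_charge_flow: "flow G (borel_charge_space X) (borel_charge_act X \<phi>)"
  unfolding borel_charge_space_def borel_charge_act_def
  by (intro flow.intro charge_flow algebra_borel_of nonempty borel_act_preimage) unfold_locales

lemma topspace_borel_charge_space [simp]: "topspace (borel_charge_space X) = borel_charges X"
  by (simp add: borel_charge_space_def borel_charges_def)

lemma borel_charge_act_apply:
  "m \<in> borel_charges X \<Longrightarrow> A \<in> sets (borel_of X) \<Longrightarrow> borel_charge_act X \<phi> g m A = m (\<phi> g -` A \<inter> topspace X)"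
  by (simp add: borel_charge_act_def charge_act_def borel_charges_def push_def)

end


section \<open>From charges to regular Borel measures\<close>

lemma regular_nbhd:
  assumes "compact_space X" "Hausdorff_space X" "openin X U" "x \<in> U"
  obtains W where "openin X W" "x \<in> W" "X closure_of W \<subseteq> U"
proof -
  have "regular_space X"
    using compact_Hausdorff_imp_regular_space assms by blast
  moreover have "closedin X (topspace X - U)" "x \<in> topspace X - (topspace X - U)"
    using assms openin_subset by auto
  ultimately obtain W where W: "openin X W" "x \<in> W" "disjnt (topspace X - U) (X closure_of W)"
    unfolding regular_space by blast
  then have "X closure_of W \<subseteq> U"
    using closure_of_subset_topspace[of X W] by (auto simp: disjnt_def)
  then show ?thesis using that W by blast
qed

text \<open>A variant of the Riesz representation theorem. Put \<open>\<tau> U\<close> for the supremum of the values \<open>m V\<close>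
  over the open \<open>V\<close> whose closure lies in \<open>U\<close>. Compactness of these closures upgrades finite
  subadditivity of \<open>m\<close> to countable subadditivity of \<open>\<tau>\<close>, and the outer measure induced by \<open>\<tau>\<close>
  makes open sets measurable. Only the inequality with \<open>m\<close> on open sets is recorded: it is what
  transfers contraction of measures towards a point to contraction of charges.\<close>

lemma regular_borel_measure_below_charge:
  assumes comp: "compact_space X" and haus: "Hausdorff_space X" and m: "m \<in> borel_charges X"
  obtains \<mu> where "\<mu> \<in> Prob X" "\<And>U. openin X U \<Longrightarrow> measure \<mu> U \<le> m U"
proof -
  let ?\<Omega> = "topspace X"
  note alg = algebra_borel_of[of X]
  have mc: "m \<in> charges ?\<Omega> (sets (borel_of X))" using m by (simp add: borel_charges_def)
  have m01: "0 \<le> m V \<and> m V \<le> 1" if "openin X V" for V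
    using charge_range[OF mc] borel_open that by blast
  define S where "S U = {V. openin X V \<and> X closure_of V \<subseteq> U}" for U
  define \<tau> where "\<tau> U = (SUP V\<in>S U. m V)" for U
  have S0: "{} \<in> S U" for U by (simp add: S_def)
  have bdd: "bdd_above (m ` S U)" for U using m01 by (auto simp: S_def bdd_above_def)
  have \<tau>_upper: "m V \<le> \<tau> U" if "openin X V" "X closure_of V \<subseteq> U" for U V
    unfolding \<tau>_def by (rule cSUP_upper[OF _ bdd]) (use that S_def in auto)
  have \<tau>_least: "\<tau> U \<le> c" if "\<And>V. openin X V \<Longrightarrow> X closure_of V \<subseteq> U \<Longrightarrow> m V \<le> c" for U c
    unfolding \<tau>_def by (rule cSUP_least) (use that S0 S_def in auto)
  have m_empty: "m {} = 0" by (rule charge_empty[OF alg mc])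
  have \<tau>_nonneg: "0 \<le> \<tau> U" for U using \<tau>_upper[of "{}" U] m_empty by simp
  have \<tau>_mono: "\<tau> U \<le> \<tau> U'" if "U \<subseteq> U'" for U U'
    using that by (intro \<tau>_least \<tau>_upper) auto
  have \<tau>_empty: "\<tau> {} = 0"
  proof -
    have "\<tau> {} \<le> 0"
    proof (rule \<tau>_least)
      fix V assume "openin X V" "X closure_of V \<subseteq> {}"
      then have "V = {}" using closure_of_subset[of V X] openin_subset by blast
      then show "m V \<le> 0" using m_empty by simp
    qed
    then show ?thesis using \<tau>_nonneg[of "{}"] by simp
  qed
  have \<tau>_le_m: "\<tau> U \<le> m U" if U: "openin X U" for U
  proof (rule \<tau>_least)
    fix V assume V: "openin X V" "X closure_of V \<subseteq> U"
    then have "V \<subseteq> U" using closure_of_subset[of V X] openin_subset by blast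
    then show "m V \<le> m U" using charge_mono[OF alg mc] borel_open U V by blast
  qed
  have \<tau>_top: "\<tau> ?\<Omega> = 1"
    using \<tau>_upper[of ?\<Omega> ?\<Omega>] \<tau>_le_m[of ?\<Omega>] charge_total[OF mc] by simp
  \<comment> \<open>a closure inside the union is covered by finitely many open sets with closure inside some \<open>U i\<close>\<close>
  have \<tau>_UN: "ennreal (\<tau> (\<Union>i. U i)) \<le> (\<Sum>i. ennreal (\<tau> (U i)))" if U: "\<And>i::nat. openin X (U i)" for U
  proof -
    have ex: "\<exists>n. m V \<le> (\<Sum>i<n. \<tau> (U i))" if V: "openin X V" "X closure_of V \<subseteq> (\<Union>i. U i)" for V
    proof -
      define \<W> where "\<W> = {W. openin X W \<and> (\<exists>i. X closure_of W \<subseteq> U i)}"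
      have "compactin X (X closure_of V)" by (intro closedin_compact_space comp closedin_closure_of)
      moreover have "X closure_of V \<subseteq> \<Union>\<W>"
      proof
        fix x assume "x \<in> X closure_of V"
        then obtain i where "x \<in> U i" using V by auto
        then obtain W where "openin X W" "x \<in> W" "X closure_of W \<subseteq> U i"
          using regular_nbhd[OF comp haus U] by blast
        then show "x \<in> \<Union>\<W>" by (auto simp: \<W>_def)
      qed
      moreover have "\<And>W. W \<in> \<W> \<Longrightarrow> openin X W" by (auto simp: \<W>_def)
      ultimately obtain \<F> where F: "finite \<F>" "\<F> \<subseteq> \<W>" "X closure_of V \<subseteq> \<Union>\<F>"
        unfolding compactin_def by meson
      have "\<forall>W\<in>\<F>. \<exists>i. X closure_of W \<subseteq> U i" using F by (auto simp: \<W>_def)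
      then obtain k where k: "\<And>W. W \<in> \<F> \<Longrightarrow> X closure_of W \<subseteq> U (k W)" by metis
      obtain n where n: "\<And>W. W \<in> \<F> \<Longrightarrow> k W < n"
        using finite_nat_set_iff_bounded[of "k ` \<F>"] F(1) by auto
      define V' where "V' i = \<Union>{W\<in>\<F>. k W = i}" for i
      have op: "openin X (V' i)" for i using F(2) by (auto simp: V'_def \<W>_def)
      have cl: "X closure_of (V' i) \<subseteq> U i" for i
        using F(1) k unfolding V'_def by (subst closure_of_Union) auto
      have "V \<subseteq> (\<Union>i<n. V' i)"
      proof
        fix x assume "x \<in> V"
        then have "x \<in> X closure_of V" using closure_of_subset[of V X] V(1) openin_subset by blast
        then obtain W where "W \<in> \<F>" "x \<in> W" using F(3) by auto
        then show "x \<in> (\<Union>i<n. V' i)" using n by (auto simp: V'_def)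
      qed
      then have "m V \<le> m (\<Union>i<n. V' i)"
        using op V by (intro charge_mono[OF alg mc] borel_open) auto
      also have "\<dots> \<le> (\<Sum>i<n. m (V' i))"
        using op by (intro charge_UN_le[OF alg mc] borel_open) auto
      also have "\<dots> \<le> (\<Sum>i<n. \<tau> (U i))" by (intro sum_mono \<tau>_upper op cl)
      finally show ?thesis by blast
    qed
    have *: "ennreal (m V) \<le> (\<Sum>i. ennreal (\<tau> (U i)))" if V: "openin X V" "X closure_of V \<subseteq> (\<Union>i. U i)" for V
    proof -
      obtain n where "m V \<le> (\<Sum>i<n. \<tau> (U i))" using ex[OF V] by blast
      then have "ennreal (m V) \<le> (\<Sum>i<n. ennreal (\<tau> (U i)))"
        using \<tau>_nonneg by (subst sum_ennreal) (auto intro: ennreal_leI)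
      also have "\<dots> \<le> (\<Sum>i. ennreal (\<tau> (U i)))" by (intro sum_le_suminf) auto
      finally show ?thesis .
    qed
    show ?thesis
    proof (cases "(\<Sum>i. ennreal (\<tau> (U i))) = \<infinity>")
      case False
      then obtain r where r: "0 \<le> r" "(\<Sum>i. ennreal (\<tau> (U i))) = ennreal r"
        by (cases "\<Sum>i. ennreal (\<tau> (U i))") auto
      have "\<tau> (\<Union>i. U i) \<le> r"
        by (rule \<tau>_least) (use * r in \<open>simp add: ennreal_le_iff\<close>)
      then show ?thesis using r by (simp add: ennreal_leI)
    qed simp
  qed
  define Ou where "Ou A = {U. openin X U \<and> A \<subseteq> U}" for A
  define f where "f A = (INF U\<in>Ou A. \<tau> U)" for A
  have Ou0: "?\<Omega> \<in> Ou A" if "A \<subseteq> ?\<Omega>" for A using that by (auto simp: Ou_def)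
  have bdb: "bdd_below (\<tau> ` I)" for I using \<tau>_nonneg by (auto simp: bdd_below_def)
  have f_lower: "f A \<le> \<tau> U" if "openin X U" "A \<subseteq> U" for A U
    unfolding f_def by (rule cINF_lower[OF bdb]) (use that Ou_def in auto)
  have f_greatest: "c \<le> f A" if "A \<subseteq> ?\<Omega>" "\<And>U. openin X U \<Longrightarrow> A \<subseteq> U \<Longrightarrow> c \<le> \<tau> U" for A c
    unfolding f_def by (rule cINF_greatest) (use that Ou0 Ou_def in auto)
  have f_nonneg: "0 \<le> f A" if "A \<subseteq> ?\<Omega>" for A using f_greatest[OF that] \<tau>_nonneg by auto
  have f_open: "f U = \<tau> U" if "openin X U" for U
    using f_lower[OF that] f_greatest[OF openin_subset[OF that]] \<tau>_mono by (intro antisym) auto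
  have f_mono: "f A \<le> f B" if "A \<subseteq> B" "B \<subseteq> ?\<Omega>" for A B
    using that by (intro f_greatest f_lower) auto
  have f_approx: "\<exists>U. openin X U \<and> A \<subseteq> U \<and> \<tau> U < f A + e" if "A \<subseteq> ?\<Omega>" "e > 0" for A e
  proof (rule ccontr)
    assume "\<not> ?thesis"
    then have "f A + e \<le> f A" using that by (intro f_greatest) (auto simp: not_less)
    then show False using that by simp
  qed
  define F where "F A = ennreal (f A)" for A
  have pos: "positive (Pow ?\<Omega>) F"
    using f_open[of "{}"] \<tau>_empty by (simp add: positive_def F_def)
  have csub: "countably_subadditive (Pow ?\<Omega>) F"
    unfolding countably_subadditive_def
  proof (intro allI impI)
    fix A :: "nat \<Rightarrow> 'a set" assume A: "range A \<subseteq> Pow ?\<Omega>"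
    show "F (\<Union>i. A i) \<le> (\<Sum>i. F (A i))"
    proof (rule ennreal_le_epsilon)
      fix e :: real assume e: "0 < e"
      have "\<forall>i. \<exists>U. openin X U \<and> A i \<subseteq> U \<and> \<tau> U < f (A i) + e * (1/2)^Suc i"
        using A e by (intro allI f_approx) auto
      then obtain U where U: "\<And>i. openin X (U i)" "\<And>i. A i \<subseteq> U i"
        "\<And>i. \<tau> (U i) < f (A i) + e * (1/2)^Suc i" by metis
      have "f (\<Union>i. A i) \<le> \<tau> (\<Union>i. U i)"
        using U by (intro f_lower openin_Union) auto
      then have "F (\<Union>i. A i) \<le> (\<Sum>i. ennreal (\<tau> (U i)))"
        unfolding F_def using \<tau>_UN[OF U(1)] by (meson ennreal_leI order_trans)
      also have "\<dots> \<le> (\<Sum>i. F (A i) + ennreal (e * (1/2)^Suc i))"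
      proof (intro suminf_le allI)
        fix i
        have "ennreal (\<tau> (U i)) \<le> ennreal (f (A i) + e * (1/2)^Suc i)"
          using U(3)[of i] by (intro ennreal_leI) simp
        also have "\<dots> = F (A i) + ennreal (e * (1/2)^Suc i)"
          unfolding F_def using f_nonneg[of "A i"] A e by (intro ennreal_plus) auto
        finally show "ennreal (\<tau> (U i)) \<le> F (A i) + ennreal (e * (1/2)^Suc i)" .
      qed auto
      also have "\<dots> = (\<Sum>i. F (A i)) + (\<Sum>i. ennreal (e * (1/2)^Suc i))"
        by (intro suminf_add[symmetric]) auto
      also have "(\<Sum>i. ennreal (e * (1/2)^Suc i)) = ennreal e"
      proof -
        have "(\<lambda>i. e * (1/2)^Suc i) sums (e * 1)" by (intro sums_mult power_half_series)
        then show ?thesis using e by (intro suminf_ennreal_eq) auto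
      qed
      finally show "F (\<Union>i. A i) \<le> (\<Sum>i. F (A i)) + ennreal e" .
    qed
  qed
  have oms: "outer_measure_space (Pow ?\<Omega>) F"
    using pos csub f_mono by (auto simp: outer_measure_space_def increasing_def F_def intro!: ennreal_leI)
  interpret PS: sigma_algebra ?\<Omega> "Pow ?\<Omega>" by (rule sigma_algebra_Pow)
  have ms: "measure_space ?\<Omega> (lambda_system ?\<Omega> (Pow ?\<Omega>) F) F"
    by (rule PS.caratheodory_lemma[OF oms])
  have sub: "subadditive (Pow ?\<Omega>) F" by (rule PS.countably_subadditive_subadditive[OF pos csub])
  \<comment> \<open>Caratheodory condition: exhaust \<open>W \<inter> U\<close> by \<open>V\<close>, and then \<open>W\<close> minus the closure of \<open>V\<close> by \<open>V'\<close>\<close>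
  have opens: "U \<in> lambda_system ?\<Omega> (Pow ?\<Omega>) F" if U: "openin X U" for U
    unfolding PS.lambda_system_eq
  proof safe
    fix x assume "x \<in> U" then show "x \<in> ?\<Omega>" using openin_subset[OF U] by auto
  next
    fix Y assume Y: "Y \<subseteq> ?\<Omega>"
    have fin: "f (Y \<inter> U) + f (Y - U) \<le> f Y"
    proof (rule f_greatest[OF Y])
      fix W assume W: "openin X W" "Y \<subseteq> W"
      have "\<tau> (W \<inter> U) \<le> \<tau> W - f (Y - U)"
      proof (rule \<tau>_least)
        fix V assume V: "openin X V" "X closure_of V \<subseteq> W \<inter> U"
        have op: "openin X (W - X closure_of V)" using W by (intro openin_diff) auto
        have "f (Y - U) \<le> \<tau> (W - X closure_of V)" using W V by (intro f_lower op) auto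
        also have "\<dots> \<le> \<tau> W - m V"
        proof (rule \<tau>_least)
          fix V' assume V': "openin X V'" "X closure_of V' \<subseteq> W - X closure_of V"
          have sub: "V \<subseteq> X closure_of V" "V' \<subseteq> X closure_of V'"
            using closure_of_subset[OF openin_subset[OF V(1)]] closure_of_subset[OF openin_subset[OF V'(1)]] .
          have "m V + m V' = m (V \<union> V')"
            using V V' sub by (intro charge_add[OF mc, symmetric] borel_open) auto
          also have "\<dots> \<le> \<tau> W" using V V' by (intro \<tau>_upper) auto
          finally show "m V' \<le> \<tau> W - m V" by simp
        qed
        finally show "m V \<le> \<tau> W - f (Y - U)" by simp
      qed
      moreover have "f (Y \<inter> U) \<le> \<tau> (W \<inter> U)" using W U by (intro f_lower) auto
      ultimately show "f (Y \<inter> U) + f (Y - U) \<le> \<tau> W" by simp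
    qed
    have nn: "0 \<le> f (Y \<inter> U)" "0 \<le> f (Y - U)" using Y by (auto intro!: f_nonneg)
    have "F (Y \<inter> U) + F (Y - U) = ennreal (f (Y \<inter> U) + f (Y - U))"
      unfolding F_def using nn by (rule ennreal_plus[symmetric])
    then have "F (Y \<inter> U) + F (Y - U) \<le> F Y"
      unfolding F_def using fin by (simp add: ennreal_leI)
    moreover have "F Y \<le> F (Y \<inter> U) + F (Y - U)"
      using sub[unfolded subadditive_def, rule_format, of "Y \<inter> U" "Y - U"] Y
      by (auto simp: Int_Diff_Un)
    ultimately show "F (Y \<inter> U) + F (Y - U) = F Y" by (rule antisym)
  qed
  have sb: "sets (borel_of X) \<subseteq> lambda_system ?\<Omega> (Pow ?\<Omega>) F"
    unfolding sets_borel_of using ms opens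
    by (intro sigma_algebra.sigma_sets_subset) (auto simp: measure_space_def)
  have ms': "measure_space ?\<Omega> (sets (borel_of X)) F"
    using measure_down[OF ms _ sb] sets.sigma_algebra_axioms[of "borel_of X"] by simp
  define \<mu> where "\<mu> = measure_of ?\<Omega> (sets (borel_of X)) F"
  have sets: "sets \<mu> = sets (borel_of X)"
    using sets.sigma_sets_eq[of "borel_of X"] sets.space_closed[of "borel_of X"]
    by (simp add: \<mu>_def sets_measure_of)
  have space: "space \<mu> = ?\<Omega>" using sets sets_eq_imp_space_eq[OF sets] by simp
  have em: "emeasure \<mu> A = F A" if "A \<in> sets (borel_of X)" for A
    unfolding \<mu>_def using ms' that by (intro emeasure_measure_of_sigma) (auto simp: measure_space_def)
  have pr: "prob_space \<mu>"
    by (rule prob_spaceI) (use em[of ?\<Omega>] f_open[of ?\<Omega>] \<tau>_top borel_open[of X ?\<Omega>] in \<open>simp add: space F_def\<close>)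
  interpret prob_space \<mu> by fact
  have mU: "measure \<mu> U = \<tau> U" if "openin X U" for U
    using em[OF borel_open[OF that]] f_open[OF that] \<tau>_nonneg by (simp add: measure_def F_def)
  have "emeasure \<mu> A = (SUP K\<in>{K. compactin X K \<and> K \<subseteq> A}. emeasure \<mu> K)" if A: "A \<in> sets \<mu>" for A
  proof (rule antisym)
    show "(SUP K\<in>{K. compactin X K \<and> K \<subseteq> A}. emeasure \<mu> K) \<le> emeasure \<mu> A"
      using A by (intro SUP_least emeasure_mono) auto
    show "emeasure \<mu> A \<le> (SUP K\<in>{K. compactin X K \<and> K \<subseteq> A}. emeasure \<mu> K)"
    proof (rule ennreal_le_epsilon)
      fix e :: real assume e: "0 < e"
      have A': "A \<subseteq> ?\<Omega>" "A \<in> sets (borel_of X)" using A sets.sets_into_space[OF A] space sets by auto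
      obtain U where U: "openin X U" "?\<Omega> - A \<subseteq> U" "\<tau> U < f (?\<Omega> - A) + e"
        using f_approx[of "?\<Omega> - A" e] e by auto
      have UK: "?\<Omega> - U \<in> sets \<mu>" using borel_open[OF U(1)] sets.compl_sets[of U \<mu>] sets space by auto
      have "measure \<mu> (?\<Omega> - A) = f (?\<Omega> - A)"
        using em[of "?\<Omega> - A"] A' sets.compl_sets[of A "borel_of X"] f_nonneg[of "?\<Omega> - A"]
        by (simp add: measure_def F_def)
      then have "1 - measure \<mu> A > \<tau> U - e" using U(3) prob_compl[OF A] space by simp
      moreover have "measure \<mu> (?\<Omega> - U) = 1 - \<tau> U"
        using prob_compl[of U] borel_open[OF U(1)] sets space mU[OF U(1)] by simp
      ultimately have "measure \<mu> A \<le> measure \<mu> (?\<Omega> - U) + e" by simp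
      then have "emeasure \<mu> A \<le> ennreal (measure \<mu> (?\<Omega> - U) + e)"
        unfolding emeasure_eq_measure by (rule ennreal_leI)
      also have "\<dots> = emeasure \<mu> (?\<Omega> - U) + ennreal e"
        unfolding emeasure_eq_measure using e by (intro ennreal_plus) auto
      also have "emeasure \<mu> (?\<Omega> - U) \<le> (SUP K\<in>{K. compactin X K \<and> K \<subseteq> A}. emeasure \<mu> K)"
        using U by (intro SUP_upper) (auto intro!: closedin_compact_space[OF comp])
      finally show "emeasure \<mu> A \<le> (SUP K\<in>{K. compactin X K \<and> K \<subseteq> A}. emeasure \<mu> K) + ennreal e"
        by (simp add: add_right_mono)
    qed
  qed
  then have "\<mu> \<in> Prob X" using pr sets by (auto simp: Prob_def)
  then show ?thesis using that mU \<tau>_le_m by simp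
qed


section \<open>Strong proximality in terms of charges\<close>

text \<open>The neighbourhood form of ``a Dirac mass lies in the orbit closure of \<open>m\<close>'', which makes sense
  for measures and for charges alike.\<close>

definition contracts ::
    "('a, 'b) monoid_scheme \<Rightarrow> 'x topology \<Rightarrow> ('a \<Rightarrow> 'x \<Rightarrow> 'x) \<Rightarrow> ('x set \<Rightarrow> real) \<Rightarrow> bool" where
  "contracts G X \<phi> m \<longleftrightarrow> (\<exists>x\<in>topspace X. \<forall>U. openin X U \<longrightarrow> x \<in> U \<longrightarrow>
     (\<forall>e>0. \<exists>g\<in>carrier G. m (\<phi> g -` U \<inter> topspace X) > 1 - e))"

lemma contractsE:
  assumes "contracts G X \<phi> m"
  obtains x where "x \<in> topspace X"
    "\<And>U e. openin X U \<Longrightarrow> x \<in> U \<Longrightarrow> e > 0 \<Longrightarrow>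
       \<exists>g\<in>carrier G. m (\<phi> g -` U \<inter> topspace X) > 1 - e"
  using assms by (auto simp: contracts_def)

lemma closure_of_meets:
  assumes "x \<in> X closure_of S" "openin X U" "x \<in> U" obtains y where "y \<in> S" "y \<in> U"
  using assms by (auto simp: in_closure_of)

lemma ProbD:
  assumes "\<mu> \<in> Prob X"
  shows "prob_space \<mu>" "sets \<mu> = sets (borel_of X)" "space \<mu> = topspace X"
    "\<And>A. A \<in> sets \<mu> \<Longrightarrow> emeasure \<mu> A = (SUP K \<in> {K. compactin X K \<and> K \<subseteq> A}. emeasure \<mu> K)"
  using assms sets_eq_imp_space_eq[of \<mu> "borel_of X"] by (auto simp: Prob_def)

lemma Prob_measure_charge:
  assumes "\<mu> \<in> Prob X"
  shows "restrict (measure \<mu>) (sets (borel_of X)) \<in> borel_charges X"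
proof -
  interpret prob_space \<mu> using ProbD[OF assms] by simp
  have s: "sets \<mu> = sets (borel_of X)" "space \<mu> = topspace X" using ProbD[OF assms] by auto
  show ?thesis unfolding borel_charges_def
  proof (rule chargesI)
    show "restrict (measure \<mu>) (sets (borel_of X)) (topspace X) = 1"
      using prob_space s borel_open[of X "topspace X"] by simp
    fix A B assume "A \<in> sets (borel_of X)" "B \<in> sets (borel_of X)" "A \<inter> B = {}"
    then show "restrict (measure \<mu>) (sets (borel_of X)) (A \<union> B) =
      restrict (measure \<mu>) (sets (borel_of X)) A + restrict (measure \<mu>) (sets (borel_of X)) B"
      using finite_measure_Union[of A B] s by auto
  qed auto
qed

lemma return_Prob:
  assumes "Hausdorff_space X" and x: "x \<in> topspace X" shows "return (borel_of X) x \<in> Prob X"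
proof -
  have sx: "{x} \<in> sets (borel_of X)"
    by (rule borel_closed[OF closedin_Hausdorff_singleton[OF assms]])
  have "emeasure (return (borel_of X) x) A
      = (SUP K \<in> {K. compactin X K \<and> K \<subseteq> A}. emeasure (return (borel_of X) x) K)"
    if A: "A \<in> sets (borel_of X)" for A
  proof (rule antisym)
    show "(SUP K \<in> {K. compactin X K \<and> K \<subseteq> A}. emeasure (return (borel_of X) x) K)
        \<le> emeasure (return (borel_of X) x) A"
      using A by (intro SUP_least emeasure_mono) auto
    show "emeasure (return (borel_of X) x) A
        \<le> (SUP K \<in> {K. compactin X K \<and> K \<subseteq> A}. emeasure (return (borel_of X) x) K)"
    proof (cases "x \<in> A")
      case True
      have "emeasure (return (borel_of X) x) A = emeasure (return (borel_of X) x) {x}"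
        using True A sx by simp
      also have "\<dots> \<le> (SUP K \<in> {K. compactin X K \<and> K \<subseteq> A}. emeasure (return (borel_of X) x) K)"
        using True x by (intro SUP_upper) auto
      finally show ?thesis .
    qed (use A in simp)
  qed
  then show ?thesis using x by (auto simp: Prob_def intro!: prob_space_return)
qed

lemma distr_Prob:
  assumes \<mu>: "\<mu> \<in> Prob X" and f: "continuous_map X Y f" and HY: "Hausdorff_space Y"
  shows "distr \<mu> (borel_of Y) f \<in> Prob Y"
proof -
  interpret prob_space \<mu> using ProbD[OF \<mu>] by simp
  have s: "sets \<mu> = sets (borel_of X)" "space \<mu> = topspace X" using ProbD[OF \<mu>] by auto
  have meas: "f \<in> \<mu> \<rightarrow>\<^sub>M borel_of Y"
    using borel_of_measurable[OF f] s by (simp cong: measurable_cong_sets)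
  let ?\<nu> = "distr \<mu> (borel_of Y) f"
  have "emeasure ?\<nu> A = (SUP K \<in> {K. compactin Y K \<and> K \<subseteq> A}. emeasure ?\<nu> K)"
    if A: "A \<in> sets (borel_of Y)" for A
  proof (rule antisym)
    show "(SUP K \<in> {K. compactin Y K \<and> K \<subseteq> A}. emeasure ?\<nu> K) \<le> emeasure ?\<nu> A"
      using A by (intro SUP_least emeasure_mono) auto
    have pre: "f -` A \<inter> topspace X \<in> sets \<mu>" using measurable_sets[OF meas A] s by simp
    have "emeasure ?\<nu> A = emeasure \<mu> (f -` A \<inter> topspace X)"
      using emeasure_distr[OF meas A] s by simp
    also have "\<dots> = (SUP K \<in> {K. compactin X K \<and> K \<subseteq> f -` A \<inter> topspace X}. emeasure \<mu> K)"
      by (rule ProbD(4)[OF \<mu> pre])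
    also have "\<dots> \<le> (SUP K \<in> {K. compactin Y K \<and> K \<subseteq> A}. emeasure ?\<nu> K)"
    proof (rule SUP_least)
      fix K assume K: "K \<in> {K. compactin X K \<and> K \<subseteq> f -` A \<inter> topspace X}"
      show "emeasure \<mu> K \<le> (SUP K \<in> {K. compactin Y K \<and> K \<subseteq> A}. emeasure ?\<nu> K)"
      proof -
        have True: "f ` K \<in> sets (borel_of Y)"
          using K image_compactin[OF _ f, of K] compactin_imp_closedin[OF HY] by (auto intro: borel_closed)
        have "emeasure \<mu> K \<le> emeasure ?\<nu> (f ` K)"
          using K s measurable_sets[OF meas True] by (subst emeasure_distr[OF meas True], intro emeasure_mono) auto
        also have "\<dots> \<le> (SUP K \<in> {K. compactin Y K \<and> K \<subseteq> A}. emeasure ?\<nu> K)"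
          using K image_compactin[OF _ f, of K] by (intro SUP_upper) auto
        finally show ?thesis .
      qed
    qed
    finally show "emeasure ?\<nu> A \<le> (SUP K \<in> {K. compactin Y K \<and> K \<subseteq> A}. emeasure ?\<nu> K)" .
  qed
  then show ?thesis using prob_space_distr[OF meas] by (auto simp: Prob_def)
qed

context flow begin

text \<open>A Urysohn function \<open>f\<close> that is \<open>1\<close> at \<open>x\<close> and \<open>0\<close> off \<open>U\<close> bounds the mass of \<open>U\<close> from below by
  the integral of \<open>f\<close>, and a weak neighbourhood of the Dirac mass at \<open>x\<close> makes that integral close
  to \<open>1\<close>.\<close>

lemma contracts_if_Dirac_limit:
  assumes sp: "strongly_proximal G X \<phi>" and \<mu>: "\<mu> \<in> Prob X"
  shows "contracts G X \<phi> (measure \<mu>)"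
proof -
  interpret prob_space \<mu> using ProbD[OF \<mu>] by simp
  have s: "sets \<mu> = sets (borel_of X)" "space \<mu> = topspace X" using ProbD[OF \<mu>] by auto
  obtain x where x: "x \<in> topspace X" and cl: "return (borel_of X) x \<in>
      Prob_topology X closure_of {distr \<mu> (borel_of X) (\<phi> g) | g. g \<in> carrier G}"
    using sp \<mu> by (auto simp: strongly_proximal_def)
  show ?thesis unfolding contracts_def
  proof (intro bexI[OF _ x] allI impI)
    fix U and e :: real assume U: "openin X U" "x \<in> U" and e: "0 < e"
    have "normal_space X" using compact Hausdorff compact_Hausdorff_or_regular_imp_normal_space by blast
    moreover have "closedin X (topspace X - U)" "closedin X {x}"
      using U x Hausdorff closedin_Hausdorff_singleton by auto
    ultimately obtain f where f: "continuous_map X (top_of_set {0..1::real}) f"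
        "f ` (topspace X - U) \<subseteq> {0}" "f ` {x} \<subseteq> {1}"
      using Urysohn_lemma[of X "topspace X - U" "{x}" 0 1] U by (auto simp: disjnt_def)
    have fc: "continuous_map X euclideanreal f" and f01: "\<And>y. y \<in> topspace X \<Longrightarrow> 0 \<le> f y \<and> f y \<le> 1"
      using f(1) by (auto simp: continuous_map_in_subtopology)
    let ?N = "{\<nu> \<in> Prob X. (\<integral>y. f y \<partial>\<nu>) \<in> {1-e<..}}"
    have op: "openin (Prob_topology X) ?N"
      unfolding Prob_topology_def by (rule topology_generated_by_Basis)
        (intro CollectI exI[of _ f] exI[of _ "{1-e<..}"] conjI refl fc open_greaterThan)
    have f0: "f y = 0" if "y \<in> topspace X" "y \<notin> U" for y using f(2) that by blast
    have fm: "f \<in> borel_measurable (borel_of X)"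
      using borel_measurable_continuous[OF fc return_Prob[OF Hausdorff x]] by simp
    have "return (borel_of X) x \<in> ?N"
      using return_Prob[OF Hausdorff x] integral_return[OF _ fm, of x] x f(3) e by simp
    then obtain g where g: "g \<in> carrier G" "distr \<mu> (borel_of X) (\<phi> g) \<in> ?N"
      using closure_of_meets[OF cl op] by auto
    have meas: "\<phi> g \<in> \<mu> \<rightarrow>\<^sub>M borel_of X"
      using borel_of_measurable[OF cont[OF g(1)]] s by (simp cong: measurable_cong_sets)
    let ?A = "\<phi> g -` U \<inter> topspace X"
    have A: "?A \<in> sets \<mu>" using borel_open[OF openin_preimage[OF g(1) U(1)]] s by simp
    have "1 - e < (\<integral>y. f y \<partial>distr \<mu> (borel_of X) (\<phi> g))" using g by simp
    also have "\<dots> = (\<integral>y. f (\<phi> g y) \<partial>\<mu>)" by (rule integral_distr[OF meas fm])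
    also have "\<dots> \<le> (\<integral>y. indicator ?A y \<partial>\<mu>)"
    proof (rule integral_mono)
      show "integrable \<mu> (\<lambda>y. f (\<phi> g y))"
        by (rule integrable_const_bound[of _ 1])
           (use f01 g(1) s measurable_compose[OF meas fm] in \<open>auto intro!: AE_I2\<close>)
      show "integrable \<mu> (indicator ?A :: _ \<Rightarrow> real)" using A by (simp add: integrable_indicator_iff emeasure_eq_measure)
      fix y assume "y \<in> space \<mu>"
      then show "f (\<phi> g y) \<le> indicator ?A y"
        using f01[of "\<phi> g y"] f0[of "\<phi> g y"] g(1) s by (auto simp: indicator_def)
    qed
    also have "\<dots> = measure \<mu> ?A" using A by (simp add: Int_absorb1 sets.sets_into_space)
    finally show "\<exists>g\<in>carrier G. 1 - e < measure \<mu> (\<phi> g -` U \<inter> topspace X)" using g(1) by blast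
  qed
qed

text \<open>A subbasic weak neighbourhood tests one continuous \<open>f\<close>, bounded by \<open>B\<close>. If all but mass \<open>e\<close> is
  moved to where \<open>f\<close> is within \<open>d/3\<close> of \<open>f x\<close>, then the integral differs from \<open>f x\<close> by at most
  \<open>d/3 + 2 B e\<close>.\<close>

lemma Dirac_limit_if_contracts:
  assumes \<mu>: "\<mu> \<in> Prob X" and c: "contracts G X \<phi> (measure \<mu>)"
  shows "\<exists>x\<in>topspace X. return (borel_of X) x \<in>
    Prob_topology X closure_of {distr \<mu> (borel_of X) (\<phi> g) | g. g \<in> carrier G}"
proof -
  interpret prob_space \<mu> using ProbD[OF \<mu>] by simp
  have s: "sets \<mu> = sets (borel_of X)" "space \<mu> = topspace X" using ProbD[OF \<mu>] by auto
  obtain x where x: "x \<in> topspace X"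
    and con: "\<And>U e. openin X U \<Longrightarrow> x \<in> U \<Longrightarrow> e > 0 \<Longrightarrow>
          \<exists>g\<in>carrier G. measure \<mu> (\<phi> g -` U \<inter> topspace X) > 1 - e"
    using contractsE[OF c] by metis
  let ?\<delta> = "return (borel_of X) x"
  define nbhd where "nbhd T \<longleftrightarrow> (\<exists>U e. openin X U \<and> x \<in> U \<and> e > 0 \<and>
     (\<forall>g\<in>carrier G. measure \<mu> (\<phi> g -` U \<inter> topspace X) > 1 - e \<longrightarrow> distr \<mu> (borel_of X) (\<phi> g) \<in> T))" for T
  have nbhd: "?\<delta> \<in> T \<Longrightarrow> nbhd T" if "openin (Prob_topology X) T" for T
    using that unfolding Prob_topology_def openin_topology_generated_by_iff
  proof (induction T rule: generate_topology_on.induct)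
    case (Int a b)
    obtain U e where 1: "openin X U" "x \<in> U" "e > 0"
      "\<And>g. g\<in>carrier G \<Longrightarrow> measure \<mu> (\<phi> g -` U \<inter> topspace X) > 1 - e \<Longrightarrow> distr \<mu> (borel_of X) (\<phi> g) \<in> a"
      using Int.IH(1) Int.prems unfolding nbhd_def by blast
    obtain V d where 2: "openin X V" "x \<in> V" "d > 0"
      "\<And>g. g\<in>carrier G \<Longrightarrow> measure \<mu> (\<phi> g -` V \<inter> topspace X) > 1 - d \<Longrightarrow> distr \<mu> (borel_of X) (\<phi> g) \<in> b"
      using Int.IH(2) Int.prems unfolding nbhd_def by blast
    show ?case unfolding nbhd_def
    proof (intro exI[of _ "U \<inter> V"] exI[of _ "min e d"] conjI ballI impI)
      fix g assume g: "g \<in> carrier G" "1 - min e d < measure \<mu> (\<phi> g -` (U \<inter> V) \<inter> topspace X)"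
      have m: "measure \<mu> (\<phi> g -` (U \<inter> V) \<inter> topspace X) \<le> measure \<mu> (\<phi> g -` W \<inter> topspace X)"
        if "openin X W" "U \<inter> V \<subseteq> W" for W
        using that borel_open[OF openin_preimage[OF g(1) that(1)]] s
        by (intro finite_measure_mono) auto
      show "distr \<mu> (borel_of X) (\<phi> g) \<in> a \<inter> b"
        using 1(4)[OF g(1)] 2(4)[OF g(1)] m[OF 1(1)] m[OF 2(1)] g(2) by auto
    qed (use 1 2 in auto)
  next
    case (UN K)
    then obtain k where "k \<in> K" "nbhd k" by auto
    then show ?case unfolding nbhd_def by blast
  next
    case (Basis T)
    then obtain f V where T: "T = {\<nu> \<in> Prob X. (\<integral>y. f y \<partial>\<nu>) \<in> V}"
      and f: "continuous_map X euclideanreal f" and V: "open V" by blast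
    have fm: "f \<in> borel_measurable (borel_of X)"
      using borel_measurable_continuous[OF f return_Prob[OF Hausdorff x]] by simp
    have "f x \<in> V" using Basis.prems integral_return[OF _ fm, of x] x by (simp add: T)
    then obtain d where d: "d > 0" "\<And>t. \<bar>t - f x\<bar> < d \<Longrightarrow> t \<in> V"
      using V unfolding open_dist by (auto simp: dist_real_def)
    have comp: "compact (f ` topspace X)"
      using image_compactin[OF _ f] compact by (simp add: compact_space_def)
    obtain B where B: "\<And>y. y \<in> topspace X \<Longrightarrow> \<bar>f y\<bar> \<le> B"
      using compact_imp_bounded[OF comp] unfolding bounded_iff by auto
    then have B0: "0 \<le> B" using x by force
    define U where "U = {y \<in> topspace X. f y \<in> ball (f x) (d/3)}"
    \<comment> \<open>this makes \<open>2 * B * e\<close> at most \<open>d/3\<close>, also when \<open>B = 0\<close>\<close>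
    define e where "e = d / (6 * (B + 1))"
    have U: "openin X U" unfolding U_def by (rule openin_continuous_map_preimage[OF f]) auto
    have e: "e > 0" and eB: "2 * B * e < d/2"
      using d(1) B0 by (auto simp: e_def field_simps intro!: add_pos_nonneg)
    show ?case unfolding nbhd_def
    proof (intro exI[of _ U] exI[of _ e] conjI ballI impI U e)
      show "x \<in> U" using x d by (simp add: U_def)
      fix g assume g: "g \<in> carrier G" and big: "1 - e < measure \<mu> (\<phi> g -` U \<inter> topspace X)"
      let ?A = "topspace X - (\<phi> g -` U \<inter> topspace X)"
      have A': "\<phi> g -` U \<inter> topspace X \<in> sets \<mu>" using borel_open[OF openin_preimage[OF g U]] s by simp
      then have A: "?A \<in> sets \<mu>" using s sets.compl_sets[OF A'] by simp
      have mA: "measure \<mu> ?A < e" using prob_compl[OF A'] s big by simp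
      have meas: "\<phi> g \<in> \<mu> \<rightarrow>\<^sub>M borel_of X"
        using borel_of_measurable[OF cont[OF g]] s by (simp cong: measurable_cong_sets)
      have fgm: "(\<lambda>y. f (\<phi> g y)) \<in> borel_measurable \<mu>" by (rule measurable_compose[OF meas fm])
      have int: "integrable \<mu> (\<lambda>y. f (\<phi> g y))"
        by (rule integrable_const_bound[of _ B]) (use B g s fgm in \<open>auto intro!: AE_I2\<close>)
      have iA: "integrable \<mu> (indicator ?A :: _ \<Rightarrow> real)" using A by (simp add: integrable_indicator_iff emeasure_eq_measure)
      have "\<bar>(\<integral>y. f (\<phi> g y) \<partial>\<mu>) - f x\<bar> = \<bar>\<integral>y. f (\<phi> g y) - f x \<partial>\<mu>\<bar>"
        using int prob_space by simp
      also have "\<dots> \<le> (\<integral>y. \<bar>f (\<phi> g y) - f x\<bar> \<partial>\<mu>)"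
        using integral_norm_bound[of \<mu> "\<lambda>y. f (\<phi> g y) - f x"] by simp
      also have "\<dots> \<le> (\<integral>y. d/3 + 2 * B * indicator ?A y \<partial>\<mu>)"
      proof (rule integral_mono)
        fix y assume y: "y \<in> space \<mu>"
        then have y': "y \<in> topspace X" using s by simp
        show "\<bar>f (\<phi> g y) - f x\<bar> \<le> d/3 + 2 * B * indicator ?A y"
        proof (cases "\<phi> g y \<in> U")
          case True then show ?thesis using B0 by (auto simp: U_def dist_real_def abs_minus_commute indicator_def)
        next
          case False
          then have "y \<in> ?A" using y' by simp
          moreover have "\<bar>f (\<phi> g y)\<bar> \<le> B" "\<bar>f x\<bar> \<le> B" using B y' g x by auto
          ultimately show ?thesis using d(1) by (simp only: indicator_simps)
        qed
      qed (use int iA in auto)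
      also have "\<dots> = d/3 + 2 * B * measure \<mu> ?A"
        using iA A prob_space by (simp add: Int_absorb1 sets.sets_into_space)
      also have "\<dots> \<le> d/3 + 2 * B * e" using mA B0 by (intro add_left_mono mult_left_mono) auto
      also have "\<dots> < d" using eB d by simp
      finally have "(\<integral>y. f (\<phi> g y) \<partial>\<mu>) \<in> V" using d(2) by blast
      then show "distr \<mu> (borel_of X) (\<phi> g) \<in> T"
        using distr_Prob[OF \<mu> cont[OF g] Hausdorff] integral_distr[OF meas fm] by (simp add: T)
    qed
  qed auto
  have "?\<delta> \<in> Prob_topology X closure_of {distr \<mu> (borel_of X) (\<phi> g) | g. g \<in> carrier G}"
    unfolding in_closure_of
  proof (intro conjI allI impI)
    have "Prob X \<in> {{\<nu> \<in> Prob X. (\<integral>y. f y \<partial>\<nu>) \<in> U} | f (U :: real set). continuous_map X euclideanreal f \<and> open U}"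
      by (intro CollectI exI[of _ "\<lambda>_. 0"] exI[of _ UNIV]) auto
    then show "?\<delta> \<in> topspace (Prob_topology X)"
      using return_Prob[OF Hausdorff x] unfolding Prob_topology_def by auto
    fix T assume "?\<delta> \<in> T \<and> openin (Prob_topology X) T"
    then have "nbhd T" using nbhd by blast
    then obtain U e where "openin X U" "x \<in> U" "e > 0"
      "\<forall>g\<in>carrier G. measure \<mu> (\<phi> g -` U \<inter> topspace X) > 1 - e \<longrightarrow> distr \<mu> (borel_of X) (\<phi> g) \<in> T"
      unfolding nbhd_def by blast
    then show "\<exists>y. y \<in> {distr \<mu> (borel_of X) (\<phi> g) | g. g \<in> carrier G} \<and> y \<in> T"
      using con by blast
  qed
  then show ?thesis using x by blast
qed

lemma contracts_charge:
  assumes sp: "strongly_proximal G X \<phi>" and m: "m \<in> borel_charges X"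
  shows "contracts G X \<phi> m"
proof -
  obtain \<mu> where \<mu>: "\<mu> \<in> Prob X" "\<And>U. openin X U \<Longrightarrow> measure \<mu> U \<le> m U"
    using regular_borel_measure_below_charge[OF compact Hausdorff m] by blast
  obtain x where x: "x \<in> topspace X"
    and con: "\<And>U e. openin X U \<Longrightarrow> x \<in> U \<Longrightarrow> e > 0 \<Longrightarrow>
          \<exists>g\<in>carrier G. measure \<mu> (\<phi> g -` U \<inter> topspace X) > 1 - e"
    using contractsE[OF contracts_if_Dirac_limit[OF sp \<mu>(1)]] by metis
  show ?thesis unfolding contracts_def
  proof (intro bexI[OF _ x] allI impI)
    fix U and e :: real assume U: "openin X U" "x \<in> U" "0 < e"
    obtain g where g: "g \<in> carrier G" "measure \<mu> (\<phi> g -` U \<inter> topspace X) > 1 - e" using con[OF U] by blast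
    then show "\<exists>g\<in>carrier G. 1 - e < m (\<phi> g -` U \<inter> topspace X)"
      using \<mu>(2)[OF openin_preimage[OF g(1) U(1)]] by (intro bexI[of _ g]) auto
  qed
qed

abbreviation "Ch \<equiv> borel_charge_space X"
abbreviation "cact \<equiv> borel_charge_act X \<phi>"

text \<open>By compactness: the conditions ``mass of \<open>U\<close> at least \<open>1 - 1/(n+1)\<close>'', for neighbourhoods \<open>U\<close> of
  the point towards which a member of \<open>K\<close> is contracted, can be met finitely many at a time inside
  \<open>K\<close>.\<close>

lemma Dirac_in_closed_invariant:
  assumes sp: "strongly_proximal G X \<phi>"
    and K: "closedin Ch K" "K \<noteq> {}" "invariant_under (carrier G) cact K"
  shows "\<exists>m\<in>K. \<exists>x. dirac_at X m x"
proof -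
  interpret C: flow G Ch cact by (rule borel_charge_flow)
  obtain m where m: "m \<in> K" using K by auto
  have KC: "K \<subseteq> borel_charges X" using closedin_subset[OF K(1)] by simp
  obtain x where x: "x \<in> topspace X"
    and con: "\<And>U e. openin X U \<Longrightarrow> x \<in> U \<Longrightarrow> e > 0 \<Longrightarrow>
          \<exists>g\<in>carrier G. m (\<phi> g -` U \<inter> topspace X) > 1 - e"
    using contractsE[OF contracts_charge[OF sp subsetD[OF KC m]]] by metis
  define I where "I = {U. openin X U \<and> x \<in> U} \<times> (UNIV :: nat set)"
  define D where "D = (\<lambda>(U, n::nat). K \<inter> {\<nu> \<in> topspace Ch. 1 - 1 / real (Suc n) \<le> \<nu> U})"
  have "topspace Ch \<inter> (\<Inter>i\<in>I. D i) \<noteq> {}"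
  proof (rule compact_space_INT_nonempty[OF C.compact])
    fix i assume "i \<in> I"
    then obtain U n where i: "i = (U, n)" "openin X U" by (auto simp: I_def)
    have "closedin Ch {\<nu> \<in> topspace Ch. 1 - 1 / real (Suc n) \<le> \<nu> U}"
      unfolding borel_charge_space_def using borel_open[OF i(2)]
      by (intro closedin_eval_le continuous_map_charge_eval) auto
    then show "closedin Ch (D i)" using K(1) i by (simp add: D_def closedin_Int)
  next
    fix F assume F: "finite F" "F \<subseteq> I"
    define U where "U = (\<Inter>i\<in>F. fst i) \<inter> topspace X"
    define n where "n = Max (insert 0 (snd ` F))"
    have U: "openin X U" "x \<in> U"
      using F x unfolding U_def I_def by (auto intro!: openin_INT)
    obtain g where g: "g \<in> carrier G" "m (\<phi> g -` U \<inter> topspace X) > 1 - 1 / real (Suc n)"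
      using con[OF U, of "1 / real (Suc n)"] by auto
    have gm: "cact g m \<in> K" using K(3) g m by (auto simp: invariant_under_def)
    then have gc: "cact g m \<in> borel_charges X" using KC by auto
    have "cact g m \<in> D i" if iF: "i \<in> F" for i
    proof -
      obtain V k where i: "i = (V, k)" "openin X V" using subsetD[OF F(2) iF] by (auto simp: I_def)
      have kn: "k \<le> n" using iF i F by (auto simp: n_def intro!: Max_ge image_eqI[of _ _ i])
      have "1 - 1 / real (Suc k) \<le> 1 - 1 / real (Suc n)" using kn by (simp add: frac_le)
      also have "\<dots> \<le> cact g m U"
        using g borel_charge_act_apply[of m U g] m KC borel_open[OF U(1)] by auto
      also have "\<dots> \<le> cact g m V"
        using gc iF i U by (intro charge_mono[OF algebra_borel_of, of _ X] borel_open) (auto simp: U_def borel_charges_def)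
      finally show ?thesis using gm gc i by (simp add: D_def)
    qed
    then show "topspace Ch \<inter> (\<Inter>i\<in>F. D i) \<noteq> {}" using gc by auto
  qed
  then obtain \<nu> where \<nu>: "\<nu> \<in> topspace Ch" "\<And>i. i \<in> I \<Longrightarrow> \<nu> \<in> D i" by auto
  have "(topspace X, 0) \<in> I" using x by (simp add: I_def)
  then have \<nu>K: "\<nu> \<in> K" using \<nu>(2) by (force simp: D_def)
  have "\<nu> U = 1" if U: "openin X U" "x \<in> U" for U
  proof (rule antisym)
    show "\<nu> U \<le> 1" using \<nu>(1) charge_range[of \<nu> _ _ U] borel_open[OF U(1)] by (simp add: borel_charges_def)
    show "1 \<le> \<nu> U"
    proof (rule field_le_epsilon)
      fix e :: real assume "0 < e"
      then obtain n where n: "1 / real (Suc n) < e" using nat_approx_posE by auto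
      have "1 - 1 / real (Suc n) \<le> \<nu> U" using \<nu>(2)[of "(U, n)"] U by (simp add: I_def D_def)
      then show "1 \<le> \<nu> U + e" using n by simp
    qed
  qed
  then have "dirac_at X \<nu> x" using x by (simp add: dirac_at_def)
  then show ?thesis using \<nu>K by blast
qed

text \<open>The form in which strong proximality is used: in a strongly proximal space, a closed condition
  that is compatible with the action and satisfied by one charge is satisfied by a Dirac charge.\<close>

lemma strongly_proximal_iff:
  "strongly_proximal G X \<phi> \<longleftrightarrow>
    (\<forall>K. closedin Ch K \<longrightarrow> K \<noteq> {} \<longrightarrow> invariant_under (carrier G) cact K \<longrightarrow> (\<exists>m\<in>K. \<exists>x. dirac_at X m x))"
    (is "_ \<longleftrightarrow> ?R")
proof
  assume "strongly_proximal G X \<phi>" then show ?R using Dirac_in_closed_invariant by blast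
next
  assume R: ?R
  interpret C: flow G Ch cact by (rule borel_charge_flow)
  show "strongly_proximal G X \<phi>" unfolding strongly_proximal_def
  proof
    fix \<mu> assume \<mu>: "\<mu> \<in> Prob X"
    let ?m = "restrict (measure \<mu>) (sets (borel_of X))"
    have m: "?m \<in> topspace Ch" using Prob_measure_charge[OF \<mu>] by simp
    let ?K = "Ch closure_of (orbit G cact ?m)"
    have inv: "invariant_under (carrier G) cact (orbit G cact ?m)"
      using m by (auto simp: invariant_under_def orbit_def simp flip: C.act_mult)
    have "?m \<in> orbit G cact ?m" using m by (force simp: orbit_def intro: exI[of _ \<one>])
    then have "?K \<noteq> {}" using closure_of_subset[OF C.orbit_subset[OF m]] by auto
    then obtain \<nu> x where \<nu>: "\<nu> \<in> ?K" "dirac_at X \<nu> x"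
      using R[rule_format, of ?K] C.closure_invariant[OF inv _ C.orbit_subset[OF m]] by auto
    have x: "x \<in> topspace X" using \<nu> by (simp add: dirac_at_def)
    have "contracts G X \<phi> (measure \<mu>)" unfolding contracts_def
    proof (intro bexI[OF _ x] allI impI)
      fix U and e :: real assume U: "openin X U" "x \<in> U" and e: "0 < e"
      have "openin Ch {\<nu>' \<in> topspace Ch. \<nu>' U \<in> {1 - e<..}}"
        unfolding borel_charge_space_def
        by (rule openin_continuous_map_preimage[OF continuous_map_charge_eval[OF borel_open[OF U(1)]]]) simp
      moreover have "\<nu> \<in> {\<nu>' \<in> topspace Ch. \<nu>' U \<in> {1 - e<..}}"
        using \<nu> U e closure_of_subset_topspace[of Ch] by (auto simp: dirac_at_def)
      ultimately obtain g where g: "g \<in> carrier G" "cact g ?m U > 1 - e"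
        using closure_of_meets[OF \<nu>(1)] by (auto simp: orbit_def)
      then show "\<exists>g\<in>carrier G. 1 - e < measure \<mu> (\<phi> g -` U \<inter> topspace X)"
        using borel_charge_act_apply[of ?m U g] m borel_open[OF U(1)] borel_open[OF openin_preimage[OF g(1) U(1)]]
        by auto
    qed
    then show "\<exists>x\<in>topspace X. return (borel_of X) x \<in>
        Prob_topology X closure_of {distr \<mu> (borel_of X) (\<phi> g) | g. g \<in> carrier G}"
      by (rule Dirac_limit_if_contracts[OF \<mu>])
  qed
qed

end


section \<open>Equivariant maps\<close>

definition equivariant ::
    "'a set \<Rightarrow> 'x topology \<Rightarrow> ('a \<Rightarrow> 'x \<Rightarrow> 'x) \<Rightarrow> 'y topology \<Rightarrow> ('a \<Rightarrow> 'y \<Rightarrow> 'y) \<Rightarrow> ('x \<Rightarrow> 'y) \<Rightarrow> bool" where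
  "equivariant S X \<phi> Y \<psi> f \<longleftrightarrow>
     continuous_map X Y f \<and> (\<forall>g\<in>S. \<forall>x\<in>topspace X. f (\<phi> g x) = \<psi> g (f x))"

abbreviation borel_push :: "'x topology \<Rightarrow> 'y topology \<Rightarrow> ('x \<Rightarrow> 'y) \<Rightarrow> ('x set \<Rightarrow> real) \<Rightarrow> 'y set \<Rightarrow> real" where
  "borel_push X Y f \<equiv> push (topspace X) (sets (borel_of Y)) f"

lemma borel_push_apply:
  "A \<in> sets (borel_of Y) \<Longrightarrow> borel_push X Y f m A = m (f -` A \<inter> topspace X)"
  by (simp add: push_def)

lemma continuous_map_borel_push:
  assumes "continuous_map X Y f"
  shows "continuous_map (borel_charge_space X) (borel_charge_space Y) (borel_push X Y f)"
  unfolding borel_charge_space_def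
  using continuous_map_image_subset_topspace[OF assms]
  by (intro continuous_map_push algebra_borel_of borel_preimage[OF assms]) (auto intro: borel_open)

lemma invariant_image:
  assumes f: "equivariant S X \<phi> Y \<psi> f" and K: "K \<subseteq> topspace X" "invariant_under S \<phi> K"
  shows "invariant_under S \<psi> (f ` K)"
  unfolding invariant_under_def
proof (intro ballI)
  fix g y assume g: "g \<in> S" and "y \<in> f ` K"
  then obtain x where x: "x \<in> K" "y = f x" by auto
  then have "\<psi> g y = f (\<phi> g x)" using f K(1) g by (auto simp: equivariant_def)
  then show "\<psi> g y \<in> f ` K" using K(2) x g by (auto simp: invariant_under_def)
qed

locale two_flows = X: flow G X \<phi> + Y: flow G Y \<psi> for G (structure) and X \<phi> Y \<psi>
begin

lemma closedin_image:
  assumes "continuous_map X Y f" "closedin X K" shows "closedin Y (f ` K)"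
  using image_compactin[OF closedin_compact_space[OF X.compact assms(2)] assms(1)]
    compactin_imp_closedin[OF Y.Hausdorff] by blast

lemma onto:
  assumes f: "equivariant (carrier G) X \<phi> Y \<psi> f" and min: "minimal_G_space G Y \<psi>"
  shows "f ` topspace X = topspace Y"
proof -
  have c: "continuous_map X Y f" using f by (simp add: equivariant_def)
  have "invariant_under (carrier G) \<psi> (f ` topspace X)"
    by (rule invariant_image[OF f]) (auto simp: invariant_under_def)
  then show ?thesis
    using min closedin_image[OF c closedin_topspace] X.nonempty unfolding Y.minimal_iff by blast
qed

lemma factor_map:
  assumes "equivariant (carrier G) X \<phi> Y \<psi> f" "minimal_G_space G Y \<psi>"
  shows "G_factor_map G X \<phi> Y \<psi> f"
  using onto[OF assms] assms(1) by (auto simp: G_factor_map_def equivariant_def)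

lemma equivariant_push:
  assumes f: "equivariant (carrier G) X \<phi> Y \<psi> f"
  shows "equivariant (carrier G) (borel_charge_space X) (borel_charge_act X \<phi>)
    (borel_charge_space Y) (borel_charge_act Y \<psi>) (borel_push X Y f)"
  unfolding equivariant_def
proof (intro conjI ballI)
  have c: "continuous_map X Y f" using f by (simp add: equivariant_def)
  note cp = continuous_map_borel_push[OF c]
  then show "continuous_map (borel_charge_space X) (borel_charge_space Y) (borel_push X Y f)" .
  interpret CX: flow G "borel_charge_space X" "borel_charge_act X \<phi>" by (rule X.borel_charge_flow)
  interpret CY: flow G "borel_charge_space Y" "borel_charge_act Y \<psi>" by (rule Y.borel_charge_flow)
  fix g m assume g: "g \<in> carrier G" and m: "m \<in> topspace (borel_charge_space X)"
  have pm: "borel_push X Y f m \<in> topspace (borel_charge_space Y)"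
    using continuous_map_image_subset_topspace[OF cp] m by blast
  show "borel_push X Y f (borel_charge_act X \<phi> g m) = borel_charge_act Y \<psi> g (borel_push X Y f m)"
  proof (rule charges_eqI[where M = "sets (borel_of Y)" and \<Omega> = "topspace Y"])
    show "borel_push X Y f (borel_charge_act X \<phi> g m) \<in> charges (topspace Y) (sets (borel_of Y))"
      using continuous_map_image_subset_topspace[OF cp] CX.act_closed[OF g m]
      by (auto simp: borel_charges_def)
    show "borel_charge_act Y \<psi> g (borel_push X Y f m) \<in> charges (topspace Y) (sets (borel_of Y))"
      using CY.act_closed[OF g pm] by (simp add: borel_charges_def)
    fix A assume A: "A \<in> sets (borel_of Y)"
    have "\<phi> g -` (f -` A \<inter> topspace X) \<inter> topspace X = f -` (\<psi> g -` A \<inter> topspace Y) \<inter> topspace X"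
      using f g continuous_map_image_subset_topspace[OF c] by (auto simp: equivariant_def)
    then show "borel_push X Y f (borel_charge_act X \<phi> g m) A = borel_charge_act Y \<psi> g (borel_push X Y f m) A"
      using A m pm g borel_preimage[OF c A] Y.borel_act_preimage[OF g A]
      by (simp add: borel_push_apply X.borel_charge_act_apply Y.borel_charge_act_apply)
  qed
qed

lemma push_closed_invariant:
  assumes f: "equivariant (carrier G) X \<phi> Y \<psi> f"
    and K: "closedin (borel_charge_space X) K" "K \<noteq> {}"
      "invariant_under (carrier G) (borel_charge_act X \<phi>) K"
  shows "closedin (borel_charge_space Y) (borel_push X Y f ` K)" "borel_push X Y f ` K \<noteq> {}"
    "invariant_under (carrier G) (borel_charge_act Y \<psi>) (borel_push X Y f ` K)"
proof -
  interpret C: two_flows G "borel_charge_space X" "borel_charge_act X \<phi>" "borel_charge_space Y" "borel_charge_act Y \<psi>"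
    by (intro two_flows.intro X.borel_charge_flow Y.borel_charge_flow)
  show "closedin (borel_charge_space Y) (borel_push X Y f ` K)"
    using f K(1) by (intro C.closedin_image continuous_map_borel_push) (auto simp: equivariant_def)
  show "borel_push X Y f ` K \<noteq> {}" using K by auto
  show "invariant_under (carrier G) (borel_charge_act Y \<psi>) (borel_push X Y f ` K)"
    by (rule invariant_image[OF equivariant_push[OF f] closedin_subset[OF K(1)] K(3)])
qed

end

lemma G_boundary_flow: "G_boundary G X \<phi> \<Longrightarrow> flow G X \<phi>"
  by (simp add: G_boundary_def flow_def)

lemma G_boundary_homeomorphic:
  assumes bX: "G_boundary G X \<phi>" and hom: "homeomorphic_maps X Y e d"
  defines "\<psi> \<equiv> \<lambda>g. \<lambda>y\<in>topspace Y. e (\<phi> g (d y))"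
  shows "G_boundary G Y \<psi>" "equivariant (carrier G) X \<phi> Y \<psi> e" "equivariant (carrier G) Y \<psi> X \<phi> d"
proof -
  interpret X: flow G X \<phi> by (rule G_boundary_flow[OF bX])
  have c: "continuous_map X Y e" "continuous_map Y X d"
    and inv: "\<And>x. x \<in> topspace X \<Longrightarrow> d (e x) = x" "\<And>y. y \<in> topspace Y \<Longrightarrow> e (d y) = y"
    using hom by (auto simp: homeomorphic_maps_def)
  have cl: "\<And>x. x \<in> topspace X \<Longrightarrow> e x \<in> topspace Y" "\<And>y. y \<in> topspace Y \<Longrightarrow> d y \<in> topspace X"
    using continuous_map_image_subset_topspace[OF c(1)] continuous_map_image_subset_topspace[OF c(2)] by auto
  have hs: "X homeomorphic_space Y" using hom homeomorphic_space_def by blast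
  have "compact_G_space G Y \<psi>"
  proof (rule compact_G_spaceI)
    show "compact_space Y" using hs X.compact homeomorphic_compact_space by blast
    show "Hausdorff_space Y" using hs X.Hausdorff homeomorphic_Hausdorff_space by blast
    show "topspace Y \<noteq> {}" using X.nonempty cl by blast
    fix g assume g: "g \<in> carrier G"
    show "continuous_map Y Y (\<psi> g)" unfolding \<psi>_def
      by (rule continuous_map_eq[OF continuous_map_compose[OF c(2) continuous_map_compose[OF X.cont[OF g] c(1)]]])
         simp
    fix h y assume "h \<in> carrier G" "y \<in> topspace Y"
    then show "\<psi> (g \<otimes>\<^bsub>G\<^esub> h) y = \<psi> g (\<psi> h y)" using g cl inv by (simp add: \<psi>_def X.act_mult)
  qed (auto simp: \<psi>_def cl inv X.is_group)
  then interpret Y: flow G Y \<psi> by (simp add: flow_def)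
  interpret XY: two_flows G X \<phi> Y \<psi> by unfold_locales
  interpret YX: two_flows G Y \<psi> X \<phi> by unfold_locales
  show eq: "equivariant (carrier G) X \<phi> Y \<psi> e" "equivariant (carrier G) Y \<psi> X \<phi> d"
    using c cl inv by (auto simp: equivariant_def \<psi>_def)
  have "minimal_G_space G Y \<psi>" unfolding Y.minimal_iff
  proof (intro allI impI)
    fix T assume T: "closedin Y T" "T \<noteq> {}" "invariant_under (carrier G) \<psi> T"
    have "d ` T = topspace X"
      using bX T(2) YX.closedin_image[OF c(2) T(1)] invariant_image[OF eq(2) closedin_subset[OF T(1)] T(3)]
      by (simp add: G_boundary_def X.minimal_iff)
    then have dT: "d ` T = topspace X" .
    show "T = topspace Y"
    proof (rule antisym[OF closedin_subset[OF T(1)] subsetI])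
      fix y assume y: "y \<in> topspace Y"
      have "d y \<in> d ` T" unfolding dT by (rule cl(2)[OF y])
      then obtain t where t: "t \<in> T" "d y = d t" by (rule imageE)
      have t': "t \<in> topspace Y" by (rule subsetD[OF closedin_subset[OF T(1)] t(1)])
      have "y = e (d y)" by (rule inv(2)[OF y, symmetric])
      also have "\<dots> = t" unfolding t(2) by (rule inv(2)[OF t'])
      finally have "y = t" .
      then show "y \<in> T" using t(1) by (rule ssubst)
    qed
  qed
  moreover have "strongly_proximal G Y \<psi>" unfolding Y.strongly_proximal_iff
  proof (intro allI impI)
    fix K assume K: "closedin Y.Ch K" "K \<noteq> {}" "invariant_under (carrier G) Y.cact K"
    have "strongly_proximal G X \<phi>" using bX by (simp add: G_boundary_def)
    from X.Dirac_in_closed_invariant[OF this YX.push_closed_invariant[OF eq(2) K]]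
    obtain \<nu> x where \<nu>: "\<nu> \<in> K" "dirac_at X (borel_push Y X d \<nu>) x" by auto
    have "dirac_at Y \<nu> (e x)" unfolding dirac_at_def
    proof (intro conjI allI impI)
      show "e x \<in> topspace Y" using \<nu> cl by (simp add: dirac_at_def)
      fix U assume U: "openin Y U" "e x \<in> U"
      let ?V = "{z \<in> topspace X. e z \<in> U}"
      have V: "openin X ?V" by (rule openin_continuous_map_preimage[OF c(1) U(1)])
      have "d -` ?V \<inter> topspace Y = U" using openin_subset[OF U(1)] inv cl by auto
      moreover have "borel_push Y X d \<nu> ?V = 1" using \<nu> V U by (auto simp: dirac_at_def)
      ultimately show "\<nu> U = 1" using borel_push_apply[OF borel_open[OF V], of Y d \<nu>] by simp
    qed
    then show "\<exists>m\<in>K. \<exists>y. dirac_at Y m y" using \<nu> by blast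
  qed
  ultimately show "G_boundary G Y \<psi>" using Y.cgs by (simp add: G_boundary_def)
qed

text \<open>A point \<open>y\<close> is encoded by the sets \<open>A\<close> of group elements such that \<open>y\<close> is a limit of the points
  \<open>\<phi> g x0\<close> with \<open>g \<in> A\<close>. Since the orbit of \<open>x0\<close> is dense and the space is regular, distinct
  points have distinct codes. Hence every boundary has a copy whose points have type \<open>'a set set\<close>.\<close>

lemma G_boundary_embedding:
  fixes G :: "('a, 'b) monoid_scheme" and X :: "'x topology"
  assumes bX: "G_boundary G X \<phi>"
  obtains Y :: "'a set set topology" and \<psi> e d
  where "G_boundary G Y \<psi>" "homeomorphic_maps X Y e d"
    "equivariant (carrier G) X \<phi> Y \<psi> e" "equivariant (carrier G) Y \<psi> X \<phi> d"
proof -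
  interpret X: flow G X \<phi> by (rule G_boundary_flow[OF bX])
  obtain x0 where x0: "x0 \<in> topspace X" using X.nonempty by blast
  define e where "e y = {A. A \<subseteq> carrier G \<and> y \<in> X closure_of ((\<lambda>g. \<phi> g x0) ` A)}" for y
  have dense: "X closure_of (orbit G \<phi> x0) = topspace X"
    using bX x0 by (simp add: G_boundary_def minimal_G_space_def)
  have inj: "inj_on e (topspace X)"
  proof (rule inj_onI, rule ccontr)
    fix y z assume y: "y \<in> topspace X" and z: "z \<in> topspace X" and eq: "e y = e z" and ne: "y \<noteq> z"
    have "openin X (topspace X - {z})" "y \<in> topspace X - {z}"
      using closedin_Hausdorff_singleton[OF X.Hausdorff z] y ne by auto
    then obtain W where W: "openin X W" "y \<in> W" "X closure_of W \<subseteq> topspace X - {z}"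
      using regular_nbhd[OF X.compact X.Hausdorff] by metis
    \<comment> \<open>the set \<open>A\<close> of elements that move \<open>x0\<close> into \<open>W\<close> lies in the code of \<open>y\<close> but not in that of \<open>z\<close>\<close>
    define A where "A = {g \<in> carrier G. \<phi> g x0 \<in> W}"
    have "y \<in> X closure_of ((\<lambda>g. \<phi> g x0) ` A)" unfolding in_closure_of
    proof (intro conjI allI impI y)
      fix T assume T: "y \<in> T \<and> openin X T"
      have TW: "openin X (T \<inter> W)" "y \<in> T \<inter> W" using T W by auto
      have "y \<in> X closure_of (orbit G \<phi> x0)" using dense y by simp
      from closure_of_meets[OF this TW] obtain w where "w \<in> orbit G \<phi> x0" "w \<in> T \<inter> W" .
      then show "\<exists>w. w \<in> (\<lambda>g. \<phi> g x0) ` A \<and> w \<in> T" by (auto simp: orbit_def A_def)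
    qed
    then have "A \<in> e z" unfolding eq[symmetric] by (auto simp: e_def A_def)
    then have "z \<in> X closure_of W"
      using closure_of_mono[of "(\<lambda>g. \<phi> g x0) ` A" W X] by (auto simp: e_def A_def)
    then show False using W by auto
  qed
  define d where "d = inv_into (topspace X) e"
  have de: "d (e x) = x" if "x \<in> topspace X" for x using that inj by (simp add: d_def)
  define Y where "Y = pullback_topology (e ` topspace X) d X"
  have top: "topspace Y = e ` topspace X" by (auto simp: Y_def topspace_pullback_topology de)
  have "homeomorphic_maps X Y e d" unfolding homeomorphic_maps_def
  proof (intro conjI ballI)
    show "continuous_map X Y e" unfolding Y_def
      by (rule continuous_map_pullback') (auto intro!: continuous_map_eq[OF continuous_map_id] simp: de)
    show "continuous_map Y X d" unfolding Y_def
      using continuous_map_pullback[OF continuous_map_id, of "e ` topspace X" d X] by simp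
  qed (use de top in auto)
  from that[OF G_boundary_homeomorphic(1)[OF bX this] this G_boundary_homeomorphic(2,3)[OF bX this]]
  show thesis .
qed

section \<open>The Furstenberg boundary\<close>

text \<open>Being Dirac at a prescribed point is a closed condition on pairs of a charge and a point; the
  point is then projected away.\<close>

lemma (in flow) closedin_Dirac_charges:
  "closedin Ch {m \<in> borel_charges X. \<exists>x. dirac_at X m x}"
proof -
  interpret C: flow G Ch cact by (rule borel_charge_flow)
  let ?P = "prod_topology Ch X"
  define D where "D U = {p \<in> topspace ?P. snd p \<in> topspace X - U} \<union> {p \<in> topspace ?P. fst p U = 1}" for U
  have "closedin ?P (topspace ?P \<inter> (\<Inter>U\<in>{U. openin X U}. D U))"
  proof (intro closedin_Int closedin_INT closedin_topspace)
    show "{U. openin X U} \<noteq> {}" using openin_empty by blast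
    fix U assume "U \<in> {U. openin X U}"
    then have U: "openin X U" by simp
    have "closedin ?P {p \<in> topspace ?P. snd p \<in> topspace X - U}"
      using U by (intro closedin_continuous_map_preimage[OF continuous_map_snd]) auto
    moreover have "continuous_map ?P euclideanreal (\<lambda>p. fst p U)"
    proof -
      have "continuous_map Ch euclideanreal (\<lambda>m. m U)"
        unfolding borel_charge_space_def by (rule continuous_map_charge_eval[OF borel_open[OF U]])
      from continuous_map_compose[OF continuous_map_fst this] show ?thesis by (simp add: o_def)
    qed
    then have "closedin ?P {p \<in> topspace ?P. fst p U = 1}"
      by (intro closedin_continuous_maps_eq[of euclideanreal]) auto
    ultimately show "closedin ?P (D U)" unfolding D_def by (rule closedin_Un)
  qed
  from closed_map_projections(1)[OF C.compact compact this]
  have "closedin Ch (fst ` (topspace ?P \<inter> (\<Inter>U\<in>{U. openin X U}. D U)))" .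
  moreover have "fst ` (topspace ?P \<inter> (\<Inter>U\<in>{U. openin X U}. D U)) = {m \<in> borel_charges X. \<exists>x. dirac_at X m x}"
  proof (intro equalityI subsetI)
    fix m assume "m \<in> fst ` (topspace ?P \<inter> (\<Inter>U\<in>{U. openin X U}. D U))"
    then obtain x where x: "(m, x) \<in> topspace ?P" "\<And>U. openin X U \<Longrightarrow> (m, x) \<in> D U" by auto
    then show "m \<in> {m \<in> borel_charges X. \<exists>x. dirac_at X m x}"
      by (auto simp: D_def dirac_at_def intro!: exI[of _ x])
  next
    fix m assume "m \<in> {m \<in> borel_charges X. \<exists>x. dirac_at X m x}"
    then obtain x where x: "m \<in> borel_charges X" "dirac_at X m x" by auto
    then have "(m, x) \<in> topspace ?P \<inter> (\<Inter>U\<in>{U. openin X U}. D U)"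
      by (auto simp: D_def dirac_at_def)
    then show "m \<in> fst ` (topspace ?P \<inter> (\<Inter>U\<in>{U. openin X U}. D U))" by (metis fst_conv imageI)
  qed
  ultimately show ?thesis by simp
qed

lemma (in flow) dirac_at_act:
  assumes "m \<in> borel_charges X" "dirac_at X m x" "g \<in> carrier G"
  shows "dirac_at X (cact g m) (\<phi> g x)"
  using assms openin_preimage[OF assms(3)]
  by (auto simp: dirac_at_def borel_charge_act_apply borel_open)

text \<open>The boundaries whose points have this fixed type form a set, so that their product can be taken.\<close>

definition all_boundaries ::
    "('a, 'b) monoid_scheme \<Rightarrow> ('a set set topology \<times> ('a \<Rightarrow> 'a set set \<Rightarrow> 'a set set)) set" where
  "all_boundaries G = {(Y, \<psi>). G_boundary G Y \<psi>}"

lemma product_flow: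
  fixes G (structure) and Y :: "'i \<Rightarrow> 'y topology" and \<psi> :: "'i \<Rightarrow> 'a \<Rightarrow> 'y \<Rightarrow> 'y"
  assumes "group G" and "\<And>i. i \<in> I \<Longrightarrow> flow G (Y i) (\<psi> i)"
  defines "P \<equiv> product_topology Y I"
  defines "\<Phi> \<equiv> \<lambda>g. \<lambda>x\<in>topspace P. \<lambda>i\<in>I. \<psi> i g (x i)"
  shows "compact_G_space G P \<Phi>"
proof (rule compact_G_spaceI)
  have fl: "compact_space (Y i)" "Hausdorff_space (Y i)" "topspace (Y i) \<noteq> {}"
    "\<And>g. g \<in> carrier G \<Longrightarrow> continuous_map (Y i) (Y i) (\<psi> i g)"
    "\<And>x. x \<in> topspace (Y i) \<Longrightarrow> \<psi> i \<one> x = x"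
    "\<And>g x. g \<in> carrier G \<Longrightarrow> x \<in> topspace (Y i) \<Longrightarrow> \<psi> i g x \<in> topspace (Y i)"
    "\<And>g h x. g \<in> carrier G \<Longrightarrow> h \<in> carrier G \<Longrightarrow> x \<in> topspace (Y i) \<Longrightarrow> \<psi> i (g \<otimes> h) x = \<psi> i g (\<psi> i h x)"
    if "i \<in> I" for i
  proof -
    interpret flow G "Y i" "\<psi> i" using assms(2)[OF that] .
    show "compact_space (Y i)" "Hausdorff_space (Y i)" "topspace (Y i) \<noteq> {}"
      "\<And>g. g \<in> carrier G \<Longrightarrow> continuous_map (Y i) (Y i) (\<psi> i g)"
      "\<And>x. x \<in> topspace (Y i) \<Longrightarrow> \<psi> i \<one> x = x"
      "\<And>g x. g \<in> carrier G \<Longrightarrow> x \<in> topspace (Y i) \<Longrightarrow> \<psi> i g x \<in> topspace (Y i)"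
      "\<And>g h x. g \<in> carrier G \<Longrightarrow> h \<in> carrier G \<Longrightarrow> x \<in> topspace (Y i) \<Longrightarrow> \<psi> i (g \<otimes> h) x = \<psi> i g (\<psi> i h x)"
      using compact Hausdorff nonempty cont act_mult by auto
  qed
  have top: "topspace P = (\<Pi>\<^sub>E i\<in>I. topspace (Y i))" by (simp add: P_def)
  have cl: "(\<lambda>i\<in>I. \<psi> i g (x i)) \<in> topspace P" if "g \<in> carrier G" "x \<in> topspace P" for g x
    using that fl(6)[OF _ that(1)] unfolding top by (simp add: PiE_iff)
  show "compact_space P" using fl by (auto simp: P_def compact_space_product_topology)
  show "Hausdorff_space P" using fl by (auto simp: P_def Hausdorff_space_product_topology)
  show "topspace P \<noteq> {}" using fl unfolding top by (auto simp: PiE_eq_empty_iff)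
  fix g assume g: "g \<in> carrier G"
  show "\<Phi> g \<in> extensional (topspace P)" by (simp add: \<Phi>_def)
  have "continuous_map P P (\<lambda>x. \<lambda>i\<in>I. \<psi> i g (x i))"
    unfolding P_def continuous_map_componentwise
  proof (intro conjI ballI)
    fix k assume k: "k \<in> I"
    have "continuous_map (product_topology Y I) (Y k) (\<psi> k g \<circ> (\<lambda>x. x k))"
      using k g by (intro continuous_map_compose[OF continuous_map_product_projection] fl)
    then show "continuous_map (product_topology Y I) (Y k) (\<lambda>x. (\<lambda>i\<in>I. \<psi> i g (x i)) k)"
      using k by (simp add: o_def)
  qed auto
  then show "continuous_map P P (\<Phi> g)" by (rule continuous_map_eq) (simp add: \<Phi>_def)
  fix h x assume h: "h \<in> carrier G" and x: "x \<in> topspace P"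
  show "\<Phi> (g \<otimes> h) x = \<Phi> g (\<Phi> h x)"
    using x cl[OF h x] fl(7)[OF _ g h] unfolding \<Phi>_def top by (auto simp: fun_eq_iff PiE_iff)
next
  fix x assume x: "x \<in> topspace P"
  show "\<Phi> \<one> x = x"
  proof
    fix i
    show "\<Phi> \<one> x i = x i"
    proof (cases "i \<in> I")
      case True
      interpret flow G "Y i" "\<psi> i" using assms(2)[OF True] .
      show ?thesis using True x by (auto simp: \<Phi>_def P_def PiE_iff)
    qed (use x in \<open>auto simp: \<Phi>_def P_def PiE_iff extensional_def\<close>)
  qed
qed (fact)


lemma equivariant_compose:
  assumes f: "equivariant S X \<phi> Y \<psi> f" and h: "equivariant S Y \<psi> Z \<zeta> h"
  shows "equivariant S X \<phi> Z \<zeta> (h \<circ> f)"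
  unfolding equivariant_def
proof (intro conjI ballI)
  have fc: "continuous_map X Y f" and hc: "continuous_map Y Z h"
    using f h by (simp_all add: equivariant_def)
  show "continuous_map X Z (h \<circ> f)" by (rule continuous_map_compose[OF fc hc])
  fix g x assume g: "g \<in> S" and x: "x \<in> topspace X"
  have "f x \<in> topspace Y" using continuous_map_image_subset_topspace[OF fc] x by blast
  then show "(h \<circ> f) (\<phi> g x) = \<zeta> g ((h \<circ> f) x)" using f h g x by (simp add: equivariant_def)
qed

text \<open>A basic open set of a product constrains finitely many coordinates, and finitely many sets of
  mass \<open>1\<close> intersect in a set of mass \<open>1\<close> even for charges. That the limit point lies in \<open>Z\<close>
  follows since otherwise the empty set would have mass \<open>1\<close>.\<close>

lemma Dirac_if_coordinates_Dirac:
  fixes Y :: "'i \<Rightarrow> 'y topology" and I :: "'i set"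
  defines "P \<equiv> product_topology Y I"
  assumes Z: "closedin P Z" and m: "m \<in> borel_charges (subtopology P Z)"
    and d: "\<And>i. i \<in> I \<Longrightarrow> dirac_at (Y i) (borel_push (subtopology P Z) (Y i) (\<lambda>x. x i) m) (y i)"
  shows "dirac_at (subtopology P Z) m (restrict y I)"
proof -
  let ?X = "subtopology P Z" and ?y = "restrict y I"
  have ZP: "Z \<subseteq> topspace P" by (rule closedin_subset[OF Z])
  have top: "topspace ?X = Z" using ZP by (rule topspace_subtopology_subset)
  have mc: "m \<in> charges Z (sets (borel_of ?X))" using m top by (simp add: borel_charges_def)
  note alg = algebra_borel_of[of ?X, unfolded top]
  have yP: "?y \<in> topspace P" using d by (auto simp: P_def dirac_at_def)
  have proj: "continuous_map ?X (Y i) (\<lambda>x. x i)" if "i \<in> I" for i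
    unfolding P_def using that by (intro continuous_map_from_subtopology continuous_map_product_projection)
  \<comment> \<open>every neighbourhood in the product of the candidate point contains an open set of mass \<open>1\<close>\<close>
  have key: "\<exists>W. openin ?X W \<and> W \<subseteq> V \<and> m W = 1" if V: "openin P V" "?y \<in> V" for V
  proof -
    obtain U where U: "?y \<in> (\<Pi>\<^sub>E i\<in>I. U i)" "\<And>i. openin (Y i) (U i)"
      "finite {i. U i \<noteq> topspace (Y i)}" "(\<Pi>\<^sub>E i\<in>I. U i) \<subseteq> V"
      using product_topology_open_contains_basis[OF V[unfolded P_def]] by auto
    define J where "J = {i\<in>I. U i \<noteq> topspace (Y i)}"
    have J: "finite J" using U(3) by (rule rev_finite_subset) (auto simp: J_def)
    define W where "W F = {x \<in> Z. \<forall>i\<in>F. x i \<in> U i}" for F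
    have "openin ?X (W F) \<and> m (W F) = 1" if "finite F" "F \<subseteq> J" for F
      using that
    proof (induction F rule: finite_induct)
      case empty
      then show ?case using charge_total[OF mc] openin_topspace[of ?X] top by (simp add: W_def)
    next
      case (insert i F)
      let ?Wi = "(\<lambda>x. x i) -` U i \<inter> Z"
      have i: "i \<in> I" using insert.prems by (auto simp: J_def)
      have "{x \<in> topspace ?X. x i \<in> U i} = ?Wi" unfolding top by auto
      then have opi: "openin ?X ?Wi"
        using openin_continuous_map_preimage[OF proj[OF i] U(2)[of i]] by simp
      have "y i \<in> U i" using U(1) i by (auto simp: PiE_iff)
      then have "borel_push ?X (Y i) (\<lambda>x. x i) m (U i) = 1" using d[OF i] U(2)[of i] by (simp add: dirac_at_def)
      then have "m ((\<lambda>x. x i) -` U i \<inter> topspace ?X) = 1"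
        by (simp only: borel_push_apply[OF borel_open[OF U(2)[of i]]])
      then have mi: "m ?Wi = 1" by (simp only: top)
      have WF: "openin ?X (W F)" "m (W F) = 1" using insert by auto
      have eq: "W (insert i F) = ?Wi \<inter> W F" by (auto simp: W_def)
      have op: "openin ?X (W (insert i F))" unfolding eq by (rule openin_Int[OF opi WF(1)])
      have "1 \<le> m (W (insert i F))" unfolding eq
        using charge_Int_ge[OF alg mc borel_open[OF opi] borel_open[OF WF(1)]] mi WF(2) by simp
      then show ?case using op charge_range[OF mc borel_open[OF op]] by simp
    qed
    from this[OF J order_refl] have "openin ?X (W J)" "m (W J) = 1" by auto
    moreover have "W J \<subseteq> V"
    proof
      fix x assume x: "x \<in> W J"
      then have xP: "x \<in> topspace P" using ZP by (auto simp: W_def)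
      have "x i \<in> U i" if "i \<in> I" for i
        using x xP that by (cases "i \<in> J") (auto simp: W_def J_def P_def)
      then have "x \<in> (\<Pi>\<^sub>E i\<in>I. U i)" using xP by (auto simp: P_def PiE_iff)
      then show "x \<in> V" using U(4) by auto
    qed
    ultimately show ?thesis by blast
  qed
  have yZ: "?y \<in> Z"
  proof (rule ccontr)
    assume n: "?y \<notin> Z"
    have "openin P (topspace P - Z)" "?y \<in> topspace P - Z" using Z yP n by auto
    from key[OF this] obtain W where W: "openin ?X W" "W \<subseteq> topspace P - Z" "m W = 1" by auto
    have "W = {}" using openin_subset[OF W(1)] W(2) top by auto
    then show False using W(3) charge_empty[OF alg mc] by simp
  qed
  show ?thesis unfolding dirac_at_def
  proof (intro conjI allI impI)
    show "?y \<in> topspace ?X" using yZ top by simp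
    fix U assume U: "openin ?X U" "?y \<in> U"
    obtain V where V: "openin P V" "U = V \<inter> Z" using U(1) by (auto simp: openin_subtopology)
    have "?y \<in> V" using U V by auto
    from key[OF V(1) this] obtain W where W: "openin ?X W" "W \<subseteq> V" "m W = 1" by auto
    have "W \<subseteq> U" using openin_subset[OF W(1)] W(2) V(2) top by auto
    then have "1 \<le> m U" using charge_mono[OF alg mc borel_open[OF W(1)] borel_open[OF U(1)]] W(3) by simp
    then show "m U = 1" using charge_range[OF mc borel_open[OF U(1)]] by simp
  qed
qed

text \<open>Take a minimal closed invariant subset of the product of all boundaries; its coordinate
  projections are the required factor maps. For strong proximality consider a minimal closed
  invariant set \<open>K0\<close> of charges. For each coordinate, the members of \<open>K0\<close> with Dirac image in that
  coordinate form a non-empty closed invariant subset, so by minimality all of \<open>K0\<close>; hence members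
  of \<open>K0\<close> are Dirac in every coordinate simultaneously.\<close>

theorem Furstenberg_boundary_exists:
  fixes G :: "('a, 'b) monoid_scheme"
  assumes "group G"
  shows "\<exists>X \<phi>. is_Furstenberg_boundary G X \<phi>"
proof -
  let ?I = "all_boundaries G"
  define P where "P = product_topology fst ?I"
  define \<Phi> where "\<Phi> g = (\<lambda>x\<in>topspace P. \<lambda>i\<in>?I. snd i g (x i))" for g
  have fl: "flow G (fst i) (snd i)" if "i \<in> ?I" for i
    using that by (intro G_boundary_flow) (auto simp: all_boundaries_def)
  interpret P: flow G P \<Phi>
    unfolding P_def \<Phi>_def by (intro flow.intro product_flow assms fl)
  have "invariant_under (carrier G) \<Phi> (topspace P)" by (auto simp: invariant_under_def)
  from P.minimal_invariant_subset[OF closedin_topspace P.nonempty this]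
  obtain Z where "Z \<subseteq> topspace P" and Z: "closedin P Z" "Z \<noteq> {}" "invariant_under (carrier G) \<Phi> Z"
    and Zmin: "\<And>M'. M' \<subseteq> Z \<Longrightarrow> closedin P M' \<Longrightarrow> M' \<noteq> {} \<Longrightarrow> invariant_under (carrier G) \<Phi> M' \<Longrightarrow> M' = Z"
    by metis
  let ?X = "subtopology P Z"
  define \<phi> where "\<phi> g = restrict (\<Phi> g) Z" for g
  interpret X: flow G ?X \<phi>
    unfolding \<phi>_def by (intro flow.intro P.subflow Z)
  have ZP: "Z \<subseteq> topspace P" by (rule closedin_subset[OF Z(1)])
  have top: "topspace ?X = Z" using ZP by (rule topspace_subtopology_subset)
  have min: "minimal_G_space G ?X \<phi>" unfolding X.minimal_iff top
  proof (intro allI impI)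
    fix T assume T: "closedin ?X T" "T \<noteq> {}" "invariant_under (carrier G) \<phi> T"
    have TZ: "T \<subseteq> Z" using closedin_subset[OF T(1)] top by simp
    have "closedin P T" using T(1) Z(1) closedin_trans_full by blast
    moreover have "invariant_under (carrier G) \<Phi> T"
      using T(3) TZ by (auto simp: invariant_under_def \<phi>_def subset_iff)
    ultimately show "T = Z" using Zmin[OF TZ] T(2) by blast
  qed
  have proj: "equivariant (carrier G) ?X \<phi> (fst i) (snd i) (\<lambda>x. x i)" if i: "i \<in> ?I" for i
    unfolding equivariant_def
  proof (intro conjI ballI)
    show "continuous_map ?X (fst i) (\<lambda>x. x i)"
      unfolding P_def using i by (intro continuous_map_from_subtopology continuous_map_product_projection)
    fix g x assume "g \<in> carrier G" "x \<in> topspace ?X"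
    then show "\<phi> g x i = snd i g (x i)" using i ZP top by (auto simp: \<phi>_def \<Phi>_def)
  qed
  have "strongly_proximal G ?X \<phi>" unfolding X.strongly_proximal_iff
  proof (intro allI impI)
    fix K assume K: "closedin X.Ch K" "K \<noteq> {}" "invariant_under (carrier G) X.cact K"
    interpret C: flow G X.Ch X.cact by (rule X.borel_charge_flow)
    obtain K0 where K0: "K0 \<subseteq> K" "closedin X.Ch K0" "K0 \<noteq> {}" "invariant_under (carrier G) X.cact K0"
      and K0min: "\<And>M'. M' \<subseteq> K0 \<Longrightarrow> closedin X.Ch M' \<Longrightarrow> M' \<noteq> {} \<Longrightarrow>
          invariant_under (carrier G) X.cact M' \<Longrightarrow> M' = K0"
      using C.minimal_invariant_subset[OF K] by metis
    obtain m where m: "m \<in> K0" using K0(3) by blast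
    have K0c: "K0 \<subseteq> borel_charges ?X" using closedin_subset[OF K0(2)] by simp
    have "\<exists>y. dirac_at (fst i) (borel_push ?X (fst i) (\<lambda>x. x i) m) y" if i: "i \<in> ?I" for i
    proof -
      interpret Y: flow G "fst i" "snd i" by (rule fl[OF i])
      interpret XY: two_flows G ?X \<phi> "fst i" "snd i" by unfold_locales
      let ?f = "borel_push ?X (fst i) (\<lambda>x. x i)"
      have ci: "continuous_map ?X (fst i) (\<lambda>x. x i)" using proj[OF i] by (simp add: equivariant_def)
      note cp = continuous_map_borel_push[OF ci]
      define D where "D = K0 \<inter> {m \<in> topspace X.Ch. ?f m \<in> {m \<in> borel_charges (fst i). \<exists>x. dirac_at (fst i) m x}}"
      have "closedin X.Ch D" unfolding D_def
        by (intro closedin_Int K0(2) closedin_continuous_map_preimage[OF cp] Y.closedin_Dirac_charges)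
      moreover have "strongly_proximal G (fst i) (snd i)"
        using i by (auto simp: all_boundaries_def G_boundary_def)
      from Y.Dirac_in_closed_invariant[OF this XY.push_closed_invariant[OF proj[OF i] K0(2-4)]]
      obtain \<nu> y where \<nu>: "\<nu> \<in> K0" "dirac_at (fst i) (?f \<nu>) y" by auto
      have im: "?f \<nu> \<in> borel_charges (fst i)" if "\<nu> \<in> borel_charges ?X" for \<nu>
        using continuous_map_image_subset_topspace[OF cp] that by auto
      have "\<nu> \<in> D" using \<nu> K0c im by (auto simp: D_def)
      moreover have "invariant_under (carrier G) X.cact D" unfolding invariant_under_def
      proof (intro ballI)
        fix g \<nu> assume g: "g \<in> carrier G" and "\<nu> \<in> D"
        then obtain y where \<nu>: "\<nu> \<in> K0" "\<nu> \<in> borel_charges ?X" "dirac_at (fst i) (?f \<nu>) y" by (auto simp: D_def)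
        have g\<nu>: "X.cact g \<nu> \<in> K0" using K0(4) g \<nu>(1) by (simp add: invariant_under_def)
        then have g\<nu>': "X.cact g \<nu> \<in> borel_charges ?X" using K0c by blast
        have "?f (X.cact g \<nu>) = Y.cact g (?f \<nu>)"
          using XY.equivariant_push[OF proj[OF i]] g \<nu>(2) by (simp add: equivariant_def)
        then have "dirac_at (fst i) (?f (X.cact g \<nu>)) (snd i g y)"
          using Y.dirac_at_act[OF im[OF \<nu>(2)] \<nu>(3) g] by simp
        then show "X.cact g \<nu> \<in> D" using g\<nu> g\<nu>' im[OF g\<nu>'] by (auto simp: D_def)
      qed
      ultimately have "D = K0" using K0min[of D] by (auto simp: D_def)
      then show ?thesis using m by (auto simp: D_def)
    qed
    then obtain y where "\<And>i. i \<in> ?I \<Longrightarrow> dirac_at (fst i) (borel_push ?X (fst i) (\<lambda>x. x i) m) (y i)"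
      by metis
    then have "dirac_at ?X m (restrict y ?I)"
      using Z(1) m K0c unfolding P_def by (intro Dirac_if_coordinates_Dirac) auto
    then show "\<exists>m\<in>K. \<exists>x. dirac_at ?X m x" using m K0(1) by blast
  qed
  then have "G_boundary G ?X \<phi>" using min X.cgs by (simp add: G_boundary_def)
  then obtain B :: "'a set set topology" and \<beta> e d
    where B: "G_boundary G B \<beta>" "equivariant (carrier G) B \<beta> ?X \<phi> d"
    using G_boundary_embedding by metis
  interpret B: flow G B \<beta> by (rule G_boundary_flow[OF B(1)])
  have "\<exists>f. G_factor_map G B \<beta> Y \<psi> f" if Y: "G_boundary G Y \<psi>" for Y :: "'a set set topology" and \<psi>
  proof -
    have i: "(Y, \<psi>) \<in> ?I" using Y by (simp add: all_boundaries_def)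
    interpret Y: flow G Y \<psi> by (rule G_boundary_flow[OF Y])
    interpret BY: two_flows G B \<beta> Y \<psi> by unfold_locales
    have p: "equivariant (carrier G) ?X \<phi> Y \<psi> (\<lambda>x. x (Y, \<psi>))" using proj[OF i] by simp
    have "equivariant (carrier G) B \<beta> Y \<psi> ((\<lambda>x. x (Y, \<psi>)) \<circ> d)"
      by (rule equivariant_compose[OF B(2) p])
    then show ?thesis using BY.factor_map Y by (auto simp: G_boundary_def)
  qed
  then have "is_Furstenberg_boundary G B \<beta>" using B(1) by (auto simp: is_Furstenberg_boundary_def)
  then show ?thesis by blast
qed

lemma Furstenberg_boundary_is:
  assumes "group G" "Furstenberg_boundary G = (X, \<phi>)" shows "is_Furstenberg_boundary G X \<phi>"
proof -
  have "case Furstenberg_boundary G of (X, \<phi>) \<Rightarrow> is_Furstenberg_boundary G X \<phi>"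
    unfolding Furstenberg_boundary_def
    by (rule someI_ex) (use Furstenberg_boundary_exists[OF assms(1)] in auto)
  then show ?thesis using assms by simp
qed

text \<open>By the embedding, universality holds for boundaries with points of any type.\<close>

lemma Furstenberg_boundary_universal:
  fixes G :: "('a, 'b) monoid_scheme" and Y :: "'y topology"
  assumes X: "is_Furstenberg_boundary G X \<phi>" and Y: "G_boundary G Y \<psi>"
  obtains f where "equivariant (carrier G) X \<phi> Y \<psi> f"
proof -
  obtain B :: "'a set set topology" and \<beta> e d
    where B: "G_boundary G B \<beta>" "equivariant (carrier G) B \<beta> Y \<psi> d"
    using G_boundary_embedding[OF Y] by metis
  obtain f where f: "G_factor_map G X \<phi> B \<beta> f" using X B by (auto simp: is_Furstenberg_boundary_def)
  then have "equivariant (carrier G) X \<phi> B \<beta> f" by (auto simp: equivariant_def G_factor_map_def)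
  from equivariant_compose[OF this B(2)]
  show thesis by (rule that)
qed

text \<open>If \<open>f\<close> and \<open>f'\<close> are equivariant, then so is sending \<open>z\<close> to the average of the point masses at
  \<open>f z\<close> and \<open>f' z\<close>. By strong proximality these averages accumulate at a Dirac charge, which
  forces \<open>f z = f' z\<close> for some \<open>z\<close>, hence for all points by minimality. The set \<open>S\<close> keeps track of
  the pair of maps along the limit by the closed condition that neighbourhoods of \<open>f z\<close> and of
  \<open>f' z\<close> have mass at least \<open>1/2\<close>.\<close>

lemma equivariant_maps_into_boundary_agree:
  assumes X: "flow G X \<phi>" "minimal_G_space G X \<phi>" and Y: "G_boundary G Y \<psi>"
    and f: "equivariant (carrier G) X \<phi> Y \<psi> f" and f': "equivariant (carrier G) X \<phi> Y \<psi> f'"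
    and x: "x \<in> topspace X"
  shows "f x = f' x"
proof -
  interpret X: flow G X \<phi> by fact
  interpret Y: flow G Y \<psi> by (rule G_boundary_flow[OF Y])
  interpret C: flow G Y.Ch Y.cact by (rule Y.borel_charge_flow)
  have fc: "continuous_map X Y f" and f'c: "continuous_map X Y f'"
    using f f' by (auto simp: equivariant_def)
  have im: "f x \<in> topspace Y" "f' x \<in> topspace Y" if "x \<in> topspace X" for x
    using continuous_map_image_subset_topspace[OF fc] continuous_map_image_subset_topspace[OF f'c] that by auto
  have eqv: "f (\<phi> g x) = \<psi> g (f x)" "f' (\<phi> g x) = \<psi> g (f' x)" if "g \<in> carrier G" "x \<in> topspace X" for g x
    using f f' that by (auto simp: equivariant_def)
  let ?P = "prod_topology Y.Ch X"
  \<comment> \<open>closed as a union, whereas it reads as the implication from \<open>h z \<in> U\<close> to \<open>m U \<ge> 1/2\<close>\<close>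
  define D where "D U h = {p \<in> topspace ?P. h (snd p) \<in> topspace Y - U} \<union> {p \<in> topspace ?P. 1/2 \<le> fst p U}" for U h
  define S where "S = topspace ?P \<inter> (\<Inter>U\<in>{U. openin Y U}. D U f \<inter> D U f')"
  have Dcl: "closedin ?P (D U h)" if U: "openin Y U" and h: "continuous_map X Y h" for U h
  proof -
    have "closedin ?P {p \<in> topspace ?P. h (snd p) \<in> topspace Y - U}"
      using U closedin_continuous_map_preimage[OF continuous_map_compose[OF continuous_map_snd h], of "topspace Y - U" Y.Ch]
      by (auto simp: o_def)
    moreover have "continuous_map Y.Ch euclideanreal (\<lambda>m. m U)"
      unfolding borel_charge_space_def by (rule continuous_map_charge_eval[OF borel_open[OF U]])
    from continuous_map_compose[OF continuous_map_fst this]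
    have "continuous_map ?P euclideanreal (\<lambda>p. fst p U)" by (simp add: o_def)
    then have "closedin ?P {p \<in> topspace ?P. 1/2 \<le> fst p U}" by (intro closedin_eval_le) auto
    ultimately show ?thesis unfolding D_def by (rule closedin_Un)
  qed
  have "closedin ?P S" unfolding S_def
  proof (intro closedin_Int closedin_INT closedin_topspace)
    show "{U. openin Y U} \<noteq> {}" using openin_empty by blast
  qed (use Dcl fc f'c in auto)
  from closed_map_projections(1)[OF C.compact X.compact this]
  have K1: "closedin Y.Ch (fst ` S)" .
  have S_iff: "(m, z) \<in> S \<longleftrightarrow> m \<in> borel_charges Y \<and> z \<in> topspace X \<and>
      (\<forall>U. openin Y U \<longrightarrow> (f z \<in> U \<longrightarrow> 1/2 \<le> m U) \<and> (f' z \<in> U \<longrightarrow> 1/2 \<le> m U))" for m z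
    using im[of z] unfolding S_def D_def by auto
  define h where "h = (\<lambda>A\<in>sets (borel_of Y). (indicator A (f x) + indicator A (f' x)) / 2 :: real)"
  have "h \<in> borel_charges Y" unfolding borel_charges_def
    by (rule chargesI) (use im[OF x] borel_open[of Y "topspace Y"] in \<open>auto simp: h_def indicator_def\<close>)
  then have "(h, x) \<in> S" using x by (auto simp: S_iff h_def borel_open)
  then have K2: "fst ` S \<noteq> {}" by blast
  have K3: "invariant_under (carrier G) Y.cact (fst ` S)" unfolding invariant_under_def
  proof (intro ballI)
    fix g m assume g: "g \<in> carrier G" and "m \<in> fst ` S"
    then obtain z where "(m, z) \<in> S" by auto
    then have z: "m \<in> borel_charges Y" "z \<in> topspace X"
      "\<And>U. openin Y U \<Longrightarrow> f z \<in> U \<Longrightarrow> 1/2 \<le> m U" "\<And>U. openin Y U \<Longrightarrow> f' z \<in> U \<Longrightarrow> 1/2 \<le> m U"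
      unfolding S_iff by auto
    have "(Y.cact g m, \<phi> g z) \<in> S" unfolding S_iff
    proof (intro conjI allI impI)
      show "Y.cact g m \<in> borel_charges Y" using C.act_closed[OF g, of m] z by simp
      show "\<phi> g z \<in> topspace X" using g z by simp
      fix U assume U: "openin Y U"
      have a: "Y.cact g m U = m (\<psi> g -` U \<inter> topspace Y)"
        by (rule Y.borel_charge_act_apply[OF z(1) borel_open[OF U]])
      show "1/2 \<le> Y.cact g m U" if "f (\<phi> g z) \<in> U"
        unfolding a using that eqv[OF g z(2)] im[OF z(2)] by (intro z(3) Y.openin_preimage g U) auto
      show "1/2 \<le> Y.cact g m U" if "f' (\<phi> g z) \<in> U"
        unfolding a using that eqv[OF g z(2)] im[OF z(2)] by (intro z(4) Y.openin_preimage g U) auto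
    qed
    then show "Y.cact g m \<in> fst ` S" by (metis fst_conv imageI)
  qed
  have "strongly_proximal G Y \<psi>" using Y by (simp add: G_boundary_def)
  from Y.Dirac_in_closed_invariant[OF this K1 K2 K3]
  obtain m z y where mz: "(m, z) \<in> S" and y: "dirac_at Y m y" by auto
  have mc: "m \<in> charges (topspace Y) (sets (borel_of Y))" "z \<in> topspace X"
    using mz unfolding S_iff by (auto simp: borel_charges_def)
  have pt: "w = y" if w: "w \<in> topspace Y" "\<And>U. openin Y U \<Longrightarrow> w \<in> U \<Longrightarrow> 1/2 \<le> m U" for w
  proof (rule ccontr)
    assume "w \<noteq> y"
    then obtain U V where UV: "openin Y U" "openin Y V" "w \<in> U" "y \<in> V" "disjnt U V"
      using Y.Hausdorff w(1) y unfolding Hausdorff_space_def dirac_at_def by metis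
    have "m (U \<union> V) = m U + m V"
      using UV by (intro charge_add[OF mc(1)] borel_open) (auto simp: disjnt_def)
    moreover have "m (U \<union> V) \<le> 1"
      using charge_range[OF mc(1) borel_open[OF openin_Un[OF UV(1,2)]]] by simp
    moreover have "m V = 1" using y UV by (auto simp: dirac_at_def)
    ultimately show False using w(2)[OF UV(1,3)] by simp
  qed
  have "\<forall>U. openin Y U \<longrightarrow> (f z \<in> U \<longrightarrow> 1/2 \<le> m U) \<and> (f' z \<in> U \<longrightarrow> 1/2 \<le> m U)"
    using mz unfolding S_iff by (elim conjE)
  then have "f z = y" "f' z = y" by (simp_all add: pt im[OF mc(2)])
  then have z: "z \<in> {x \<in> topspace X. f x = f' x}" using mc by simp
  have "closedin X {x \<in> topspace X. f x = f' x}"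
    by (rule closedin_continuous_maps_eq[OF Y.Hausdorff fc f'c])
  moreover have "invariant_under (carrier G) \<phi> {x \<in> topspace X. f x = f' x}"
    using eqv by (auto simp: invariant_under_def)
  ultimately have "{x \<in> topspace X. f x = f' x} = topspace X"
    using X(2) z unfolding X.minimal_iff by blast
  then show ?thesis using x by blast
qed


section \<open>Integration against a charge\<close>

definition simple_int :: "'x set \<Rightarrow> ('x set \<Rightarrow> real) \<Rightarrow> ('x \<Rightarrow> real) \<Rightarrow> real" where
  "simple_int \<Omega> m s = (\<Sum>v\<in>s ` \<Omega>. v * m (s -` {v} \<inter> \<Omega>))"

text \<open>The integral of a bounded function against a charge on all subsets, as supremum over the
  functions with finitely many values below \<open>F\<close>. Since every bounded function is a uniform limit
  of such functions, the lower integral is additive.\<close>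

definition lower_int :: "'x set \<Rightarrow> ('x set \<Rightarrow> real) \<Rightarrow> ('x \<Rightarrow> real) \<Rightarrow> real" where
  "lower_int \<Omega> m F = Sup (simple_int \<Omega> m ` {s. finite (s ` \<Omega>) \<and> (\<forall>x\<in>\<Omega>. s x \<le> F x)})"

lemma algebra_Pow: "Sigma_Algebra.algebra \<Omega> (Pow \<Omega>)"
  by (rule sigma_algebra.axioms(1)[OF sigma_algebra_Pow])

lemma charge_UN_disjoint:
  assumes m: "m \<in> charges \<Omega> (Pow \<Omega>)" and W: "finite W"
    and A: "\<And>w. w \<in> W \<Longrightarrow> A w \<subseteq> \<Omega>" "\<And>w w'. w \<in> W \<Longrightarrow> w' \<in> W \<Longrightarrow> w \<noteq> w' \<Longrightarrow> A w \<inter> A w' = {}"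
  shows "m (\<Union>w\<in>W. A w) = (\<Sum>w\<in>W. m (A w))"
  using W A
proof (induction W rule: finite_induct)
  case empty then show ?case using charge_empty[OF algebra_Pow m] by simp
next
  case (insert w W)
  have "m (A w \<union> (\<Union>w\<in>W. A w)) = m (A w) + m (\<Union>w\<in>W. A w)"
  proof (rule charge_add[OF m])
    show "A w \<inter> (\<Union>w\<in>W. A w) = {}" using insert.hyps(2) insert.prems(2)[of w] by fastforce
  qed (use insert.prems(1) in auto)
  then show ?case using insert by simp
qed

context
  fixes \<Omega> :: "'x set" and m
  assumes m: "m \<in> charges \<Omega> (Pow \<Omega>)"
begin

text \<open>Computes the integral of \<open>f \<circ> t\<close> on the level sets of \<open>t\<close> instead of those of \<open>f \<circ> t\<close>; applied
  to \<open>t = (s, s')\<close> this gives two simple functions a common partition.\<close>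

lemma simple_int_regroup:
  assumes t: "finite (t ` \<Omega>)"
  shows "simple_int \<Omega> m (\<lambda>x. f (t x)) = (\<Sum>w\<in>t ` \<Omega>. f w * m (t -` {w} \<inter> \<Omega>))"
proof -
  have "(\<Sum>w\<in>t ` \<Omega>. f w * m (t -` {w} \<inter> \<Omega>))
      = (\<Sum>v\<in>f ` t ` \<Omega>. \<Sum>w\<in>{w \<in> t ` \<Omega>. f w = v}. f w * m (t -` {w} \<inter> \<Omega>))"
    by (rule sum.image_gen[OF t])
  also have "\<dots> = (\<Sum>v\<in>(\<lambda>x. f (t x)) ` \<Omega>. v * m ((\<lambda>x. f (t x)) -` {v} \<inter> \<Omega>))"
  proof (rule sum.cong)
    fix v assume "v \<in> (\<lambda>x. f (t x)) ` \<Omega>"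
    have eq: "(\<lambda>x. f (t x)) -` {v} \<inter> \<Omega> = (\<Union>w\<in>{w \<in> t ` \<Omega>. f w = v}. t -` {w} \<inter> \<Omega>)" by auto
    have "(\<Sum>w\<in>{w \<in> t ` \<Omega>. f w = v}. f w * m (t -` {w} \<inter> \<Omega>))
        = v * (\<Sum>w\<in>{w \<in> t ` \<Omega>. f w = v}. m (t -` {w} \<inter> \<Omega>))"
      unfolding sum_distrib_left by (rule sum.cong) auto
    also have "(\<Sum>w\<in>{w \<in> t ` \<Omega>. f w = v}. m (t -` {w} \<inter> \<Omega>)) = m ((\<lambda>x. f (t x)) -` {v} \<inter> \<Omega>)"
      unfolding eq by (rule charge_UN_disjoint[OF m, symmetric]) (use t in auto)
    finally show "(\<Sum>w\<in>{w \<in> t ` \<Omega>. f w = v}. f w * m (t -` {w} \<inter> \<Omega>))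
        = v * m ((\<lambda>x. f (t x)) -` {v} \<inter> \<Omega>)" .
  qed (auto simp: image_image)
  finally show ?thesis by (simp add: simple_int_def)
qed

lemma simple_int_pair:
  assumes "finite (s ` \<Omega>)" "finite (s' ` \<Omega>)"
  defines "T \<equiv> (\<lambda>x. (s x, s' x))"
  shows "finite (T ` \<Omega>)" "simple_int \<Omega> m s = (\<Sum>w\<in>T ` \<Omega>. fst w * m (T -` {w} \<inter> \<Omega>))"
    "simple_int \<Omega> m s' = (\<Sum>w\<in>T ` \<Omega>. snd w * m (T -` {w} \<inter> \<Omega>))"
proof -
  have "T ` \<Omega> \<subseteq> s ` \<Omega> \<times> s' ` \<Omega>" by (auto simp: T_def)
  then show fin: "finite (T ` \<Omega>)" by (rule finite_subset) (use assms in auto)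
  show "simple_int \<Omega> m s = (\<Sum>w\<in>T ` \<Omega>. fst w * m (T -` {w} \<inter> \<Omega>))"
    "simple_int \<Omega> m s' = (\<Sum>w\<in>T ` \<Omega>. snd w * m (T -` {w} \<inter> \<Omega>))"
    using simple_int_regroup[OF fin, of fst] simple_int_regroup[OF fin, of snd] by (simp_all add: T_def)
qed

lemma simple_int_add:
  assumes "finite (s ` \<Omega>)" "finite (s' ` \<Omega>)"
  shows "simple_int \<Omega> m (\<lambda>x. s x + s' x) = simple_int \<Omega> m s + simple_int \<Omega> m s'"
  using simple_int_regroup[OF simple_int_pair(1)[OF assms], of "\<lambda>w. fst w + snd w"]
  by (simp add: simple_int_pair(2,3)[OF assms] sum.distrib distrib_right)

lemma simple_int_mono:
  assumes "finite (s ` \<Omega>)" "finite (s' ` \<Omega>)" "\<And>x. x \<in> \<Omega> \<Longrightarrow> s x \<le> s' x"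
  shows "simple_int \<Omega> m s \<le> simple_int \<Omega> m s'"
  unfolding simple_int_pair(2,3)[OF assms(1,2)]
  using assms(3) charge_range[OF m] by (intro sum_mono mult_right_mono) auto

lemma simple_int_const: "simple_int \<Omega> m (\<lambda>_. c) = c"
proof (cases "\<Omega> = {}")
  case True
  then show ?thesis using charge_total[OF m] charge_empty[OF algebra_Pow m] by simp
next
  case False
  then have "(\<lambda>_. c) ` \<Omega> = {c}" by auto
  moreover have "(\<lambda>_. c) -` {c} \<inter> \<Omega> = \<Omega>" by auto
  ultimately show ?thesis using charge_total[OF m] by (simp add: simple_int_def)
qed

lemma finite_const_image: "finite ((\<lambda>_. c) ` \<Omega>)"
  by (rule finite_subset[of _ "{c}"]) auto

lemma lower_int_upper:
  assumes "finite (s ` \<Omega>)" "\<And>x. x \<in> \<Omega> \<Longrightarrow> s x \<le> F x" "\<And>x. x \<in> \<Omega> \<Longrightarrow> F x \<le> B"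
  shows "simple_int \<Omega> m s \<le> lower_int \<Omega> m F"
  unfolding lower_int_def
proof (rule cSup_upper)
  show "bdd_above (simple_int \<Omega> m ` {s. finite (s ` \<Omega>) \<and> (\<forall>x\<in>\<Omega>. s x \<le> F x)})"
  proof (rule bdd_aboveI2)
    fix s' assume "s' \<in> {s. finite (s ` \<Omega>) \<and> (\<forall>x\<in>\<Omega>. s x \<le> F x)}"
    then have "finite (s' ` \<Omega>)" "\<And>x. x \<in> \<Omega> \<Longrightarrow> s' x \<le> B" using assms(3) by (auto intro: order_trans)
    then have "simple_int \<Omega> m s' \<le> simple_int \<Omega> m (\<lambda>_. B)"
      by (intro simple_int_mono finite_const_image)
    then show "simple_int \<Omega> m s' \<le> B" by (simp add: simple_int_const)
  qed
qed (use assms in auto)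

lemma lower_int_least:
  assumes "\<And>x. x \<in> \<Omega> \<Longrightarrow> b \<le> F x"
    "\<And>s. finite (s ` \<Omega>) \<Longrightarrow> (\<And>x. x \<in> \<Omega> \<Longrightarrow> s x \<le> F x) \<Longrightarrow> simple_int \<Omega> m s \<le> c"
  shows "lower_int \<Omega> m F \<le> c"
  unfolding lower_int_def
proof (rule cSup_least)
  have "(\<lambda>_. b) \<in> {s. finite (s ` \<Omega>) \<and> (\<forall>x\<in>\<Omega>. s x \<le> F x)}"
    using assms(1) finite_const_image by auto
  then show "simple_int \<Omega> m ` {s. finite (s ` \<Omega>) \<and> (\<forall>x\<in>\<Omega>. s x \<le> F x)} \<noteq> {}" by blast
qed (use assms(2) in auto)

lemma lower_int_bounds:
  assumes "\<And>x. x \<in> \<Omega> \<Longrightarrow> a \<le> F x" "\<And>x. x \<in> \<Omega> \<Longrightarrow> F x \<le> b"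
  shows "a \<le> lower_int \<Omega> m F" "lower_int \<Omega> m F \<le> b"
proof -
  show "a \<le> lower_int \<Omega> m F"
    using lower_int_upper[of "\<lambda>_. a" F b, OF finite_const_image[of a]] assms by (simp add: simple_int_const)
  show "lower_int \<Omega> m F \<le> b"
  proof (rule lower_int_least[OF assms(1)])
    fix s :: "'x \<Rightarrow> real" assume s: "finite (s ` \<Omega>)" "\<And>x. x \<in> \<Omega> \<Longrightarrow> s x \<le> F x"
    then have "simple_int \<Omega> m s \<le> simple_int \<Omega> m (\<lambda>_. b)"
      using assms(2) by (intro simple_int_mono finite_const_image) (auto intro: order_trans)
    then show "simple_int \<Omega> m s \<le> b" by (simp add: simple_int_const)
  qed
qed

text \<open>Rounding down to multiples of \<open>1/n\<close>.\<close>

lemma simple_approx: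
  fixes n :: nat
  assumes F: "\<And>x. x \<in> \<Omega> \<Longrightarrow> 0 \<le> F x \<and> F x \<le> (1::real)" and n: "n > 0"
  obtains s where "finite (s ` \<Omega>)" "\<And>x. x \<in> \<Omega> \<Longrightarrow> s x \<le> F x" "\<And>x. x \<in> \<Omega> \<Longrightarrow> F x \<le> s x + 1 / n"
proof
  let ?s = "\<lambda>x. of_int \<lfloor>real n * F x\<rfloor> / real n"
  have "?s ` \<Omega> \<subseteq> (\<lambda>k. of_int k / real n) ` {0..int n}"
  proof
    fix y assume "y \<in> ?s ` \<Omega>"
    then obtain x where x: "x \<in> \<Omega>" "y = ?s x" by auto
    have "0 \<le> real n * F x" "real n * F x \<le> real n * 1"
      using F[OF x(1)] n by (auto intro!: mult_left_mono)
    then have "\<lfloor>real n * F x\<rfloor> \<in> {0..int n}" by (auto simp: floor_le_iff)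
    then show "y \<in> (\<lambda>k. of_int k / real n) ` {0..int n}" using x by auto
  qed
  then show "finite (?s ` \<Omega>)" by (rule finite_subset) auto
  fix x
  have "of_int \<lfloor>real n * F x\<rfloor> \<le> real n * F x" "real n * F x \<le> of_int \<lfloor>real n * F x\<rfloor> + 1" by linarith+
  then show "?s x \<le> F x" "F x \<le> ?s x + 1 / n" using n by (auto simp: field_simps)
qed

lemma lower_int_add:
  assumes F: "\<And>x. x \<in> \<Omega> \<Longrightarrow> 0 \<le> F x \<and> F x \<le> 1" and F': "\<And>x. x \<in> \<Omega> \<Longrightarrow> 0 \<le> F' x \<and> F' x \<le> 1"
  shows "lower_int \<Omega> m (\<lambda>x. F x + F' x) = lower_int \<Omega> m F + lower_int \<Omega> m F'"
proof (rule antisym)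
  have "simple_int \<Omega> m s \<le> lower_int \<Omega> m F + lower_int \<Omega> m F'"
    if s: "finite (s ` \<Omega>)" "\<And>x. x \<in> \<Omega> \<Longrightarrow> s x \<le> F x + F' x" for s
  proof (rule field_le_epsilon)
    fix e :: real assume "0 < e"
    then obtain n :: nat where n: "1 / real (Suc n) < e / 2" using nat_approx_posE[of "e/2"] by auto
    obtain u where u: "finite (u ` \<Omega>)" "\<And>x. x \<in> \<Omega> \<Longrightarrow> u x \<le> F x" "\<And>x. x \<in> \<Omega> \<Longrightarrow> F x \<le> u x + 1 / Suc n"
      using simple_approx[of F "Suc n", OF F zero_less_Suc] by metis
    obtain u' where u': "finite (u' ` \<Omega>)" "\<And>x. x \<in> \<Omega> \<Longrightarrow> u' x \<le> F' x" "\<And>x. x \<in> \<Omega> \<Longrightarrow> F' x \<le> u' x + 1 / Suc n"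
      using simple_approx[of F' "Suc n", OF F' zero_less_Suc] by metis
    have f1: "finite ((\<lambda>x. u x + u' x) ` \<Omega>)"
    proof -
      have "(\<lambda>x. u x + u' x) ` \<Omega> = (\<lambda>(a,b). a + b) ` (\<lambda>x. (u x, u' x)) ` \<Omega>" by (auto simp: image_image)
      then show ?thesis using simple_int_pair(1)[OF u(1) u'(1)] by simp
    qed
    have f2: "finite ((\<lambda>x. u x + u' x + e) ` \<Omega>)"
    proof -
      have "(\<lambda>x. u x + u' x + e) ` \<Omega> = (\<lambda>a. a + e) ` (\<lambda>x. u x + u' x) ` \<Omega>" by (auto simp: image_image)
      then show ?thesis using f1 by simp
    qed
    have "simple_int \<Omega> m s \<le> simple_int \<Omega> m (\<lambda>x. u x + u' x + e)"
    proof (rule simple_int_mono[OF s(1) f2])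
      fix x assume x: "x \<in> \<Omega>"
      show "s x \<le> u x + u' x + e" using s(2)[OF x] u(3)[OF x] u'(3)[OF x] n by linarith
    qed
    also have "\<dots> = simple_int \<Omega> m u + simple_int \<Omega> m u' + e"
      using simple_int_add[OF f1 finite_const_image, of e] simple_int_add[OF u(1) u'(1)]
      by (simp add: simple_int_const)
    also have "\<dots> \<le> lower_int \<Omega> m F + lower_int \<Omega> m F' + e"
      using lower_int_upper[OF u(1,2), of 1] lower_int_upper[OF u'(1,2), of 1] F F' by simp
    finally show "simple_int \<Omega> m s \<le> lower_int \<Omega> m F + lower_int \<Omega> m F' + e" .
  qed
  then show "lower_int \<Omega> m (\<lambda>x. F x + F' x) \<le> lower_int \<Omega> m F + lower_int \<Omega> m F'"
    using F F' by (intro lower_int_least[of 0]) auto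
  have "lower_int \<Omega> m F \<le> lower_int \<Omega> m (\<lambda>x. F x + F' x) - lower_int \<Omega> m F'"
  proof (rule lower_int_least[of 0])
    fix s assume s: "finite (s ` \<Omega>)" "\<And>x. x \<in> \<Omega> \<Longrightarrow> s x \<le> F x"
    have "lower_int \<Omega> m F' \<le> lower_int \<Omega> m (\<lambda>x. F x + F' x) - simple_int \<Omega> m s"
    proof (rule lower_int_least[of 0])
      fix s' assume s': "finite (s' ` \<Omega>)" "\<And>x. x \<in> \<Omega> \<Longrightarrow> s' x \<le> F' x"
      have "(\<lambda>x. s x + s' x) ` \<Omega> = (\<lambda>(a,b). a + b) ` (\<lambda>x. (s x, s' x)) ` \<Omega>" by (auto simp: image_image)
      then have "finite ((\<lambda>x. s x + s' x) ` \<Omega>)" using simple_int_pair(1)[OF s(1) s'(1)] by simp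
      then have "simple_int \<Omega> m (\<lambda>x. s x + s' x) \<le> lower_int \<Omega> m (\<lambda>x. F x + F' x)"
      proof (rule lower_int_upper[where B = 2])
        fix x assume x: "x \<in> \<Omega>"
        show "s x + s' x \<le> F x + F' x" "F x + F' x \<le> 2" using s(2)[OF x] s'(2)[OF x] F[OF x] F'[OF x] by auto
      qed
      then show "simple_int \<Omega> m s' \<le> lower_int \<Omega> m (\<lambda>x. F x + F' x) - simple_int \<Omega> m s"
        using simple_int_add[OF s(1) s'(1)] by simp
    qed (use F' in auto)
    then show "simple_int \<Omega> m s \<le> lower_int \<Omega> m (\<lambda>x. F x + F' x) - lower_int \<Omega> m F'" by simp
  qed (use F in auto)
  then show "lower_int \<Omega> m F + lower_int \<Omega> m F' \<le> lower_int \<Omega> m (\<lambda>x. F x + F' x)" by simp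
qed

text \<open>Invariance of the charge under \<open>\<tau>\<close> in the form of one inequality. The action by the inverse
  element supplies the reverse one.\<close>

lemma lower_int_le_transform:
  assumes \<tau>: "\<tau> ` \<Omega> = \<Omega>" "\<And>A. A \<subseteq> \<Omega> \<Longrightarrow> m (\<tau> -` A \<inter> \<Omega>) = m A"
    and F: "\<And>x. x \<in> \<Omega> \<Longrightarrow> a \<le> F x \<and> F x \<le> b"
  shows "lower_int \<Omega> m F \<le> lower_int \<Omega> m (\<lambda>x. F (\<tau> x))"
proof (rule lower_int_least[of a])
  fix s :: "'x \<Rightarrow> real" assume s: "finite (s ` \<Omega>)" "\<And>x. x \<in> \<Omega> \<Longrightarrow> s x \<le> F x"
  have im: "(\<lambda>x. s (\<tau> x)) ` \<Omega> = s ` \<Omega>" using \<tau>(1) by (metis image_image)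
  have "m ((\<lambda>x. s (\<tau> x)) -` {v} \<inter> \<Omega>) = m (s -` {v} \<inter> \<Omega>)" for v
  proof -
    have "(\<lambda>x. s (\<tau> x)) -` {v} \<inter> \<Omega> = \<tau> -` (s -` {v} \<inter> \<Omega>) \<inter> \<Omega>" using \<tau>(1) by auto
    then show ?thesis using \<tau>(2)[of "s -` {v} \<inter> \<Omega>"] by simp
  qed
  then have "simple_int \<Omega> m s = simple_int \<Omega> m (\<lambda>x. s (\<tau> x))" unfolding simple_int_def im by simp
  also have "\<dots> \<le> lower_int \<Omega> m (\<lambda>x. F (\<tau> x))"
  proof (rule lower_int_upper[where B = b])
    fix x assume "x \<in> \<Omega>"
    then have "\<tau> x \<in> \<Omega>" using \<tau>(1) by auto
    then show "s (\<tau> x) \<le> F (\<tau> x)" "F (\<tau> x) \<le> b" using s F by auto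
  qed (use im s in simp)
  finally show "simple_int \<Omega> m s \<le> lower_int \<Omega> m (\<lambda>x. F (\<tau> x))" .
qed (use F in auto)

end

section \<open>Means on a group and invariant charges\<close>

definition fixed_charges :: "'a set \<Rightarrow> 'x topology \<Rightarrow> ('a \<Rightarrow> 'x \<Rightarrow> 'x) \<Rightarrow> ('x set \<Rightarrow> real) set" where
  "fixed_charges H X \<phi> = {\<nu> \<in> borel_charges X. \<forall>h\<in>H. borel_charge_act X \<phi> h \<nu> = \<nu>}"

text \<open>Invariance is expressed by preimages, as for push-forwards. The carrier \<open>\<Omega>\<close> and the acting set
  \<open>H\<close> are separate because means on the whole group that are invariant under a subgroup only have
  to be considered.\<close>

definition left_invariant :: "('a, 'b) monoid_scheme \<Rightarrow> 'a set \<Rightarrow> 'a set \<Rightarrow> ('a set \<Rightarrow> real) \<Rightarrow> bool" where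
  "left_invariant G \<Omega> H m \<longleftrightarrow> (\<forall>h\<in>H. \<forall>A. A \<subseteq> \<Omega> \<longrightarrow> m ((\<lambda>x. h \<otimes>\<^bsub>G\<^esub> x) -` A \<inter> \<Omega>) = m A)"

lemma (in group) lcoset_eq_preimage:
  assumes "g \<in> carrier G" "A \<subseteq> carrier G"
  shows "(\<lambda>x. g \<otimes> x) -` (g <# A) \<inter> carrier G = A"
  using assms by (auto simp: l_coset_def subset_iff)

lemma (in group) preimage_eq_lcoset:
  assumes "g \<in> carrier G" "A \<subseteq> carrier G"
  shows "(\<lambda>x. g \<otimes> x) -` A \<inter> carrier G = inv g <# A"
proof (intro equalityI subsetI)
  fix x assume "x \<in> (\<lambda>x. g \<otimes> x) -` A \<inter> carrier G"
  then have "x \<in> carrier G" "g \<otimes> x \<in> A" by auto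
  moreover have "x = inv g \<otimes> (g \<otimes> x)" using assms calculation by (simp add: m_assoc[symmetric])
  ultimately show "x \<in> inv g <# A" unfolding l_coset_def by blast
next
  fix x assume "x \<in> inv g <# A"
  then obtain a where "a \<in> A" "x = inv g \<otimes> a" by (auto simp: l_coset_def)
  moreover have "g \<otimes> (inv g \<otimes> a) = a" if "a \<in> carrier G" using assms that by (simp add: m_assoc[symmetric])
  ultimately show "x \<in> (\<lambda>x. g \<otimes> x) -` A \<inter> carrier G" using assms by auto
qed

lemma amenable_group_iff:
  fixes G (structure)
  shows
  "amenable_group G \<longleftrightarrow> group G \<and>
    (\<exists>m\<in>charges (carrier G) (Pow (carrier G)). left_invariant G (carrier G) (carrier G) m)"
proof
  assume a: "amenable_group G"
  then interpret group G by (simp add: amenable_group_def)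
  obtain m :: "'a set \<Rightarrow> real" where
    "(\<forall>A. A \<subseteq> carrier G \<longrightarrow> 0 \<le> m A) \<and> m (carrier G) = 1 \<and>
     (\<forall>A B. A \<subseteq> carrier G \<longrightarrow> B \<subseteq> carrier G \<longrightarrow> A \<inter> B = {} \<longrightarrow> m (A \<union> B) = m A + m B) \<and>
     (\<forall>g\<in>carrier G. \<forall>A. A \<subseteq> carrier G \<longrightarrow> m (g <#\<^bsub>G\<^esub> A) = m A)"
    using a unfolding amenable_group_def by (elim conjE exE) (rule that, intro conjI)
  then have m: "\<And>A. A \<subseteq> carrier G \<Longrightarrow> 0 \<le> m A" "m (carrier G) = 1"
    "\<And>A B. A \<subseteq> carrier G \<Longrightarrow> B \<subseteq> carrier G \<Longrightarrow> A \<inter> B = {} \<Longrightarrow> m (A \<union> B) = m A + m B"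
    "\<And>g A. g \<in> carrier G \<Longrightarrow> A \<subseteq> carrier G \<Longrightarrow> m (g <#\<^bsub>G\<^esub> A) = m A"
    by simp_all
  let ?m = "restrict m (Pow (carrier G))"
  have "?m \<in> charges (carrier G) (Pow (carrier G))"
  proof (rule chargesI)
    fix A assume "A \<in> Pow (carrier G)"
    then have A: "A \<subseteq> carrier G" by simp
    have "m A + m (carrier G - A) = 1" using m(3)[of A "carrier G - A"] A m(2) by (simp add: Un_absorb1)
    then show "0 \<le> ?m A \<and> ?m A \<le> 1" using m(1)[of A] m(1)[of "carrier G - A"] A by simp
  qed (use m in auto)
  moreover have "left_invariant G (carrier G) (carrier G) ?m" unfolding left_invariant_def
  proof (intro ballI allI impI)
    fix g A assume "g \<in> carrier G" "A \<subseteq> carrier G"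
    then show "?m ((\<lambda>x. g \<otimes> x) -` A \<inter> carrier G) = ?m A"
      using m(4)[of "inv g" A] preimage_eq_lcoset[of g A] by (simp add: l_coset_subset_G)
  qed
  ultimately show "group G \<and> (\<exists>m\<in>charges (carrier G) (Pow (carrier G)). left_invariant G (carrier G) (carrier G) m)"
    using is_group by blast
next
  assume "group G \<and> (\<exists>m\<in>charges (carrier G) (Pow (carrier G)). left_invariant G (carrier G) (carrier G) m)"
  then obtain m where G: "group G" and m: "m \<in> charges (carrier G) (Pow (carrier G))"
    "left_invariant G (carrier G) (carrier G) m" by blast
  interpret group G by fact
  have "m (g <# A) = m A" if "g \<in> carrier G" "A \<subseteq> carrier G" for g A
    using m(2) that lcoset_eq_preimage[OF that] l_coset_subset_G[OF that(2,1)]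
    unfolding left_invariant_def by metis
  then show "amenable_group G" unfolding amenable_group_def
    using G charge_range[OF m(1)] charge_total[OF m(1)] charge_add[OF m(1)] by (intro conjI exI[of _ m]) auto
qed

text \<open>Choosing a representative \<open>r g\<close> in each coset \<open>H #> g\<close> gives the map \<open>g \<mapsto> g \<otimes> inv (r g)\<close> into
  \<open>H\<close>. It commutes with left translation by \<open>H\<close>, so it carries an \<open>H\<close>-invariant mean on the group
  to an invariant mean on \<open>H\<close>.\<close>

lemma (in group) amenable_subgroupI:
  assumes H: "subgroup H G" and m: "m \<in> charges (carrier G) (Pow (carrier G))"
    "left_invariant G (carrier G) H m"
  shows "amenable_group (G\<lparr>carrier := H\<rparr>)"
proof -
  interpret H: subgroup H G by fact
  define r where "r g = (SOME y. y \<in> H #> g)" for g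
  define p where "p g = g \<otimes> inv (r g)" for g
  have r: "r g \<in> H #> g" if "g \<in> carrier G" for g
    unfolding r_def using rcos_self[OF that H] by (rule someI)
  have rh: "r (h \<otimes> g) = r g" if "h \<in> H" "g \<in> carrier G" for h g
  proof -
    have "H #> (h \<otimes> g) = H #> g"
      using that H.mem_carrier coset_mult_assoc[of H h g] coset_join2[of h H] H H.subset by simp
    then show ?thesis by (simp add: r_def)
  qed
  have p: "p g \<in> H" if g: "g \<in> carrier G" for g
  proof -
    obtain h where h: "h \<in> H" "r g = h \<otimes> g" using r[OF g] by (auto simp: r_coset_def)
    have "p g = inv h" unfolding p_def h(2) using g h H.mem_carrier by (simp add: inv_mult_group m_assoc[symmetric])
    then show ?thesis using h by simp
  qed
  have rc: "r g \<in> carrier G" if "g \<in> carrier G" for g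
    using r[OF that] r_coset_subset_G[OF H.subset that] by blast
  have ph: "p (h \<otimes> g) = h \<otimes> p g" if "h \<in> H" "g \<in> carrier G" for h g
    unfolding p_def rh[OF that] using that rc[OF that(2)] H.mem_carrier by (simp add: m_assoc)
  let ?\<nu> = "push (carrier G) (Pow H) p m"
  have "?\<nu> \<in> charges H (Pow H)"
    by (rule push_charge[OF algebra_Pow m(1)]) (use p in auto)
  moreover have "left_invariant (G\<lparr>carrier := H\<rparr>) H H ?\<nu>" unfolding left_invariant_def
  proof (intro ballI allI impI)
    fix h A assume h: "h \<in> H" and A: "A \<subseteq> H"
    let ?B = "(\<lambda>x. h \<otimes>\<^bsub>G\<lparr>carrier := H\<rparr>\<^esub> x) -` A \<inter> H"
    have "p -` ?B \<inter> carrier G = (\<lambda>x. h \<otimes> x) -` (p -` A \<inter> carrier G) \<inter> carrier G"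
      using p ph[OF h] h H.mem_carrier by auto
    then have "m (p -` ?B \<inter> carrier G) = m (p -` A \<inter> carrier G)"
      using m(2) h unfolding left_invariant_def by (metis Int_lower2)
    moreover have "?\<nu> C = m (p -` C \<inter> carrier G)" if "C \<subseteq> H" for C
      unfolding push_def using that by (intro restrict_apply') simp
    ultimately show "?\<nu> ?B = ?\<nu> A" using A by (metis Int_lower2)
  qed
  moreover have "group (G\<lparr>carrier := H\<rparr>)" by (rule subgroup_imp_group[OF H])
  ultimately show ?thesis unfolding amenable_group_iff by auto
qed

lemma (in group) amenable_subgroup:
  assumes "amenable_group G" "subgroup H G" shows "amenable_group (G\<lparr>carrier := H\<rparr>)"
proof -
  obtain m where m: "m \<in> charges (carrier G) (Pow (carrier G))" "left_invariant G (carrier G) (carrier G) m"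
    using assms(1) unfolding amenable_group_iff by blast
  have "left_invariant G (carrier G) H m"
    using m(2) subgroup.subset[OF assms(2)] unfolding left_invariant_def by blast
  then show ?thesis by (rule amenable_subgroupI[OF assms(2) m(1)])
qed


lemma average_charge:
  assumes I: "finite I" "I \<noteq> {}" and \<nu>: "\<And>i. i \<in> I \<Longrightarrow> \<nu> i \<in> borel_charges X"
  shows "(\<lambda>A\<in>sets (borel_of X). (\<Sum>i\<in>I. \<nu> i A) / card I) \<in> borel_charges X"
  unfolding borel_charges_def
proof (rule chargesI)
  have c: "\<nu> i \<in> charges (topspace X) (sets (borel_of X))" if "i \<in> I" for i
    using \<nu>[OF that] by (simp add: borel_charges_def)
  have card: "real (card I) > 0" using I by (simp add: card_gt_0_iff)
  fix A assume A: "A \<in> sets (borel_of X)"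
  have "0 \<le> (\<Sum>i\<in>I. \<nu> i A)" using charge_range[OF c A] by (intro sum_nonneg) auto
  moreover have "(\<Sum>i\<in>I. \<nu> i A) \<le> of_nat (card I) * 1" using charge_range[OF c A] by (intro sum_bounded_above) auto
  ultimately show "0 \<le> (\<lambda>A\<in>sets (borel_of X). (\<Sum>i\<in>I. \<nu> i A) / card I) A \<and>
      (\<lambda>A\<in>sets (borel_of X). (\<Sum>i\<in>I. \<nu> i A) / card I) A \<le> 1"
    using A card by simp
  fix B assume B: "B \<in> sets (borel_of X)" "A \<inter> B = {}"
  have "(\<Sum>i\<in>I. \<nu> i (A \<union> B)) = (\<Sum>i\<in>I. \<nu> i A) + (\<Sum>i\<in>I. \<nu> i B)"
    unfolding sum.distrib[symmetric] by (intro sum.cong refl charge_add[OF c] A B)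
  then show "(\<lambda>A\<in>sets (borel_of X). (\<Sum>i\<in>I. \<nu> i A) / card I) (A \<union> B) =
      (\<lambda>A\<in>sets (borel_of X). (\<Sum>i\<in>I. \<nu> i A) / card I) A + (\<lambda>A\<in>sets (borel_of X). (\<Sum>i\<in>I. \<nu> i A) / card I) B"
    using A B by (simp add: add_divide_distrib)
next
  have "(\<Sum>i\<in>I. \<nu> i (topspace X)) = (\<Sum>i\<in>I. 1)"
    using \<nu> by (intro sum.cong) (auto simp: borel_charges_def dest: charge_total)
  then show "(\<lambda>A\<in>sets (borel_of X). (\<Sum>i\<in>I. \<nu> i A) / card I) (topspace X) = 1"
    using I borel_open[of X "topspace X"] by simp
qed auto

context flow begin

interpretation C: flow G Ch cact by (rule borel_charge_flow)

lemma borel_charge_eqI: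
  "\<mu> \<in> borel_charges X \<Longrightarrow> \<nu> \<in> borel_charges X \<Longrightarrow> (\<And>A. A \<in> sets (borel_of X) \<Longrightarrow> \<mu> A = \<nu> A) \<Longrightarrow> \<mu> = \<nu>"
  unfolding borel_charges_def by (rule charges_eqI)

lemma closedin_fixed_charges:
  assumes "H \<subseteq> carrier G" shows "closedin Ch (fixed_charges H X \<phi>)"
proof -
  define D where "D h = {\<nu> \<in> topspace Ch. cact h \<nu> = \<nu>}" for h
  have "closedin Ch (D h)" if "h \<in> H" for h
    using that assms unfolding D_def
    by (intro closedin_continuous_maps_eq[OF C.Hausdorff C.cont] continuous_map_id[unfolded id_def]) auto
  then have "closedin Ch (topspace Ch \<inter> \<Inter>(insert (topspace Ch) (D ` H)))"
    using closedin_topspace[of Ch] by (intro closedin_Int closedin_Inter) auto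
  moreover have "topspace Ch \<inter> \<Inter>(insert (topspace Ch) (D ` H)) = fixed_charges H X \<phi>"
    by (auto simp: D_def fixed_charges_def)
  ultimately show ?thesis by simp
qed

text \<open>Push an invariant mean forward along the orbit map of a point.\<close>

lemma amenable_fixes_charge:
  assumes H: "subgroup H G" and am: "amenable_group (G\<lparr>carrier := H\<rparr>)"
  shows "fixed_charges H X \<phi> \<noteq> {}"
proof -
  interpret H: subgroup H G by fact
  obtain m where m: "m \<in> charges H (Pow H)" "left_invariant (G\<lparr>carrier := H\<rparr>) H H m"
    using am unfolding amenable_group_iff by auto
  obtain x where x: "x \<in> topspace X" using nonempty by blast
  let ?\<nu> = "push H (sets (borel_of X)) (\<lambda>h. \<phi> h x) m"
  have \<nu>: "?\<nu> \<in> borel_charges X" unfolding borel_charges_def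
    by (rule push_charge[OF algebra_Pow m(1)])
       (use x H.mem_carrier in \<open>auto intro: borel_open\<close>)
  have "cact k ?\<nu> = ?\<nu>" if k: "k \<in> H" for k
  proof (rule borel_charge_eqI)
    show "cact k ?\<nu> \<in> borel_charges X" using C.act_closed[of k ?\<nu>] \<nu> k H.mem_carrier by simp
    fix A assume A: "A \<in> sets (borel_of X)"
    have kc: "k \<in> carrier G" using k H.mem_carrier by simp
    let ?S = "(\<lambda>h. \<phi> h x) -` A \<inter> H"
    have "cact k ?\<nu> A = ?\<nu> (\<phi> k -` A \<inter> topspace X)" by (rule borel_charge_act_apply[OF \<nu> A])
    also have "\<dots> = m ((\<lambda>h. \<phi> h x) -` (\<phi> k -` A \<inter> topspace X) \<inter> H)"
      using borel_act_preimage[OF kc A] by (simp add: push_def)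
    also have "(\<lambda>h. \<phi> h x) -` (\<phi> k -` A \<inter> topspace X) \<inter> H = (\<lambda>h. k \<otimes> h) -` ?S \<inter> H"
      using x k kc H.mem_carrier by (auto simp: act_mult)
    also have "m ((\<lambda>h. k \<otimes> h) -` ?S \<inter> H) = m ?S"
      using m(2)[unfolded left_invariant_def, rule_format, OF k, of ?S] by simp
    finally have "cact k ?\<nu> A = m ?S" .
    moreover have "?\<nu> A = m ?S" using A by (simp add: push_def)
    ultimately show "cact k ?\<nu> A = ?\<nu> A" by (rule trans_sym)
  qed (rule \<nu>)
  then have "?\<nu> \<in> fixed_charges H X \<phi>" using \<nu> by (simp add: fixed_charges_def)
  then show ?thesis by blast
qed

text \<open>The average over the finite orbit is fixed. In this way a fixed charge of a subgroup of finite
  index yields one of the whole group.\<close>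

lemma finite_orbit_fixes_charge:
  assumes H: "subgroup H G" and \<nu>: "\<nu> \<in> borel_charges X" and fin: "finite ((\<lambda>h. cact h \<nu>) ` H)"
  shows "fixed_charges H X \<phi> \<noteq> {}"
proof -
  interpret H: subgroup H G by fact
  let ?I = "(\<lambda>h. cact h \<nu>) ` H"
  define \<mu> where "\<mu> = (\<lambda>A\<in>sets (borel_of X). (\<Sum>\<kappa>\<in>?I. \<kappa> A) / card ?I)"
  have Ic: "\<kappa> \<in> borel_charges X" if "\<kappa> \<in> ?I" for \<kappa>
    using that C.act_closed \<nu> H.mem_carrier by auto
  have \<mu>: "\<mu> \<in> borel_charges X"
    unfolding \<mu>_def by (rule average_charge[OF fin _ Ic]) (use H.one_closed in blast)
  have "cact k \<mu> = \<mu>" if k: "k \<in> H" for k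
  proof (rule borel_charge_eqI)
    have kc: "k \<in> carrier G" using k H.mem_carrier by simp
    show "cact k \<mu> \<in> borel_charges X" using C.act_closed[OF kc, of \<mu>] \<mu> by simp
    fix A assume A: "A \<in> sets (borel_of X)"
    have "cact k ` ?I = ?I"
    proof (intro equalityI subsetI)
      fix \<kappa> assume "\<kappa> \<in> cact k ` ?I"
      then obtain h where h: "h \<in> H" "\<kappa> = cact k (cact h \<nu>)" by auto
      have "\<kappa> = cact (k \<otimes> h) \<nu>" using h kc \<nu> H.mem_carrier by (simp add: C.act_mult)
      then show "\<kappa> \<in> ?I" using h k by blast
    next
      fix \<kappa> assume "\<kappa> \<in> ?I"
      then obtain h where h: "h \<in> H" "\<kappa> = cact h \<nu>" by auto
      have hc: "inv k \<otimes> h \<in> carrier G" "h \<in> carrier G" using h kc H.mem_carrier by auto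
      have "cact k (cact (inv k \<otimes> h) \<nu>) = cact (k \<otimes> (inv k \<otimes> h)) \<nu>" using hc kc \<nu> by (simp add: C.act_mult)
      also have "k \<otimes> (inv k \<otimes> h) = h" using hc kc by (simp add: m_assoc[symmetric])
      finally have "\<kappa> = cact k (cact (inv k \<otimes> h) \<nu>)" using h by simp
      moreover have "inv k \<otimes> h \<in> H" using h k by simp
      ultimately show "\<kappa> \<in> cact k ` ?I" by blast
    qed
    moreover have "inj_on (cact k) ?I"
    proof (rule inj_on_inverseI[where g = "cact (inv k)"])
      fix \<kappa> assume "\<kappa> \<in> ?I" then show "cact (inv k) (cact k \<kappa>) = \<kappa>" using Ic kc by simp
    qed
    ultimately have eq: "(\<Sum>\<kappa>\<in>?I. cact k \<kappa> A) = (\<Sum>\<kappa>\<in>?I. \<kappa> A)"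
      using sum.reindex[of "cact k" ?I "\<lambda>\<kappa>. \<kappa> A"] by (simp add: o_def)
    have "cact k \<mu> A = \<mu> (\<phi> k -` A \<inter> topspace X)" by (rule borel_charge_act_apply[OF \<mu> A])
    also have "\<dots> = (\<Sum>\<kappa>\<in>?I. \<kappa> (\<phi> k -` A \<inter> topspace X)) / card ?I"
      using borel_act_preimage[OF kc A] by (simp add: \<mu>_def)
    also have "(\<Sum>\<kappa>\<in>?I. \<kappa> (\<phi> k -` A \<inter> topspace X)) = (\<Sum>\<kappa>\<in>?I. cact k \<kappa> A)"
      by (intro sum.cong refl borel_charge_act_apply[symmetric] Ic A)
    finally have "cact k \<mu> A = (\<Sum>\<kappa>\<in>?I. \<kappa> A) / card ?I" unfolding eq .
    moreover have "\<mu> A = (\<Sum>\<kappa>\<in>?I. \<kappa> A) / card ?I" using A by (simp add: \<mu>_def)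
    ultimately show "cact k \<mu> A = \<mu> A" by (rule trans_sym)
  qed (rule \<mu>)
  then have "\<mu> \<in> fixed_charges H X \<phi>" using \<mu> by (simp add: fixed_charges_def)
  then show ?thesis by blast
qed

text \<open>The step of the Markov--Kakutani fixed point theorem. The hypothesis \<open>comm\<close> says that \<open>H\<close>
  commutes with \<open>S\<close> up to elements acting trivially on the charges fixed by \<open>S\<close>, so \<open>h\<close> maps these
  charges to themselves. The Cesaro averages of the charges \<open>h\<^sup>i \<nu>\<close> are \<open>h\<close>-invariant up to \<open>1/n\<close>
  by telescoping, and a cluster point is fixed by \<open>h\<close>.\<close>

lemma abelian_step_fixes_charge:
  assumes H: "subgroup H G" and S: "S \<subseteq> H"
    and comm: "\<And>h k. h \<in> H \<Longrightarrow> k \<in> S \<Longrightarrow>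
        \<exists>a. a \<in> carrier G \<and> (\<forall>\<nu>\<in>fixed_charges S X \<phi>. cact a \<nu> = \<nu>) \<and> k \<otimes> h = h \<otimes> k \<otimes> a"
    and ne: "fixed_charges S X \<phi> \<noteq> {}" and h: "h \<in> H"
  shows "fixed_charges (insert h S) X \<phi> \<noteq> {}"
proof -
  interpret H: subgroup H G by fact
  have hc: "h \<in> carrier G" and Sc: "S \<subseteq> carrier G" using h S H.subset by auto
  obtain \<nu> where \<nu>: "\<nu> \<in> fixed_charges S X \<phi>" using ne by blast
  have \<nu>c: "\<nu> \<in> borel_charges X" and \<nu>S: "\<And>k. k \<in> S \<Longrightarrow> cact k \<nu> = \<nu>" using \<nu> by (auto simp: fixed_charges_def)
  have ev: "continuous_map Ch euclideanreal (\<lambda>\<kappa>. \<kappa> A)" if "A \<in> sets (borel_of X)" for A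
    unfolding borel_charge_space_def by (rule continuous_map_charge_eval[OF that])
  have ev': "continuous_map Ch euclideanreal (\<lambda>\<kappa>. cact h \<kappa> A)" if "A \<in> sets (borel_of X)" for A
    using continuous_map_compose[OF C.cont[OF hc] ev[OF that]] by (simp add: o_def)
  \<comment> \<open>approximate invariance under \<open>h\<close>: one set and one tolerance at a time\<close>
  define E where "E = (\<lambda>(A, n::nat). fixed_charges S X \<phi> \<inter>
      {\<kappa> \<in> topspace Ch. cact h \<kappa> A - \<kappa> A \<le> 1 / Suc n} \<inter> {\<kappa> \<in> topspace Ch. \<kappa> A - cact h \<kappa> A \<le> 1 / Suc n})"
  let ?I = "sets (borel_of X) \<times> (UNIV :: nat set)"
  have cl: "closedin Ch (E i)" if i: "i \<in> ?I" for i
  proof -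
    obtain A n where i: "i = (A, n)" "A \<in> sets (borel_of X)" using i by auto
    show ?thesis unfolding E_def i split_conv
      by (intro closedin_Int closedin_fixed_charges Sc closedin_eval_le continuous_map_diff ev ev' i) auto
  qed
  have hp: "h [^] i \<in> H" for i :: nat using h by (induction i) auto
  define \<nu>i where "\<nu>i i = cact (h [^] (i::nat)) \<nu>" for i
  have \<nu>ic: "\<nu>i i \<in> borel_charges X" for i
    unfolding \<nu>i_def using C.act_closed[of "h [^] i" \<nu>] hc \<nu>c by simp
  have \<nu>iS: "cact k (\<nu>i i) = \<nu>i i" if k: "k \<in> S" for k i
  proof -
    obtain a where a: "a \<in> carrier G" "cact a \<nu> = \<nu>" "k \<otimes> (h [^] i) = (h [^] i) \<otimes> k \<otimes> a"
      using comm[OF hp k] \<nu> by blast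
    have kc: "k \<in> carrier G" using k Sc by auto
    have "cact k (\<nu>i i) = cact ((h [^] i) \<otimes> k \<otimes> a) \<nu>"
      unfolding \<nu>i_def a(3)[symmetric] using kc hc \<nu>c by (simp add: C.act_mult)
    also have "\<dots> = \<nu>i i" unfolding \<nu>i_def using a kc hc \<nu>c \<nu>S[OF k] by (simp add: C.act_mult)
    finally show ?thesis .
  qed
  have hi: "cact h (\<nu>i i) = \<nu>i (Suc i)" for i
    unfolding \<nu>i_def nat_pow_Suc2[OF hc] using hc \<nu>c by (simp add: C.act_mult)
  have "topspace Ch \<inter> (\<Inter>i\<in>?I. E i) \<noteq> {}"
  proof (rule compact_space_INT_nonempty[OF C.compact cl])
    fix F assume F: "finite F" "F \<subseteq> ?I"
    define n where "n = Suc (Max (insert 0 (snd ` F)))"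
    define \<mu> where "\<mu> = (\<lambda>A\<in>sets (borel_of X). (\<Sum>i<n. \<nu>i i A) / card {..<n})"
    have n: "real n > 0" by (simp add: n_def)
    have \<mu>: "\<mu> \<in> borel_charges X" unfolding \<mu>_def by (rule average_charge) (use \<nu>ic n in \<open>auto\<close>)
    have act\<mu>: "cact k \<mu> A = (\<Sum>i<n. cact k (\<nu>i i) A) / n" if "k \<in> carrier G" "A \<in> sets (borel_of X)" for k A
    proof -
      have "cact k \<mu> A = \<mu> (\<phi> k -` A \<inter> topspace X)" by (rule borel_charge_act_apply[OF \<mu> that(2)])
      also have "\<dots> = (\<Sum>i<n. \<nu>i i (\<phi> k -` A \<inter> topspace X)) / n"
        using borel_act_preimage[OF that] by (simp add: \<mu>_def)
      also have "(\<Sum>i<n. \<nu>i i (\<phi> k -` A \<inter> topspace X)) = (\<Sum>i<n. cact k (\<nu>i i) A)"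
        by (intro sum.cong refl borel_charge_act_apply[symmetric] \<nu>ic that)
      finally show ?thesis .
    qed
    have "cact k \<mu> = \<mu>" if k: "k \<in> S" for k
    proof (rule borel_charge_eqI[OF _ \<mu>])
      have kc: "k \<in> carrier G" using k Sc by auto
      then show "cact k \<mu> \<in> borel_charges X" using C.act_closed[OF kc, of \<mu>] \<mu> by simp
      fix A assume A: "A \<in> sets (borel_of X)"
      show "cact k \<mu> A = \<mu> A" using act\<mu>[OF kc A] A by (simp add: \<nu>iS[OF k] \<mu>_def)
    qed
    then have \<mu>f: "\<mu> \<in> fixed_charges S X \<phi>" using \<mu> by (simp add: fixed_charges_def)
    have diff: "\<bar>cact h \<mu> A - \<mu> A\<bar> \<le> 1 / n" if A: "A \<in> sets (borel_of X)" for A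
    proof -
      have "cact h \<mu> A - \<mu> A = ((\<Sum>i<n. \<nu>i (Suc i) A) - (\<Sum>i<n. \<nu>i i A)) / n"
        using act\<mu>[OF hc A] A by (simp add: hi \<mu>_def diff_divide_distrib)
      also have "(\<Sum>i<n. \<nu>i (Suc i) A) - (\<Sum>i<n. \<nu>i i A) = \<nu>i n A - \<nu>i 0 A"
        unfolding sum_subtractf[symmetric] by (rule sum_lessThan_telescope)
      finally have "\<bar>cact h \<mu> A - \<mu> A\<bar> = \<bar>\<nu>i n A - \<nu>i 0 A\<bar> / n" using n by simp
      also have "\<bar>\<nu>i n A - \<nu>i 0 A\<bar> \<le> 1"
        using charge_range[OF \<nu>ic[of n, unfolded borel_charges_def] A] charge_range[OF \<nu>ic[of 0, unfolded borel_charges_def] A] by auto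
      finally show ?thesis using n by (simp add: divide_right_mono)
    qed
    have "\<mu> \<in> E i" if i: "i \<in> F" for i
    proof -
      obtain A k where Ak: "i = (A, k)" "A \<in> sets (borel_of X)" using i F by auto
      have "k \<le> Max (insert 0 (snd ` F))" using i F Ak by (auto intro!: Max_ge image_eqI[of _ _ i])
      then have "1 / real n \<le> 1 / Suc k" by (simp add: n_def frac_le)
      then show ?thesis using diff[OF Ak(2)] \<mu>f \<mu> Ak by (auto simp: E_def)
    qed
    then show "topspace Ch \<inter> (\<Inter>i\<in>F. E i) \<noteq> {}" using \<mu> by auto
  qed
  then obtain \<kappa> where \<kappa>: "\<kappa> \<in> topspace Ch" "\<And>i. i \<in> ?I \<Longrightarrow> \<kappa> \<in> E i" by auto
  have "({}, 0) \<in> ?I" by simp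
  then have \<kappa>S: "\<kappa> \<in> fixed_charges S X \<phi>" using \<kappa>(2) by (force simp: E_def)
  have "cact h \<kappa> = \<kappa>"
  proof (rule borel_charge_eqI)
    show "cact h \<kappa> \<in> borel_charges X" using C.act_closed[OF hc \<kappa>(1)] by simp
    show "\<kappa> \<in> borel_charges X" using \<kappa>(1) by simp
    fix A assume A: "A \<in> sets (borel_of X)"
    have b: "\<bar>cact h \<kappa> A - \<kappa> A\<bar> \<le> 1 / Suc n" for n using \<kappa>(2)[of "(A, n)"] A by (auto simp: E_def)
    show "cact h \<kappa> A = \<kappa> A"
    proof (rule ccontr)
      assume "cact h \<kappa> A \<noteq> \<kappa> A"
      then obtain n where "1 / real (Suc n) < \<bar>cact h \<kappa> A - \<kappa> A\<bar>" using nat_approx_posE[of "\<bar>cact h \<kappa> A - \<kappa> A\<bar>"] by auto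
      then show False using b[of n] by simp
    qed
  qed
  then show ?thesis using \<kappa>S by (auto simp: fixed_charges_def)
qed

text \<open>Modulo its derived subgroup \<open>H\<close> is abelian, so finitely many elements of \<open>H\<close> can be added one at
  a time; compactness gives a charge fixed by all of them.\<close>

lemma derived_fixes_charge:
  assumes H: "subgroup H G" and ne: "fixed_charges (derived G H) X \<phi> \<noteq> {}"
  shows "fixed_charges H X \<phi> \<noteq> {}"
proof -
  interpret H: subgroup H G by fact
  let ?A = "derived G H"
  have AH: "?A \<subseteq> H" using derived_incl[OF subset_refl H] .
  have key: "fixed_charges (?A \<union> F) X \<phi> \<noteq> {}" if "finite F" "F \<subseteq> H" for F
    using that
  proof (induction F rule: finite_induct)
    case empty then show ?case using ne by simp
  next
    case (insert h F)
    have "fixed_charges (insert h (?A \<union> F)) X \<phi> \<noteq> {}"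
    proof (rule abelian_step_fixes_charge[OF H])
      show "?A \<union> F \<subseteq> H" using AH insert.prems by auto
      show "h \<in> H" "fixed_charges (?A \<union> F) X \<phi> \<noteq> {}" using insert by auto
      fix g k assume g: "g \<in> H" and "k \<in> ?A \<union> F"
      then have k: "k \<in> H" using AH insert.prems by auto
      have c: "g \<in> carrier G" "k \<in> carrier G" using g k H.mem_carrier by auto
      let ?a = "inv k \<otimes> inv g \<otimes> inv (inv k) \<otimes> inv (inv g)"
      have "?a \<in> ?A" unfolding derived_def
        by (rule generate.incl) (use g k in blast)
      moreover have "g \<otimes> k \<otimes> ?a = k \<otimes> g"
      proof -
        have "x \<otimes> (inv x \<otimes> z) = z" if "x \<in> carrier G" "z \<in> carrier G" for x z
          using that by (simp add: m_assoc[symmetric])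
        then show ?thesis using c by (simp add: m_assoc)
      qed
      ultimately show "\<exists>a. a \<in> carrier G \<and> (\<forall>\<nu>\<in>fixed_charges (?A \<union> F) X \<phi>. cact a \<nu> = \<nu>) \<and> k \<otimes> g = g \<otimes> k \<otimes> a"
        using c by (intro exI[of _ ?a]) (auto simp: fixed_charges_def)
    qed
    then show ?case by simp
  qed
  have "topspace Ch \<inter> (\<Inter>h\<in>H. fixed_charges (insert h ?A) X \<phi>) \<noteq> {}"
  proof (rule compact_space_INT_nonempty[OF C.compact])
    fix h assume "h \<in> H"
    then show "closedin Ch (fixed_charges (insert h ?A) X \<phi>)"
      using AH H.subset by (intro closedin_fixed_charges) auto
  next
    fix F assume F: "finite F" "F \<subseteq> H"
    from key[OF this] show "topspace Ch \<inter> (\<Inter>h\<in>F. fixed_charges (insert h ?A) X \<phi>) \<noteq> {}"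
      by (auto simp: fixed_charges_def)
  qed
  then obtain \<nu> where "\<nu> \<in> borel_charges X" "\<forall>h\<in>H. \<nu> \<in> fixed_charges (insert h ?A) X \<phi>" by auto
  then have "\<nu> \<in> fixed_charges H X \<phi>" by (auto simp: fixed_charges_def)
  then show ?thesis by blast
qed

lemma trivial_derived_series_fixes_charge:
  assumes "subgroup H G" "(derived G ^^ n) H = {\<one>}"
  shows "fixed_charges H X \<phi> \<noteq> {}"
  using assms
proof (induction n arbitrary: H)
  case 0
  then have H: "H = {\<one>}" by simp
  obtain x where "x \<in> topspace X" using nonempty by blast
  then have "point_charge (sets (borel_of X)) x \<in> topspace Ch"
    using point_charge[OF algebra_borel_of] by (simp add: borel_charges_def)
  then have "point_charge (sets (borel_of X)) x \<in> fixed_charges H X \<phi>"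
    unfolding H by (simp add: fixed_charges_def)
  then show ?case by blast
next
  case (Suc n)
  have "subgroup (derived G H) G" using derived_is_subgroup Suc.prems(1) subgroup.subset by blast
  moreover have "(derived G ^^ n) (derived G H) = {\<one>}" using Suc.prems(2) by (simp add: funpow_swap1)
  ultimately show ?case using Suc.IH derived_fixes_charge[OF Suc.prems(1)] by blast
qed

text \<open>A charge \<open>\<nu>0\<close> fixed by \<open>H \<inter> N\<close> has translates \<open>h \<nu>0\<close> depending only on the coset of \<open>h\<close> modulo
  \<open>N\<close>. These cosets form a subgroup of the amenable group \<open>R\<close>, and averaging the translates
  against an invariant mean on that subgroup gives a charge fixed by \<open>H\<close>.\<close>

lemma amenable_extension_fixes_charge:
  assumes N: "N \<lhd> G" and R: "subgroup R (G Mod N)" "amenable_group ((G Mod N)\<lparr>carrier := R\<rparr>)"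
    and H: "subgroup H G" "\<And>h. h \<in> H \<Longrightarrow> N #> h \<in> R"
    and ne: "fixed_charges (H \<inter> N) X \<phi> \<noteq> {}"
  shows "fixed_charges H X \<phi> \<noteq> {}"
proof -
  interpret H: subgroup H G by fact
  interpret N: normal N G by fact
  interpret Q: group "G Mod N" by (rule N.factorgroup_is_group)
  interpret \<pi>: group_hom G "G Mod N" "\<lambda>a. N #> a"
    by (rule group_hom.intro) (use is_group Q.is_group N.r_coset_hom_Mod in \<open>auto simp: group_hom_axioms_def\<close>)
  define S where "S = (\<lambda>h. N #> h) ` H"
  have S: "subgroup S (G Mod N)" unfolding S_def by (rule \<pi>.subgroup_img_is_subgroup[OF H(1)])
  have SR: "S \<subseteq> R" using H(2) by (auto simp: S_def)
  interpret RG: group "(G Mod N)\<lparr>carrier := R\<rparr>" using R(2) by (simp add: amenable_group_def)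
  have "subgroup S ((G Mod N)\<lparr>carrier := R\<rparr>)" by (rule Q.subgroup_incl[OF S R(1) SR])
  from RG.amenable_subgroup[OF R(2) this]
  obtain m where m: "m \<in> charges S (Pow S)" "left_invariant (G Mod N) S S m"
    unfolding amenable_group_iff by (auto simp: left_invariant_def)
  obtain \<nu>0 where \<nu>0: "\<nu>0 \<in> borel_charges X" "\<And>n. n \<in> H \<inter> N \<Longrightarrow> cact n \<nu>0 = \<nu>0"
    using ne by (auto simp: fixed_charges_def)
  have same: "cact h \<nu>0 = cact k \<nu>0" if hk: "h \<in> H" "k \<in> H" "N #> h = N #> k" for h k
  proof -
    have c: "h \<in> carrier G" "k \<in> carrier G" using hk H.mem_carrier by auto
    have "h \<in> N #> k" using hk(3) c rcos_self[OF c(1) N.subgroup_axioms] by simp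
    then have "h \<in> k <# N" using N.coset_eq c by blast
    then obtain n where n: "n \<in> N" "h = k \<otimes> n" by (auto simp: l_coset_def)
    have nc: "n \<in> carrier G" using n N.mem_carrier by simp
    have "inv k \<otimes> h = n" using n nc c by (simp add: m_assoc[symmetric])
    moreover have "inv k \<otimes> h \<in> H" using hk by simp
    ultimately have "n \<in> H \<inter> N" using n(1) by simp
    then show ?thesis using \<nu>0 n nc c by (simp add: C.act_mult)
  qed
  define rep where "rep c = (SOME h. h \<in> H \<and> N #> h = c)" for c
  have rep: "rep c \<in> H \<and> N #> rep c = c" if "c \<in> S" for c
    unfolding rep_def by (rule someI_ex) (use that S_def in auto)
  define F where "F A c = cact (rep c) \<nu>0 A" for A c
  have gc: "cact h \<nu>0 \<in> charges (topspace X) (sets (borel_of X))" if "h \<in> H" for h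
    using C.act_closed[of h \<nu>0] \<nu>0(1) H.mem_carrier[OF that] by (simp add: borel_charges_def)
  have F01: "0 \<le> F A c \<and> F A c \<le> 1" if "c \<in> S" "A \<in> sets (borel_of X)" for A c
    unfolding F_def using charge_range[OF gc that(2)] rep[OF that(1)] by blast
  define \<nu> where "\<nu> = (\<lambda>A\<in>sets (borel_of X). lower_int S m (F A))"
  have \<nu>: "\<nu> \<in> borel_charges X" unfolding borel_charges_def
  proof (rule chargesI)
    fix A assume A: "A \<in> sets (borel_of X)"
    show "0 \<le> \<nu> A \<and> \<nu> A \<le> 1"
      using lower_int_bounds[OF m(1), of 0 "F A" 1] F01[OF _ A] A by (simp add: \<nu>_def)
    fix B assume B: "B \<in> sets (borel_of X)" "A \<inter> B = {}"
    have "F (A \<union> B) c = F A c + F B c" if "c \<in> S" for c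
      unfolding F_def using charge_add[OF gc A B] rep[OF that] by blast
    then have "lower_int S m (F (A \<union> B)) = lower_int S m (\<lambda>c. F A c + F B c)"
      unfolding lower_int_def by (intro arg_cong[where f = Sup] image_cong) auto
    also have "\<dots> = lower_int S m (F A) + lower_int S m (F B)"
      using F01 A B by (intro lower_int_add[OF m(1)]) auto
    finally show "\<nu> (A \<union> B) = \<nu> A + \<nu> B" using A B by (simp add: \<nu>_def)
  next
    have "F (topspace X) c = 1" if "c \<in> S" for c
      unfolding F_def using charge_total[OF gc] rep[OF that] by blast
    then show "\<nu> (topspace X) = 1"
      using lower_int_bounds[OF m(1), of 1 "F (topspace X)" 1] borel_open[of X "topspace X"]
      by (simp add: \<nu>_def)
  qed (simp add: \<nu>_def)
  have le: "\<nu> A \<le> cact k \<nu> A" if k: "k \<in> H" and A: "A \<in> sets (borel_of X)" for k A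
  proof -
    have kc: "k \<in> carrier G" using k H.mem_carrier by simp
    define \<tau> where "\<tau> c = (N #> k) \<otimes>\<^bsub>G Mod N\<^esub> c" for c
    have kS: "N #> k \<in> S" using k by (auto simp: S_def)
    have \<tau>S: "\<tau> c \<in> S" if "c \<in> S" for c unfolding \<tau>_def using subgroup.m_closed[OF S kS that] .
    have im: "\<tau> ` S = S"
    proof (intro equalityI subsetI)
      fix c assume c: "c \<in> S"
      have cs: "c \<in> carrier (G Mod N)" "N #> k \<in> carrier (G Mod N)" using subgroup.mem_carrier[OF S] c kS by auto
      have "c = \<tau> (inv\<^bsub>G Mod N\<^esub> (N #> k) \<otimes>\<^bsub>G Mod N\<^esub> c)"
        unfolding \<tau>_def by (metis Q.inv_closed Q.l_one Q.m_assoc Q.r_inv cs)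
      moreover have "inv\<^bsub>G Mod N\<^esub> (N #> k) \<otimes>\<^bsub>G Mod N\<^esub> c \<in> S"
        using subgroup.m_closed[OF S subgroup.m_inv_closed[OF S kS] c] .
      ultimately show "c \<in> \<tau> ` S" by blast
    qed (use \<tau>S in auto)
    have inv: "m (\<tau> -` B \<inter> S) = m B" if "B \<subseteq> S" for B
      using m(2) kS that unfolding left_invariant_def \<tau>_def by blast
    have "F A (\<tau> c) = F (\<phi> k -` A \<inter> topspace X) c" if c: "c \<in> S" for c
    proof -
      have r: "rep c \<in> H" "N #> rep c = c" "rep (\<tau> c) \<in> H" "N #> rep (\<tau> c) = \<tau> c"
        using rep c \<tau>S[OF c] by auto
      have rc: "rep c \<in> carrier G" using r H.mem_carrier by simp
      have "N #> (k \<otimes> rep c) = \<tau> c"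
        unfolding \<tau>_def using \<pi>.hom_mult[OF kc rc] r by simp
      then have "cact (rep (\<tau> c)) \<nu>0 = cact (k \<otimes> rep c) \<nu>0"
        using same[of "rep (\<tau> c)" "k \<otimes> rep c"] r k by simp
      also have "\<dots> = cact k (cact (rep c) \<nu>0)" using C.act_mult[OF kc rc, of \<nu>0] \<nu>0(1) by simp
      finally have "F A (\<tau> c) = cact k (cact (rep c) \<nu>0) A" by (simp add: F_def)
      also have "\<dots> = cact (rep c) \<nu>0 (\<phi> k -` A \<inter> topspace X)"
        using gc[OF r(1)] by (intro borel_charge_act_apply A) (simp add: borel_charges_def)
      finally show ?thesis by (simp add: F_def)
    qed
    then have eq: "lower_int S m (\<lambda>c. F A (\<tau> c)) = lower_int S m (F (\<phi> k -` A \<inter> topspace X))"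
      unfolding lower_int_def by (intro arg_cong[where f = Sup] image_cong) auto
    have "\<nu> A = lower_int S m (F A)" using A by (simp add: \<nu>_def)
    also have "\<dots> \<le> lower_int S m (\<lambda>c. F A (\<tau> c))"
      by (rule lower_int_le_transform[OF m(1) im inv, where a = 0 and b = 1]) (use F01 A in auto)
    also have "\<dots> = cact k \<nu> A"
      unfolding eq borel_charge_act_apply[OF \<nu> A] using borel_act_preimage[OF kc A] by (simp add: \<nu>_def)
    finally show ?thesis .
  qed
  have "cact k \<nu> = \<nu>" if k: "k \<in> H" for k
  proof (rule borel_charge_eqI[OF _ \<nu>])
    have kc: "k \<in> carrier G" using k H.mem_carrier by simp
    show c: "cact k \<nu> \<in> borel_charges X" using C.act_closed[OF kc, of \<nu>] \<nu> by simp
    fix A assume A: "A \<in> sets (borel_of X)"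
    let ?A = "\<phi> k -` A \<inter> topspace X"
    have A': "?A \<in> sets (borel_of X)" by (rule borel_act_preimage[OF kc A])
    have "cact k \<nu> A = \<nu> ?A" by (rule borel_charge_act_apply[OF \<nu> A])
    also have "\<dots> \<le> cact (inv k) \<nu> ?A" using k by (intro le A') auto
    also have "\<dots> = \<nu> (\<phi> (inv k) -` ?A \<inter> topspace X)" by (rule borel_charge_act_apply[OF \<nu> A'])
    also have "\<phi> (inv k) -` ?A \<inter> topspace X = A"
      using kc sets.sets_into_space[OF A] by auto
    finally show "cact k \<nu> A = \<nu> A" using le[OF k A] by simp
  qed
  then have "\<nu> \<in> fixed_charges H X \<phi>" using \<nu> by (simp add: fixed_charges_def)
  then show ?thesis by blast
qed

end


section \<open>Convex sets of charges\<close>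

definition mix :: "'x set set \<Rightarrow> real \<Rightarrow> ('x set \<Rightarrow> real) \<Rightarrow> ('x set \<Rightarrow> real) \<Rightarrow> 'x set \<Rightarrow> real" where
  "mix M t a b = (\<lambda>A\<in>M. t * a A + (1 - t) * b A)"

definition cvx :: "'x set set \<Rightarrow> ('x set \<Rightarrow> real) set \<Rightarrow> bool" where
  "cvx M D \<longleftrightarrow> (\<forall>a\<in>D. \<forall>b\<in>D. \<forall>t\<in>{0..1}. mix M t a b \<in> D)"

definition extreme :: "'x set set \<Rightarrow> ('x set \<Rightarrow> real) set \<Rightarrow> ('x set \<Rightarrow> real) \<Rightarrow> bool" where
  "extreme M D c \<longleftrightarrow> c \<in> D \<and> (\<forall>a\<in>D. \<forall>b\<in>D. \<forall>t\<in>{0<..<1}. c = mix M t a b \<longrightarrow> a = c \<and> b = c)"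

text \<open>For \<open>e = 0\<close> the convex hull of two convex sets. For \<open>e > 0\<close> a definite weight is required on
  \<open>D\<close>; such a join of \<open>D\<close> with the ambient set still omits every extreme point outside \<open>D\<close>.\<close>

definition join :: "'x set set \<Rightarrow> real \<Rightarrow> ('x set \<Rightarrow> real) set \<Rightarrow> ('x set \<Rightarrow> real) set \<Rightarrow> ('x set \<Rightarrow> real) set" where
  "join M e D D' = {mix M t d d' | t d d'. t \<in> {e..1} \<and> d \<in> D \<and> d' \<in> D'}"

locale charge_algebra = Sigma_Algebra.algebra \<Omega> M for \<Omega> :: "'x set" and M
begin

abbreviation "\<C> \<equiv> charges \<Omega> M"
abbreviation "\<S> \<equiv> charge_space \<Omega> M"

lemma compact: "compact_space \<S>" by (rule compact_charge_space) unfold_locales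

lemma ev: "A \<in> M \<Longrightarrow> continuous_map \<S> euclideanreal (\<lambda>m. m A)"
  by (rule continuous_map_charge_eval)

lemma mix_charge:
  assumes a: "a \<in> \<C>" and b: "b \<in> \<C>" and t: "0 \<le> t" "t \<le> 1" shows "mix M t a b \<in> \<C>"
proof (rule chargesI)
  fix A assume A: "A \<in> M"
  have "t * a A + (1 - t) * b A \<le> t * 1 + (1 - t) * 1"
    using charge_range[OF a A] charge_range[OF b A] t by (intro add_mono mult_left_mono) auto
  then show "0 \<le> mix M t a b A \<and> mix M t a b A \<le> 1"
    using charge_range[OF a A] charge_range[OF b A] t A by (simp add: mix_def)
  fix B assume B: "B \<in> M" "A \<inter> B = {}"
  show "mix M t a b (A \<union> B) = mix M t a b A + mix M t a b B"
    using charge_add[OF a A B] charge_add[OF b A B] A B Un[OF A B(1)] by (simp add: mix_def algebra_simps)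
qed (use charge_total[OF a] charge_total[OF b] in \<open>auto simp: mix_def\<close>)

lemma mix_one: "a \<in> \<C> \<Longrightarrow> mix M 1 a b = a"
  by (auto simp: mix_def charges_def PiE_def extensional_def fun_eq_iff)

lemma mix_zero: "b \<in> \<C> \<Longrightarrow> mix M 0 a b = b"
  by (auto simp: mix_def charges_def PiE_def extensional_def fun_eq_iff)

lemma charge_nbhd:
  assumes U: "openin \<S> U" "c \<in> U"
  obtains F \<delta> where "finite F" "F \<subseteq> M" "\<delta> > 0"
    "\<And>m. m \<in> \<C> \<Longrightarrow> (\<And>A. A \<in> F \<Longrightarrow> \<bar>m A - c A\<bar> < \<delta>) \<Longrightarrow> m \<in> U"
proof -
  obtain V where V: "openin (product_topology (\<lambda>_. euclideanreal) M) V" "U = V \<inter> \<C>"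
    using U(1) unfolding charge_space_def openin_subtopology by auto
  have cV: "c \<in> V" using U V by auto
  obtain X where X: "c \<in> (\<Pi>\<^sub>E i\<in>M. X i)" "\<And>i. open (X i)" "finite {i. X i \<noteq> UNIV}" "(\<Pi>\<^sub>E i\<in>M. X i) \<subseteq> V"
    using product_topology_open_contains_basis[OF V(1) cV] by auto
  define F where "F = {i \<in> M. X i \<noteq> UNIV}"
  have F: "finite F" using X(3) by (rule rev_finite_subset) (auto simp: F_def)
  have "\<exists>d>0. \<forall>r. \<bar>r - c A\<bar> < d \<longrightarrow> r \<in> X A" if "A \<in> F" for A
  proof -
    have "c A \<in> X A" using X(1) that by (auto simp: F_def PiE_iff)
    then show ?thesis using X(2)[of A] unfolding open_dist by (auto simp: dist_real_def)
  qed
  then obtain d where d: "\<And>A. A \<in> F \<Longrightarrow> d A > 0" "\<And>A r. A \<in> F \<Longrightarrow> \<bar>r - c A\<bar> < d A \<Longrightarrow> r \<in> X A"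
    by metis
  define \<delta> where "\<delta> = Min (insert 1 (d ` F))"
  have "\<delta> > 0" using F d by (auto simp: \<delta>_def)
  moreover have "m \<in> U" if m: "m \<in> \<C>" "\<And>A. A \<in> F \<Longrightarrow> \<bar>m A - c A\<bar> < \<delta>" for m
  proof -
    have "m A \<in> X A" if A: "A \<in> M" for A
    proof (cases "A \<in> F")
      case True
      have "\<delta> \<le> d A" unfolding \<delta>_def using F True by (intro Min_le) auto
      then show ?thesis using d(2)[OF True, of "m A"] m(2)[OF True] by simp
    qed (use A in \<open>auto simp: F_def\<close>)
    then have "m \<in> (\<Pi>\<^sub>E i\<in>M. X i)" using m(1) by (auto simp: charges_def PiE_iff)
    then show ?thesis using X(4) V(2) m(1) by auto
  qed
  ultimately show thesis using that[of F \<delta>] F by (auto simp: F_def)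
qed

lemma closedin_subset_charges: "closedin \<S> D \<Longrightarrow> D \<subseteq> \<C>"
  using closedin_subset[of \<S> D] by simp

lemma closedin_join:
  assumes D: "closedin \<S> D" "closedin \<S> D'" and e: "0 \<le> e"
  shows "closedin \<S> (join M e D D')"
proof -
  let ?T = "prod_topology (top_of_set {e..1}) (prod_topology (subtopology \<S> D) (subtopology \<S> D'))"
  have sub: "D \<subseteq> \<C>" "D' \<subseteq> \<C>" using D closedin_subset_charges by auto
  have top: "topspace ?T = {e..1} \<times> D \<times> D'" using sub by auto
  let ?f = "\<lambda>p. mix M (fst p) (fst (snd p)) (snd (snd p))"
  have cc: "compact_space ?T"
    using D closedin_compact_space[OF compact] by (simp add: compact_space_prod_topology compact_space_subtopology)
  have "continuous_map ?T \<S> ?f"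
  proof (rule continuous_map_into_charge_space)
    fix z assume "z \<in> topspace ?T"
    then show "?f z \<in> \<C>" unfolding top using sub e by (intro mix_charge) auto
  next
    fix A assume A: "A \<in> M"
    have 1: "continuous_map ?T euclideanreal fst"
      using continuous_map_fst[of "top_of_set {e..1}" "prod_topology (subtopology \<S> D) (subtopology \<S> D')"]
      by (simp add: continuous_map_in_subtopology)
    have 2: "continuous_map ?T euclideanreal (\<lambda>p. fst (snd p) A)"
      using continuous_map_compose[OF continuous_map_snd
          continuous_map_compose[OF continuous_map_fst continuous_map_from_subtopology[OF ev[OF A]]],
          of "top_of_set {e..1}" D "subtopology \<S> D'"] by (simp add: o_def)
    have 3: "continuous_map ?T euclideanreal (\<lambda>p. snd (snd p) A)"
      using continuous_map_compose[OF continuous_map_snd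
          continuous_map_compose[OF continuous_map_snd continuous_map_from_subtopology[OF ev[OF A]]],
          of "top_of_set {e..1}" "subtopology \<S> D" D'] by (simp add: o_def)
    have "continuous_map ?T euclideanreal (\<lambda>p. fst p * fst (snd p) A + (1 - fst p) * snd (snd p) A)"
      by (intro continuous_map_add continuous_map_real_mult continuous_map_diff 1 2 3) auto
    then show "continuous_map ?T euclideanreal (\<lambda>z. ?f z A)" using A by (simp add: mix_def)
  qed
  then have "compactin \<S> (?f ` topspace ?T)" using image_compactin cc unfolding compact_space_def by blast
  moreover have "?f ` topspace ?T = join M e D D'"
    unfolding top join_def by (force simp: image_iff)
  ultimately show ?thesis using compactin_imp_closedin[OF Hausdorff_charge_space] by simp
qed

text \<open>In a combination of two members of the join, the parts from \<open>D\<close> are collected into one point of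
  \<open>D\<close>, with weight \<open>r\<close>, and the parts from \<open>D'\<close> into one point of \<open>D'\<close>.\<close>

lemma cvx_join:
  assumes D: "cvx M D" "cvx M D'" "D \<subseteq> \<C>" "D' \<subseteq> \<C>" and e: "0 \<le> e"
  shows "cvx M (join M e D D')"
  unfolding cvx_def
proof (intro ballI)
  fix a b l assume "a \<in> join M e D D'" "b \<in> join M e D D'" and l: "l \<in> {0..1::real}"
  then obtain t d d' s f f' where a: "a = mix M t d d'" "t \<in> {e..1}" "d \<in> D" "d' \<in> D'"
    and b: "b = mix M s f f'" "s \<in> {e..1}" "f \<in> D" "f' \<in> D'" unfolding join_def by blast
  define r where "r = l * t + (1 - l) * s"
  have bds: "0 \<le> l" "l \<le> 1" "e \<le> t" "t \<le> 1" "e \<le> s" "s \<le> 1" using l a b by auto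
  have "l * e + (1 - l) * e \<le> r" unfolding r_def using bds by (intro add_mono mult_left_mono) auto
  then have r1: "e \<le> r" by (simp add: algebra_simps)
  have "r \<le> l * 1 + (1 - l) * 1" unfolding r_def using bds by (intro add_mono mult_left_mono) auto
  then have r2: "r \<le> 1" by simp
  have aux: "\<exists>q\<in>E. \<forall>A\<in>M. w * q A = u * x A + v * y A"
    if "cvx M E" "x \<in> E" "y \<in> E" "0 \<le> u" "0 \<le> v" "w = u + v" for E x y u v w
  proof (cases "w = 0")
    case True
    then have "u = 0" "v = 0" using that by auto
    then show ?thesis using that(2) by (auto simp: True)
  next
    case False
    then have w: "w > 0" using that by auto
    have "u / w \<in> {0..1}" using that w by (auto simp: field_simps)
    then have "mix M (u / w) x y \<in> E" using that by (auto simp: cvx_def)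
    moreover have "w * mix M (u / w) x y A = u * x A + v * y A" if "A \<in> M" for A
    proof -
      have "w * mix M (u / w) x y A = (w * (u / w)) * x A + (w - w * (u / w)) * y A"
        using that by (simp add: mix_def algebra_simps)
      also have "w * (u / w) = u" using w by simp
      finally show ?thesis using \<open>w = u + v\<close> by simp
    qed
    ultimately show ?thesis by blast
  qed
  obtain q where q: "q \<in> D" "\<And>A. A \<in> M \<Longrightarrow> r * q A = (l * t) * d A + ((1 - l) * s) * f A"
    using aux[OF D(1) a(3) b(3), of "l * t" "(1 - l) * s" r] bds e by (auto simp: r_def)
  obtain q' where q': "q' \<in> D'" "\<And>A. A \<in> M \<Longrightarrow> (1 - r) * q' A = (l * (1 - t)) * d' A + ((1 - l) * (1 - s)) * f' A"
  proof -
    have 1: "0 \<le> l * (1 - t)" "0 \<le> (1 - l) * (1 - s)" using bds by auto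
    have 2: "1 - r = l * (1 - t) + (1 - l) * (1 - s)" by (simp add: r_def algebra_simps)
    from aux[OF D(2) a(4) b(4) 1 2] show thesis using that by metis
  qed
  have "mix M l a b = mix M r q q'"
  proof
    fix A show "mix M l a b A = mix M r q q' A"
    proof (cases "A \<in> M")
      case True
      then have "mix M r q q' A = (l * t) * d A + ((1 - l) * s) * f A + ((l * (1 - t)) * d' A + ((1 - l) * (1 - s)) * f' A)"
        using q(2) q'(2) by (simp add: mix_def)
      also have "\<dots> = mix M l a b A" using True by (simp add: a(1) b(1) mix_def algebra_simps)
      finally show ?thesis by simp
    qed (simp add: mix_def)
  qed
  then show "mix M l a b \<in> join M e D D'" using q(1) q'(1) r1 r2 unfolding join_def by auto
qed

lemma extreme_notin_join:
  assumes c: "extreme M C c" and D: "D \<subseteq> C" "D' \<subseteq> C" and C: "C \<subseteq> \<C>"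
    and n: "c \<notin> D" "e > 0 \<or> c \<notin> D'" and e: "0 \<le> e"
  shows "c \<notin> join M e D D'"
proof
  assume "c \<in> join M e D D'"
  then obtain t d d' where t: "c = mix M t d d'" "t \<in> {e..1}" "d \<in> D" "d' \<in> D'"
    unfolding join_def by blast
  consider "t = 1" | "t = 0" | "t \<in> {0<..<1}" using t(2) e by fastforce
  then show False
  proof cases
    case 1 then show False using t n(1) D C mix_one[of d d'] by auto
  next
    case 2 then show False using t n(2) D C mix_zero[of d' d] by auto
  next
    case 3
    have "d \<in> C" "d' \<in> C" using t D by auto
    then have "d = c" using c[unfolded extreme_def, THEN conjunct2] t(1) 3 by metis
    then show False using t(3) n(1) by simp
  qed
qed

text \<open>Plays the role of Milman's converse to the Krein--Milman theorem. Outside a basic neighbourhood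
  of \<open>c\<close>, a member of \<open>C\<close> lies in one of finitely many half-space slices, none of which contains
  \<open>c\<close>. Joining these closed convex slices two by two never produces the extreme point \<open>c\<close>.\<close>

lemma extreme_separated:
  assumes C: "closedin \<S> C" "cvx M C" and c: "extreme M C c" and U: "openin \<S> U" "c \<in> U"
  obtains D where "closedin \<S> D" "cvx M D" "D \<subseteq> C" "C - U \<subseteq> D" "c \<notin> D"
proof -
  have CC: "C \<subseteq> \<C>" by (rule closedin_subset_charges[OF C(1)])
  obtain F \<delta> where F: "finite F" "F \<subseteq> M" "\<delta> > 0"
    "\<And>m. m \<in> \<C> \<Longrightarrow> (\<And>A. A \<in> F \<Longrightarrow> \<bar>m A - c A\<bar> < \<delta>) \<Longrightarrow> m \<in> U"
    using charge_nbhd[OF U] by metis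
  define good where "good D \<longleftrightarrow> closedin \<S> D \<and> cvx M D \<and> D \<subseteq> C \<and> c \<notin> D" for D
  have jn: "\<exists>E. good E \<and> D \<union> D' \<subseteq> E" if g: "good D" "good D'" for D D'
  proof (cases "D = {} \<or> D' = {}")
    case False
    then obtain x x' where x: "x \<in> D" "x' \<in> D'" by auto
    have sub: "D \<subseteq> \<C>" "D' \<subseteq> \<C>" using g CC by (auto simp: good_def)
    have "join M 0 D D' \<subseteq> C"
    proof
      fix m assume "m \<in> join M 0 D D'"
      then obtain t d d' where m: "m = mix M t d d'" "t \<in> {0..1}" "d \<in> D" "d' \<in> D'"
        unfolding join_def by blast
      have "d \<in> C" "d' \<in> C" using m g unfolding good_def by blast+
      then show "m \<in> C" using C(2) m(1,2) unfolding cvx_def by blast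
    qed
    moreover have "closedin \<S> (join M 0 D D')" "cvx M (join M 0 D D')" "c \<notin> join M 0 D D'"
      using g sub closedin_join cvx_join extreme_notin_join[OF c _ _ CC, of D D' 0] by (auto simp: good_def)
    moreover have "D \<subseteq> join M 0 D D'"
    proof
      fix d assume d: "d \<in> D"
      have "d = mix M 1 d x'" using mix_one[of d x'] d sub by auto
      then show "d \<in> join M 0 D D'" using d x unfolding join_def by force
    qed
    moreover have "D' \<subseteq> join M 0 D D'"
    proof
      fix d assume d: "d \<in> D'"
      have "d = mix M 0 x d" using mix_zero[of d x] d sub by auto
      then show "d \<in> join M 0 D D'" using d x unfolding join_def by force
    qed
    ultimately show ?thesis unfolding good_def by blast
  qed (use g in auto)
  have half: "good {m \<in> C. c A + \<delta> \<le> m A}" "good {m \<in> C. m A \<le> c A - \<delta>}" if A: "A \<in> M" for A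
  proof -
    have "closedin \<S> (C \<inter> {m \<in> topspace \<S>. c A + \<delta> \<le> m A})" "closedin \<S> (C \<inter> {m \<in> topspace \<S>. m A \<le> c A - \<delta>})"
      by (intro closedin_Int C(1) closedin_eval_le ev A; simp)+
    moreover have "C \<inter> {m \<in> topspace \<S>. c A + \<delta> \<le> m A} = {m \<in> C. c A + \<delta> \<le> m A}"
      "C \<inter> {m \<in> topspace \<S>. m A \<le> c A - \<delta>} = {m \<in> C. m A \<le> c A - \<delta>}" using CC by auto
    moreover have "cvx M {m \<in> C. k \<le> m A}" for k
      unfolding cvx_def
    proof (intro ballI)
      fix a b t assume ab: "a \<in> {m \<in> C. k \<le> m A}" "b \<in> {m \<in> C. k \<le> m A}" and t: "t \<in> {0..1::real}"
      have "t * k + (1 - t) * k \<le> t * a A + (1 - t) * b A" using ab t by (intro add_mono mult_left_mono) auto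
      then have "k \<le> mix M t a b A" using A by (simp add: mix_def algebra_simps)
      then show "mix M t a b \<in> {m \<in> C. k \<le> m A}" using C(2) ab t by (auto simp: cvx_def)
    qed
    moreover have "cvx M {m \<in> C. m A \<le> k}" for k
      unfolding cvx_def
    proof (intro ballI)
      fix a b t assume ab: "a \<in> {m \<in> C. m A \<le> k}" "b \<in> {m \<in> C. m A \<le> k}" and t: "t \<in> {0..1::real}"
      have "t * a A + (1 - t) * b A \<le> t * k + (1 - t) * k" using ab t by (intro add_mono mult_left_mono) auto
      then have "mix M t a b A \<le> k" using A by (simp add: mix_def algebra_simps)
      then show "mix M t a b \<in> {m \<in> C. m A \<le> k}" using C(2) ab t by (auto simp: cvx_def)
    qed
    ultimately show "good {m \<in> C. c A + \<delta> \<le> m A}" "good {m \<in> C. m A \<le> c A - \<delta>}"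
      using F(3) by (auto simp: good_def)
  qed
  have "\<exists>D. good D \<and> (\<forall>m\<in>C. \<forall>A\<in>F'. \<delta> \<le> \<bar>m A - c A\<bar> \<longrightarrow> m \<in> D)" if "finite F'" "F' \<subseteq> M" for F'
    using that
  proof (induction F' rule: finite_induct)
    case empty
    have "good {}" by (simp add: good_def cvx_def)
    then show ?case by blast
  next
    case (insert A F')
    then obtain D where D: "good D" "\<forall>m\<in>C. \<forall>A\<in>F'. \<delta> \<le> \<bar>m A - c A\<bar> \<longrightarrow> m \<in> D" by auto
    have A: "A \<in> M" using insert.prems by auto
    obtain E where E: "good E" "D \<union> {m \<in> C. c A + \<delta> \<le> m A} \<subseteq> E" using jn[OF D(1) half(1)[OF A]] by auto
    obtain E' where E': "good E'" "E \<union> {m \<in> C. m A \<le> c A - \<delta>} \<subseteq> E'" using jn[OF E(1) half(2)[OF A]] by auto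
    have "m \<in> E'" if m: "m \<in> C" "B \<in> insert A F'" "\<delta> \<le> \<bar>m B - c B\<bar>" for m B
    proof (cases "B = A")
      case True
      have "\<delta> \<le> \<bar>m A - c A\<bar>" using m(3) unfolding True .
      then have "c A + \<delta> \<le> m A \<or> m A \<le> c A - \<delta>" by arith
      then show ?thesis using m(1) E E' by auto
    next
      case False
      then show ?thesis using D(2) m E(2) E'(2) by auto
    qed
    then show ?case using E'(1) by blast
  qed
  from this[OF F(1,2)] obtain D where D: "good D" "\<forall>m\<in>C. \<forall>A\<in>F. \<delta> \<le> \<bar>m A - c A\<bar> \<longrightarrow> m \<in> D" by auto
  have "C - U \<subseteq> D"
  proof
    fix m assume m: "m \<in> C - U"
    then have "\<not> (\<forall>A\<in>F. \<bar>m A - c A\<bar> < \<delta>)" using F(4)[of m] CC by auto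
    then show "m \<in> D" using D(2) m by (auto simp: not_less)
  qed
  then show thesis using that D(1) by (auto simp: good_def)
qed

text \<open>A minimal closed face is a single charge, since the points where the evaluation at a given set
  attains its maximum on the face form a smaller closed face.\<close>

lemma extreme_exists:
  assumes C: "closedin \<S> C" "C \<noteq> {}"
  obtains c where "extreme M C c"
proof -
  have CC: "C \<subseteq> \<C>" by (rule closedin_subset_charges[OF C(1)])
  define P where "P F \<longleftrightarrow> (\<forall>a\<in>C. \<forall>b\<in>C. \<forall>t\<in>{0<..<1}. mix M t a b \<in> F \<longrightarrow> a \<in> F \<and> b \<in> F)" for F
  have PC: "P C" by (auto simp: P_def)
  have Pch: "P (\<Inter>\<F>)" if "\<F> \<noteq> {}" "\<forall>F\<in>\<F>. closedin \<S> F \<and> P F" for \<F>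
    using that(2) unfolding P_def by (meson InterE InterI)
  from minimal_closed_subset[OF compact C PC Pch] obtain F where F: "F \<subseteq> C" "closedin \<S> F" "F \<noteq> {}" "P F"
    and Fmin: "\<And>F'. F' \<subseteq> F \<Longrightarrow> closedin \<S> F' \<Longrightarrow> F' \<noteq> {} \<Longrightarrow> P F' \<Longrightarrow> F' = F"
    by metis
  obtain c where c: "c \<in> F" using F(3) by blast
  have eq: "m A = c A" if m: "m \<in> F" and A: "A \<in> M" for m A
  proof -
    have "compact ((\<lambda>m. m A) ` F)"
      using image_compactin[OF closedin_compact_space[OF compact F(2)] ev[OF A]] by simp
    then obtain p where p: "p \<in> F" "\<And>q. q \<in> F \<Longrightarrow> q A \<le> p A"
      using compact_attains_sup[of "(\<lambda>m. m A) ` F"] F(3) by auto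
    have c1: "closedin \<S> (F \<inter> {q \<in> topspace \<S>. p A \<le> q A})"
      by (intro closedin_Int F(2) closedin_eval_le ev A) simp
    have c2: "P (F \<inter> {q \<in> topspace \<S>. p A \<le> q A})" unfolding P_def
    proof (intro ballI impI)
      fix a b t assume ab: "a \<in> C" "b \<in> C" and t: "t \<in> {0<..<1::real}"
        and mx: "mix M t a b \<in> F \<inter> {q \<in> topspace \<S>. p A \<le> q A}"
      have abF: "a \<in> F" "b \<in> F" using F(4) ab t mx unfolding P_def by blast+
      have "p A \<le> t * a A + (1 - t) * b A" using mx A by (simp add: mix_def)
      moreover have "t * a A \<le> t * p A" "(1 - t) * b A \<le> (1 - t) * p A"
        using p(2)[OF abF(1)] p(2)[OF abF(2)] t by auto
      ultimately have "t * p A \<le> t * a A" "(1 - t) * p A \<le> (1 - t) * b A" by (auto simp: algebra_simps)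
      then have "p A \<le> a A" "p A \<le> b A" using t by auto
      then show "a \<in> F \<inter> {q \<in> topspace \<S>. p A \<le> q A} \<and> b \<in> F \<inter> {q \<in> topspace \<S>. p A \<le> q A}"
        using abF F(1) CC by auto
    qed
    have "p \<in> F \<inter> {q \<in> topspace \<S>. p A \<le> q A}" using p(1) F(1) CC by auto
    then have "F \<inter> {q \<in> topspace \<S>. p A \<le> q A} \<noteq> {}" by blast
    from Fmin[OF Int_lower1 c1 this c2] have "F \<inter> {q \<in> topspace \<S>. p A \<le> q A} = F" .
    then have "p A \<le> m A" "p A \<le> c A" using m c by auto
    then show ?thesis using p(2)[OF m] p(2)[OF c] by simp
  qed
  have sing: "m = c" if "m \<in> F" for m
    by (rule charges_eqI[of _ \<Omega> M]) (use that c F(1) CC eq in auto)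
  have "extreme M C c" unfolding extreme_def
  proof (intro conjI ballI impI)
    show "c \<in> C" using c F(1) by auto
    fix a b t assume "a \<in> C" "b \<in> C" "t \<in> {0<..<1::real}" "c = mix M t a b"
    then have "a \<in> F" "b \<in> F" using F(4) c unfolding P_def by blast+
    then show "a = c" "b = c" using sing by auto
  qed
  then show thesis by (rule that)
qed

lemma convex_combination:
  assumes D: "cvx M D" "D \<subseteq> \<C>" and J: "finite J" "\<And>j. j \<in> J \<Longrightarrow> 0 \<le> w j" "(\<Sum>j\<in>J. w j) = 1"
    "\<And>j. j \<in> J \<Longrightarrow> y j \<in> D"
  shows "(\<lambda>A\<in>M. \<Sum>j\<in>J. w j * y j A) \<in> D"
proof -
  have "\<exists>d\<in>D. \<forall>A\<in>M. (\<Sum>j\<in>J. w j) * d A = (\<Sum>j\<in>J. w j * y j A)"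
    if "J \<noteq> {}"
    using J(1) that J(2,4)
  proof (induction J rule: finite_ne_induct)
    case (singleton j)
    then show ?case by auto
  next
    case (insert j J)
    then obtain d where d: "d \<in> D" "\<forall>A\<in>M. (\<Sum>j\<in>J. w j) * d A = (\<Sum>j\<in>J. w j * y j A)" by auto
    let ?s = "\<Sum>i\<in>J. w i"
    have s: "0 \<le> ?s" "0 \<le> w j" using insert.prems by (auto intro: sum_nonneg)
    show ?case
    proof (cases "w j + ?s = 0")
      case True
      then have "w j = 0" "?s = 0" using s by auto
      then show ?thesis using d insert.hyps by auto
    next
      case False
      then have p: "w j + ?s > 0" using s by auto
      define t where "t = w j / (w j + ?s)"
      have t: "t \<in> {0..1}" using s p by (auto simp: t_def field_simps)
      have "mix M t (y j) d \<in> D" using D(1) d(1) insert.prems(2)[of j] t by (auto simp: cvx_def)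
      moreover have "(w j + ?s) * mix M t (y j) d A = w j * y j A + ?s * d A" if "A \<in> M" for A
      proof -
        have tt: "(w j + ?s) * t = w j" using p by (simp add: t_def)
        have "(w j + ?s) * mix M t (y j) d A = ((w j + ?s) * t) * y j A + ((w j + ?s) - (w j + ?s) * t) * d A"
          using that by (simp add: mix_def algebra_simps)
        then show ?thesis unfolding tt by simp
      qed
      ultimately show ?thesis using d(2) insert.hyps by (intro bexI[of _ "mix M t (y j) d"]) auto
    qed
  qed
  moreover have "J \<noteq> {}" using J(3) by auto
  ultimately obtain d where d: "d \<in> D" "\<forall>A\<in>M. d A = (\<Sum>j\<in>J. w j * y j A)" using J(3) by auto
  have "d \<in> extensional M" using d(1) D(2) by (auto simp: charges_def PiE_def)
  then have "(\<lambda>A\<in>M. \<Sum>j\<in>J. w j * y j A) = d" using d(2) by (auto simp: extensional_def fun_eq_iff)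
  then show ?thesis using d(1) by simp
qed

end


section \<open>A boundary consisting of means\<close>

lemma (in flow) strongly_proximalI:
  assumes "\<And>\<mu>. \<mu> \<in> Prob X \<Longrightarrow> contracts G X \<phi> (measure \<mu>)"
  shows "strongly_proximal G X \<phi>"
  unfolding strongly_proximal_def using Dirac_limit_if_contracts assms by blast

context charge_algebra begin

lemma evaluation_measurable:
  assumes "\<mu> \<in> Prob (subtopology \<S> Z)" "A \<in> M" shows "(\<lambda>y. y A) \<in> borel_measurable \<mu>"
  by (rule borel_measurable_continuous[OF continuous_map_from_subtopology[OF ev[OF assms(2)]] assms(1)])

text \<open>For a basic neighbourhood of the barycenter, which tests finitely many sets, cut \<open>S\<close> into
  finitely many pieces on which all tested values vary by at most \<open>1/n\<close>. Choosing one charge per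
  piece and weighting it by the measure of the piece gives a finite convex combination, a member
  of \<open>D\<close>, in that neighbourhood.\<close>

lemma barycenter_in_convex:
  assumes Z: "Z \<subseteq> \<C>" and \<mu>: "\<mu> \<in> Prob (subtopology \<S> Z)"
    and D: "closedin \<S> D" "cvx M D" and S: "S \<in> sets \<mu>" "S \<subseteq> D" and p: "measure \<mu> S > 0"
  shows "(\<lambda>A\<in>M. (\<integral>y. indicator S y * y A \<partial>\<mu>) / measure \<mu> S) \<in> D"
proof -
  interpret prob_space \<mu> by (rule ProbD(1)[OF \<mu>])
  have sp: "space \<mu> = Z" using ProbD(3)[OF \<mu>] Z by auto
  have SZ: "S \<subseteq> Z" using sets.sets_into_space[OF S(1)] sp by simp
  have DC: "D \<subseteq> \<C>" by (rule closedin_subset_charges[OF D(1)])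
  note meas = evaluation_measurable[OF \<mu>]
  have y01: "0 \<le> y A \<and> y A \<le> 1" if "y \<in> Z" "A \<in> M" for y A
    using charge_range[of y \<Omega> M A] that Z by auto
  have iS: "integrable \<mu> (indicator S :: _ \<Rightarrow> real)" using S by (simp add: integrable_indicator_iff emeasure_eq_measure)
  have intS: "(\<integral>y. indicator S y \<partial>\<mu>) = measure \<mu> S" using S by (simp add: Int_absorb1 sets.sets_into_space)
  have int: "integrable \<mu> (\<lambda>y. indicator S y * y A)" if A: "A \<in> M" for A
  proof (rule integrable_const_bound[where B = 1])
    show "AE y in \<mu>. norm (indicator S y * y A) \<le> 1"
      using y01[OF _ A] sp by (intro AE_I2) (auto simp: indicator_def)
    show "(\<lambda>y. indicator S y * y A) \<in> borel_measurable \<mu>"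
      using meas[OF A] S(1) by (intro borel_measurable_times borel_measurable_indicator)
  qed
  define p where "p = measure \<mu> S"
  have p0: "p > 0" using p by (simp add: p_def)
  define b where "b = (\<lambda>A\<in>M. (\<integral>y. indicator S y * y A \<partial>\<mu>) / p)"
  have b: "b \<in> \<C>"
  proof (rule chargesI)
    fix A assume A: "A \<in> M"
    have "0 \<le> (\<integral>y. indicator S y * y A \<partial>\<mu>)"
      by (rule Bochner_Integration.integral_nonneg_AE, rule AE_I2) (use y01[OF _ A] sp in \<open>auto simp: indicator_def\<close>)
    moreover have "(\<integral>y. indicator S y * y A \<partial>\<mu>) \<le> (\<integral>y. indicator S y \<partial>\<mu>)"
      by (rule integral_mono[OF int[OF A] iS]) (use y01[OF _ A] sp in \<open>auto simp: indicator_def\<close>)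
    ultimately show "0 \<le> b A \<and> b A \<le> 1" using A p0 intS by (simp add: b_def p_def)
    fix B assume B: "B \<in> M" "A \<inter> B = {}"
    have "(\<integral>y. indicator S y * y (A \<union> B) \<partial>\<mu>) = (\<integral>y. indicator S y * y A + indicator S y * y B \<partial>\<mu>)"
    proof (rule Bochner_Integration.integral_cong)
      fix y assume "y \<in> space \<mu>"
      then have yC: "y \<in> \<C>" using sp Z by auto
      then show "indicator S y * y (A \<union> B) = indicator S y * y A + indicator S y * y B"
        using charge_add[OF yC A B] by (simp add: algebra_simps)
    qed simp
    also have "\<dots> = (\<integral>y. indicator S y * y A \<partial>\<mu>) + (\<integral>y. indicator S y * y B \<partial>\<mu>)"
      by (rule Bochner_Integration.integral_add[OF int[OF A] int[OF B(1)]])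
    finally show "b (A \<union> B) = b A + b B" using A B Un[OF A B(1)] by (simp add: b_def add_divide_distrib)
  next
    have "(\<integral>y. indicator S y * y \<Omega> \<partial>\<mu>) = (\<integral>y. indicator S y \<partial>\<mu>)"
      by (rule Bochner_Integration.integral_cong) (use sp Z charge_total in auto)
    then show "b \<Omega> = 1" using p0 intS by (simp add: b_def p_def)
  qed (simp add: b_def)
  have "b \<in> D"
  proof (rule ccontr)
    assume "b \<notin> D"
    then have "openin \<S> (topspace \<S> - D)" "b \<in> topspace \<S> - D"
      using openin_diff[OF openin_topspace D(1)] b by auto
    from charge_nbhd[OF this] obtain F \<delta> where F: "finite F" "F \<subseteq> M" "\<delta> > 0"
      "\<And>m. m \<in> \<C> \<Longrightarrow> (\<And>A. A \<in> F \<Longrightarrow> \<bar>m A - b A\<bar> < \<delta>) \<Longrightarrow> m \<in> topspace \<S> - D" by metis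
    obtain k where k: "1 / real (Suc k) < \<delta>" using nat_approx_posE[OF F(3)] by metis
    define n where "n = real (Suc k)"
    have n: "n > 0" "1 / n < \<delta>" using k by (auto simp: n_def)
    define t where "t y = (\<lambda>A\<in>F. \<lfloor>n * y A\<rfloor>)" for y :: "'x set \<Rightarrow> real"
    define W where "W = t ` S"
    have "W \<subseteq> F \<rightarrow>\<^sub>E {0..int (Suc k)}"
    proof
      fix w assume "w \<in> W"
      then obtain y where y: "y \<in> S" "w = t y" by (auto simp: W_def)
      have "\<lfloor>n * y A\<rfloor> \<in> {0..int (Suc k)}" if "A \<in> F" for A
      proof -
        have "0 \<le> y A" "y A \<le> 1" using y01[of y A] y SZ that F(2) by auto
        then have "0 \<le> n * y A" "n * y A \<le> n * 1" using n by (auto intro!: mult_left_mono)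
        then have "0 \<le> \<lfloor>n * y A\<rfloor>" "\<lfloor>n * y A\<rfloor> \<le> \<lfloor>n\<rfloor>" using floor_mono[of "n * y A" n] by auto
        moreover have "\<lfloor>n\<rfloor> = int (Suc k)" unfolding n_def by (rule floor_of_nat)
        ultimately show ?thesis by simp
      qed
      then show "w \<in> F \<rightarrow>\<^sub>E {0..int (Suc k)}" unfolding y(2) t_def by auto
    qed
    then have Wf: "finite W" by (rule finite_subset) (use F in \<open>auto intro: finite_PiE\<close>)
    define P where "P w = {y \<in> S. t y = w}" for w
    have Pm: "P w \<in> sets \<mu>" if "w \<in> W" for w
    proof -
      have ext: "w \<in> extensional F" using that by (auto simp: W_def t_def)
      have "{y \<in> space \<mu>. \<forall>A\<in>F. \<lfloor>n * y A\<rfloor> = w A} \<in> sets \<mu>"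
      proof (rule sets.sets_Collect_finite_All[OF _ F(1)])
        fix A assume "A \<in> F"
        then have mA[measurable]: "(\<lambda>y. y A) \<in> borel_measurable \<mu>" using meas F(2) by auto
        have "{y \<in> space \<mu>. \<lfloor>n * y A\<rfloor> = w A} = {y \<in> space \<mu>. of_int (w A) \<le> n * y A \<and> n * y A < of_int (w A) + 1}"
          by (auto simp: floor_eq_iff)
        also have "\<dots> \<in> sets \<mu>" by measurable
        finally show "{y \<in> space \<mu>. \<lfloor>n * y A\<rfloor> = w A} \<in> sets \<mu>" .
      qed
      then have "S \<inter> {y \<in> space \<mu>. \<forall>A\<in>F. \<lfloor>n * y A\<rfloor> = w A} \<in> sets \<mu>" using S(1) by auto
      moreover have "S \<inter> {y \<in> space \<mu>. \<forall>A\<in>F. \<lfloor>n * y A\<rfloor> = w A} = P w"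
        using SZ sp ext by (auto simp: P_def t_def fun_eq_iff extensional_def)
      ultimately show ?thesis by simp
    qed
    have "\<forall>w\<in>W. \<exists>y. y \<in> S \<and> t y = w" by (auto simp: W_def)
    then obtain y0 where y0: "\<And>w. w \<in> W \<Longrightarrow> y0 w \<in> S \<and> t (y0 w) = w" by metis
    have SP: "S = (\<Union>w\<in>W. P w)" by (auto simp: P_def W_def)
    have sumP: "(\<Sum>w\<in>W. measure \<mu> (P w)) = p"
      unfolding p_def SP by (rule finite_measure_finite_Union[symmetric])
        (use Wf Pm in \<open>auto simp: disjoint_family_on_def P_def\<close>)
    define d where "d = (\<lambda>A\<in>M. \<Sum>w\<in>W. (measure \<mu> (P w) / p) * y0 w A)"
    have dD: "d \<in> D" unfolding d_def
    proof (rule convex_combination[OF D(2) DC Wf])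
      show "(\<Sum>w\<in>W. measure \<mu> (P w) / p) = 1" using sumP p0 by (simp add: sum_divide_distrib[symmetric])
    qed (use p0 y0 S(2) in auto)
    have "\<bar>d A - b A\<bar> < \<delta>" if AF: "A \<in> F" for A
    proof -
      have A: "A \<in> M" using AF F(2) by auto
      have iP: "integrable \<mu> (\<lambda>y. indicator (P w) y * y0 w A)" if "w \<in> W" for w
        using Pm[OF that] by (simp add: integrable_indicator_iff emeasure_eq_measure)
      have val: "(\<Sum>w\<in>W. indicator (P w) y * y0 w A) = (if y \<in> S then y0 (t y) A else 0)" for y
      proof (cases "y \<in> S")
        case True
        have "(\<Sum>w\<in>W. indicator (P w) y * y0 w A) = (\<Sum>w\<in>W. if w = t y then y0 w A else 0)"
          using True by (intro sum.cong) (auto simp: P_def indicator_def)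
        also have "\<dots> = y0 (t y) A" using Wf True by (simp add: W_def)
        finally show ?thesis using True by simp
      qed (auto simp: P_def)
      have "(\<integral>y. (\<Sum>w\<in>W. indicator (P w) y * y0 w A) \<partial>\<mu>) = (\<Sum>w\<in>W. measure \<mu> (P w) * y0 w A)"
        using iP Pm by (subst Bochner_Integration.integral_sum) (auto simp: Int_absorb1 sets.sets_into_space)
      moreover have "(\<Sum>w\<in>W. measure \<mu> (P w) * y0 w A) = p * d A"
        using p0 A by (simp add: d_def sum_distrib_left)
      ultimately have e1: "p * d A = (\<integral>y. (\<Sum>w\<in>W. indicator (P w) y * y0 w A) \<partial>\<mu>)" by simp
      have e2: "p * b A = (\<integral>y. indicator S y * y A \<partial>\<mu>)" using p0 A by (simp add: b_def)
      have isum: "integrable \<mu> (\<lambda>y. \<Sum>w\<in>W. indicator (P w) y * y0 w A)"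
        using iP by (intro Bochner_Integration.integrable_sum) auto
      have "p * \<bar>d A - b A\<bar> = \<bar>p * d A - p * b A\<bar>" using p0 by (simp add: abs_mult right_diff_distrib[symmetric])
      also have "\<dots> = \<bar>\<integral>y. (\<Sum>w\<in>W. indicator (P w) y * y0 w A) - indicator S y * y A \<partial>\<mu>\<bar>"
        unfolding e1 e2 by (simp add: Bochner_Integration.integral_diff[OF isum int[OF A]])
      also have "\<dots> \<le> (\<integral>y. \<bar>(\<Sum>w\<in>W. indicator (P w) y * y0 w A) - indicator S y * y A\<bar> \<partial>\<mu>)"
        using integral_norm_bound[of \<mu> "\<lambda>y. (\<Sum>w\<in>W. indicator (P w) y * y0 w A) - indicator S y * y A"] by simp
      also have "\<dots> \<le> (\<integral>y. indicator S y * (1 / n) \<partial>\<mu>)"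
      proof (rule integral_mono)
        fix y assume "y \<in> space \<mu>"
        show "\<bar>(\<Sum>w\<in>W. indicator (P w) y * y0 w A) - indicator S y * y A\<bar> \<le> indicator S y * (1 / n)"
        proof (cases "y \<in> S")
          case True
          then have "t (y0 (t y)) = t y" using y0 by (auto simp: W_def)
          then have "t (y0 (t y)) A = t y A" by simp
          then have fl: "\<lfloor>n * y0 (t y) A\<rfloor> = \<lfloor>n * y A\<rfloor>" using AF by (simp add: t_def)
          have "\<bar>n * y0 (t y) A - n * y A\<bar> \<le> 1" using fl by linarith
          then have "n * \<bar>y0 (t y) A - y A\<bar> \<le> 1" using n by (simp add: abs_mult right_diff_distrib[symmetric])
          then have "\<bar>y0 (t y) A - y A\<bar> \<le> 1 / n" using n by (simp add: field_simps)
          then show ?thesis unfolding val using True by simp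
        qed (simp add: val)
      next
        show "integrable \<mu> (\<lambda>y. \<bar>(\<Sum>w\<in>W. indicator (P w) y * y0 w A) - indicator S y * y A\<bar>)"
          using Bochner_Integration.integrable_diff[OF isum int[OF A]] by (rule integrable_abs)
        show "integrable \<mu> (\<lambda>y. indicator S y * (1 / n))" using iS by (rule integrable_mult_left)
      qed
      also have "\<dots> = p * (1 / n)" using intS by (simp add: p_def)
      finally have "\<bar>d A - b A\<bar> \<le> 1 / n" by (rule mult_left_le_imp_le[OF _ p0])
      then show ?thesis using n by simp
    qed
    then have "d \<in> topspace \<S> - D" using F(4)[of d] dD DC by blast
    then show False using dD by simp
  qed
  then show ?thesis by (simp add: b_def p_def)
qed

definition barycenter :: "('x set \<Rightarrow> real) measure \<Rightarrow> 'x set \<Rightarrow> real" where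
  "barycenter \<mu> = (\<lambda>A\<in>M. (\<integral>y. y A \<partial>\<mu>))"

text \<open>The barycenter splits as a combination of the conditional barycenters over \<open>Z - U\<close>, which lies
  in \<open>D\<close>, and over \<open>U\<close>. The weight of the former is at least \<open>e\<close>.\<close>

lemma barycenter_in_join:
  assumes C: "closedin \<S> C" "cvx M C" and Z: "Z \<subseteq> C" and \<mu>: "\<mu> \<in> Prob (subtopology \<S> Z)"
    and D: "closedin \<S> D" "cvx M D" "D \<subseteq> C" "Z - U \<subseteq> D" and U: "U \<in> sets \<mu>"
    and e: "0 < e" "measure \<mu> U \<le> 1 - e"
  shows "barycenter \<mu> \<in> join M e D C"
proof -
  interpret prob_space \<mu> by (rule ProbD(1)[OF \<mu>])
  have CC: "C \<subseteq> \<C>" by (rule closedin_subset_charges[OF C(1)])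
  have ZC: "Z \<subseteq> \<C>" using Z CC by auto
  have sp: "space \<mu> = Z" using ProbD(3)[OF \<mu>] ZC by auto
  let ?V = "Z - U"
  have V: "?V \<in> sets \<mu>" using sets.compl_sets[OF U] sp by simp
  have pV: "measure \<mu> ?V = 1 - measure \<mu> U" using prob_compl[OF U] sp by simp
  have pos: "measure \<mu> ?V > 0" using pV e by simp
  define b1 where "b1 = (\<lambda>A\<in>M. (\<integral>y. indicator ?V y * y A \<partial>\<mu>) / measure \<mu> ?V)"
  have b1: "b1 \<in> D" unfolding b1_def by (rule barycenter_in_convex[OF ZC \<mu> D(1,2) V D(4) pos])
  have US: "U \<subseteq> Z" using sets.sets_into_space[OF U] sp by simp
  have int: "integrable \<mu> (\<lambda>y. indicator S y * y A)" if A: "A \<in> M" and S: "S \<in> sets \<mu>" for A S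
  proof (rule integrable_const_bound[where B = 1])
    show "AE y in \<mu>. norm (indicator S y * y A) \<le> 1"
      using charge_range[of _ \<Omega> M A] A sp ZC by (intro AE_I2) (auto simp: indicator_def subset_iff)
    show "(\<lambda>y. indicator S y * y A) \<in> borel_measurable \<mu>"
      using evaluation_measurable[OF \<mu> A] S by (intro borel_measurable_times borel_measurable_indicator)
  qed
  have split: "barycenter \<mu> A = (\<integral>y. indicator ?V y * y A \<partial>\<mu>) + (\<integral>y. indicator U y * y A \<partial>\<mu>)" if A: "A \<in> M" for A
  proof -
    have "(\<integral>y. y A \<partial>\<mu>) = (\<integral>y. indicator ?V y * y A + indicator U y * y A \<partial>\<mu>)"
      by (rule Bochner_Integration.integral_cong) (use sp in \<open>auto simp: indicator_def\<close>)
    also have "\<dots> = (\<integral>y. indicator ?V y * y A \<partial>\<mu>) + (\<integral>y. indicator U y * y A \<partial>\<mu>)"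
      by (rule Bochner_Integration.integral_add[OF int[OF A V] int[OF A U]])
    finally show ?thesis using A by (simp add: barycenter_def)
  qed
  have "\<exists>b2\<in>C. \<forall>A\<in>M. (\<integral>y. indicator U y * y A \<partial>\<mu>) = measure \<mu> U * b2 A"
  proof (cases "measure \<mu> U = 0")
    case True
    have "b1 \<in> C" using b1 D(3) by auto
    moreover have "(\<integral>y. indicator U y * y A \<partial>\<mu>) = 0" for A
    proof (rule integral_eq_zero_AE)
      have "U \<in> null_sets \<mu>" using True U by (intro null_setsI) (auto simp: emeasure_eq_measure)
      from AE_not_in[OF this] show "AE y in \<mu>. indicator U y * y A = 0" by eventually_elim simp
    qed
    ultimately show ?thesis using True by auto
  next
    case False
    then have pU: "measure \<mu> U > 0" by (simp add: zero_less_measure_iff)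
    have "U \<subseteq> C" using US Z by auto
    from barycenter_in_convex[OF ZC \<mu> C U this pU] show ?thesis
      by (rule rev_bexI) (use pU in auto)
  qed
  then obtain b2 where b2: "b2 \<in> C" "\<And>A. A \<in> M \<Longrightarrow> (\<integral>y. indicator U y * y A \<partial>\<mu>) = measure \<mu> U * b2 A" by auto
  have "barycenter \<mu> = mix M (measure \<mu> ?V) b1 b2"
  proof
    fix A show "barycenter \<mu> A = mix M (measure \<mu> ?V) b1 b2 A"
      using split[of A] b2(2)[of A] pos pV by (cases "A \<in> M") (auto simp: mix_def b1_def barycenter_def)
  qed
  moreover have "measure \<mu> ?V \<in> {e..1}" using pV e by simp
  ultimately show ?thesis using b1 b2(1) unfolding join_def by blast
qed

lemma charge_act_mix:
  assumes inv: "\<And>A. A \<in> M \<Longrightarrow> \<phi> g -` A \<inter> \<Omega> \<in> M" and a: "a \<in> \<C>" "b \<in> \<C>" and t: "0 \<le> t" "t \<le> 1"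
  shows "charge_act \<Omega> M \<phi> g (mix M t a b) = mix M t (charge_act \<Omega> M \<phi> g a) (charge_act \<Omega> M \<phi> g b)"
  using mix_charge[OF a t] a inv by (auto simp: charge_act_def push_def mix_def fun_eq_iff)

text \<open>Let \<open>C\<close> be a minimal closed convex invariant set of charges, \<open>c\<close> an extreme point of \<open>C\<close>, and
  \<open>Z\<close> a minimal closed invariant subset of \<open>C\<close>. By minimality of \<open>C\<close>, every closed convex set that
  contains a whole orbit in \<open>C\<close> contains \<open>c\<close>. Applied to the set separating \<open>c\<close> from the
  complement of a neighbourhood, this puts \<open>c\<close> into \<open>Z\<close>. Moreover every probability measure on \<open>Z\<close>
  is contracted towards \<open>c\<close>: if all translates gave mass at least \<open>e\<close> to the complement of a
  neighbourhood of \<open>c\<close>, then all translates of the barycenter, hence \<open>c\<close>, would lie in a join that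
  omits \<open>c\<close>.\<close>

theorem boundary_of_charges:
  assumes act: "group_action G \<Omega> \<phi>" and ne: "\<Omega> \<noteq> {}"
    and inv: "\<And>g A. g \<in> carrier G \<Longrightarrow> A \<in> M \<Longrightarrow> \<phi> g -` A \<inter> \<Omega> \<in> M"
  obtains Z where "Z \<subseteq> \<C>" "G_boundary G (subtopology \<S> Z) (\<lambda>g. restrict (charge_act \<Omega> M \<phi> g) Z)"
proof -
  let ?act = "charge_act \<Omega> M \<phi>"
  interpret L: flow G \<S> ?act
    by (intro flow.intro charge_flow act ne inv) unfold_locales
  \<comment> \<open>convexity is part of the condition, so \<open>C\<close> is in general larger than the boundary \<open>Z\<close> inside it\<close>
  define P where "P T \<longleftrightarrow> invariant_under (carrier G) ?act T \<and> cvx M T" for T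
  have P1: "P (topspace \<S>)"
    using mix_charge L.act_closed by (auto simp: P_def invariant_under_def cvx_def)
  have P2: "P (\<Inter>\<F>)" if "\<F> \<noteq> {}" "\<forall>F\<in>\<F>. closedin \<S> F \<and> P F" for \<F>
    using that(2) unfolding P_def invariant_under_def cvx_def by (meson InterE InterI)
  from minimal_closed_subset[OF compact closedin_topspace L.nonempty P1 P2]
  obtain C where C: "closedin \<S> C" "C \<noteq> {}" "P C"
    and Cmin: "\<And>T. T \<subseteq> C \<Longrightarrow> closedin \<S> T \<Longrightarrow> T \<noteq> {} \<Longrightarrow> P T \<Longrightarrow> T = C" by metis
  have Cc: "cvx M C" and Ci: "invariant_under (carrier G) ?act C" using C(3) by (auto simp: P_def)
  have CC: "C \<subseteq> \<C>" by (rule closedin_subset_charges[OF C(1)])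
  obtain c where c: "extreme M C c" using extreme_exists[OF C(1,2)] .
  have cC: "c \<in> C" using c by (simp add: extreme_def)
  \<comment> \<open>the points of \<open>C\<close> whose orbit stays in \<open>Q\<close> form a closed convex invariant set, hence all of \<open>C\<close>\<close>
  have hull: "c \<in> Q" if Q: "closedin \<S> Q" "cvx M Q" and b: "b \<in> C" "\<And>g. g \<in> carrier G \<Longrightarrow> ?act g b \<in> Q" for Q b
  proof -
    define E where "E g = {x \<in> topspace \<S>. ?act g x \<in> Q}" for g
    define T where "T = C \<inter> \<Inter>(E ` carrier G)"
    have "carrier G \<noteq> {}" using L.one_closed by blast
    moreover have "closedin \<S> (E g)" if "g \<in> carrier G" for g
      unfolding E_def by (rule closedin_continuous_map_preimage[OF L.cont[OF that] Q(1)])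
    ultimately have "closedin \<S> T" unfolding T_def
      by (intro closedin_Int C(1) closedin_Inter) auto
    moreover have "T \<noteq> {}" using b CC by (auto simp: T_def E_def)
    moreover have "P T" unfolding P_def invariant_under_def cvx_def
    proof (intro conjI ballI)
      fix g x assume g: "g \<in> carrier G" and x: "x \<in> T"
      then have xC: "x \<in> C" "x \<in> topspace \<S>" using CC by (auto simp: T_def)
      have "?act g x \<in> C" using Ci g xC by (auto simp: invariant_under_def)
      moreover have "?act h (?act g x) \<in> Q" if "h \<in> carrier G" for h
      proof -
        have "?act (h \<otimes>\<^bsub>G\<^esub> g) x \<in> Q" using x g that by (auto simp: T_def E_def)
        then show ?thesis using L.act_mult[OF that g xC(2)] by simp
      qed
      ultimately show "?act g x \<in> T" using CC by (auto simp: T_def E_def)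
    next
      fix a b t assume ab: "a \<in> T" "b \<in> T" and t: "t \<in> {0..1::real}"
      have abC: "a \<in> C" "b \<in> C" using ab by (auto simp: T_def)
      have mC: "mix M t a b \<in> C" using Cc abC t by (auto simp: cvx_def)
      moreover have "?act g (mix M t a b) \<in> Q" if g: "g \<in> carrier G" for g
      proof -
        have "?act g (mix M t a b) = mix M t (?act g a) (?act g b)"
          using abC CC t by (intro charge_act_mix inv[OF g]) auto
        moreover have "?act g a \<in> Q" "?act g b \<in> Q" using ab g by (auto simp: T_def E_def)
        ultimately show ?thesis using Q(2) t by (auto simp: cvx_def)
      qed
      ultimately show "mix M t a b \<in> T" using CC by (auto simp: T_def E_def)
    qed
    ultimately have "T = C" using Cmin[of T] by (auto simp: T_def)
    then have "c \<in> T" using cC by simp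
    then have "?act \<one>\<^bsub>G\<^esub> c \<in> Q" using L.one_closed by (auto simp: T_def E_def)
    then show ?thesis using L.act_one[of c] cC CC by auto
  qed
  obtain Z where Z: "Z \<subseteq> C" "closedin \<S> Z" "Z \<noteq> {}" "invariant_under (carrier G) ?act Z"
    and Zmin: "\<And>T. T \<subseteq> Z \<Longrightarrow> closedin \<S> T \<Longrightarrow> T \<noteq> {} \<Longrightarrow> invariant_under (carrier G) ?act T \<Longrightarrow> T = Z"
    using L.minimal_invariant_subset[OF C(1,2) Ci] by metis
  have ZC: "Z \<subseteq> \<C>" using Z(1) CC by auto
  have cZ: "c \<in> Z"
  proof (rule ccontr)
    assume "c \<notin> Z"
    then have "openin \<S> (topspace \<S> - Z)" "c \<in> topspace \<S> - Z"
      using openin_diff[OF openin_topspace Z(2)] cC CC by auto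
    from extreme_separated[OF C(1) Cc c this]
    obtain D where D: "closedin \<S> D" "cvx M D" "C - (topspace \<S> - Z) \<subseteq> D" "c \<notin> D" by metis
    obtain z where z: "z \<in> Z" using Z(3) by blast
    have "?act g z \<in> D" if "g \<in> carrier G" for g
    proof -
      have "?act g z \<in> Z" using Z(4) z that by (auto simp: invariant_under_def)
      then show ?thesis using D(3) Z(1) by auto
    qed
    then have "c \<in> D" using z Z(1) by (intro hull[OF D(1,2), of z]) auto
    then show False using D(4) by simp
  qed
  let ?Y = "subtopology \<S> Z" and ?\<psi> = "\<lambda>g. restrict (?act g) Z"
  interpret Y: flow G ?Y ?\<psi> by (intro flow.intro L.subflow Z)
  have top: "topspace ?Y = Z" using ZC by auto
  have "minimal_G_space G ?Y ?\<psi>" unfolding Y.minimal_iff top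
  proof (intro allI impI)
    fix T assume T: "closedin ?Y T" "T \<noteq> {}" "invariant_under (carrier G) ?\<psi> T"
    have TZ: "T \<subseteq> Z" using closedin_subset[OF T(1)] top by simp
    have "closedin \<S> T" using T(1) Z(2) closedin_trans_full by blast
    moreover have "invariant_under (carrier G) ?act T"
      using T(3) TZ by (auto simp: invariant_under_def subset_iff)
    ultimately show "T = Z" using Zmin[OF TZ] T(2) by blast
  qed
  moreover have "strongly_proximal G ?Y ?\<psi>"
  proof (rule Y.strongly_proximalI)
    fix \<mu> assume \<mu>: "\<mu> \<in> Prob ?Y"
    interpret prob_space \<mu> by (rule ProbD(1)[OF \<mu>])
    have sp: "space \<mu> = Z" using ProbD(3)[OF \<mu>] top by simp
    have st: "sets \<mu> = sets (borel_of ?Y)" by (rule ProbD(2)[OF \<mu>])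
    have bC: "barycenter \<mu> \<in> C"
    proof -
      have "Z \<in> sets \<mu>" using sets.top[of \<mu>] sp by simp
      from barycenter_in_convex[OF ZC \<mu> C(1) Cc this Z(1)]
      have "(\<lambda>A\<in>M. (\<integral>y. indicator Z y * y A \<partial>\<mu>) / measure \<mu> Z) \<in> C" using prob_space sp by simp
      moreover have "(\<integral>y. indicator Z y * y A \<partial>\<mu>) = (\<integral>y. y A \<partial>\<mu>)" for A
        by (rule Bochner_Integration.integral_cong) (use sp in auto)
      moreover have "measure \<mu> Z = 1" using prob_space sp by simp
      ultimately show ?thesis by (simp add: barycenter_def)
    qed
    have equi: "barycenter (distr \<mu> (borel_of ?Y) (?\<psi> g)) = ?act g (barycenter \<mu>)" if g: "g \<in> carrier G" for g
    proof
      fix A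
      have meas: "?\<psi> g \<in> \<mu> \<rightarrow>\<^sub>M borel_of ?Y"
        using borel_of_measurable[OF Y.cont[OF g]] st by (simp cong: measurable_cong_sets)
      show "barycenter (distr \<mu> (borel_of ?Y) (?\<psi> g)) A = ?act g (barycenter \<mu>) A"
      proof (cases "A \<in> M")
        case True
        have mA: "(\<lambda>y. y A) \<in> borel_measurable (borel_of ?Y)"
          using evaluation_measurable[OF \<mu> True] st by (simp cong: measurable_cong_sets)
        have "(\<integral>y. y A \<partial>distr \<mu> (borel_of ?Y) (?\<psi> g)) = (\<integral>y. ?\<psi> g y A \<partial>\<mu>)"
          by (rule integral_distr[OF meas mA])
        also have "\<dots> = (\<integral>y. y (\<phi> g -` A \<inter> \<Omega>) \<partial>\<mu>)"
        proof (rule Bochner_Integration.integral_cong)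
          fix y assume "y \<in> space \<mu>"
          then have "y \<in> Z" "y \<in> \<C>" using sp ZC by auto
          then show "?\<psi> g y A = y (\<phi> g -` A \<inter> \<Omega>)" using True by (simp add: charge_act_def push_def)
        qed simp
        finally show ?thesis
          using True bC CC inv[OF g True] by (auto simp: barycenter_def charge_act_def push_def)
      next
        case False
        have "?act g (barycenter \<mu>) A = undefined" using bC CC False by (auto simp: charge_act_def push_def)
        then show ?thesis using False by (simp add: barycenter_def)
      qed
    qed
    show "contracts G ?Y ?\<psi> (measure \<mu>)" unfolding contracts_def
    proof (intro bexI[where x = c] allI impI)
      show "c \<in> topspace ?Y" using cZ top by simp
      fix U and e :: real assume U: "openin ?Y U" "c \<in> U" and e: "0 < e"
      obtain V where V: "openin \<S> V" "U = V \<inter> Z" using U(1) by (auto simp: openin_subtopology)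
      have cV: "c \<in> V" using U V by auto
      obtain D where D: "closedin \<S> D" "cvx M D" "D \<subseteq> C" "C - V \<subseteq> D" "c \<notin> D"
        using extreme_separated[OF C(1) Cc c V(1) cV] by metis
      show "\<exists>g\<in>carrier G. 1 - e < measure \<mu> (?\<psi> g -` U \<inter> topspace ?Y)"
      proof (rule ccontr)
        assume "\<not> ?thesis"
        then have small: "measure \<mu> (?\<psi> g -` U \<inter> topspace ?Y) \<le> 1 - e" if "g \<in> carrier G" for g
          using that by (simp add: not_less)
        have "?act g (barycenter \<mu>) \<in> join M e D C" if g: "g \<in> carrier G" for g
          unfolding equi[OF g, symmetric]
        proof (rule barycenter_in_join[OF C(1) Cc Z(1) _ D(1-3), where U = U])
          have meas: "?\<psi> g \<in> \<mu> \<rightarrow>\<^sub>M borel_of ?Y"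
            using borel_of_measurable[OF Y.cont[OF g]] st by (simp cong: measurable_cong_sets)
          show "distr \<mu> (borel_of ?Y) (?\<psi> g) \<in> Prob ?Y"
            by (rule distr_Prob[OF \<mu> Y.cont[OF g] Y.Hausdorff])
          show "Z - U \<subseteq> D" using D(4) V(2) Z(1) by auto
          show "U \<in> sets (distr \<mu> (borel_of ?Y) (?\<psi> g))" using borel_open[OF U(1)] by simp
          show "measure (distr \<mu> (borel_of ?Y) (?\<psi> g)) U \<le> 1 - e"
            using small[OF g] measure_distr[OF meas borel_open[OF U(1)]] sp top by simp
        qed (rule e)
        then have "c \<in> join M e D C"
          using e CC D by (intro hull[OF closedin_join cvx_join, OF D(1) C(1) _ D(2) Cc _ CC _ bC]) auto
        moreover have "c \<notin> join M e D C"
          using e by (intro extreme_notin_join[OF c D(3) order_refl CC D(5)]) auto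
        ultimately show False by simp
      qed
    qed
  qed
  ultimately have "G_boundary G ?Y ?\<psi>" using Y.cgs by (simp add: G_boundary_def)
  then show thesis using that ZC by blast
qed

end

text \<open>The group has a boundary consisting of means on itself. By universality the Furstenberg boundary
  maps to it equivariantly, and the image of \<open>x\<close> is a mean invariant under the stabilizer of \<open>x\<close>.\<close>

theorem amenable_stabilizer:
  fixes G (structure)
  assumes "group G" and X: "is_Furstenberg_boundary G X \<phi>" and x: "x \<in> topspace X"
  shows "amenable_group (G\<lparr>carrier := stabilizer G \<phi> x\<rparr>)"
proof -
  interpret group G by fact
  have "G_boundary G X \<phi>" using X by (simp add: is_Furstenberg_boundary_def)
  then interpret X: flow G X \<phi> by (rule G_boundary_flow)
  let ?\<Omega> = "carrier G" and ?L = "\<lambda>g. \<lambda>y\<in>carrier G. g \<otimes> y"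
  interpret A: charge_algebra ?\<Omega> "Pow ?\<Omega>"
    by (simp add: charge_algebra_def algebra_Pow)
  have act: "group_action G ?\<Omega> ?L"
    by (rule group_actionI) (auto simp: is_group m_assoc)
  have "?\<Omega> \<noteq> {}" using one_closed by blast
  from A.boundary_of_charges[OF act this]
  obtain Z where Z: "Z \<subseteq> charges ?\<Omega> (Pow ?\<Omega>)"
    "G_boundary G (subtopology (charge_space ?\<Omega> (Pow ?\<Omega>)) Z) (\<lambda>g. restrict (charge_act ?\<Omega> (Pow ?\<Omega>) ?L g) Z)"
    by auto
  obtain f where f: "equivariant (carrier G) X \<phi> (subtopology (charge_space ?\<Omega> (Pow ?\<Omega>)) Z)
      (\<lambda>g. restrict (charge_act ?\<Omega> (Pow ?\<Omega>) ?L g) Z) f"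
    using Furstenberg_boundary_universal[OF X Z(2)] by metis
  have "continuous_map X (subtopology (charge_space ?\<Omega> (Pow ?\<Omega>)) Z) f" using f by (simp add: equivariant_def)
  from continuous_map_image_subset_topspace[OF this] have fx: "f x \<in> Z" "f x \<in> charges ?\<Omega> (Pow ?\<Omega>)" using x by auto
  have "left_invariant G ?\<Omega> (stabilizer G \<phi> x) (f x)" unfolding left_invariant_def
  proof (intro ballI allI impI)
    fix h A assume "h \<in> stabilizer G \<phi> x" and A: "A \<subseteq> carrier G"
    then have h: "h \<in> carrier G" "\<phi> h x = x" by (auto simp: stabilizer_def)
    have "f (\<phi> h x) = restrict (charge_act ?\<Omega> (Pow ?\<Omega>) ?L h) Z (f x)"
      using f h(1) x by (simp add: equivariant_def)
    then have "f x = push ?\<Omega> (Pow ?\<Omega>) (?L h) (f x)" using h(2) fx by (simp add: charge_act_def)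
    then have "f x A = push ?\<Omega> (Pow ?\<Omega>) (?L h) (f x) A" by (rule fun_cong)
    also have "\<dots> = f x (?L h -` A \<inter> ?\<Omega>)" using A by (simp add: push_def)
    also have "?L h -` A \<inter> ?\<Omega> = (\<lambda>y. h \<otimes> y) -` A \<inter> ?\<Omega>" by auto
    finally show "f x ((\<lambda>y. h \<otimes> y) -` A \<inter> ?\<Omega>) = f x A" by simp
  qed
  then show ?thesis by (rule amenable_subgroupI[OF X.stabilizer_subgroup[OF x] fx(2)])
qed


section \<open>The space of subgroups\<close>

text \<open>Conjugation, restricted to the set of subgroups so that it is a group action in the strict sense
  of \<open>group_action\<close>.\<close>

definition Sub_act :: "('a, 'b) monoid_scheme \<Rightarrow> 'a \<Rightarrow> 'a set \<Rightarrow> 'a set" where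
  "Sub_act G g = (\<lambda>H\<in>{H. subgroup H G}. g <#\<^bsub>G\<^esub> H #>\<^bsub>G\<^esub> (inv\<^bsub>G\<^esub> g))"

text \<open>Relative to an acting set \<open>S\<close>: the Furstenberg URS of a group will turn out to be minimal under
  certain normal subgroups as well.\<close>

definition minimal_closed :: "'a set \<Rightarrow> 'x topology \<Rightarrow> ('a \<Rightarrow> 'x \<Rightarrow> 'x) \<Rightarrow> 'x set \<Rightarrow> bool" where
  "minimal_closed S X \<phi> T \<longleftrightarrow> closedin X T \<and> T \<noteq> {} \<and> invariant_under S \<phi> T \<and>
     (\<forall>M. M \<subseteq> T \<longrightarrow> closedin X M \<longrightarrow> M \<noteq> {} \<longrightarrow> invariant_under S \<phi> M \<longrightarrow> M = T)"

lemma minimal_closedD: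
  assumes "minimal_closed S X \<phi> T"
  shows "closedin X T" "T \<noteq> {}" "invariant_under S \<phi> T"
    "\<And>M. M \<subseteq> T \<Longrightarrow> closedin X M \<Longrightarrow> M \<noteq> {} \<Longrightarrow> invariant_under S \<phi> M \<Longrightarrow> M = T"
  using assms by (auto simp: minimal_closed_def)

lemma minimal_closed_eq:
  assumes T: "minimal_closed S X \<phi> T" and U: "minimal_closed S X \<phi> U" and "T \<inter> U \<noteq> {}"
  shows "T = U"
proof -
  have "closedin X (T \<inter> U)" using T U by (auto simp: minimal_closed_def)
  moreover have "invariant_under S \<phi> (T \<inter> U)" using T U by (auto simp: minimal_closed_def invariant_under_def)
  ultimately have "T \<inter> U = T" "T \<inter> U = U"
    using assms(3) minimal_closedD(4)[OF T, of "T \<inter> U"] minimal_closedD(4)[OF U, of "T \<inter> U"] by auto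
  then show ?thesis by simp
qed

lemma (in flow) minimal_closed_exists:
  assumes "closedin X T" "T \<noteq> {}" "invariant_under S \<phi> T"
  obtains M where "M \<subseteq> T" "minimal_closed S X \<phi> M"
  using minimal_invariant_subset[OF assms] unfolding minimal_closed_def by metis

lemma (in flow) minimal_G_space_minimal_closed:
  "minimal_G_space G X \<phi> \<longleftrightarrow> minimal_closed (carrier G) X \<phi> (topspace X)"
proof -
  have "invariant_under (carrier G) \<phi> (topspace X)" by (auto simp: invariant_under_def)
  then show ?thesis unfolding minimal_iff minimal_closed_def using nonempty closedin_subset by blast
qed

context group begin

abbreviation "Sub \<equiv> Sub_topology G"

lemma topspace_Sub [simp]: "topspace Sub = {H. subgroup H G}"
  by (auto simp: Sub_topology_def topspace_pullback_topology)

lemma continuous_map_member: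
  assumes "g \<in> carrier G" shows "continuous_map Sub (discrete_topology UNIV) (\<lambda>H. g \<in> H)"
proof -
  have "continuous_map Sub (product_topology (\<lambda>_. discrete_topology UNIV) (carrier G))
          ((\<lambda>f. f) \<circ> (\<lambda>H. \<lambda>g\<in>carrier G. g \<in> H))"
    unfolding Sub_topology_def by (rule continuous_map_pullback) simp
  from continuous_map_compose[OF this continuous_map_product_projection[OF assms]]
  show ?thesis using assms by (simp add: o_def)
qed

lemma closedin_member:
  assumes "g \<in> carrier G"
  shows "closedin Sub {H. subgroup H G \<and> g \<in> H}" "closedin Sub {H. subgroup H G \<and> g \<notin> H}"
  using closedin_continuous_map_preimage[OF continuous_map_member[OF assms], of "{True}"]
    closedin_continuous_map_preimage[OF continuous_map_member[OF assms], of "{False}"]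
  by simp_all

lemma continuous_map_into_Sub:
  assumes "\<And>z. z \<in> topspace Z \<Longrightarrow> subgroup (F z) G"
    and "\<And>g. g \<in> carrier G \<Longrightarrow> continuous_map Z (discrete_topology UNIV) (\<lambda>z. g \<in> F z)"
  shows "continuous_map Z Sub F"
  unfolding Sub_topology_def
proof (rule continuous_map_pullback')
  show "continuous_map Z (product_topology (\<lambda>_. discrete_topology UNIV) (carrier G)) ((\<lambda>H. \<lambda>g\<in>carrier G. g \<in> H) \<circ> F)"
    unfolding continuous_map_componentwise using assms(2) by (auto simp: o_def)
qed (use assms(1) in auto)

lemma Hausdorff_Sub: "Hausdorff_space Sub"
proof (rule Hausdorff_space_injective_preimage)
  show "continuous_map Sub (product_topology (\<lambda>_. discrete_topology UNIV) (carrier G)) (\<lambda>H. \<lambda>g\<in>carrier G. g \<in> H)"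
    unfolding continuous_map_componentwise using continuous_map_member by auto
  show "inj_on (\<lambda>H. \<lambda>g\<in>carrier G. g \<in> H) (topspace Sub)"
  proof (rule inj_onI)
    fix H K assume "H \<in> topspace Sub" "K \<in> topspace Sub" and eq: "(\<lambda>g\<in>carrier G. g \<in> H) = (\<lambda>g\<in>carrier G. g \<in> K)"
    then have "H \<subseteq> carrier G" "K \<subseteq> carrier G" by (auto dest: subgroup.subset)
    moreover have "g \<in> H \<longleftrightarrow> g \<in> K" if "g \<in> carrier G" for g using fun_cong[OF eq, of g] that by simp
    ultimately show "H = K" by blast
  qed
qed (simp add: Hausdorff_space_product_topology)

lemma compact_Sub: "compact_space Sub"
proof -
  let ?P = "product_topology (\<lambda>_. discrete_topology (UNIV :: bool set)) (carrier G)"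
  define d where "d f = {g \<in> carrier G. f g}" for f :: "'a \<Rightarrow> bool"
  define v where "v g b = {f \<in> topspace ?P. f g = b}" for g b
  have v: "closedin ?P (v g b)" if "g \<in> carrier G" for g b
    using closedin_continuous_map_preimage[OF continuous_map_product_projection[OF that, of "\<lambda>_. discrete_topology UNIV"], of "{b}"]
    by (simp add: v_def)
  define I where "I = v \<one> True \<inter> (\<Inter>p\<in>carrier G \<times> carrier G. v (fst p) False \<union> v (snd p) False \<union> v (fst p \<otimes> snd p) True)
     \<inter> (\<Inter>g\<in>carrier G. v g False \<union> v (inv g) True)"
  have ne: "carrier G \<noteq> {}" using one_closed by blast
  have "closedin ?P I" unfolding I_def
    by (intro closedin_Int closedin_INT closedin_Un v) (use ne in auto)
  moreover have "compact_space ?P" by (simp add: compact_space_product_topology compact_space_discrete_topology)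
  ultimately have "compact_space (subtopology ?P I)"
    using closedin_compact_space compact_space_subtopology by blast
  moreover have top: "topspace (subtopology ?P I) = I" by (auto simp: I_def v_def)
  have sub: "subgroup (d f) G" if "f \<in> I" for f
  proof (rule subgroupI)
    have "f \<one>" using that by (auto simp: I_def v_def)
    then show "d f \<noteq> {}" by (auto simp: d_def)
    show "inv g \<in> d f" if "g \<in> d f" for g using that \<open>f \<in> I\<close> by (auto simp: I_def v_def d_def)
    show "g \<otimes> h \<in> d f" if "g \<in> d f" "h \<in> d f" for g h using that \<open>f \<in> I\<close> by (fastforce simp: I_def v_def d_def)
  qed (auto simp: d_def)
  have "continuous_map (subtopology ?P I) Sub d"
  proof (rule continuous_map_into_Sub)
    fix z assume "z \<in> topspace (subtopology ?P I)" then show "subgroup (d z) G" using sub top by auto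
  next
    fix g assume g: "g \<in> carrier G"
    have "continuous_map (subtopology ?P I) (discrete_topology UNIV) (\<lambda>f. f g)"
      by (rule continuous_map_from_subtopology[OF continuous_map_product_projection[OF g]])
    then show "continuous_map (subtopology ?P I) (discrete_topology UNIV) (\<lambda>z. g \<in> d z)" using g by (simp add: d_def)
  qed
  ultimately have "compactin Sub (d ` I)" using image_compactin[of "subtopology ?P I" I Sub d] top unfolding compact_space_def by simp
  moreover have "d ` I = topspace Sub"
  proof (intro equalityI subsetI)
    fix H assume "H \<in> topspace Sub"
    then have H: "subgroup H G" by simp
    then interpret H: subgroup H G .
    let ?f = "\<lambda>g\<in>carrier G. g \<in> H"
    have "d ?f = H" using H.subset by (auto simp: d_def)
    moreover have "?f \<in> I" by (auto simp: I_def v_def)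
    ultimately show "H \<in> d ` I" by blast
  qed (use sub in auto)
  ultimately show ?thesis by (simp add: compact_space_def)
qed

lemma conj_eq: "g <# K #> h = (\<lambda>k. g \<otimes> k \<otimes> h) ` K"
  by (auto simp: l_coset_def r_coset_def)

lemma normal_conj_iff:
  assumes N: "N \<lhd> G" and g: "g \<in> carrier G" and x: "x \<in> carrier G"
  shows "inv g \<otimes> x \<otimes> g \<in> N \<longleftrightarrow> x \<in> N"
proof
  assume "inv g \<otimes> x \<otimes> g \<in> N"
  then have "g \<otimes> (inv g \<otimes> x \<otimes> g) \<otimes> inv g \<in> N" using normal.inv_op_closed2[OF N] g by simp
  moreover have "g \<otimes> (inv g \<otimes> x \<otimes> g) \<otimes> inv g = (g \<otimes> inv g) \<otimes> x \<otimes> (g \<otimes> inv g)"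
    using g x by (simp only: m_assoc m_closed inv_closed)
  ultimately show "x \<in> N" using g x by simp
qed (use normal.inv_op_closed1[OF N] g in simp)

lemma Sub_act_apply: "subgroup H G \<Longrightarrow> Sub_act G g H = (\<lambda>k. g \<otimes> k \<otimes> inv g) ` H"
  by (simp add: Sub_act_def conj_eq)

lemma Sub_act_member:
  assumes H: "subgroup H G" and g: "g \<in> carrier G" and x: "x \<in> carrier G"
  shows "x \<in> Sub_act G g H \<longleftrightarrow> inv g \<otimes> x \<otimes> g \<in> H"
proof
  interpret H: subgroup H G by fact
  assume "x \<in> Sub_act G g H"
  then obtain k where k: "k \<in> H" "x = g \<otimes> k \<otimes> inv g" by (auto simp: Sub_act_apply[OF H])
  have kc: "k \<in> carrier G" using k(1) H.mem_carrier by simp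
  have "inv g \<otimes> x \<otimes> g = (inv g \<otimes> g) \<otimes> k \<otimes> (inv g \<otimes> g)"
    unfolding k(2) using kc g by (simp only: m_assoc m_closed inv_closed)
  then have "inv g \<otimes> x \<otimes> g = k" using kc g by simp
  then show "inv g \<otimes> x \<otimes> g \<in> H" using k(1) by simp
next
  assume *: "inv g \<otimes> x \<otimes> g \<in> H"
  have "g \<otimes> (inv g \<otimes> x \<otimes> g) \<otimes> inv g = (g \<otimes> inv g) \<otimes> x \<otimes> (g \<otimes> inv g)"
    using g x by (simp only: m_assoc m_closed inv_closed)
  then have "g \<otimes> (inv g \<otimes> x \<otimes> g) \<otimes> inv g = x" using g x by simp
  then show "x \<in> Sub_act G g H" unfolding Sub_act_apply[OF H] using * by (metis imageI)
qed

lemma Sub_flow: "flow G Sub (Sub_act G)"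
proof (intro flow.intro compact_G_spaceI)
  show "topspace Sub \<noteq> {}" using subgroup_self by auto
  interpret S: group_action G "{H. subgroup H G}" "Sub_act G"
    unfolding Sub_act_def by (rule action_by_conjugation_on_subgroups_set)
  show "Sub_act G \<one> x = x" if "x \<in> topspace Sub" for x
    using S.id_eq_one that by (metis restrict_apply' topspace_Sub)
  fix g assume g: "g \<in> carrier G"
  have cl: "subgroup (Sub_act G g H) G" if "subgroup H G" for H using S.element_image[OF g] that by blast
  show "continuous_map Sub Sub (Sub_act G g)"
  proof (rule continuous_map_into_Sub)
    fix x assume x: "x \<in> carrier G"
    have "continuous_map Sub (discrete_topology UNIV) (\<lambda>H. inv g \<otimes> x \<otimes> g \<in> H)"
      using g x by (intro continuous_map_member) simp
    then show "continuous_map Sub (discrete_topology UNIV) (\<lambda>H. x \<in> Sub_act G g H)"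
      by (rule continuous_map_eq) (use Sub_act_member g x in auto)
  qed (use cl in auto)
  fix h x assume "h \<in> carrier G" "x \<in> topspace Sub"
  then show "Sub_act G (g \<otimes> h) x = Sub_act G g (Sub_act G h x)" using S.composition_rule g by simp
qed (auto simp: compact_Sub Hausdorff_Sub is_group Sub_act_def)

interpretation S: flow G Sub "Sub_act G" by (rule Sub_flow)

lemma conj_invariant_iff:
  assumes "T \<subseteq> {H. subgroup H G}"
  shows "conj_invariant G T \<longleftrightarrow> invariant_under (carrier G) (Sub_act G) T"
  using assms by (auto simp: conj_invariant_def invariant_under_def Sub_act_def subset_iff)

lemma is_URS_iff: "is_URS G T \<longleftrightarrow> minimal_closed (carrier G) Sub (Sub_act G) T"
proof -
  have "conj_invariant G M \<longleftrightarrow> invariant_under (carrier G) (Sub_act G) M" if "closedin Sub M" for M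
    using conj_invariant_iff closedin_subset[OF that] by simp
  then show ?thesis unfolding is_URS_def minimal_closed_def by blast
qed

lemma closedin_Sub_pairs: "closedin (prod_topology Sub Sub) {p. subgroup (fst p) G \<and> subgroup (snd p) G \<and> fst p \<subseteq> snd p}"
proof -
  let ?P = "prod_topology Sub Sub"
  define D where "D g = {p \<in> topspace ?P. fst p \<in> {H. subgroup H G \<and> g \<notin> H}} \<union> {p \<in> topspace ?P. snd p \<in> {H. subgroup H G \<and> g \<in> H}}" for g
  have D: "closedin ?P (D g)" if "g \<in> carrier G" for g
    unfolding D_def using that
    by (intro closedin_Un closedin_continuous_map_preimage[OF continuous_map_fst]
        closedin_continuous_map_preimage[OF continuous_map_snd] closedin_member)
  have "carrier G \<noteq> {}" using one_closed by blast
  then have "closedin ?P (\<Inter>g\<in>carrier G. D g)" using D by (intro closedin_INT) auto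
  moreover have "(\<Inter>g\<in>carrier G. D g) = {p. subgroup (fst p) G \<and> subgroup (snd p) G \<and> fst p \<subseteq> snd p}"
  proof (intro equalityI subsetI)
    fix p assume p: "p \<in> (\<Inter>g\<in>carrier G. D g)"
    then have "p \<in> D \<one>" by auto
    then have s: "subgroup (fst p) G" "subgroup (snd p) G" by (auto simp: D_def)
    have "g \<in> snd p" if "g \<in> fst p" for g
      using p subgroup.mem_carrier[OF s(1) that] that by (auto simp: D_def)
    then show "p \<in> {p. subgroup (fst p) G \<and> subgroup (snd p) G \<and> fst p \<subseteq> snd p}" using s by auto
  next
    fix p assume "p \<in> {p. subgroup (fst p) G \<and> subgroup (snd p) G \<and> fst p \<subseteq> snd p}"
    then show "p \<in> (\<Inter>g\<in>carrier G. D g)" by (cases p) (auto simp: D_def)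
  qed
  ultimately show ?thesis by simp
qed

lemma closedin_subgroups_below: "closedin Sub {K. subgroup K G \<and> K \<subseteq> L}"
proof -
  have eq: "{K. subgroup K G \<and> K \<subseteq> L} = \<Inter>(insert {H. subgroup H G} ((\<lambda>g. {H. subgroup H G \<and> g \<notin> H}) ` (carrier G - L)))"
  proof (intro equalityI subsetI)
    fix H assume H: "H \<in> \<Inter>(insert {H. subgroup H G} ((\<lambda>g. {H. subgroup H G \<and> g \<notin> H}) ` (carrier G - L)))"
    then have s: "subgroup H G" by simp
    have "g \<in> L" if "g \<in> H" for g using H subgroup.mem_carrier[OF s that] that by auto
    then show "H \<in> {K. subgroup K G \<and> K \<subseteq> L}" using s by auto
  qed auto
  show ?thesis unfolding eq
    using closedin_topspace[of Sub] closedin_member(2) by (intro closedin_Inter) auto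
qed

text \<open>Containment is a closed relation on pairs of subgroups, and \<open>K'\<close> ranges over a compact set.\<close>

lemma closedin_above:
  assumes T: "closedin Sub T" shows "closedin Sub {K. subgroup K G \<and> (\<exists>K'\<in>T. K' \<subseteq> K)}"
proof -
  let ?E = "{p \<in> topspace (prod_topology Sub Sub). fst p \<in> T} \<inter> {p. subgroup (fst p) G \<and> subgroup (snd p) G \<and> fst p \<subseteq> snd p}"
  have "closedin (prod_topology Sub Sub) ?E"
    by (intro closedin_Int closedin_Sub_pairs closedin_continuous_map_preimage[OF continuous_map_fst] T)
  from closed_map_projections(2)[OF compact_Sub compact_Sub this]
  have "closedin Sub (snd ` ?E)" .
  moreover have "snd ` ?E = {K. subgroup K G \<and> (\<exists>K'\<in>T. K' \<subseteq> K)}"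
  proof (intro equalityI subsetI)
    fix K assume "K \<in> {K. subgroup K G \<and> (\<exists>K'\<in>T. K' \<subseteq> K)}"
    then obtain K' where K: "subgroup K G" "K' \<in> T" "K' \<subseteq> K" by auto
    have "K' \<in> topspace Sub" by (rule subsetD[OF closedin_subset[OF T] K(2)])
    then have "(K', K) \<in> ?E" using K by simp
    then show "K \<in> snd ` ?E" by (rule image_eqI[rotated]) simp
  next
    fix K assume "K \<in> snd ` ?E"
    then obtain p where "p \<in> ?E" "K = snd p" by (rule imageE)
    then show "K \<in> {K. subgroup K G \<and> (\<exists>K'\<in>T. K' \<subseteq> K)}" by auto
  qed
  ultimately show ?thesis by simp
qed

text \<open>By compactness \<open>T\<close> contains a subgroup \<open>K\<close> that is minimal for inclusion among the members of
  \<open>T\<close>. Going down from \<open>K\<close> to a member of \<open>U\<close> and down again to \<open>T\<close> returns to \<open>K\<close>, so that member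
  of \<open>U\<close> equals \<open>K\<close>.\<close>

lemma mutually_dominating_meet:
  assumes T: "closedin Sub T" "T \<noteq> {}" and U: "closedin Sub U"
    and TU: "\<And>K. K \<in> T \<Longrightarrow> \<exists>L\<in>U. L \<subseteq> K" and UT: "\<And>L. L \<in> U \<Longrightarrow> \<exists>K\<in>T. K \<subseteq> L"
  shows "T \<inter> U \<noteq> {}"
proof -
  define P where "P C \<longleftrightarrow> (\<forall>L\<in>C. \<forall>L'\<in>T. L' \<subseteq> L \<longrightarrow> L' \<in> C)" for C
  have "P T" by (simp add: P_def)
  have Pch: "P (\<Inter>\<F>)" if "\<F> \<noteq> {}" "\<forall>F\<in>\<F>. closedin Sub F \<and> P F" for \<F>
    using that(2) unfolding P_def by (meson InterE InterI)
  from minimal_closed_subset[OF compact_Sub T \<open>P T\<close> Pch]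
  obtain C where C: "C \<subseteq> T" "closedin Sub C" "C \<noteq> {}" "P C"
    and Cmin: "\<And>C'. C' \<subseteq> C \<Longrightarrow> closedin Sub C' \<Longrightarrow> C' \<noteq> {} \<Longrightarrow> P C' \<Longrightarrow> C' = C" by metis
  obtain K where K: "K \<in> C" using C(3) by blast
  have Ks: "subgroup L G" if "L \<in> T" for L using closedin_subset[OF T(1)] that by auto
  have below: "K \<subseteq> L" if L: "L \<in> C" for L
  proof -
    define D where "D = C \<inter> {L'. subgroup L' G \<and> L' \<subseteq> L}"
    have "closedin Sub D" unfolding D_def by (rule closedin_Int[OF C(2) closedin_subgroups_below])
    moreover have "L \<in> D" using L C(1) Ks by (auto simp: D_def)
    moreover have "P D" unfolding P_def
    proof (intro ballI impI)
      fix H H' assume H: "H \<in> D" "H' \<in> T" "H' \<subseteq> H"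
      then have "H' \<in> C" using C(4) unfolding P_def D_def by auto
      then show "H' \<in> D" using H Ks[OF H(2)] unfolding D_def by auto
    qed
    ultimately have "D = C" using Cmin[of D] by (auto simp: D_def)
    then show ?thesis using K by (auto simp: D_def)
  qed
  have KT: "K \<in> T" using K C(1) by auto
  obtain L where L: "L \<in> U" "L \<subseteq> K" using TU[OF KT] by blast
  obtain K'' where K'': "K'' \<in> T" "K'' \<subseteq> L" using UT[OF L(1)] by blast
  have "K'' \<in> C" using C(4) K K'' L unfolding P_def by blast
  then have "K \<subseteq> K''" by (rule below)
  then have "L = K" using K'' L by auto
  then show ?thesis using L KT by blast
qed

end

section \<open>Stabilizers\<close>

text \<open>For \<open>R = carrier G\<close> the subgroups \<open>st y\<close> below are the usual stabilizers. The smaller \<open>R\<close> of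
  interest are normal subgroups that contain the Furstenberg URS.\<close>

locale flow_normal = flow + fixes R assumes R: "R \<lhd> G"
begin

interpretation S: flow G Sub "Sub_act G" by (rule Sub_flow)

definition st :: "'c \<Rightarrow> 'a set" where "st y = R \<inter> stabilizer G \<phi> y"

lemma subgroup_st: "y \<in> topspace X \<Longrightarrow> subgroup (st y) G"
  unfolding st_def using R stabilizer_subgroup by (intro subgroups_Inter_pair) (auto simp: normal_def)

lemma st_act:
  assumes g: "g \<in> carrier G" and y: "y \<in> topspace X" shows "st (\<phi> g y) = Sub_act G g (st y)"
proof -
  have "x \<in> st (\<phi> g y) \<longleftrightarrow> x \<in> Sub_act G g (st y)" if x: "x \<in> carrier G" for x
  proof -
    have "\<phi> x (\<phi> g y) = \<phi> g y \<longleftrightarrow> \<phi> (inv g) (\<phi> x (\<phi> g y)) = y"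
    proof
      assume "\<phi> (inv g) (\<phi> x (\<phi> g y)) = y"
      then have "\<phi> g (\<phi> (inv g) (\<phi> x (\<phi> g y))) = \<phi> g y" by simp
      then show "\<phi> x (\<phi> g y) = \<phi> g y" using g x y by simp
    qed (use g y in simp)
    moreover have "\<phi> (inv g) (\<phi> x (\<phi> g y)) = \<phi> (inv g \<otimes> x \<otimes> g) y" using g x y by (simp add: act_mult)
    moreover have "x \<in> R \<longleftrightarrow> inv g \<otimes> x \<otimes> g \<in> R" by (rule normal_conj_iff[OF R g x, symmetric])
    ultimately show ?thesis
      unfolding Sub_act_member[OF subgroup_st[OF y] g x] using g x by (auto simp: st_def stabilizer_def)
  qed
  moreover have "st (\<phi> g y) \<subseteq> carrier G" "Sub_act G g (st y) \<subseteq> carrier G"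
    using subgroup_st[of "\<phi> g y"] S.act_closed[OF g, of "st y"] subgroup_st[OF y] g y
    by (auto dest: subgroup.subset)
  ultimately show ?thesis by blast
qed

lemma closedin_st_pairs:
  "closedin (prod_topology Sub X) {p. subgroup (fst p) G \<and> snd p \<in> topspace X \<and> fst p \<subseteq> st (snd p)}"
proof -
  let ?P = "prod_topology Sub X"
  define D where "D g = {p \<in> topspace ?P. fst p \<in> {H. subgroup H G \<and> g \<notin> H}} \<union>
      (if g \<in> R then {p \<in> topspace ?P. snd p \<in> {y \<in> topspace X. \<phi> g y = y}} else {})" for g
  have D: "closedin ?P (D g)" if g: "g \<in> carrier G" for g
  proof -
    have "closedin X {y \<in> topspace X. \<phi> g y = y}"
      by (rule closedin_continuous_maps_eq[OF Hausdorff cont[OF g]]) simp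
    then have "closedin ?P {p \<in> topspace ?P. snd p \<in> {y \<in> topspace X. \<phi> g y = y}}"
      by (rule closedin_continuous_map_preimage[OF continuous_map_snd])
    moreover have "closedin ?P {p \<in> topspace ?P. fst p \<in> {H. subgroup H G \<and> g \<notin> H}}"
      by (rule closedin_continuous_map_preimage[OF continuous_map_fst closedin_member(2)[OF g]])
    ultimately show ?thesis unfolding D_def by (intro closedin_Un) auto
  qed
  have "carrier G \<noteq> {}" using one_closed by blast
  then have "closedin ?P (\<Inter>g\<in>carrier G. D g)" using D by (intro closedin_INT) auto
  moreover have "(\<Inter>g\<in>carrier G. D g) = {p. subgroup (fst p) G \<and> snd p \<in> topspace X \<and> fst p \<subseteq> st (snd p)}"
  proof (intro equalityI subsetI)
    fix p assume p: "p \<in> (\<Inter>g\<in>carrier G. D g)"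
    then have "p \<in> D \<one>" by auto
    then have s: "subgroup (fst p) G" "snd p \<in> topspace X" by (auto simp: D_def split: if_splits)
    have "g \<in> st (snd p)" if gp: "g \<in> fst p" for g
    proof -
      have gc: "g \<in> carrier G" by (rule subgroup.mem_carrier[OF s(1) gp])
      then have "p \<in> D g" using p by auto
      then show ?thesis using gp gc by (auto simp: D_def st_def stabilizer_def split: if_splits)
    qed
    then show "p \<in> {p. subgroup (fst p) G \<and> snd p \<in> topspace X \<and> fst p \<subseteq> st (snd p)}" using s by auto
  next
    fix p assume "p \<in> {p. subgroup (fst p) G \<and> snd p \<in> topspace X \<and> fst p \<subseteq> st (snd p)}"
    then show "p \<in> (\<Inter>g\<in>carrier G. D g)" by (cases p) (auto simp: D_def st_def stabilizer_def)
  qed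
  ultimately show ?thesis by simp
qed

lemma closedin_below_st: "closedin Sub {K. subgroup K G \<and> (\<exists>y\<in>topspace X. K \<subseteq> st y)}"
proof -
  from closed_map_projections(1)[OF compact_Sub compact closedin_st_pairs]
  have "closedin Sub (fst ` {p. subgroup (fst p) G \<and> snd p \<in> topspace X \<and> fst p \<subseteq> st (snd p)})" .
  moreover have "fst ` {p. subgroup (fst p) G \<and> snd p \<in> topspace X \<and> fst p \<subseteq> st (snd p)}
      = {K. subgroup K G \<and> (\<exists>y\<in>topspace X. K \<subseteq> st y)}" by (force simp: image_iff)
  ultimately show ?thesis by simp
qed

lemma closedin_st_above:
  assumes T: "closedin Sub T" shows "closedin X {y \<in> topspace X. \<exists>K\<in>T. K \<subseteq> st y}"
proof -
  let ?E = "{p \<in> topspace (prod_topology Sub X). fst p \<in> T} \<inter>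
     {p. subgroup (fst p) G \<and> snd p \<in> topspace X \<and> fst p \<subseteq> st (snd p)}"
  have "closedin (prod_topology Sub X) ?E"
    by (intro closedin_Int closedin_st_pairs closedin_continuous_map_preimage[OF continuous_map_fst] T)
  from closed_map_projections(2)[OF compact_Sub compact this]
  have "closedin X (snd ` ?E)" .
  moreover have "snd ` ?E = {y \<in> topspace X. \<exists>K\<in>T. K \<subseteq> st y}"
  proof (intro equalityI subsetI)
    fix y assume "y \<in> {y \<in> topspace X. \<exists>K\<in>T. K \<subseteq> st y}"
    then obtain K where K: "K \<in> T" "K \<subseteq> st y" "y \<in> topspace X" by auto
    have "K \<in> topspace Sub" by (rule subsetD[OF closedin_subset[OF T] K(1)])
    then have "(K, y) \<in> ?E" using K by simp
    then show "y \<in> snd ` ?E" by (rule image_eqI[rotated]) simp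
  next
    fix y assume "y \<in> snd ` ?E"
    then obtain p where "p \<in> ?E" "y = snd p" by (rule imageE)
    then show "y \<in> {y \<in> topspace X. \<exists>K\<in>T. K \<subseteq> st y}" by auto
  qed
  ultimately show ?thesis by simp
qed

abbreviation "cl_st \<equiv> Sub closure_of (st ` topspace X)"

lemma cl_st_below: "K \<in> cl_st \<Longrightarrow> \<exists>y\<in>topspace X. K \<subseteq> st y"
proof -
  assume K: "K \<in> cl_st"
  have "st ` topspace X \<subseteq> {K. subgroup K G \<and> (\<exists>y\<in>topspace X. K \<subseteq> st y)}"
    using subgroup_st by auto
  from closure_of_minimal[OF this closedin_below_st] K show ?thesis by auto
qed

lemma cl_st_invariant: "invariant_under (carrier G) (Sub_act G) cl_st"
proof (rule S.closure_invariant)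
  show "invariant_under (carrier G) (Sub_act G) (st ` topspace X)"
    using st_act by (force simp: invariant_under_def)
  show "st ` topspace X \<subseteq> topspace Sub" using subgroup_st by auto
qed simp

text \<open>The points \<open>y\<close> whose stabilizer contains a member of \<open>T\<close> form a closed \<open>N\<close>-invariant set, so all
  points have this property by minimality. It passes to limits of stabilizers because the
  subgroups above a closed set of subgroups form a closed set.\<close>

lemma cl_st_dominated:
  assumes N: "N \<subseteq> carrier G" and min: "minimal_closed N X \<phi> (topspace X)"
    and T: "closedin Sub T" "invariant_under N (Sub_act G) T"
    and K0: "K0 \<in> T" "y0 \<in> topspace X" "K0 \<subseteq> st y0" and K: "K \<in> cl_st"
  shows "\<exists>K'\<in>T. K' \<subseteq> K"
proof -
  let ?Y = "{y \<in> topspace X. \<exists>K\<in>T. K \<subseteq> st y}"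
  have Ts: "subgroup K G" if "K \<in> T" for K using closedin_subset[OF T(1)] that by auto
  have "invariant_under N \<phi> ?Y" unfolding invariant_under_def
  proof (intro ballI)
    fix g y assume g: "g \<in> N" and "y \<in> ?Y"
    then obtain K where K: "K \<in> T" "K \<subseteq> st y" and y: "y \<in> topspace X" by auto
    have gc: "g \<in> carrier G" using g N by auto
    have "Sub_act G g K \<subseteq> Sub_act G g (st y)"
      unfolding Sub_act_apply[OF Ts[OF K(1)]] Sub_act_apply[OF subgroup_st[OF y]] using K(2) by (rule image_mono)
    moreover have "Sub_act G g K \<in> T" using T(2) g K(1) by (simp add: invariant_under_def)
    ultimately show "\<phi> g y \<in> ?Y" using gc y by (auto simp: st_act)
  qed
  moreover have "y0 \<in> ?Y" using K0 by auto
  then have "?Y \<noteq> {}" by (metis empty_iff)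
  moreover have "?Y \<subseteq> topspace X" by (rule Collect_restrict)
  ultimately have YX: "?Y = topspace X"
    using minimal_closedD(4)[OF min _ closedin_st_above[OF T(1)]] by simp
  have above: "\<exists>K\<in>T. K \<subseteq> st y" if "y \<in> topspace X" for y
    using subsetD[OF equalityD2[OF YX] that] by simp
  have "st ` topspace X \<subseteq> {K. subgroup K G \<and> (\<exists>K'\<in>T. K' \<subseteq> K)}"
  proof
    fix H assume "H \<in> st ` topspace X"
    then obtain y where y: "y \<in> topspace X" "H = st y" by (rule imageE)
    show "H \<in> {K. subgroup K G \<and> (\<exists>K'\<in>T. K' \<subseteq> K)}"
      unfolding y(2) using subgroup_st[OF y(1)] above[OF y(1)] by simp
  qed
  from closure_of_minimal[OF this closedin_above[OF T(1)]] show ?thesis using K by auto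
qed

text \<open>Two such sets dominate each other, so they meet, and minimal sets that meet are equal.\<close>

lemma minimal_in_cl_st_unique:
  assumes N: "N \<subseteq> carrier G" and min: "minimal_closed N X \<phi> (topspace X)"
    and T: "minimal_closed N Sub (Sub_act G) T" "T \<subseteq> cl_st"
    and U: "minimal_closed N Sub (Sub_act G) U" "U \<subseteq> cl_st"
  shows "T = U"
proof (rule minimal_closed_eq[OF T(1) U(1)])
  have dom: "\<exists>K'\<in>V. K' \<subseteq> K" if V: "minimal_closed N Sub (Sub_act G) V" "V \<subseteq> cl_st" and K: "K \<in> cl_st" for V K
  proof -
    obtain K0 where K0: "K0 \<in> V" using minimal_closedD(2)[OF V(1)] by blast
    then have "\<exists>y\<in>topspace X. K0 \<subseteq> st y" using V(2) by (intro cl_st_below) (rule subsetD)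
    then obtain y where "y \<in> topspace X" "K0 \<subseteq> st y" by metis
    from cl_st_dominated[OF N min minimal_closedD(1,3)[OF V(1)] K0 this K] show ?thesis .
  qed
  show "T \<inter> U \<noteq> {}"
  proof (rule mutually_dominating_meet[OF minimal_closedD(1,2)[OF T(1)] minimal_closedD(1)[OF U(1)]])
    show "\<exists>L\<in>U. L \<subseteq> K" if "K \<in> T" for K by (rule dom[OF U subsetD[OF T(2) that]])
    show "\<exists>K\<in>T. K \<subseteq> L" if "L \<in> U" for L by (rule dom[OF T subsetD[OF U(2) that]])
  qed
qed

lemma minimal_in_cl_st_exists:
  assumes N: "N \<subseteq> carrier G"
  obtains T where "minimal_closed N Sub (Sub_act G) T" "T \<subseteq> cl_st"
proof -
  have "cl_st \<noteq> {}"
    using closure_of_subset[of "st ` topspace X" Sub] subgroup_st nonempty by (force simp del: topspace_Sub simp: topspace_Sub)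
  moreover have "invariant_under N (Sub_act G) cl_st" using cl_st_invariant N by (auto simp: invariant_under_def)
  ultimately show thesis using S.minimal_closed_exists[of cl_st N] that by auto
qed

end

text \<open>The definite description in \<open>stabilizer_URS\<close> is justified by existence and uniqueness of the
  minimal closed invariant set of limits of stabilizers.\<close>

lemma (in flow) stabilizer_URS_is:
  assumes "minimal_G_space G X \<phi>"
  shows "is_URS G (stabilizer_URS G X \<phi>)"
    and "stabilizer_URS G X \<phi> \<subseteq> Sub closure_of (stabilizer G \<phi> ` topspace X)"
proof -
  have car: "carrier G \<lhd> G" by (simp add: normal_inv_iff subgroup_self)
  interpret F: flow_normal G X \<phi> "carrier G" by (intro flow_normal.intro flow_normal_axioms.intro flow_axioms car)
  have eq: "F.st ` topspace X = stabilizer G \<phi> ` topspace X"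
    by (intro image_cong refl) (auto simp: F.st_def stabilizer_def)
  have min: "minimal_closed (carrier G) X \<phi> (topspace X)" using assms by (simp add: minimal_G_space_minimal_closed)
  have "\<exists>!T. is_URS G T \<and> T \<subseteq> Sub closure_of (stabilizer G \<phi> ` topspace X)"
  proof (rule ex_ex1I)
    obtain T where "minimal_closed (carrier G) Sub (Sub_act G) T" "T \<subseteq> F.cl_st"
      using F.minimal_in_cl_st_exists[OF order_refl] by metis
    then show "\<exists>T. is_URS G T \<and> T \<subseteq> Sub closure_of (stabilizer G \<phi> ` topspace X)" using eq is_URS_iff by auto
  next
    fix T U assume "is_URS G T \<and> T \<subseteq> Sub closure_of (stabilizer G \<phi> ` topspace X)"
      "is_URS G U \<and> U \<subseteq> Sub closure_of (stabilizer G \<phi> ` topspace X)"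
    then show "T = U" using F.minimal_in_cl_st_unique[OF order_refl min, of T U] eq is_URS_iff by auto
  qed
  note ex = this
  have "is_URS G (stabilizer_URS G X \<phi>) \<and> stabilizer_URS G X \<phi> \<subseteq> Sub closure_of (stabilizer G \<phi> ` topspace X)"
    unfolding stabilizer_URS_def by (rule theI'[OF ex])
  then show "is_URS G (stabilizer_URS G X \<phi>)" "stabilizer_URS G X \<phi> \<subseteq> Sub closure_of (stabilizer G \<phi> ` topspace X)" by auto
qed


section \<open>Changing the acting group\<close>

lemma G_boundary_pullback:
  assumes G': "group G'" and \<sigma>: "\<sigma> \<in> hom G' G" "\<sigma> ` carrier G' = carrier G" and X: "G_boundary G X \<phi>"
  shows "G_boundary G' X (\<lambda>g. \<phi> (\<sigma> g))"
proof -
  interpret X: flow G X \<phi> by (rule G_boundary_flow[OF X])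
  interpret \<sigma>: group_hom G' G \<sigma>
    by (intro group_hom.intro group_hom_axioms.intro G' X.is_group \<sigma>(1))
  have \<sigma>c: "\<sigma> g \<in> carrier G" if "g \<in> carrier G'" for g using \<sigma>.hom_closed[OF that] .
  have ext: "\<phi> g \<in> extensional (topspace X)" if "g \<in> carrier G" for g
    using X.bij_prop0[OF that] by (simp add: Bij_def)
  have "compact_G_space G' X (\<lambda>g. \<phi> (\<sigma> g))"
    by (rule compact_G_spaceI)
       (use \<sigma>c X.nonempty in \<open>auto simp: G' X.compact X.Hausdorff ext X.cont X.act_mult\<close>)
  moreover have "orbit G' (\<lambda>g. \<phi> (\<sigma> g)) x = orbit G \<phi> x" for x
    unfolding orbit_def \<sigma>(2)[symmetric] by auto
  moreover have "{distr \<mu> (borel_of X) (\<phi> (\<sigma> g)) | g. g \<in> carrier G'} = {distr \<mu> (borel_of X) (\<phi> g) | g. g \<in> carrier G}" for \<mu>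
    unfolding \<sigma>(2)[symmetric] by auto
  ultimately show ?thesis
    using X by (simp add: G_boundary_def minimal_G_space_def strongly_proximal_def)
qed

text \<open>On the Furstenberg boundary \<open>Y\<close> of \<open>M\<close>, let \<open>m\<close> act by its conjugate \<open>g m g\<^sup>-\<^sup>1\<close>. This is again
  a boundary of \<open>M\<close>, so universality gives a map \<open>\<theta> g\<close> from \<open>Y\<close> to itself intertwining the two
  actions, and uniqueness of equivariant maps into a boundary makes \<open>g \<mapsto> \<theta> g\<close> an action of \<open>G\<close>
  that extends the action of \<open>M\<close>. Minimality and strong proximality are inherited from \<open>M\<close>.\<close>

theorem boundary_of_normal_subgroup:
  fixes G :: "('a, 'b) monoid_scheme" (structure)
  assumes "group G" and M: "M \<lhd> G"
  obtains Y :: "'a set set topology" and \<psi>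
  where "G_boundary G Y \<psi>" "minimal_closed M Y \<psi> (topspace Y)"
    "\<And>y. y \<in> topspace Y \<Longrightarrow> amenable_group (G\<lparr>carrier := M \<inter> stabilizer G \<psi> y\<rparr>)"
proof -
  interpret G: group G by fact
  interpret M: normal M G by (rule M)
  define GM where "GM = G\<lparr>carrier := M\<rparr>"
  interpret GM: group GM unfolding GM_def by (rule G.subgroup_imp_group[OF M.subgroup_axioms])
  have cM: "carrier GM = M" "\<And>x y. x \<otimes>\<^bsub>GM\<^esub> y = x \<otimes> y" "\<one>\<^bsub>GM\<^esub> = \<one>" by (simp_all add: GM_def)
  obtain Y :: "'a set set topology" and \<beta> where Yb: "is_Furstenberg_boundary GM Y \<beta>"
    using Furstenberg_boundary_exists[OF GM.is_group] by blast
  then have bY: "G_boundary GM Y \<beta>" by (simp add: is_Furstenberg_boundary_def)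
  interpret Y: flow GM Y \<beta> by (rule G_boundary_flow[OF bY])
  have min: "minimal_G_space GM Y \<beta>" and sp: "strongly_proximal GM Y \<beta>"
    using bY by (simp_all add: G_boundary_def)
  have Mc: "m \<in> carrier G" if "m \<in> M" for m using that M.subset by auto
  define c where "c g m = g \<otimes> m \<otimes> inv g" for g m
  have cMM: "c g m \<in> M" if "g \<in> carrier G" "m \<in> M" for g m
    unfolding c_def by (rule M.inv_op_closed2[OF that])
  have cc: "c g (c h m) = c (g \<otimes> h) m" if "g \<in> carrier G" "h \<in> carrier G" "m \<in> M" for g h m
    unfolding c_def using that Mc by (simp add: G.m_assoc G.inv_mult_group)
  have ccan: "c g (c (inv g) m) = m" if "g \<in> carrier G" "m \<in> M" for g m
    using cc[of g "inv g" m] that Mc by (simp add: c_def)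
  have bc: "G_boundary GM Y (\<lambda>m. \<beta> (c g m))" if g: "g \<in> carrier G" for g
  proof (rule G_boundary_pullback[OF GM.is_group _ _ bY])
    show "c g \<in> hom GM GM"
    proof (rule homI)
      fix m n assume "m \<in> carrier GM" "n \<in> carrier GM"
      then have mn: "m \<in> carrier G" "n \<in> carrier G" using Mc cM by auto
      have "c g m \<otimes> c g n = g \<otimes> m \<otimes> (inv g \<otimes> g) \<otimes> n \<otimes> inv g"
        unfolding c_def using mn g by (simp only: G.m_assoc G.m_closed G.inv_closed)
      then show "c g (m \<otimes>\<^bsub>GM\<^esub> n) = c g m \<otimes>\<^bsub>GM\<^esub> c g n"
        unfolding cM using mn g by (simp add: c_def G.m_assoc)
    qed (use cMM g cM in auto)
    show "c g ` carrier GM = carrier GM"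
    proof (intro equalityI subsetI)
      fix m assume "m \<in> carrier GM"
      then have m: "m \<in> M" using cM by simp
      have "m = c g (c (inv g) m)" using ccan[OF g m] by simp
      then show "m \<in> c g ` carrier GM" using cMM[of "inv g" m] g m cM by blast
    qed (use cMM g cM in auto)
  qed
  have "\<exists>f. equivariant M Y \<beta> Y (\<lambda>m. \<beta> (c g m)) f" if g: "g \<in> carrier G" for g
    using Furstenberg_boundary_universal[OF Yb bc[OF g]] cM by metis
  then obtain \<theta> where \<theta>: "\<And>g. g \<in> carrier G \<Longrightarrow> equivariant M Y \<beta> Y (\<lambda>m. \<beta> (c g m)) (\<theta> g)" by metis
  have \<theta>c: "continuous_map Y Y (\<theta> g)" if "g \<in> carrier G" for g using \<theta>[OF that] by (simp add: equivariant_def)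
  have \<theta>cl: "\<theta> g y \<in> topspace Y" if "g \<in> carrier G" "y \<in> topspace Y" for g y
    using continuous_map_image_subset_topspace[OF \<theta>c[OF that(1)]] that(2) by blast
  have \<theta>eq: "\<theta> g (\<beta> m y) = \<beta> (c g m) (\<theta> g y)" if "g \<in> carrier G" "m \<in> M" "y \<in> topspace Y" for g m y
    using \<theta>[OF that(1)] that(2,3) by (simp add: equivariant_def)
  \<comment> \<open>target of the uniqueness lemma: \<open>Y\<close> with the twisted action\<close>
  have unique: "f y = \<theta> g y" if g: "g \<in> carrier G" and f: "equivariant M Y \<beta> Y (\<lambda>m. \<beta> (c g m)) f" and y: "y \<in> topspace Y" for g f y
    using equivariant_maps_into_boundary_agree[OF Y.flow_axioms min bc[OF g], of f "\<theta> g" y] f \<theta>[OF g] y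
    unfolding cM by blast
  have \<theta>mult: "\<theta> g (\<theta> h y) = \<theta> (g \<otimes> h) y" if g: "g \<in> carrier G" and h: "h \<in> carrier G" and y: "y \<in> topspace Y" for g h y
  proof (rule unique[where f = "\<lambda>y. \<theta> g (\<theta> h y)", OF G.m_closed[OF g h] _ y])
    show "equivariant M Y \<beta> Y (\<lambda>m. \<beta> (c (g \<otimes> h) m)) (\<lambda>y. \<theta> g (\<theta> h y))"
      unfolding equivariant_def
    proof (intro conjI ballI)
      show "continuous_map Y Y (\<lambda>y. \<theta> g (\<theta> h y))"
        using continuous_map_compose[OF \<theta>c[OF h] \<theta>c[OF g]] by (simp add: o_def)
      fix m y assume m: "m \<in> M" and y: "y \<in> topspace Y"
      show "\<theta> g (\<theta> h (\<beta> m y)) = \<beta> (c (g \<otimes> h) m) (\<theta> g (\<theta> h y))"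
        by (simp add: \<theta>eq[OF h m y] \<theta>eq[OF g cMM[OF h m] \<theta>cl[OF h y]] cc[OF g h m])
    qed
  qed
  have \<theta>M: "\<beta> n y = \<theta> n y" if n: "n \<in> M" and y: "y \<in> topspace Y" for n y
  proof (rule unique[OF Mc[OF n] _ y])
    show "equivariant M Y \<beta> Y (\<lambda>m. \<beta> (c n m)) (\<beta> n)" unfolding equivariant_def
    proof (intro conjI ballI)
      show "continuous_map Y Y (\<beta> n)" using Y.cont n cM by simp
      fix m y assume m: "m \<in> M" and y: "y \<in> topspace Y"
      have "c n m \<otimes> n = n \<otimes> m" using m n Mc by (simp add: c_def G.m_assoc)
      then show "\<beta> n (\<beta> m y) = \<beta> (c n m) (\<beta> n y)"
        using Y.act_mult[of n m y] Y.act_mult[of "c n m" n y] m n y cMM[OF Mc[OF n] m] cM by simp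
    qed
  qed
  define \<psi> where "\<psi> g = restrict (\<theta> g) (topspace Y)" for g
  have "compact_G_space G Y \<psi>"
  proof (rule compact_G_spaceI)
    show "topspace Y \<noteq> {}" by (rule Y.nonempty)
    fix g assume g: "g \<in> carrier G"
    show "continuous_map Y Y (\<psi> g)" by (rule continuous_map_eq[OF \<theta>c[OF g]]) (simp add: \<psi>_def)
    show "\<psi> g \<in> extensional (topspace Y)" by (simp add: \<psi>_def)
    fix h y assume "h \<in> carrier G" "y \<in> topspace Y"
    then show "\<psi> (g \<otimes> h) y = \<psi> g (\<psi> h y)" using \<theta>mult[OF g, of h y] \<theta>cl by (simp add: \<psi>_def)
  next
    fix y assume y: "y \<in> topspace Y"
    have "\<beta> \<one> y = y" using Y.act_one[OF y] cM by simp
    then show "\<psi> \<one> y = y" using \<theta>M[OF M.one_closed y] y by (simp add: \<psi>_def)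
  qed (auto simp: G.is_group Y.compact Y.Hausdorff)
  then interpret P: flow G Y \<psi> by (simp add: flow_def)
  have \<psi>M: "\<psi> m = \<beta> m" if m: "m \<in> M" for m
  proof -
    have "\<beta> m \<in> extensional (topspace Y)" using Y.bij_prop0[of m] m cM by (simp add: Bij_def)
    then show ?thesis using \<theta>M[OF m] by (auto simp: \<psi>_def fun_eq_iff extensional_def)
  qed
  have inv_eq: "invariant_under M \<psi> T \<longleftrightarrow> invariant_under M \<beta> T" for T
    by (simp add: invariant_under_def \<psi>M)
  have minM: "minimal_closed M Y \<psi> (topspace Y)"
    using min unfolding Y.minimal_G_space_minimal_closed minimal_closed_def inv_eq cM .
  have "minimal_G_space G Y \<psi>" unfolding P.minimal_iff
  proof (intro allI impI)
    fix T assume T: "closedin Y T" "T \<noteq> {}" "invariant_under (carrier G) \<psi> T"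
    have "invariant_under M \<psi> T" using T(3) Mc by (auto simp: invariant_under_def)
    then show "T = topspace Y" using minimal_closedD(4)[OF minM closedin_subset[OF T(1)] T(1,2)] by simp
  qed
  moreover have "strongly_proximal G Y \<psi>"
  proof (rule P.strongly_proximalI)
    fix \<mu> assume \<mu>: "\<mu> \<in> Prob Y"
    obtain x where x: "x \<in> topspace Y"
      "\<And>U e. openin Y U \<Longrightarrow> x \<in> U \<Longrightarrow> e > 0 \<Longrightarrow>
         \<exists>g\<in>carrier GM. measure \<mu> (\<beta> g -` U \<inter> topspace Y) > 1 - e"
      using contractsE[OF Y.contracts_if_Dirac_limit[OF sp \<mu>]] by metis
    show "contracts G Y \<psi> (measure \<mu>)" unfolding contracts_def
    proof (intro bexI[OF _ x(1)] allI impI)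
      fix U and e :: real assume "openin Y U" "x \<in> U" "0 < e"
      from x(2)[OF this] obtain g where g: "g \<in> M" "measure \<mu> (\<beta> g -` U \<inter> topspace Y) > 1 - e" using cM by auto
      then have "1 - e < measure \<mu> (\<psi> g -` U \<inter> topspace Y)" by (simp add: \<psi>M)
      then show "\<exists>g\<in>carrier G. 1 - e < measure \<mu> (\<psi> g -` U \<inter> topspace Y)" by (rule bexI[OF _ Mc[OF g(1)]])
    qed
  qed
  ultimately have "G_boundary G Y \<psi>" using P.cgs by (simp add: G_boundary_def)
  moreover have "amenable_group (G\<lparr>carrier := M \<inter> stabilizer G \<psi> y\<rparr>)" if y: "y \<in> topspace Y" for y
  proof -
    have "M \<inter> stabilizer G \<psi> y = stabilizer GM \<beta> y"
      using Mc \<psi>M by (auto simp: stabilizer_def cM)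
    then show ?thesis using amenable_stabilizer[OF GM.is_group Yb y] by (simp add: GM_def)
  qed
  ultimately show thesis using that minM by blast
qed

section \<open>Subgroups fixing a charge\<close>

lemma (in flow) dirac_at_unique:
  assumes m: "m \<in> borel_charges X" and x: "dirac_at X m x" and y: "dirac_at X m y"
  shows "x = y"
proof (rule ccontr)
  assume "x \<noteq> y"
  then obtain U V where UV: "openin X U" "openin X V" "x \<in> U" "y \<in> V" "disjnt U V"
    using Hausdorff x y unfolding Hausdorff_space_def dirac_at_def by metis
  have mc: "m \<in> charges (topspace X) (sets (borel_of X))" using m by (simp add: borel_charges_def)
  have "m (U \<union> V) = m U + m V"
    using UV by (intro charge_add[OF mc] borel_open) (auto simp: disjnt_def)
  moreover have "m (U \<union> V) \<le> 1"
    using charge_range[OF mc borel_open[OF openin_Un[OF UV(1,2)]]] by simp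
  moreover have "m U = 1" "m V = 1" using x y UV by (auto simp: dirac_at_def)
  ultimately show False by simp
qed

lemma (in group) conj_conj:
  assumes "g \<in> carrier G" "k \<in> carrier G" shows "g \<otimes> k \<otimes> inv g \<otimes> g = g \<otimes> k"
  using assms by (simp add: m_assoc)

text \<open>The charges fixed by some member of \<open>T\<close> form a closed invariant set, which is non-empty by
  assumption and so contains a Dirac charge. A subgroup fixing a Dirac charge fixes the point.\<close>

lemma (in flow) fixing_subgroup_in_stabilizer:
  assumes sp: "strongly_proximal G X \<phi>"
    and T: "closedin Sub T" "invariant_under (carrier G) (Sub_act G) T"
    and K0: "K0 \<in> T" "fixed_charges K0 X \<phi> \<noteq> {}"
  shows "\<exists>K\<in>T. \<exists>x\<in>topspace X. K \<subseteq> stabilizer G \<phi> x"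
proof -
  interpret C: flow G Ch cact by (rule borel_charge_flow)
  interpret S: flow G Sub "Sub_act G" by (rule Sub_flow)
  have Ts: "subgroup K G" if "K \<in> T" for K using closedin_subset[OF T(1)] that by auto
  let ?P = "prod_topology Ch Sub"
  define D where "D g = {p \<in> topspace ?P. snd p \<in> {H. subgroup H G \<and> g \<notin> H}} \<union>
      {p \<in> topspace ?P. fst p \<in> {\<nu> \<in> topspace Ch. cact g \<nu> = \<nu>}}" for g
  define E where "E = {p \<in> topspace ?P. snd p \<in> T} \<inter> (\<Inter>g\<in>carrier G. D g)"
  have D: "closedin ?P (D g)" if g: "g \<in> carrier G" for g
  proof -
    have "closedin Ch {\<nu> \<in> topspace Ch. cact g \<nu> = \<nu>}"
      by (rule closedin_continuous_maps_eq[OF C.Hausdorff C.cont[OF g]]) simp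
    then have "closedin ?P {p \<in> topspace ?P. fst p \<in> {\<nu> \<in> topspace Ch. cact g \<nu> = \<nu>}}"
      by (rule closedin_continuous_map_preimage[OF continuous_map_fst])
    moreover have "closedin ?P {p \<in> topspace ?P. snd p \<in> {H. subgroup H G \<and> g \<notin> H}}"
      by (rule closedin_continuous_map_preimage[OF continuous_map_snd closedin_member(2)[OF g]])
    ultimately show ?thesis unfolding D_def by (intro closedin_Un)
  qed
  have ne: "carrier G \<noteq> {}" using one_closed by blast
  have "closedin ?P E" unfolding E_def
    by (intro closedin_Int closedin_INT closedin_continuous_map_preimage[OF continuous_map_snd T(1)] D ne)
  from closed_map_projections(1)[OF C.compact compact_Sub this]
  have F1: "closedin Ch (fst ` E)" .
  have E_iff: "(\<nu>, K) \<in> E \<longleftrightarrow> K \<in> T \<and> \<nu> \<in> fixed_charges K X \<phi>" for \<nu> K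
  proof
    assume e: "(\<nu>, K) \<in> E"
    then have K: "K \<in> T" "\<nu> \<in> borel_charges X" by (auto simp: E_def)
    moreover have "cact k \<nu> = \<nu>" if k: "k \<in> K" for k
    proof -
      have "k \<in> carrier G" using subgroup.mem_carrier[OF Ts[OF K(1)] k] .
      then have "(\<nu>, K) \<in> D k" using e by (simp add: E_def)
      then show ?thesis using k by (auto simp: D_def)
    qed
    ultimately show "K \<in> T \<and> \<nu> \<in> fixed_charges K X \<phi>" by (simp add: fixed_charges_def)
  next
    assume "K \<in> T \<and> \<nu> \<in> fixed_charges K X \<phi>"
    then show "(\<nu>, K) \<in> E" using Ts by (auto simp: E_def D_def fixed_charges_def)
  qed
  obtain \<nu>0 where "\<nu>0 \<in> fixed_charges K0 X \<phi>" using K0(2) by blast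
  then have "(\<nu>0, K0) \<in> E" using K0(1) E_iff by simp
  then have F2: "fst ` E \<noteq> {}" by blast
  have F3: "invariant_under (carrier G) cact (fst ` E)" unfolding invariant_under_def
  proof (intro ballI)
    fix g \<nu> assume g: "g \<in> carrier G" and "\<nu> \<in> fst ` E"
    then obtain K where "(\<nu>, K) \<in> E" by auto
    then have K: "K \<in> T" "\<nu> \<in> borel_charges X" "\<And>k. k \<in> K \<Longrightarrow> cact k \<nu> = \<nu>"
      unfolding E_iff fixed_charges_def by auto
    have "cact k' (cact g \<nu>) = cact g \<nu>" if k': "k' \<in> Sub_act G g K" for k'
    proof -
      obtain k where k: "k \<in> K" "k' = g \<otimes> k \<otimes> inv g" using k' Sub_act_apply[OF Ts[OF K(1)]] by auto
      have kc: "k \<in> carrier G" using subgroup.mem_carrier[OF Ts[OF K(1)] k(1)] .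
      have "cact k' (cact g \<nu>) = cact (k' \<otimes> g) \<nu>" using k(2) kc g K(2) by (simp add: C.act_mult)
      also have "k' \<otimes> g = g \<otimes> k" unfolding k(2) by (rule conj_conj[OF g kc])
      also have "cact (g \<otimes> k) \<nu> = cact g \<nu>" using kc g K(2) K(3)[OF k(1)] by (simp add: C.act_mult)
      finally show ?thesis .
    qed
    moreover have "Sub_act G g K \<in> T" using T(2) g K(1) by (simp add: invariant_under_def)
    moreover have "cact g \<nu> \<in> borel_charges X" using C.act_closed[OF g, of \<nu>] K(2) by simp
    ultimately have "(cact g \<nu>, Sub_act G g K) \<in> E" unfolding E_iff fixed_charges_def by simp
    then show "cact g \<nu> \<in> fst ` E" by (metis fst_conv imageI)
  qed
  from Dirac_in_closed_invariant[OF sp F1 F2 F3]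
  obtain \<nu> K x where e: "(\<nu>, K) \<in> E" and d: "dirac_at X \<nu> x" by auto
  have K: "K \<in> T" "\<nu> \<in> borel_charges X" "\<And>k. k \<in> K \<Longrightarrow> cact k \<nu> = \<nu>"
    using e unfolding E_iff fixed_charges_def by auto
  have "K \<subseteq> stabilizer G \<phi> x"
  proof
    fix k assume k: "k \<in> K"
    have kc: "k \<in> carrier G" using subgroup.mem_carrier[OF Ts[OF K(1)] k] .
    have "dirac_at X \<nu> (\<phi> k x)" using dirac_at_act[OF K(2) d kc] K(3)[OF k] by simp
    then have "\<phi> k x = x" by (rule dirac_at_unique[OF K(2) _ d])
    then show "k \<in> stabilizer G \<phi> x" using kc by (simp add: stabilizer_def)
  qed
  then show ?thesis using K(1) d by (auto simp: dirac_at_def)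
qed

context group begin

interpretation S: flow G Sub "Sub_act G" by (rule Sub_flow)

text \<open>Membership of \<open>r\<close> in the product \<open>H M\<close> is an open condition on \<open>H\<close>, preserved by conjugation
  with elements of \<open>M\<close>. Hence the members of \<open>A\<close> that violate it form a closed \<open>M\<close>-invariant
  subset, which is empty or all of \<open>A\<close>. So the product \<open>K M\<close> is the same for all \<open>K \<in> A\<close>.\<close>

lemma minimal_closed_translates_agree:
  assumes M: "M \<lhd> G" and A: "minimal_closed M Sub (Sub_act G) A"
    and K: "K \<in> A" and L: "L \<in> A" and r: "r \<in> carrier G" and m: "m \<in> M" "r \<otimes> m \<in> K"
  shows "\<exists>m\<in>M. r \<otimes> m \<in> L"
proof (rule ccontr)
  assume n: "\<not> ?thesis"
  interpret M: normal M G by (rule M)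
  have As: "subgroup H G" if "H \<in> A" for H using closedin_subset[OF minimal_closedD(1)[OF A]] that by auto
  define D where "D = A \<inter> \<Inter>((\<lambda>m. {H. subgroup H G \<and> r \<otimes> m \<notin> H}) ` M)"
  have "M \<noteq> {}" using m by auto
  then have "closedin Sub D" unfolding D_def
    using r by (intro closedin_Int minimal_closedD(1)[OF A] closedin_Inter) (auto intro!: closedin_member(2))
  moreover have LD: "L \<in> D" using L n As by (auto simp: D_def)
  moreover have "invariant_under M (Sub_act G) D" unfolding invariant_under_def
  proof (intro ballI)
    fix n H assume nM: "n \<in> M" and H: "H \<in> D"
    have HA: "H \<in> A" "subgroup H G" using H As by (auto simp: D_def)
    have nc: "n \<in> carrier G" using nM by simp
    have nH: "Sub_act G n H \<in> A" using minimal_closedD(3)[OF A] nM HA(1) by (simp add: invariant_under_def)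
    moreover have "r \<otimes> m \<notin> Sub_act G n H" if mM: "m \<in> M" for m
    proof
      have mc: "m \<in> carrier G" using mM by simp
      assume "r \<otimes> m \<in> Sub_act G n H"
      then have "inv n \<otimes> (r \<otimes> m) \<otimes> n \<in> H" using Sub_act_member[OF HA(2) nc, of "r \<otimes> m"] r mc by simp
      moreover have "inv n \<otimes> (r \<otimes> m) \<otimes> n = r \<otimes> ((inv r \<otimes> inv n \<otimes> r) \<otimes> m \<otimes> n)"
      proof -
        have "r \<otimes> ((inv r \<otimes> inv n \<otimes> r) \<otimes> m \<otimes> n) = (r \<otimes> inv r) \<otimes> (inv n \<otimes> (r \<otimes> m) \<otimes> n)"
          using r nc mc by (simp only: m_assoc m_closed inv_closed)
        then show ?thesis using r nc mc by simp
      qed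
      moreover have "inv r \<otimes> inv n \<otimes> r \<in> M" using M.inv_op_closed1[OF r, of "inv n"] nM by simp
      then have "(inv r \<otimes> inv n \<otimes> r) \<otimes> m \<otimes> n \<in> M" using mM nM by simp
      ultimately show False using H by (auto simp: D_def)
    qed
    ultimately show "Sub_act G n H \<in> D" using As[OF nH] by (auto simp: D_def)
  qed
  ultimately have "D = A" using minimal_closedD(4)[OF A, of D] by (auto simp: D_def)
  then show False using K m by (auto simp: D_def)
qed

lemma minimal_closed_translate:
  assumes M: "M \<lhd> G" and T: "minimal_closed M Sub (Sub_act G) T" and g: "g \<in> carrier G"
  shows "minimal_closed M Sub (Sub_act G) (Sub_act G g ` T)"
proof -
  interpret M: normal M G by (rule M)
  have Tt: "T \<subseteq> topspace Sub" by (rule closedin_subset[OF minimal_closedD(1)[OF T]])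
  have inv: "invariant_under M (Sub_act G) (Sub_act G g ` U)"
    if U: "invariant_under M (Sub_act G) U" "U \<subseteq> topspace Sub" "g \<in> carrier G" for U g
    unfolding invariant_under_def
  proof (intro ballI)
    fix m K assume m: "m \<in> M" and "K \<in> Sub_act G g ` U"
    then obtain H where H: "H \<in> U" "K = Sub_act G g H" by auto
    have Ht: "H \<in> topspace Sub" using H U by auto
    have mc: "m \<in> carrier G" using m by simp
    let ?n = "inv g \<otimes> m \<otimes> g"
    have n: "?n \<in> M" using M.inv_op_closed1[OF U(3) m] .
    have "g \<otimes> ?n = (g \<otimes> inv g) \<otimes> m \<otimes> g" using U(3) mc by (simp only: m_assoc m_closed inv_closed)
    then have gn: "g \<otimes> ?n = m \<otimes> g" using U(3) mc by simp
    have nc: "?n \<in> carrier G" using n by simp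
    have "Sub_act G m K = Sub_act G (m \<otimes> g) H" unfolding H(2) by (rule S.act_mult[OF mc U(3) Ht, symmetric])
    also have "\<dots> = Sub_act G g (Sub_act G ?n H)" unfolding gn[symmetric] by (rule S.act_mult[OF U(3) nc Ht])
    finally show "Sub_act G m K \<in> Sub_act G g ` U" using U(1) n H(1) by (auto simp: invariant_under_def)
  qed
  show ?thesis unfolding minimal_closed_def
  proof (intro conjI allI impI)
    show "closedin Sub (Sub_act G g ` T)" by (rule S.closedin_act_image[OF g minimal_closedD(1)[OF T]])
    show "Sub_act G g ` T \<noteq> {}" using minimal_closedD(2)[OF T] by simp
    show "invariant_under M (Sub_act G) (Sub_act G g ` T)" by (rule inv[OF minimal_closedD(3)[OF T] Tt g])
    fix U assume U: "U \<subseteq> Sub_act G g ` T" "closedin Sub U" "U \<noteq> {}" "invariant_under M (Sub_act G) U"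
    have Ut: "U \<subseteq> topspace Sub" by (rule closedin_subset[OF U(2)])
    have ig: "inv g \<in> carrier G" using g by simp
    have "Sub_act G (inv g) ` U \<subseteq> T"
    proof
      fix K assume "K \<in> Sub_act G (inv g) ` U"
      then obtain H where "H \<in> T" "K = Sub_act G (inv g) (Sub_act G g H)" using U(1) by blast
      then show "K \<in> T" using S.act_inv[OF g, of H] Tt by auto
    qed
    from minimal_closedD(4)[OF T this S.closedin_act_image[OF ig U(2)] _ inv[OF U(4) Ut ig]]
    have eq: "Sub_act G (inv g) ` U = T" using U(3) by simp
    show "U = Sub_act G g ` T"
    proof (rule antisym[OF U(1)], rule subsetI)
      fix K assume "K \<in> Sub_act G g ` T"
      then obtain H where H: "H \<in> U" "K = Sub_act G g (Sub_act G (inv g) H)" unfolding eq[symmetric] by blast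
      then show "K \<in> U" using S.act_inv'[OF g, of H] Ut by auto
    qed
  qed
qed

end


section \<open>The Furstenberg URS and normal subgroups\<close>

lemma (in flow) fixed_charges_antimono: "H \<subseteq> K \<Longrightarrow> fixed_charges K X \<phi> \<subseteq> fixed_charges H X \<phi>"
  by (auto simp: fixed_charges_def)

locale Furstenberg_flow = flow G X \<phi> for G :: "('a, 'b) monoid_scheme" (structure) and X :: "'a set set topology" and \<phi> +
  assumes Furstenberg: "is_Furstenberg_boundary G X \<phi>"
begin

interpretation S: flow G Sub "Sub_act G" by (rule Sub_flow)

lemma boundary: "G_boundary G X \<phi>" using Furstenberg by (simp add: is_Furstenberg_boundary_def)

lemma minimal: "minimal_G_space G X \<phi>" and sp: "strongly_proximal G X \<phi>"
  using boundary by (simp_all add: G_boundary_def)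

lemma carrier_normal: "carrier G \<lhd> G" by (simp add: normal_inv_iff subgroup_self)

interpretation F: flow_normal G X \<phi> "carrier G"
  by (intro flow_normal.intro flow_normal_axioms.intro flow_axioms carrier_normal)

lemma st_eq [simp]: "F.st y = stabilizer G \<phi> y" by (auto simp: F.st_def stabilizer_def)

abbreviation "cl_stab \<equiv> Sub closure_of (stabilizer G \<phi> ` topspace X)"

definition "\<A> = stabilizer_URS G X \<phi>"

lemma URS: "minimal_closed (carrier G) Sub (Sub_act G) \<A>"
  unfolding \<A>_def is_URS_iff[symmetric] by (rule stabilizer_URS_is(1)[OF minimal])

lemma URS_cl: "\<A> \<subseteq> cl_stab"
  unfolding \<A>_def by (rule stabilizer_URS_is(2)[OF minimal])

lemma URS_subgroup: "K \<in> \<A> \<Longrightarrow> subgroup K G"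
  using closedin_subset[OF minimal_closedD(1)[OF URS]] by auto

lemma URS_in_stabilizer: "K \<in> \<A> \<Longrightarrow> \<exists>x\<in>topspace X. K \<subseteq> stabilizer G \<phi> x"
  using F.cl_st_below[of K] URS_cl by auto

lemma minX: "minimal_closed (carrier G) X \<phi> (topspace X)"
  using minimal by (simp add: minimal_G_space_minimal_closed)

text \<open>The defining feature of the Furstenberg URS: it lies below every closed invariant set of
  subgroups one of which fixes a charge on the boundary.\<close>

lemma dominated_by_fixing:
  assumes T: "closedin Sub T" "invariant_under (carrier G) (Sub_act G) T"
    and K0: "K0 \<in> T" "fixed_charges K0 X \<phi> \<noteq> {}" and K: "K \<in> \<A>"
  shows "\<exists>K'\<in>T. K' \<subseteq> K"
proof -
  obtain L x where L: "L \<in> T" "x \<in> topspace X" "L \<subseteq> stabilizer G \<phi> x"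
    using fixing_subgroup_in_stabilizer[OF sp T K0] by metis
  have "K \<in> F.cl_st" using K URS_cl by auto
  then show ?thesis using F.cl_st_dominated[OF order_refl minX T L(1,2)] L(3) by simp
qed

text \<open>For a normal subgroup \<open>E\<close> the singleton \<open>{E}\<close> is closed and invariant.\<close>

lemma normal_fixing_below:
  assumes E: "E \<lhd> G" "fixed_charges E X \<phi> \<noteq> {}" and K: "K \<in> \<A>"
  shows "E \<subseteq> K"
proof -
  have s: "subgroup E G" using E(1) by (rule normal_imp_subgroup)
  have "Sub_act G g E = E" if g: "g \<in> carrier G" for g
  proof -
    have "x \<in> Sub_act G g E \<longleftrightarrow> x \<in> E" if x: "x \<in> carrier G" for x
      by (rule trans[OF Sub_act_member[OF s g x] normal_conj_iff[OF E(1) g x]])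
    moreover have "Sub_act G g E \<subseteq> carrier G" "E \<subseteq> carrier G"
      using S.act_closed[OF g, of E] s by (auto dest: subgroup.subset)
    ultimately show ?thesis by blast
  qed
  then have inv: "invariant_under (carrier G) (Sub_act G) {E}" by (simp add: invariant_under_def)
  have "closedin Sub {E}" using closedin_Hausdorff_singleton[OF Hausdorff_Sub, of E] s by simp
  from dominated_by_fixing[OF this inv _ E(2) K] show ?thesis by simp
qed

text \<open>The members of the URS contained in \<open>R\<close> form a closed invariant subset.\<close>

lemma URS_below_normal:
  assumes R: "R \<lhd> G" and K0: "K0 \<in> \<A>" "K0 \<subseteq> R" and K: "K \<in> \<A>"
  shows "K \<subseteq> R"
proof -
  let ?T = "\<A> \<inter> {K. subgroup K G \<and> K \<subseteq> R}"
  have "closedin Sub ?T"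
    by (intro closedin_Int minimal_closedD(1)[OF URS] closedin_subgroups_below)
  moreover have "K0 \<in> ?T" using K0 URS_subgroup by simp
  moreover have "invariant_under (carrier G) (Sub_act G) ?T" unfolding invariant_under_def
  proof (intro ballI)
    fix g H assume g: "g \<in> carrier G" and H: "H \<in> ?T"
    have gH: "Sub_act G g H \<in> \<A>" using minimal_closedD(3)[OF URS] g H by (simp add: invariant_under_def)
    have "Sub_act G g H \<subseteq> R"
      using H normal.inv_op_closed2[OF R g] by (auto simp: Sub_act_apply)
    then show "Sub_act G g H \<in> ?T" using gH URS_subgroup by simp
  qed
  ultimately have "?T = \<A>" using minimal_closedD(4)[OF URS, of ?T] by auto
  then show ?thesis using K by auto
qed

text \<open>The only consequence of \<open>G Mod M\<close> being in \<open>\<F>\<close> that enters the argument: some normal subgroup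
  \<open>R\<close> contains the whole URS, and within \<open>R\<close> fixed charges extend from \<open>H \<inter> M\<close> to \<open>H\<close>, as they do
  when \<open>R\<close> is amenable modulo \<open>M\<close>. Unlike a condition on the quotient, this form visibly passes to
  finite intersections.\<close>

definition co_fixing :: "'a set \<Rightarrow> bool" where
  "co_fixing M \<longleftrightarrow> M \<lhd> G \<and> (\<exists>R. R \<lhd> G \<and> (\<forall>K\<in>\<A>. K \<subseteq> R) \<and>
     (\<forall>H. subgroup H G \<longrightarrow> H \<subseteq> R \<longrightarrow> fixed_charges (H \<inter> M) X \<phi> \<noteq> {} \<longrightarrow> fixed_charges H X \<phi> \<noteq> {}))"

lemma co_fixing_carrier: "co_fixing (carrier G)"
proof -
  have "fixed_charges H X \<phi> \<noteq> {}" if "subgroup H G" "fixed_charges (H \<inter> carrier G) X \<phi> \<noteq> {}" for H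
    using that subgroup.subset[OF that(1)] by (simp add: Int_absorb2)
  then show ?thesis unfolding co_fixing_def using carrier_normal URS_subgroup subgroup.subset by blast
qed

text \<open>Extend in two steps, from \<open>H \<inter> M \<inter> N\<close> to \<open>H \<inter> M\<close> and then to \<open>H\<close>.\<close>

lemma co_fixing_Int:
  assumes "co_fixing M" "co_fixing N" shows "co_fixing (M \<inter> N)"
proof -
  obtain R where R: "M \<lhd> G" "R \<lhd> G" "\<And>K. K \<in> \<A> \<Longrightarrow> K \<subseteq> R"
    "\<And>H. subgroup H G \<Longrightarrow> H \<subseteq> R \<Longrightarrow> fixed_charges (H \<inter> M) X \<phi> \<noteq> {} \<Longrightarrow> fixed_charges H X \<phi> \<noteq> {}"
    using assms(1) unfolding co_fixing_def by metis
  obtain Q where Q: "N \<lhd> G" "Q \<lhd> G" "\<And>K. K \<in> \<A> \<Longrightarrow> K \<subseteq> Q"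
    "\<And>H. subgroup H G \<Longrightarrow> H \<subseteq> Q \<Longrightarrow> fixed_charges (H \<inter> N) X \<phi> \<noteq> {} \<Longrightarrow> fixed_charges H X \<phi> \<noteq> {}"
    using assms(2) unfolding co_fixing_def by metis
  have "fixed_charges H X \<phi> \<noteq> {}"
    if H: "subgroup H G" "H \<subseteq> R \<inter> Q" "fixed_charges (H \<inter> (M \<inter> N)) X \<phi> \<noteq> {}" for H
  proof -
    have "subgroup (H \<inter> M) G" by (rule subgroups_Inter_pair[OF H(1) normal_imp_subgroup[OF R(1)]])
    moreover have "H \<inter> M \<subseteq> Q" using H(2) by auto
    moreover have "fixed_charges (H \<inter> M \<inter> N) X \<phi> \<noteq> {}" using H(3) by (simp add: Int_assoc)
    ultimately have "fixed_charges (H \<inter> M) X \<phi> \<noteq> {}" by (rule Q(4))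
    then show ?thesis using R(4)[OF H(1)] H(2) by simp
  qed
  moreover have "K \<subseteq> R \<inter> Q" if "K \<in> \<A>" for K using R(3)[OF that] Q(3)[OF that] by simp
  ultimately show ?thesis unfolding co_fixing_def
    using normal_subgroup_intersect[OF R(1) Q(1)] normal_subgroup_intersect[OF R(2) Q(2)] by blast
qed

lemma co_fixing_finite_Int:
  assumes "finite J" "\<And>j. j \<in> J \<Longrightarrow> co_fixing (M j)"
  shows "\<exists>N. co_fixing N \<and> (\<forall>j\<in>J. N \<subseteq> M j)"
  using assms
proof (induction J rule: finite_induct)
  case empty then show ?case using co_fixing_carrier by blast
next
  case (insert j J)
  then obtain N where "co_fixing N" "\<forall>j\<in>J. N \<subseteq> M j" by auto
  then show ?case using co_fixing_Int[of N "M j"] insert.prems by (intro exI[of _ "N \<inter> M j"]) auto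
qed

text \<open>Let \<open>G\<close> act on a boundary \<open>Y\<close> of \<open>M\<close>, and let \<open>T\<close> be the unique \<open>M\<close>-minimal closed set of limits
  of the stabilizers \<open>R \<inter> G\<^sub>y\<close>. Uniqueness makes \<open>T\<close> invariant under \<open>G\<close>. The URS and \<open>T\<close> dominate
  each other: in one direction because the boundary of \<open>G\<close> maps to \<open>Y\<close>, in the other because the
  stabilizers meet \<open>M\<close> in amenable subgroups, so that they fix charges on the boundary of \<open>G\<close>
  because \<open>M\<close> is co-fixing. Hence they meet. The intersection is closed and \<open>G\<close>-invariant, so it
  is all of the URS, and by \<open>M\<close>-minimality of \<open>T\<close> also all of \<open>T\<close>.\<close>

lemma URS_minimal_under_co_fixing:
  assumes "co_fixing M" shows "minimal_closed M Sub (Sub_act G) \<A>"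
proof -
  obtain R where M: "M \<lhd> G" and R: "R \<lhd> G" "\<And>K. K \<in> \<A> \<Longrightarrow> K \<subseteq> R"
    "\<And>H. subgroup H G \<Longrightarrow> H \<subseteq> R \<Longrightarrow> fixed_charges (H \<inter> M) X \<phi> \<noteq> {} \<Longrightarrow> fixed_charges H X \<phi> \<noteq> {}"
    using assms unfolding co_fixing_def by metis
  have Ms: "subgroup M G" by (rule normal_imp_subgroup[OF M])
  have Mc: "M \<subseteq> carrier G" by (rule subgroup.subset[OF Ms])
  obtain Y :: "'a set set topology" and \<psi>
    where Y: "G_boundary G Y \<psi>" "minimal_closed M Y \<psi> (topspace Y)"
      "\<And>y. y \<in> topspace Y \<Longrightarrow> amenable_group (G\<lparr>carrier := M \<inter> stabilizer G \<psi> y\<rparr>)"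
    using boundary_of_normal_subgroup[OF is_group M] by metis
  interpret Y: flow G Y \<psi> by (rule G_boundary_flow[OF Y(1)])
  interpret FY: flow_normal G Y \<psi> R
    by (intro flow_normal.intro flow_normal_axioms.intro Y.flow_axioms R(1))
  obtain T where T: "minimal_closed M Sub (Sub_act G) T" "T \<subseteq> FY.cl_st"
    using FY.minimal_in_cl_st_exists[OF Mc] by metis
  have Ts: "subgroup K G" if "K \<in> T" for K using closedin_subset[OF minimal_closedD(1)[OF T(1)]] that by auto
  have Tinv: "invariant_under (carrier G) (Sub_act G) T" unfolding invariant_under_def
  proof (intro ballI)
    fix g K assume g: "g \<in> carrier G" and K: "K \<in> T"
    have "Sub_act G g ` T \<subseteq> FY.cl_st" using FY.cl_st_invariant T(2) g by (auto simp: invariant_under_def)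
    then have "Sub_act G g ` T = T"
      using FY.minimal_in_cl_st_unique[OF Mc Y(2) minimal_closed_translate[OF M T(1) g] _ T] by simp
    then show "Sub_act G g K \<in> T" using K by blast
  qed
  \<comment> \<open>the map from the boundary of \<open>G\<close> to \<open>Y\<close> puts a member of the URS below a stabilizer\<close>
  obtain K0 where K0: "K0 \<in> \<A>" using minimal_closedD(2)[OF URS] by blast
  obtain x where x: "x \<in> topspace X" "K0 \<subseteq> stabilizer G \<phi> x" using URS_in_stabilizer[OF K0] by metis
  obtain p where p: "equivariant (carrier G) X \<phi> Y \<psi> p"
    using Furstenberg_boundary_universal[OF Furstenberg Y(1)] by metis
  have px: "p x \<in> topspace Y"
    using continuous_map_image_subset_topspace[of X Y p] p x(1) by (auto simp: equivariant_def)
  have "K0 \<subseteq> FY.st (p x)"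
  proof
    fix k assume k: "k \<in> K0"
    then have kc: "k \<in> carrier G" "\<phi> k x = x" using x(2) by (auto simp: stabilizer_def)
    then have "\<psi> k (p x) = p x" using p x(1) by (metis equivariant_def)
    then show "k \<in> FY.st (p x)" using k kc R(2)[OF K0] by (auto simp: FY.st_def stabilizer_def)
  qed
  have AM: "invariant_under M (Sub_act G) \<A>"
    using minimal_closedD(3)[OF URS] Mc by (auto simp: invariant_under_def)
  have d1: "\<exists>K\<in>\<A>. K \<subseteq> L" if "L \<in> T" for L
    by (rule FY.cl_st_dominated[OF Mc Y(2) minimal_closedD(1)[OF URS] AM K0 px \<open>K0 \<subseteq> FY.st (p x)\<close>])
       (use that T(2) in blast)
  \<comment> \<open>members of \<open>T\<close> lie below stabilizers that meet \<open>M\<close> in amenable groups, so they fix charges\<close>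
  obtain L0 where L0: "L0 \<in> T" using minimal_closedD(2)[OF T(1)] by blast
  obtain y where y: "y \<in> topspace Y" "L0 \<subseteq> FY.st y" using FY.cl_st_below[of L0] L0 T(2) by blast
  have sy: "subgroup (FY.st y) G" by (rule FY.subgroup_st[OF y(1)])
  have "subgroup (M \<inter> stabilizer G \<psi> y) G"
    by (rule subgroups_Inter_pair[OF Ms Y.stabilizer_subgroup[OF y(1)]])
  from amenable_fixes_charge[OF this Y(3)[OF y(1)]]
  have "fixed_charges (FY.st y \<inter> M) X \<phi> \<noteq> {}"
    using fixed_charges_antimono[of "FY.st y \<inter> M" "M \<inter> stabilizer G \<psi> y"] by (auto simp: FY.st_def)
  then have "fixed_charges (FY.st y) X \<phi> \<noteq> {}" using R(3)[OF sy] by (auto simp: FY.st_def)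
  then have "fixed_charges L0 X \<phi> \<noteq> {}" using fixed_charges_antimono[OF y(2)] by blast
  from dominated_by_fixing[OF minimal_closedD(1)[OF T(1)] Tinv L0 this]
  have d2: "\<exists>K'\<in>T. K' \<subseteq> K" if "K \<in> \<A>" for K using that .
  have "T \<inter> \<A> \<noteq> {}"
    by (rule mutually_dominating_meet[OF minimal_closedD(1,2)[OF T(1)] minimal_closedD(1)[OF URS] d1 d2])
  moreover have "closedin Sub (T \<inter> \<A>)"
    by (intro closedin_Int minimal_closedD(1)[OF T(1)] minimal_closedD(1)[OF URS])
  moreover have "invariant_under (carrier G) (Sub_act G) (T \<inter> \<A>)"
    using Tinv minimal_closedD(3)[OF URS] by (auto simp: invariant_under_def)
  ultimately have "T \<inter> \<A> = \<A>" using minimal_closedD(4)[OF URS, of "T \<inter> \<A>"] by simp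
  then have "\<A> \<subseteq> T" by blast
  from minimal_closedD(4)[OF T(1) this minimal_closedD(1,2)[OF URS] AM] T(1)
  show ?thesis by simp
qed

text \<open>Let \<open>R\<close> be the preimage of the unique member \<open>R'\<close> of the Furstenberg URS of \<open>G Mod N\<close>. It is
  normal, and \<open>R'\<close> is amenable as a subgroup of a point stabilizer, so fixed charges extend along
  \<open>R\<close>. The boundary of \<open>G\<close> maps to that of \<open>G Mod N\<close>, whence the limit of stabilizers \<open>R\<close> contains
  a member of the URS of \<open>G\<close>, and then all of them by normality.\<close>

lemma co_fixing_if_quotient_in_class_F:
  assumes N: "N \<lhd> G" and F: "class_F (G Mod N)"
  shows "co_fixing N"
proof -
  interpret N: normal N G by (rule N)
  let ?Q = "G Mod N" and ?\<pi> = "\<lambda>g. N #> g"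
  interpret Q: group ?Q by (rule N.factorgroup_is_group)
  interpret \<pi>: group_hom G ?Q ?\<pi>
    by (rule group_hom.intro) (use is_group Q.is_group N.r_coset_hom_Mod in \<open>auto simp: group_hom_axioms_def\<close>)
  have \<pi>im: "?\<pi> ` carrier G = carrier ?Q" by (auto simp: FactGroup_def RCOSETS_def)
  obtain B \<beta> where B: "Furstenberg_boundary ?Q = (B, \<beta>)" by (cases "Furstenberg_boundary ?Q")
  have Bf: "is_Furstenberg_boundary ?Q B \<beta>" by (rule Furstenberg_boundary_is[OF Q.is_group B])
  then have Bb: "G_boundary ?Q B \<beta>" by (simp add: is_Furstenberg_boundary_def)
  interpret B: flow ?Q B \<beta> by (rule G_boundary_flow[OF Bb])
  interpret BF: Furstenberg_flow ?Q B \<beta> by unfold_locales (rule Bf)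
  obtain R' where R': "BF.\<A> = {R'}"
    using F B unfolding class_F_def Furstenberg_URS_def BF.\<A>_def by auto
  have R's: "subgroup R' ?Q" using BF.URS_subgroup R' by simp
  interpret R': subgroup R' ?Q by (rule R's)
  have R'conj: "q \<otimes>\<^bsub>?Q\<^esub> k \<otimes>\<^bsub>?Q\<^esub> inv\<^bsub>?Q\<^esub> q \<in> R'" if "q \<in> carrier ?Q" "k \<in> R'" for q k
  proof -
    have "Sub_act ?Q q R' = R'"
      using minimal_closedD(3)[OF BF.URS] R' that(1) by (simp add: invariant_under_def)
    then show ?thesis using Q.Sub_act_apply[OF R's, of q] that(2) by blast
  qed
  obtain b where b: "b \<in> topspace B" "R' \<subseteq> stabilizer ?Q \<beta> b" using BF.URS_in_stabilizer R' by blast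
  have am: "amenable_group (?Q\<lparr>carrier := R'\<rparr>)"
  proof -
    have sb: "subgroup (stabilizer ?Q \<beta> b) ?Q" by (rule B.stabilizer_subgroup[OF b(1)])
    interpret sb: group "?Q\<lparr>carrier := stabilizer ?Q \<beta> b\<rparr>" by (rule Q.subgroup_imp_group[OF sb])
    show ?thesis
      using sb.amenable_subgroup[OF amenable_stabilizer[OF Q.is_group Bf b(1)] Q.subgroup_incl[OF R's sb b(2)]] by simp
  qed
  define pre where "pre H = {g \<in> carrier G. ?\<pi> g \<in> H}" for H
  have pre_sub: "subgroup (pre H) G" if H: "subgroup H ?Q" for H
  proof (rule subgroupI)
    interpret H: subgroup H ?Q by (rule H)
    show "pre H \<noteq> {}" using H.one_closed \<pi>.hom_one by (force simp: pre_def)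
    show "inv g \<in> pre H" if "g \<in> pre H" for g using that \<pi>.hom_inv[of g] by (auto simp: pre_def)
    show "g \<otimes> h \<in> pre H" if "g \<in> pre H" "h \<in> pre H" for g h
      using that \<pi>.hom_mult[of g h] H.m_closed[of "?\<pi> g" "?\<pi> h"] by (auto simp: pre_def)
  qed (auto simp: pre_def)
  define R where "R = pre R'"
  have R: "R \<lhd> G" unfolding normal_inv_iff
  proof (intro conjI ballI)
    show "subgroup R G" unfolding R_def by (rule pre_sub[OF R's])
    fix x h assume x: "x \<in> carrier G" and h: "h \<in> R"
    have hc: "h \<in> carrier G" "?\<pi> h \<in> R'" using h by (auto simp: R_def pre_def)
    have "?\<pi> (x \<otimes> h \<otimes> inv x) = ?\<pi> x \<otimes>\<^bsub>?Q\<^esub> ?\<pi> h \<otimes>\<^bsub>?Q\<^esub> inv\<^bsub>?Q\<^esub> (?\<pi> x)"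
      using x hc by (simp only: \<pi>.hom_mult \<pi>.hom_inv m_closed inv_closed)
    then show "x \<otimes> h \<otimes> inv x \<in> R"
      using R'conj[OF \<pi>.hom_closed[OF x] hc(2)] x hc(1) by (simp add: R_def pre_def)
  qed
  have pb: "G_boundary G B (\<lambda>g. \<beta> (?\<pi> g))"
    by (rule G_boundary_pullback[OF is_group \<pi>.homh \<pi>im Bb])
  interpret P: flow G B "\<lambda>g. \<beta> (?\<pi> g)" by (rule G_boundary_flow[OF pb])
  interpret FP: flow_normal G B "\<lambda>g. \<beta> (?\<pi> g)" "carrier G"
    by (intro flow_normal.intro flow_normal_axioms.intro P.flow_axioms carrier_normal)
  have st: "FP.st y = pre (stabilizer ?Q \<beta> y)" for y
    using \<pi>.hom_closed by (auto simp: FP.st_def stabilizer_def pre_def)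
  have minP: "minimal_closed (carrier G) B (\<lambda>g. \<beta> (?\<pi> g)) (topspace B)"
    using pb by (simp add: G_boundary_def P.minimal_G_space_minimal_closed)
  \<comment> \<open>continuity of taking preimages shows that \<open>R\<close> is a limit of stabilizers of the pulled back action\<close>
  have "continuous_map Q.Sub Sub pre"
  proof (rule continuous_map_into_Sub)
    fix H assume "H \<in> topspace Q.Sub" then show "subgroup (pre H) G" using pre_sub by simp
  next
    fix g assume g: "g \<in> carrier G"
    have "continuous_map Q.Sub (discrete_topology UNIV) (\<lambda>H. ?\<pi> g \<in> H)"
      by (rule Q.continuous_map_member[OF \<pi>.hom_closed[OF g]])
    then show "continuous_map Q.Sub (discrete_topology UNIV) (\<lambda>H. g \<in> pre H)" using g by (simp add: pre_def)
  qed
  from continuous_map_image_closure_subset[OF this, of "stabilizer ?Q \<beta> ` topspace B"]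
  have "pre R' \<in> Sub closure_of (pre ` stabilizer ?Q \<beta> ` topspace B)"
    using BF.URS_cl R' by auto
  then have Rcl: "R \<in> FP.cl_st" unfolding R_def by (simp add: st image_image)
  obtain K0 where K0: "K0 \<in> \<A>" using minimal_closedD(2)[OF URS] by blast
  obtain x where x: "x \<in> topspace X" "K0 \<subseteq> stabilizer G \<phi> x" using URS_in_stabilizer[OF K0] by metis
  obtain p where p: "equivariant (carrier G) X \<phi> B (\<lambda>g. \<beta> (?\<pi> g)) p"
    using Furstenberg_boundary_universal[OF Furstenberg pb] by metis
  have px: "p x \<in> topspace B"
    using continuous_map_image_subset_topspace[of X B p] p x(1) by (auto simp: equivariant_def)
  have K0st: "K0 \<subseteq> FP.st (p x)"
  proof
    fix k assume k: "k \<in> K0"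
    then have kc: "k \<in> carrier G" "\<phi> k x = x" using x(2) by (auto simp: stabilizer_def)
    then have "\<beta> (?\<pi> k) (p x) = p x" using p x(1) by (metis equivariant_def)
    then show "k \<in> FP.st (p x)" using kc by (auto simp: FP.st_def stabilizer_def)
  qed
  obtain K1 where K1: "K1 \<in> \<A>" "K1 \<subseteq> R"
    using FP.cl_st_dominated[OF order_refl minP minimal_closedD(1,3)[OF URS] K0 px K0st Rcl] by metis
  have AR: "K \<subseteq> R" if "K \<in> \<A>" for K by (rule URS_below_normal[OF R K1 that])
  have "fixed_charges H X \<phi> \<noteq> {}"
    if H: "subgroup H G" "H \<subseteq> R" "fixed_charges (H \<inter> N) X \<phi> \<noteq> {}" for H
    by (rule amenable_extension_fixes_charge[OF N R's am H(1) _ H(3)]) (use H(2) in \<open>auto simp: R_def pre_def\<close>)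
  then show ?thesis unfolding co_fixing_def using N R AR by blast
qed

end


section \<open>The Furstenberg URS of a residually-\<open>\<F>\<close> group\<close>

context Furstenberg_flow begin

text \<open>The intersection of the sets \<open>L M\<close> over all co-fixing \<open>M\<close>: the closure of \<open>L\<close> in the group
  topology with these \<open>M\<close> as neighbourhoods of the identity.\<close>

definition co_fixing_closure :: "'a set \<Rightarrow> 'a set" where
  "co_fixing_closure L = {r \<in> carrier G. \<forall>M. co_fixing M \<longrightarrow> (\<exists>m\<in>M. r \<otimes> m \<in> L)}"

lemma co_fixing_normal: "co_fixing M \<Longrightarrow> M \<lhd> G"
  by (simp add: co_fixing_def)

lemma subgroup_co_fixing_closure:
  assumes L: "subgroup L G" shows "subgroup (co_fixing_closure L) G"
proof (rule subgroupI)
  interpret L: subgroup L G by fact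
  have "\<one> \<in> co_fixing_closure L" unfolding co_fixing_closure_def
  proof (intro CollectI conjI allI impI one_closed)
    fix M assume "co_fixing M"
    then have "\<one> \<in> M" by (intro subgroup.one_closed[OF normal_imp_subgroup[OF co_fixing_normal]])
    then show "\<exists>m\<in>M. \<one> \<otimes> m \<in> L" by (rule bexI[rotated]) simp
  qed
  then show "co_fixing_closure L \<noteq> {}" by blast
  show "co_fixing_closure L \<subseteq> carrier G" by (auto simp: co_fixing_closure_def)
  fix r assume r: "r \<in> co_fixing_closure L"
  then have rc: "r \<in> carrier G" by (simp add: co_fixing_closure_def)
  show "inv r \<in> co_fixing_closure L" unfolding co_fixing_closure_def
  proof (intro CollectI conjI allI impI)
    fix M assume M: "co_fixing M"
    interpret M: normal M G by (rule co_fixing_normal[OF M])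
    obtain m where m: "m \<in> M" "r \<otimes> m \<in> L" using r M unfolding co_fixing_closure_def by blast
    have mc: "m \<in> carrier G" using m(1) by simp
    have "inv (r \<otimes> m) = inv r \<otimes> (r \<otimes> inv m \<otimes> inv r)"
      using rc mc by (simp add: inv_mult_group m_assoc[symmetric])
    moreover have "inv (r \<otimes> m) \<in> L" using m(2) by simp
    moreover have "r \<otimes> inv m \<otimes> inv r \<in> M" using M.inv_op_closed2[OF rc, of "inv m"] m(1) by simp
    ultimately show "\<exists>m\<in>M. inv r \<otimes> m \<in> L" by auto
  qed (use rc in simp)
  fix s assume s: "s \<in> co_fixing_closure L"
  then have sc: "s \<in> carrier G" by (simp add: co_fixing_closure_def)
  show "r \<otimes> s \<in> co_fixing_closure L" unfolding co_fixing_closure_def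
  proof (intro CollectI conjI allI impI)
    fix M assume M: "co_fixing M"
    interpret M: normal M G by (rule co_fixing_normal[OF M])
    obtain m where m: "m \<in> M" "r \<otimes> m \<in> L" using r M unfolding co_fixing_closure_def by blast
    obtain n where n: "n \<in> M" "s \<otimes> n \<in> L" using s M unfolding co_fixing_closure_def by blast
    have mc: "m \<in> carrier G" "n \<in> carrier G" using m(1) n(1) by simp_all
    have "(r \<otimes> s) \<otimes> ((inv s \<otimes> m \<otimes> s) \<otimes> n) = r \<otimes> (s \<otimes> inv s) \<otimes> m \<otimes> (s \<otimes> n)"
      using rc sc mc by (simp only: m_assoc m_closed inv_closed)
    then have "(r \<otimes> s) \<otimes> ((inv s \<otimes> m \<otimes> s) \<otimes> n) = (r \<otimes> m) \<otimes> (s \<otimes> n)" using rc sc mc by simp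
    moreover have "(r \<otimes> m) \<otimes> (s \<otimes> n) \<in> L" by (rule L.m_closed[OF m(2) n(2)])
    ultimately have "(r \<otimes> s) \<otimes> ((inv s \<otimes> m \<otimes> s) \<otimes> n) \<in> L" by simp
    moreover have "(inv s \<otimes> m \<otimes> s) \<otimes> n \<in> M" using M.inv_op_closed1[OF sc m(1)] n(1) by simp
    ultimately show "\<exists>m\<in>M. r \<otimes> s \<otimes> m \<in> L" by (rule bexI)
  qed (use rc sc in simp)
qed

text \<open>Conjugating by \<open>g\<close> replaces \<open>K\<close> by another member of the URS, which has the same product with
  every co-fixing \<open>M\<close>.\<close>

lemma normal_co_fixing_closure:
  assumes K: "K \<in> \<A>" shows "co_fixing_closure K \<lhd> G"
  unfolding normal_inv_iff
proof (intro conjI ballI)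
  have Ks: "subgroup K G" by (rule URS_subgroup[OF K])
  show "subgroup (co_fixing_closure K) G" by (rule subgroup_co_fixing_closure[OF Ks])
  fix g r assume g: "g \<in> carrier G" and r: "r \<in> co_fixing_closure K"
  have rc: "r \<in> carrier G" using r by (simp add: co_fixing_closure_def)
  show "g \<otimes> r \<otimes> inv g \<in> co_fixing_closure K" unfolding co_fixing_closure_def
  proof (intro CollectI conjI allI impI)
    fix M assume M: "co_fixing M"
    interpret M: normal M G by (rule co_fixing_normal[OF M])
    obtain m where m: "m \<in> M" "r \<otimes> m \<in> K" using r M unfolding co_fixing_closure_def by blast
    have mc: "m \<in> carrier G" using m(1) by simp
    have "(g \<otimes> r \<otimes> inv g) \<otimes> (g \<otimes> m \<otimes> inv g) = g \<otimes> r \<otimes> (inv g \<otimes> g) \<otimes> m \<otimes> inv g"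
      using g rc mc by (simp only: m_assoc m_closed inv_closed)
    also have "\<dots> = g \<otimes> (r \<otimes> m) \<otimes> inv g" using g rc mc by (simp add: m_assoc)
    finally have "(g \<otimes> r \<otimes> inv g) \<otimes> (g \<otimes> m \<otimes> inv g) \<in> Sub_act G g K"
      unfolding Sub_act_apply[OF Ks] using m(2) by auto
    moreover have "Sub_act G g K \<in> \<A>" using minimal_closedD(3)[OF URS] g K by (simp add: invariant_under_def)
    moreover have "g \<otimes> m \<otimes> inv g \<in> M" using M.inv_op_closed2[OF g m(1)] .
    ultimately show "\<exists>m\<in>M. g \<otimes> r \<otimes> inv g \<otimes> m \<in> K"
      using minimal_closed_translates_agree[OF co_fixing_normal[OF M] URS_minimal_under_co_fixing[OF M] _ K, of _ "g \<otimes> r \<otimes> inv g"] g rc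
      by simp
  qed (use g rc in simp)
qed

lemma URS_subset_co_fixing_closure:
  assumes K: "K \<in> \<A>" and L: "L \<in> \<A>" shows "L \<subseteq> co_fixing_closure K"
proof
  fix r assume r: "r \<in> L"
  have rc: "r \<in> carrier G" by (rule subgroup.mem_carrier[OF URS_subgroup[OF L] r])
  show "r \<in> co_fixing_closure K" unfolding co_fixing_closure_def
  proof (intro CollectI conjI allI impI rc)
    fix M assume M: "co_fixing M"
    have "\<one> \<in> M" by (rule subgroup.one_closed[OF normal_imp_subgroup[OF co_fixing_normal[OF M]]])
    moreover have "r \<otimes> \<one> \<in> L" using r rc by simp
    ultimately show "\<exists>m\<in>M. r \<otimes> m \<in> K"
      by (rule minimal_closed_translates_agree[OF co_fixing_normal[OF M] URS_minimal_under_co_fixing[OF M] L K rc])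
  qed
qed

text \<open>If finitely many translates of \<open>K0\<close> cover \<open>K\<close>, then the same translates of the closure of \<open>K0\<close>
  cover the closure of \<open>K\<close>. If \<open>r\<close> were missed by each of them, finitely many co-fixing subgroups
  would witness this, and so would a co-fixing subgroup \<open>N\<close> contained in all of these.\<close>

lemma co_fixing_closure_finite_index:
  assumes J: "finite J" "J \<subseteq> carrier G" and cov: "\<And>k. k \<in> K \<Longrightarrow> \<exists>j\<in>J. j \<otimes> k \<in> K0"
    and r: "r \<in> co_fixing_closure K"
  shows "\<exists>j\<in>J. j \<otimes> r \<in> co_fixing_closure K0"
proof (rule ccontr)
  assume n: "\<not> ?thesis"
  have rc: "r \<in> carrier G" using r by (simp add: co_fixing_closure_def)
  have "\<exists>M. co_fixing M \<and> (\<forall>m\<in>M. j \<otimes> r \<otimes> m \<notin> K0)" if j: "j \<in> J" for j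
  proof -
    have jc: "j \<in> carrier G" using j J by auto
    have "j \<otimes> r \<notin> co_fixing_closure K0" using n j by blast
    then show ?thesis using jc rc by (auto simp: co_fixing_closure_def)
  qed
  then obtain M where M: "\<And>j. j \<in> J \<Longrightarrow> co_fixing (M j)" "\<And>j m. j \<in> J \<Longrightarrow> m \<in> M j \<Longrightarrow> j \<otimes> r \<otimes> m \<notin> K0" by metis
  obtain N where N: "co_fixing N" "\<forall>j\<in>J. N \<subseteq> M j" using co_fixing_finite_Int[of J M, OF J(1) M(1)] by blast
  obtain m where m: "m \<in> N" "r \<otimes> m \<in> K" using r N(1) unfolding co_fixing_closure_def by blast
  have mc: "m \<in> carrier G" by (rule subgroup.mem_carrier[OF normal_imp_subgroup[OF co_fixing_normal[OF N(1)]] m(1)])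
  obtain j where j: "j \<in> J" "j \<otimes> (r \<otimes> m) \<in> K0" using cov[OF m(2)] by blast
  have "j \<otimes> r \<otimes> m \<in> K0" using j J(2) rc mc by (simp add: m_assoc subset_iff)
  then show False using M(2)[OF j(1)] N(2) j(1) m(1) by blast
qed

text \<open>Modulo \<open>N\<close> the closure of \<open>K0\<close> has the same image as \<open>K0\<close>.\<close>

lemma derived_series_co_fixing_closure:
  assumes K0: "subgroup K0 G" "(derived G ^^ d) K0 = {\<one>}" and N: "N \<lhd> G" "co_fixing N"
  shows "(derived G ^^ d) (co_fixing_closure K0) \<subseteq> N"
proof
  interpret N: normal N G by (rule N)
  let ?Q = "G Mod N" and ?\<pi> = "\<lambda>g. N #> g"
  interpret Q: group ?Q by (rule N.factorgroup_is_group)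
  interpret \<pi>: group_hom G ?Q ?\<pi>
    by (rule group_hom.intro) (use is_group Q.is_group N.r_coset_hom_Mod in \<open>auto simp: group_hom_axioms_def\<close>)
  have gc: "co_fixing_closure K0 \<subseteq> carrier G" by (auto simp: co_fixing_closure_def)
  have one: "?\<pi> m = N" if "m \<in> N" for m using that N.rcos_const[OF is_group] by simp
  have sub: "?\<pi> ` co_fixing_closure K0 \<subseteq> ?\<pi> ` K0"
  proof
    fix q assume "q \<in> ?\<pi> ` co_fixing_closure K0"
    then obtain r where r: "r \<in> co_fixing_closure K0" "q = ?\<pi> r" by blast
    obtain m where m: "m \<in> N" "r \<otimes> m \<in> K0" using r(1) N(2) unfolding co_fixing_closure_def by blast
    have c: "r \<in> carrier G" "m \<in> carrier G" using r(1) gc m(1) by auto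
    have "?\<pi> (r \<otimes> m) = ?\<pi> r \<otimes>\<^bsub>?Q\<^esub> ?\<pi> m" by (rule \<pi>.hom_mult[OF c])
    also have "\<dots> = ?\<pi> r \<otimes>\<^bsub>?Q\<^esub> \<one>\<^bsub>?Q\<^esub>" using one[OF m(1)] by (simp add: FactGroup_def)
    also have "\<dots> = ?\<pi> r" by (rule Q.r_one[OF \<pi>.hom_closed[OF c(1)]])
    finally show "q \<in> ?\<pi> ` K0" using r(2) m(2) by auto
  qed
  fix x assume x: "x \<in> (derived G ^^ d) (co_fixing_closure K0)"
  have xc: "x \<in> carrier G" using exp_of_derived_in_carrier[OF gc] x by blast
  have "?\<pi> x \<in> ?\<pi> ` ((derived G ^^ d) (co_fixing_closure K0))" using x by blast
  also have "\<dots> = (derived ?Q ^^ d) (?\<pi> ` co_fixing_closure K0)" by (rule \<pi>.exp_of_derived_img[OF gc, symmetric])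
  also have "\<dots> \<subseteq> (derived ?Q ^^ d) (?\<pi> ` K0)" by (rule Q.mono_exp_of_derived[OF sub])
  also have "\<dots> = ?\<pi> ` ((derived G ^^ d) K0)" by (rule \<pi>.exp_of_derived_img[OF subgroup.subset[OF K0(1)]])
  also have "\<dots> = {N}" using K0(2) one[OF N.one_closed] by simp
  finally have "N #> x = N" by simp
  then show "x \<in> N" using rcos_self[OF xc N.subgroup_axioms] by simp
qed

text \<open>Let \<open>K\<close> belong to the URS and let \<open>E\<close> be its co-fixing closure, a normal subgroup containing the
  whole URS. Conversely \<open>E\<close> lies below the whole URS as soon as it fixes a charge. Since \<open>K\<close> is
  amenable, it has a solvable subgroup \<open>K0\<close> of finite index. The closure \<open>H\<close> of \<open>K0\<close> has finite
  index in \<open>E\<close>, and its last derived subgroup lies in all normal \<open>N\<close> with quotient in \<open>\<F>\<close>, hence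
  is trivial by residuality. So \<open>H\<close> fixes a charge, which has a finite orbit under \<open>E\<close>.\<close>

lemma URS_singleton:
  assumes vs: "\<And>H. subgroup H G \<Longrightarrow> amenable_group (G\<lparr>carrier := H\<rparr>) \<Longrightarrow> virtually_solvable (G\<lparr>carrier := H\<rparr>)"
    and res: "residually class_F G"
  shows "\<exists>H. \<A> = {H}"
proof -
  obtain K where K: "K \<in> \<A>" using minimal_closedD(2)[OF URS] by blast
  have Ks: "subgroup K G" by (rule URS_subgroup[OF K])
  interpret K: subgroup K G by (rule Ks)
  obtain x where x: "x \<in> topspace X" "K \<subseteq> stabilizer G \<phi> x" using URS_in_stabilizer[OF K] by metis
  have ss: "subgroup (stabilizer G \<phi> x) G" by (rule stabilizer_subgroup[OF x(1)])
  interpret S: group "G\<lparr>carrier := stabilizer G \<phi> x\<rparr>" by (rule subgroup_imp_group[OF ss])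
  have "amenable_group (G\<lparr>carrier := K\<rparr>)"
    using S.amenable_subgroup[OF amenable_stabilizer[OF is_group Furstenberg x(1)] subgroup_incl[OF Ks ss x(2)]] by simp
  from vs[OF Ks this] obtain K0 where K0: "subgroup K0 (G\<lparr>carrier := K\<rparr>)"
    "finite (rcosets\<^bsub>G\<lparr>carrier := K\<rparr>\<^esub> K0)" "solvable (G\<lparr>carrier := K, carrier := K0\<rparr>)"
    unfolding virtually_solvable_def by blast
  have K0s: "subgroup K0 G" by (rule incl_subgroup[OF Ks K0(1)])
  interpret K0: subgroup K0 G by (rule K0s)
  have K0K: "K0 \<subseteq> K" using subgroup.subset[OF K0(1)] by simp
  obtain d where d: "(derived G ^^ d) K0 = {\<one>}"
  proof -
    let ?G0 = "G\<lparr>carrier := K0\<rparr>"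
    interpret G0: group ?G0 by (rule subgroup_imp_group[OF K0s])
    interpret i: group_hom ?G0 G "\<lambda>x. x"
      by (intro group_hom.intro group_hom_axioms.intro G0.is_group is_group homI) auto
    have "solvable ?G0" using K0(3) by simp
    then obtain d where "(derived ?G0 ^^ d) K0 = {\<one>}" using G0.solvable_iff_trivial_derived_seq by auto
    moreover have "(derived G ^^ d) ((\<lambda>x. x) ` K0) = (\<lambda>x. x) ` ((derived ?G0 ^^ d) K0)"
      by (rule i.exp_of_derived_img) simp
    ultimately show thesis using that by simp
  qed
  obtain J where J: "finite J" "J \<subseteq> K" "(\<lambda>k. K0 #> k) ` K = (\<lambda>k. K0 #> k) ` J"
  proof -
    have "rcosets\<^bsub>G\<lparr>carrier := K\<rparr>\<^esub> K0 = (\<lambda>k. K0 #> k) ` K" by (auto simp: RCOSETS_def r_coset_def)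
    then have "finite ((\<lambda>k. K0 #> k) ` K)" using K0(2) by simp
    from finite_subset_image[OF this order_refl] that show thesis by metis
  qed
  have Jc: "J \<subseteq> carrier G" using J(2) K.subset by auto
  \<comment> \<open>take \<open>j\<close> in the right coset of \<open>inv k\<close>\<close>
  have cov: "\<exists>j\<in>J. j \<otimes> k \<in> K0" if k: "k \<in> K" for k
  proof -
    have kc: "k \<in> carrier G" "inv k \<in> K" using k by simp_all
    have "K0 #> inv k \<in> (\<lambda>k. K0 #> k) ` K" using kc by blast
    then obtain j where j: "j \<in> J" "K0 #> inv k = K0 #> j" using J(3) by auto
    have jc: "j \<in> carrier G" using j Jc by auto
    have "inv k \<in> K0 #> j" using rcos_self[of "inv k" K0] kc K0s j(2) by simp
    then obtain h where h: "h \<in> K0" "inv k = h \<otimes> j" by (auto simp: r_coset_def)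
    have hc: "h \<in> carrier G" using h by simp
    have "inv h \<otimes> (h \<otimes> j) \<otimes> k = j \<otimes> k" using hc jc kc by (simp add: m_assoc[symmetric])
    moreover have "inv h \<otimes> inv k \<otimes> k = inv h" using hc kc by (simp add: m_assoc)
    ultimately have "j \<otimes> k = inv h" using h(2) by simp
    then have "j \<otimes> k \<in> K0" using K0.m_inv_closed[OF h(1)] by simp
    then show ?thesis using j(1) by (rule bexI)
  qed
  let ?E = "co_fixing_closure K" and ?H = "co_fixing_closure K0"
  have Es: "subgroup ?E G" by (rule subgroup_co_fixing_closure[OF Ks])
  have Hs: "subgroup ?H G" by (rule subgroup_co_fixing_closure[OF K0s])
  have "(derived G ^^ d) ?H \<subseteq> {\<one>}"
  proof -
    have "(derived G ^^ d) ?H \<subseteq> N" if "N \<lhd> G" "class_F (G Mod N)" for N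
      using derived_series_co_fixing_closure[OF K0s d that(1) co_fixing_if_quotient_in_class_F[OF that]] .
    moreover have "(derived G ^^ d) ?H \<subseteq> carrier G"
      by (rule exp_of_derived_in_carrier[OF subgroup.subset[OF Hs]])
    ultimately have "(derived G ^^ d) ?H \<subseteq> carrier G \<inter> \<Inter>{N. N \<lhd> G \<and> class_F (G Mod N)}" by blast
    then show ?thesis using res unfolding residually_def by simp
  qed
  then have "(derived G ^^ d) ?H = {\<one>}"
    using subgroup.one_closed[OF exp_of_derived_is_subgroup[OF Hs, of d]] by blast
  from trivial_derived_series_fixes_charge[OF Hs this]
  obtain \<nu> where \<nu>: "\<nu> \<in> borel_charges X" "\<And>h. h \<in> ?H \<Longrightarrow> cact h \<nu> = \<nu>"
    by (auto simp: fixed_charges_def)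
  interpret C: flow G Ch cact by (rule borel_charge_flow)
  have "(\<lambda>e. cact e \<nu>) ` ?E \<subseteq> (\<lambda>j. cact (inv j) \<nu>) ` J"
  proof
    fix \<kappa> assume "\<kappa> \<in> (\<lambda>e. cact e \<nu>) ` ?E"
    then obtain e where e: "e \<in> ?E" "\<kappa> = cact e \<nu>" by blast
    have ec: "e \<in> carrier G" using e(1) by (simp add: co_fixing_closure_def)
    obtain j where j: "j \<in> J" "j \<otimes> e \<in> ?H" using co_fixing_closure_finite_index[OF J(1) Jc cov e(1)] by blast
    have jc: "j \<in> carrier G" using j Jc by auto
    have "e = inv j \<otimes> (j \<otimes> e)" using ec jc by (simp add: m_assoc[symmetric])
    then have "\<kappa> = cact (inv j \<otimes> (j \<otimes> e)) \<nu>" using e(2) by simp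
    also have "\<dots> = cact (inv j) (cact (j \<otimes> e) \<nu>)" using jc ec \<nu>(1) by (intro C.act_mult) auto
    also have "\<dots> = cact (inv j) \<nu>" using \<nu>(2)[OF j(2)] by simp
    finally show "\<kappa> \<in> (\<lambda>j. cact (inv j) \<nu>) ` J" using j(1) by blast
  qed
  then have "finite ((\<lambda>e. cact e \<nu>) ` ?E)" by (rule finite_subset) (use J(1) in simp)
  from finite_orbit_fixes_charge[OF Es \<nu>(1) this]
  have "?E \<subseteq> L" if "L \<in> \<A>" for L
    by (rule normal_fixing_below[OF normal_co_fixing_closure[OF K] _ that])
  then have eq: "L = ?E" if "L \<in> \<A>" for L using URS_subset_co_fixing_closure[OF K that] that by blast
  then have "\<A> \<subseteq> {?E}" by (intro subsetI) simp
  moreover have "?E \<in> \<A>" using K unfolding eq[OF K, symmetric] .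
  ultimately have "\<A> = {?E}" by blast
  then show ?thesis by blast
qed

end

theorem theorem1:
  fixes G :: "('a, 'b) monoid_scheme"
  assumes "group G"
    and "\<And>H. subgroup H G \<Longrightarrow> amenable_group (G\<lparr>carrier := H\<rparr>) \<Longrightarrow>
           virtually_solvable (G\<lparr>carrier := H\<rparr>)"
    and "residually class_F G"
  shows "class_F G"
proof -
  obtain X \<phi> where X: "Furstenberg_boundary G = (X, \<phi>)" by (cases "Furstenberg_boundary G")
  have F: "is_Furstenberg_boundary G X \<phi>" by (rule Furstenberg_boundary_is[OF assms(1) X])
  then have "G_boundary G X \<phi>" by (simp add: is_Furstenberg_boundary_def)
  then interpret X: flow G X \<phi> by (rule G_boundary_flow)
  interpret X: Furstenberg_flow G X \<phi> by unfold_locales (rule F)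
  have "\<exists>H. X.\<A> = {H}" by (rule X.URS_singleton[OF assms(2,3)])
  then show ?thesis using assms(1) X by (simp add: class_F_def Furstenberg_URS_def X.\<A>_def)
qed

end
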